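(* Let $p\ge 3$ be a prime, $k$ an algebraically closed field of characteristic $p$, and $G=SL_2$ over $k$. For all integers $n\ge 1$ and all $m\in X^+=\mathbb N$, $$\dim \mathrm{H}^n(G,L(m))\le(2n+7)C_n.$$ In other words, the sequence $\left(\max_{m\in X^+}\dim \mathrm{H}^n(G,L(m))\right)_n$ has exponential growth.
   Context: Dominant weights of $SL_2$ are identified with $X^+=\mathbb N=\{0,1,2,\dots\}$, and $L(m)$ is the simple $G$-module of highest weight $m$. $\mathrm{H}^n(G,M)=\mathrm{Ext}^n_G(k,M)$ is rational cohomology. $C_n=n\,4^n e^{2\pi n/\sqrt3}$. A sequence $(x_n)$ has exponential growth if it is bounded above and below by exponential functions, i.e. there are constants $c,c'>0$ and $\alpha,\beta>1$ with $c\,\alpha^n\le x_n\le c'\beta^n$ for all sufficiently large $n$. *)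

theory Defs
  imports
    "HOL-Algebra.AbelCoset"
    "Jordan_Normal_Form.VS_Connect"
    "Jordan_Normal_Form.Determinant"
    "HOL-Computational_Algebra.Computational_Algebra"
    Complex_Main
begin

section \<open>Rational modules for the algebraic group SL2\<close>

text \<open>
  The field \<open>k\<close> is a type \<open>'k\<close>. When it is algebraically closed, the (reduced) algebraic group
  \<open>SL2\<close> over \<open>k\<close> is determined by its group of \<open>k\<close>-points, on which the coordinate algebra
  \<open>k[G]\<close> is the algebra of functions generated by the four matrix entries.
\<close>

definition SL2 :: "'k::comm_ring_1 mat set" where
  "SL2 = {g \<in> carrier_mat 2 2. det g = 1}"

text \<open>Only the restrictions of these functions to \<open>SL2\<close> matter below.\<close>

inductive_set regular_functions :: "('k::comm_ring_1 mat \<Rightarrow> 'k) set" where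
  const: "(\<lambda>g. c) \<in> regular_functions"
| entry: "i < 2 \<Longrightarrow> j < 2 \<Longrightarrow> (\<lambda>g. g $$ (i, j)) \<in> regular_functions"
| add: "f \<in> regular_functions \<Longrightarrow> h \<in> regular_functions \<Longrightarrow> (\<lambda>g. f g + h g) \<in> regular_functions"
| mult: "f \<in> regular_functions \<Longrightarrow> h \<in> regular_functions \<Longrightarrow> (\<lambda>g. f g * h g) \<in> regular_functions"

text \<open>A module record over \<open>k\<close> together with an action of matrices on its elements.\<close>

record ('k, 'v) gmodule = "('k, 'v) module" +
  act :: "'k mat \<Rightarrow> 'v \<Rightarrow> 'v"

text \<open>
  Rationality: the action comes from a comodule map \<open>V \<rightarrow> V \<otimes> k[G]\<close>, i.e. for every
  \<open>v\<close> there are finitely many \<open>a \<in> V\<close> and \<open>f a \<in> k[G]\<close> with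
  \<open>g v = (\<Sum>a. f a (g) a)\<close> for all \<open>g\<close>. The space \<open>V\<close> may be infinite-dimensional.
\<close>

locale rational_module = vectorspace class_ring V
  for V :: "('k::field, 'v) gmodule" (structure) +
  assumes act_hom: "g \<in> SL2 \<Longrightarrow> act V g \<in> LinearCombinations.module_hom class_ring V V"
    and act_one: "v \<in> carrier V \<Longrightarrow> act V (1\<^sub>m 2) v = v"
    and act_mult: "g \<in> SL2 \<Longrightarrow> h \<in> SL2 \<Longrightarrow> v \<in> carrier V \<Longrightarrow>
      act V (g * h) v = act V g (act V h v)"
    and rational: "v \<in> carrier V \<Longrightarrow>
      \<exists>A f. finite A \<and> A \<subseteq> carrier V \<and> (\<forall>a\<in>A. f a \<in> regular_functions) \<and>
        (\<forall>g\<in>SL2. act V g v = (\<Oplus>\<^bsub>V\<^esub>a\<in>A. f a g \<odot>\<^bsub>V\<^esub> a))"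

definition simple_module :: "('k::field, 'v) gmodule \<Rightarrow> bool" where
  "simple_module V \<longleftrightarrow> rational_module V \<and> carrier V \<noteq> {\<zero>\<^bsub>V\<^esub>} \<and>
     (\<forall>W. VectorSpace.subspace class_ring W V \<and> (\<forall>g\<in>SL2. \<forall>w\<in>W. act V g w \<in> W) \<longrightarrow>
        W = {\<zero>\<^bsub>V\<^esub>} \<or> W = carrier V)"

text \<open>The weights of the diagonal torus are identified with the integers; the positive root is 2.\<close>

definition weight_space :: "('k::field, 'v) gmodule \<Rightarrow> int \<Rightarrow> 'v set" where
  "weight_space V \<mu> = {v \<in> carrier V. \<forall>t. t \<noteq> 0 \<longrightarrow>
     act V (mat_of_rows_list 2 [[t, 0], [0, inverse t]]) v = (t powi \<mu>) \<odot>\<^bsub>V\<^esub> v}"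

definition is_weight :: "('k::field, 'v) gmodule \<Rightarrow> int \<Rightarrow> bool" where
  "is_weight V \<mu> \<longleftrightarrow> weight_space V \<mu> \<noteq> {\<zero>\<^bsub>V\<^esub>}"

text \<open>Highest means greatest in the dominance order: \<open>\<mu> \<le> m\<close> iff \<open>m - \<mu>\<close> is a
  nonnegative multiple of the positive root.\<close>

definition highest_weight :: "('k::field, 'v) gmodule \<Rightarrow> int \<Rightarrow> bool" where
  "highest_weight V m \<longleftrightarrow> is_weight V m \<and> (\<forall>\<mu>. is_weight V \<mu> \<longrightarrow> (\<exists>j::nat. \<mu> = m - 2 * int j))"

definition is_simple_of_highest_weight :: "nat \<Rightarrow> ('k::field, 'v) gmodule \<Rightarrow> bool" where
  "is_simple_of_highest_weight m V \<longleftrightarrow> simple_module V \<and> highest_weight V (int m)"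

definition trivial_module :: "('k::field, 'k) gmodule" where
  "trivial_module = \<lparr>carrier = UNIV, monoid.mult = (*), one = 1, zero = 0, add = (+),
     module.smult = (*), act = (\<lambda>g v. v)\<rparr>"

section \<open>Ext groups as derived functors\<close>

text \<open>The value of a homomorphism outside the carrier is fixed, so that homomorphisms form a
  vector space.\<close>

definition G_hom :: "('k::field, 'v) gmodule \<Rightarrow> ('k, 'w) gmodule \<Rightarrow> ('v \<Rightarrow> 'w) set" where
  "G_hom V W = {f \<in> LinearCombinations.module_hom class_ring V W \<inter> extensional (carrier V).
     \<forall>g\<in>SL2. \<forall>v\<in>carrier V. f (act V g v) = act W g (f v)}"

definition Hom_space :: "('k::field, 'v) gmodule \<Rightarrow> ('k, 'w) gmodule \<Rightarrow> ('k, 'v \<Rightarrow> 'w) module" where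
  "Hom_space V W = \<lparr>carrier = G_hom V W, monoid.mult = undefined, one = undefined,
     zero = (\<lambda>v\<in>carrier V. \<zero>\<^bsub>W\<^esub>),
     add = (\<lambda>f h. \<lambda>v\<in>carrier V. f v \<oplus>\<^bsub>W\<^esub> h v),
     module.smult = (\<lambda>c f. \<lambda>v\<in>carrier V. c \<odot>\<^bsub>W\<^esub> f v)\<rparr>"

definition quotient_space :: "('k, 'v) module \<Rightarrow> 'v set \<Rightarrow> ('k, 'v set) module" where
  "quotient_space V W = \<lparr>carrier = a_rcosets\<^bsub>V\<^esub> W, monoid.mult = undefined, one = undefined,
     zero = W, add = set_add V,
     module.smult = (\<lambda>c X. \<Union>x\<in>X. W +>\<^bsub>V\<^esub> (c \<odot>\<^bsub>V\<^esub> x))\<rparr>"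

text \<open>
  The modules whose carrier is a set of elements of \<open>'v\<close> (with arbitrary operations) serve as the
  category of rational modules in which the modules over \<open>'v\<close> are resolved. This loses nothing for
  infinite \<open>k\<close>: if it contains a nonzero module then \<open>'v\<close> is at least as large as \<open>k\<close>, so
  \<open>V \<otimes> k[G]\<close> again has a copy with carrier in \<open>'v\<close>. Hence there are enough injectives, and an
  injective object embeds in, and is thus a summand of, some \<open>V \<otimes> k[G]\<close>, so it is injective among
  all rational modules.
\<close>

definition injective_module :: "('k::field, 'v) gmodule \<Rightarrow> bool" where
  "injective_module J \<longleftrightarrow> rational_module J \<and>
     (\<forall>(A :: ('k, 'v) gmodule) (B :: ('k, 'v) gmodule) i f.
        rational_module A \<and> rational_module B \<and>
        i \<in> G_hom A B \<and> inj_on i (carrier A) \<and> f \<in> G_hom A J \<longrightarrow>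
        (\<exists>h\<in>G_hom B J. \<forall>a\<in>carrier A. h (i a) = f a))"

definition injective_resolution ::
  "('k::field, 'v) gmodule \<Rightarrow> (nat \<Rightarrow> ('k, 'v) gmodule) \<Rightarrow> (nat \<Rightarrow> 'v \<Rightarrow> 'v) \<Rightarrow> bool" where
  "injective_resolution M I d \<longleftrightarrow>
     (\<forall>n. injective_module (I n) \<and> d n \<in> G_hom (I n) (I (Suc n))) \<and>
     (\<exists>e\<in>G_hom M (I 0). inj_on e (carrier M) \<and>
        e ` carrier M = {v \<in> carrier (I 0). d 0 v = \<zero>\<^bsub>I 1\<^esub>}) \<and>
     (\<forall>n. d n ` carrier (I n) = {v \<in> carrier (I (Suc n)). d (Suc n) v = \<zero>\<^bsub>I (Suc (Suc n))\<^esub>})"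

definition cocycles ::
  "('k::field, 'w) gmodule \<Rightarrow> (nat \<Rightarrow> ('k, 'v) gmodule) \<Rightarrow> (nat \<Rightarrow> 'v \<Rightarrow> 'v) \<Rightarrow> nat \<Rightarrow> ('w \<Rightarrow> 'v) set" where
  "cocycles N I d n = {f \<in> G_hom N (I n). \<forall>v\<in>carrier N. d n (f v) = \<zero>\<^bsub>I (Suc n)\<^esub>}"

fun coboundaries ::
  "('k::field, 'w) gmodule \<Rightarrow> (nat \<Rightarrow> ('k, 'v) gmodule) \<Rightarrow> (nat \<Rightarrow> 'v \<Rightarrow> 'v) \<Rightarrow> nat \<Rightarrow> ('w \<Rightarrow> 'v) set" where
  "coboundaries N I d 0 = {\<zero>\<^bsub>Hom_space N (I 0)\<^esub>}"
| "coboundaries N I d (Suc n) = compose (carrier N) (d n) ` G_hom N (I n)"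

text \<open>The right derived functors of \<open>Hom(N, -)\<close>, computed with a chosen injective resolution.\<close>

definition Ext :: "nat \<Rightarrow> ('k::field, 'w) gmodule \<Rightarrow> ('k, 'v) gmodule \<Rightarrow> ('k, ('w \<Rightarrow> 'v) set) module" where
  "Ext n N M = (let (I, d) = SOME (I, d). injective_resolution M I d in
     quotient_space (Hom_space N (I n)\<lparr>carrier := cocycles N I d n\<rparr>) (coboundaries N I d n))"

definition rational_cohomology :: "nat \<Rightarrow> ('k::field, 'v) gmodule \<Rightarrow> ('k, ('k \<Rightarrow> 'v) set) module" where
  "rational_cohomology n M = Ext n trivial_module M"

section \<open>Growth\<close>

definition C_const :: "nat \<Rightarrow> real" where
  "C_const n = real n * 4 ^ n * exp (2 * pi * real n / sqrt 3)"

definition exponential_growth :: "(nat \<Rightarrow> real) \<Rightarrow> bool" where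
  "exponential_growth x \<longleftrightarrow> (\<exists>c c' \<alpha> \<beta>. c > 0 \<and> c' > 0 \<and> \<alpha> > 1 \<and> \<beta> > 1 \<and>
     (\<forall>\<^sub>F n in sequentially. c * \<alpha> ^ n \<le> x n \<and> x n \<le> c' * \<beta> ^ n))"

end

theory Submission
 imports Defs "HOL-Library.Function_Algebras"
begin

text \<open>The unipotent group \<open>U\<close> of upper unitriangular matrices acts on a rational module through the commuting
 nilpotent operators \<open>e i\<close>, the divided powers of the root operator of order \<open>p ^ i\<close>. The periodic minimal
 resolutions over the truncated polynomial rings \<open>k[e i] / (e i ^ p)\<close> combine to an explicit complex of cochains
 indexed by finitely supported sequences \<open>r\<close>, and taking torus invariants amounts to prescribing the
 weight of the value at \<open>r\<close>. This complex computes the rational cohomology of \<open>G\<close>: its cohomology in degree \<open>0\<close>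
 consists of the \<open>G\<close>-invariants, and it is acyclic on \<open>W \<otimes> k[G]\<close> by a Cech argument on the cover of
 \<open>G\<close> by \<open>a \<noteq> 0\<close> and \<open>c \<noteq> 0\<close>; on each piece \<open>U\<close> acts freely. An injective module is a direct summand of
 such a module, so dimension shifting along an injective resolution applies.

 On the simple module of highest weight \<open>m\<close>, which is a twisted tensor product of symmetric powers of degrees the
 digits of \<open>m\<close>, each \<open>e i\<close> is a single Jordan block of size \<open>m i + 1\<close> on one factor. Hence the dimension of the
 cohomology in degree \<open>n\<close> is the number of sequences \<open>r\<close> of degree \<open>n\<close>, supported where \<open>m i \<noteq> p - 1\<close>, that solve
 one linear weight equation. Reading this equation digit by digit with a carry bounds the number of solutions by
 \<open>20 ^ n\<close>, and for suitable \<open>m\<close> independent choices in disjoint blocks of digits give exponentially many.\<close>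

subsection \<open>The complex of a family of commuting nilpotent operators\<close>

text \<open>G can be replaced by its Borel subgroup B because G/B is a projective line: a regular
  function invariant under right translation by B is constant, and a Laurent polynomial in
  \<open>c / a\<close> splits into a part without pole on \<open>a \<noteq> 0\<close> and one
  without pole on \<open>c \<noteq> 0\<close>. Other functions are split and glued with the binomial
  expansion of \<open>(a d - b c) ^ n = 1\<close>.

  \<open>Ext\<close> refers to a resolution that is merely chosen, so acyclicity is needed for every
  injective module, and the element type must be shown to have room for
  \<open>W \<otimes> k[G]\<close>. Quotients are formed as late as possible: dimensions are stated
  by representatives (\<open>quot_dim\<close>), and resolutions are built from maps with a
  prescribed kernel.

  Since positions are unbounded, it is not clear beforehand that the weight equation has finitely
  many solutions; the count is therefore bounded for finitely many positions, uniformly in their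
  number. The constant 20 is not sharp, but it fits below the required bound because
  \<open>5 \<le> exp 2 \<le> exp (2 * pi / sqrt 3)\<close>.\<close>

definition inc :: "nat => (nat => nat) => nat => nat" where
 "inc i r = r(i := r i + 1)"

definition dec :: "nat => (nat => nat) => nat => nat" where
 "dec i r = r(i := r i - 1)"

definition fin_supp :: "(nat => nat) => bool" where
 "fin_supp r \<longleftrightarrow> finite {i. r i > 0}"

definition deg :: "(nat => nat) => nat" where
 "deg r = (\<Sum>i | r i > 0. r i)"

text \<open>The weights, in units of the root, of the generators of the minimal resolution of
  \<open>k\<close> over \<open>k[x] / (x ^ p)\<close>: 0, 1, p, p + 1, 2 p, ..., because the
  differentials alternate between \<open>x\<close> and \<open>x ^ (p - 1)\<close>.\<close>

definition omega :: "nat => nat => nat" where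
 "omega p j = p * (j div 2) + j mod 2"

definition wgt :: "nat => (nat => nat) => nat" where
 "wgt p r = (\<Sum>i | r i > 0. p ^ i * omega p (r i))"

text \<open>The Koszul sign of the \<open>i\<close>-th differential in a tensor product of
  complexes.\<close>

definition sg :: "nat => (nat => nat) => 'a::ab_group_add => 'a" where
 "sg i r v = (if even (\<Sum>l<i. r l) then v else - v)"

lemma inc_simps [simp]: "inc i r i = r i + 1" "l \<noteq> i ==> inc i r l = r l"
 by (auto simp: inc_def)

lemma dec_simps [simp]: "dec i r i = r i - 1" "l \<noteq> i ==> dec i r l = r l"
 by (auto simp: dec_def)

lemma dec_inc [simp]: "dec i (inc i r) = r"
 by (auto simp: dec_def inc_def)

lemma inc_dec [simp]: "r i > 0 ==> inc i (dec i r) = r"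
 by (auto simp: dec_def inc_def)

lemma dec_commute: "dec i (dec l r) = dec l (dec i r)"
 by (auto simp: dec_def)

lemma inc_dec_commute: "i \<noteq> l ==> inc i (dec l r) = dec l (inc i r)"
 by (auto simp: dec_def inc_def)

lemma supp_inc: "{l. inc i r l > 0} = insert i {l. r l > 0}"
 by (auto simp: inc_def)

lemma fin_supp_inc [simp]: "fin_supp (inc i r) \<longleftrightarrow> fin_supp r"
 by (simp add: fin_supp_def supp_inc)

text \<open>The old value at \<open>i\<close> is added on both sides, so that no subtraction of
  natural numbers occurs. \<open>deg\<close>, \<open>wgt\<close> and \<open>num\<close> are
  instances.\<close>

lemma sum_supp_inc:
 fixes f :: "nat => nat => nat"
 assumes "fin_supp r" "\<And>l. f l 0 = 0"
 shows "(\<Sum>l | inc i r l > 0. f l (inc i r l)) + f i (r i) = (\<Sum>l | r l > 0. f l (r l)) + f i (r i + 1)"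
proof -
 have fin: "finite {l. r l > 0}" using assms by (simp add: fin_supp_def)
 let ?S = "{l. r l > 0} - {i}"
 have "(\<Sum>l | inc i r l > 0. f l (inc i r l)) = f i (r i + 1) + (\<Sum>l\<in>?S. f l (inc i r l))"
  unfolding supp_inc using fin by (simp add: sum.insert_remove)
 also have "(\<Sum>l\<in>?S. f l (inc i r l)) = (\<Sum>l\<in>?S. f l (r l))"
  by (rule sum.cong) auto
 finally have 1: "(\<Sum>l | inc i r l > 0. f l (inc i r l)) = f i (r i + 1) + (\<Sum>l\<in>?S. f l (r l))" .
 have "(\<Sum>l | r l > 0. f l (r l)) = f i (r i) + (\<Sum>l\<in>?S. f l (r l))"
  using fin assms(2) by (cases "r i > 0") (auto simp: sum.remove)
 then show ?thesis using 1 by simp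
qed

lemma deg_inc: "fin_supp r ==> deg (inc i r) = Suc (deg r)"
 using sum_supp_inc[of r "\<lambda>l c. c" i] by (simp add: deg_def)

lemma wgt_inc:
 assumes "fin_supp r" "p > 0"
 shows "wgt p (inc i r) = wgt p r + p ^ i * (if even (r i) then 1 else p - 1)"
proof -
 have "omega p (Suc c) = omega p c + (if even c then 1 else p - 1)" for c
 proof (cases "even c")
  case True
  then obtain k where "c = 2 * k" by (auto elim: evenE)
  then show ?thesis by (simp add: omega_def)
 next
  case False
  then obtain k where "c = 2 * k + 1" by (auto elim: oddE)
  then show ?thesis using assms by (simp add: omega_def)
 qed
 then show ?thesis
  using sum_supp_inc[of r "\<lambda>l c. p ^ l * omega p c" i] assms
  by (auto simp: wgt_def omega_def algebra_simps)
qed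

lemma sg_additive: "sg i r (v + w) = sg i r v + sg i r w"
 and sg_0 [simp]: "sg i r 0 = 0"
 and sg_minus: "sg i r (- v) = - sg i r v"
 and sg_sg [simp]: "sg i r (sg i r v) = v"
 and sg_eq_0 [simp]: "sg i r v = 0 \<longleftrightarrow> v = 0"
 by (auto simp: sg_def)

lemma sg_commute: "sg i r (sg j \<delta> v) = sg j \<delta> (sg i r v)"
 by (simp add: sg_def)

lemma sg_sum: "sg i r (sum f A) = (\<Sum>a\<in>A. sg i r (f a))"
 by (simp add: sg_def sum_negf)

lemma sum_lessThan_inc: "(\<Sum>l<j. inc i r l) = (\<Sum>l<j. r l) + (if i < j then 1 else (0::nat))"
proof (induction j)
 case (Suc j)
 then show ?case by (cases "i = j") auto
qed simp

lemma sg_inc: "sg j (inc i r) v = (if i < j then - sg j r v else sg j r v)"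
 by (simp add: sg_def sum_lessThan_inc)

lemma sg_dec: "r i > 0 ==> sg j (dec i r) v = (if i < j then - sg j r v else sg j r v)"
 using sg_inc[of j i "dec i r" v] by (auto split: if_splits)

text \<open>\<open>S\<close> is a subset of an ambient group, so that submodules and changes of
  module stay within one type. \<open>e_fin\<close> makes every vector feel only finitely many of
  the operators, which keeps the supports of chains finite.\<close>

locale graded_module =
 fixes p :: nat and S :: "'a::ab_group_add set" and e :: "nat => 'a => 'a" and Wt :: "int => 'a set"
 assumes p2: "p \<ge> 2"
  and S_0: "0 \<in> S" and S_add: "v \<in> S ==> w \<in> S ==> v + w \<in> S" and S_minus: "v \<in> S ==> - v \<in> S"
  and e_S: "v \<in> S ==> e i v \<in> S"
  and e_add: "v \<in> S ==> w \<in> S ==> e i (v + w) = e i v + e i w"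
  and e_commute: "v \<in> S ==> e i (e j v) = e j (e i v)"
  and e_nilp: "v \<in> S ==> (e i ^^ p) v = 0"
  and e_fin: "v \<in> S ==> \<exists>N. \<forall>i\<ge>N. e i v = 0"
  and Wt_S: "v \<in> Wt \<mu> ==> v \<in> S"
  and Wt_0: "0 \<in> Wt \<mu>" and Wt_add: "v \<in> Wt \<mu> ==> w \<in> Wt \<mu> ==> v + w \<in> Wt \<mu>"
  and Wt_minus: "v \<in> Wt \<mu> ==> - v \<in> Wt \<mu>"
  and e_Wt: "v \<in> Wt \<mu> ==> e i v \<in> Wt (\<mu> + 2 * int (p ^ i))"

text \<open>The argument \<open>c\<close> is the degree of the target: an odd degree is entered by
  \<open>e i\<close>, a positive even one by its power \<open>p - 1\<close>.\<close>

definition E_op :: "nat => (nat => 'a => 'a) => nat => nat => 'a => 'a::ab_group_add" where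
 "E_op p e i c v = (if odd c then e i v else (e i ^^ (p - 1)) v)"

definition D_op :: "nat => (nat => 'a => 'a) => ((nat => nat) => 'a) => (nat => nat) => 'a::ab_group_add" where
 "D_op p e z r = (\<Sum>i | r i > 0. sg i r (E_op p e i (r i) (z (dec i r))))"

text \<open>The degree is an integer so that \<open>q - 1\<close> makes sense at
  \<open>q = 0\<close>: no sequence has degree \<open>-1\<close>, hence 0 is the only chain there
  and \<open>cobd\<close> is trivial in degree 0. The factor 2 turns multiples of the root into
  weights.\<close>

definition chains :: "nat => (int => 'a set) => int => ((nat => nat) => 'a::ab_group_add) set" where
 "chains p Wt q = {z. finite {r. z r \<noteq> 0} \<and> (\<forall>r. z r \<in> Wt (2 * int (wgt p r))) \<and>
   (\<forall>r. z r \<noteq> 0 \<longrightarrow> fin_supp r \<and> int (deg r) = q)}"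

definition cocyc :: "nat => (nat => 'a => 'a) => (int => 'a set) => int => ((nat => nat) => 'a::ab_group_add) set" where
 "cocyc p e Wt q = {z \<in> chains p Wt q. D_op p e z = 0}"

definition cobd :: "nat => (nat => 'a => 'a) => (int => 'a set) => int => ((nat => nat) => 'a::ab_group_add) set" where
 "cobd p e Wt q = D_op p e ` chains p Wt (q - 1)"

context graded_module
begin

lemma e_0 [simp]: "e i 0 = 0"
 using e_add[OF S_0 S_0] by simp

lemma S_diff: "v \<in> S ==> w \<in> S ==> v - w \<in> S"
 using S_add S_minus by (metis diff_conv_add_uminus)

lemma Wt_sum: "(\<And>a. a \<in> A ==> f a \<in> Wt \<mu>) ==> sum f A \<in> Wt \<mu>"
 by (induction A rule: infinite_finite_induct) (auto simp: Wt_0 Wt_add)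

lemma S_sum: "(\<And>a. a \<in> A ==> f a \<in> S) ==> sum f A \<in> S"
 by (induction A rule: infinite_finite_induct) (auto simp: S_0 S_add)

lemma epow_S: "v \<in> S ==> (e i ^^ n) v \<in> S"
 by (induction n) (auto simp: e_S)

lemma epow_0 [simp]: "(e i ^^ n) 0 = 0"
 by (induction n) auto

lemma epow_add: "v \<in> S ==> w \<in> S ==> (e i ^^ n) (v + w) = (e i ^^ n) v + (e i ^^ n) w"
 by (induction n) (auto simp: epow_S e_add)

lemma epow_e: "v \<in> S ==> (e i ^^ n) (e j v) = e j ((e i ^^ n) v)"
 by (induction n) (auto simp: epow_S e_commute)

lemma epow_commute: "v \<in> S ==> (e i ^^ n) ((e j ^^ m) v) = (e j ^^ m) ((e i ^^ n) v)"
 by (induction n) (auto simp: epow_S epow_e[symmetric])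

lemma epow_Wt: "v \<in> Wt \<mu> ==> (e i ^^ n) v \<in> Wt (\<mu> + 2 * int (p ^ i * n))"
proof (induction n)
 case (Suc n)
 then have "e i ((e i ^^ n) v) \<in> Wt (\<mu> + 2 * int (p ^ i * n) + 2 * int (p ^ i))" using e_Wt by blast
 then show ?case by (simp add: algebra_simps)
qed simp

abbreviation "E \<equiv> E_op p e"
abbreviation "D \<equiv> D_op p e"
abbreviation "Ch \<equiv> chains p Wt"

lemma E_S: "v \<in> S ==> E i c v \<in> S"
 by (simp add: E_op_def e_S epow_S)

lemma E_0 [simp]: "E i c 0 = 0"
 by (simp add: E_op_def)

lemma E_add: "v \<in> S ==> w \<in> S ==> E i c (v + w) = E i c v + E i c w"
 by (simp add: E_op_def e_add epow_add)

lemma E_minus: "v \<in> S ==> E i c (- v) = - E i c v"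
 using E_add[of v "- v" i c] S_minus by (simp add: add_eq_0_iff)

lemma E_commute: "v \<in> S ==> E i c (E j d v) = E j d (E i c v)"
 by (auto simp: E_op_def epow_commute e_commute epow_e)

lemma E_E_Suc: "v \<in> S ==> E i (Suc c) (E i c v) = 0"
proof -
 assume v: "v \<in> S"
 have "(e i ^^ (p - 1)) (e i v) = (e i ^^ p) v"
  using p2 by (cases p) (auto simp: funpow_swap1)
 moreover have "e i ((e i ^^ (p - 1)) v) = (e i ^^ p) v"
  using p2 by (cases p) auto
 ultimately show ?thesis using e_nilp[OF v] by (simp add: E_op_def)
qed

lemma E_sum: "(\<And>a. a \<in> A ==> f a \<in> S) ==> E i c (sum f A) = (\<Sum>a\<in>A. E i c (f a))"
 by (induction A rule: infinite_finite_induct) (auto simp: E_add S_sum)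

lemma E_sg: "v \<in> S ==> E i c (sg j r v) = sg j r (E i c v)"
 by (simp add: sg_def E_minus)

lemma sg_S: "v \<in> S ==> sg j r v \<in> S"
 by (simp add: sg_def S_minus)

lemma sg_Wt: "v \<in> Wt \<mu> ==> sg j r v \<in> Wt \<mu>"
 by (simp add: sg_def Wt_minus)

lemma E_Wt:
 assumes "fin_supp r" "v \<in> Wt (2 * int (wgt p r))"
 shows "E i (r i + 1) v \<in> Wt (2 * int (wgt p (inc i r)))"
proof -
 have "E i (r i + 1) v \<in> Wt (2 * int (wgt p r) + 2 * int (p ^ i * (if even (r i) then 1 else p - 1)))"
  using e_Wt[OF assms(2), of i] epow_Wt[OF assms(2), of "p - 1" i] by (auto simp: E_op_def)
 then show ?thesis using wgt_inc[OF assms(1), of p i] p2 by (simp add: algebra_simps)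
qed

lemma chainsD:
 assumes "z \<in> Ch q"
 shows "z r \<in> S" "z r \<in> Wt (2 * int (wgt p r))" "z r \<noteq> 0 ==> fin_supp r"
  "z r \<noteq> 0 ==> int (deg r) = q" "finite {r. z r \<noteq> 0}"
 using assms Wt_S by (auto simp: chains_def)

lemma chains_0: "0 \<in> Ch q"
 by (simp add: chains_def Wt_0)

lemma chains_add: "z \<in> Ch q ==> w \<in> Ch q ==> z + w \<in> Ch q"
proof -
 assume a: "z \<in> Ch q" "w \<in> Ch q"
 have "{r. (z + w) r \<noteq> 0} \<subseteq> {r. z r \<noteq> 0} \<union> {r. w r \<noteq> 0}" by auto
 then have "finite {r. (z + w) r \<noteq> 0}" using chainsD(5)[OF a(1)] chainsD(5)[OF a(2)] by (rule finite_subset[OF _ finite_UnI])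
 moreover have "(z + w) r \<noteq> 0 ==> fin_supp r \<and> int (deg r) = q" for r
  using a chainsD(3,4)[of z q r] chainsD(3,4)[of w q r] by (cases "z r = 0") auto
 ultimately show ?thesis using a by (auto simp: chains_def Wt_add)
qed

lemma chains_minus: "z \<in> Ch q ==> - z \<in> Ch q"
 by (auto simp: chains_def Wt_minus)

lemma chains_diff: "z \<in> Ch q ==> w \<in> Ch q ==> z - w \<in> Ch q"
 using chains_add[OF _ chains_minus] by (metis diff_conv_add_uminus)

lemma D_add: "z \<in> Ch q ==> w \<in> Ch q ==> D (z + w) = D z + D w"
 by (rule ext) (simp add: D_op_def E_add chainsD(1) sg_additive sum.distrib)

lemma D_minus: "z \<in> Ch q ==> D (- z) = - D z"
 by (rule ext) (simp add: D_op_def E_minus chainsD(1) sg_minus sum_negf)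

lemma D_diff: "z \<in> Ch q ==> w \<in> Ch q ==> D (z - w) = D z - D w"
 using D_add[of z q "- w"] D_minus[of w q] chains_minus by simp

lemma D_0 [simp]: "D 0 = 0"
 by (rule ext) (simp add: D_op_def)

lemma D_chains:
 assumes z: "z \<in> Ch q"
 shows "D z \<in> Ch (q + 1)"
proof -
 let ?A = "{r. z r \<noteq> 0}"
 have "\<exists>N. \<forall>i\<ge>N. e i (z r) = 0" for r using e_fin chainsD(1)[OF z] by blast
 then obtain N where N: "\<And>r i. i \<ge> N r ==> e i (z r) = 0" by metis
 \<comment> \<open>Since \<open>p \<ge> 2\<close>, the power \<open>p - 1\<close> also contains a
   factor \<open>e i\<close>.\<close>
 have E0: "E i c (z r) = 0" if "i \<ge> N r" for i c r
 proof -
  have "(e i ^^ (p - 1)) (z r) = (e i ^^ (p - 2)) (e i (z r))"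
   using p2 by (metis (no_types, lifting) Suc_1 Suc_diff_Suc Suc_le_lessD comp_apply funpow_Suc_right numeral_2_eq_2 One_nat_def)
  then show ?thesis using N[OF that] by (simp add: E_op_def)
 qed
 have nz: "\<exists>i. r i > 0 \<and> z (dec i r) \<noteq> 0 \<and> i < N (dec i r)" if "D z r \<noteq> 0" for r
 proof -
  obtain i where "r i > 0" "E i (r i) (z (dec i r)) \<noteq> 0"
   using \<open>D z r \<noteq> 0\<close> unfolding D_op_def by (auto elim!: sum.not_neutral_contains_not_neutral)
  then show ?thesis using E0 by (metis E_0 not_le)
 qed
 have "{r. D z r \<noteq> 0} \<subseteq> (\<Union>\<delta>\<in>?A. (\<lambda>i. inc i \<delta>) ` {..<N \<delta>})"
 proof
  fix r assume "r \<in> {r. D z r \<noteq> 0}"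
  then obtain i where "r i > 0" "z (dec i r) \<noteq> 0" "i < N (dec i r)" using nz by blast
  then show "r \<in> (\<Union>\<delta>\<in>?A. (\<lambda>i. inc i \<delta>) ` {..<N \<delta>})"
   by (intro UN_I[of "dec i r"]) (auto intro!: image_eqI[of _ _ i])
 qed
 then have 1: "finite {r. D z r \<noteq> 0}"
  by (rule finite_subset) (auto simp: chainsD(5)[OF z])
 have 2: "D z r \<in> Wt (2 * int (wgt p r))" for r
  unfolding D_op_def
 proof (intro Wt_sum sg_Wt)
  fix i assume i: "i \<in> {i. r i > 0}"
  show "E i (r i) (z (dec i r)) \<in> Wt (2 * int (wgt p r))"
  proof (cases "z (dec i r) = 0")
   case False
   then show ?thesis using E_Wt[of "dec i r" "z (dec i r)" i] chainsD(2,3)[OF z, of "dec i r"] i by auto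
  qed (simp add: Wt_0)
 qed
 have 3: "fin_supp r \<and> int (deg r) = q + 1" if "D z r \<noteq> 0" for r
 proof -
  obtain i where i: "r i > 0" "z (dec i r) \<noteq> 0" using nz[OF \<open>D z r \<noteq> 0\<close>] by blast
  then have f: "fin_supp (dec i r)" "int (deg (dec i r)) = q" using chainsD[OF z] by auto
  have "fin_supp (inc i (dec i r))" "deg (inc i (dec i r)) = Suc (deg (dec i r))"
   using f deg_inc by auto
  then show ?thesis using i f by simp
 qed
 show ?thesis using 1 2 3 by (auto simp: chains_def)
qed

text \<open>Terms using the same index twice contain \<open>e i ^^ p\<close>; terms with two
  different indices occur in both orders, with opposite Koszul signs.\<close>

lemma D_D:
 assumes z: "z \<in> Ch q"
 shows "D (D z) = 0"
proof
 fix r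
 have zS: "z \<delta> \<in> S" for \<delta> using chainsD(1)[OF z] .
 show "D (D z) r = 0 r"
 proof (cases "fin_supp r")
  case False
  then show ?thesis by (simp add: D_op_def[of p e "D z"] fin_supp_def)
 next
  case True
  let ?A = "{i. r i > 0}"
  have fin: "finite ?A" using True by (simp add: fin_supp_def)
  define t where "t i l = sg i r (sg l (dec i r) (E i (r i) (E l (dec i r l) (z (dec l (dec i r))))))" for i l
  have sub: "{l. dec i r l > 0} \<subseteq> ?A" for i by (auto simp: dec_def split: if_splits)
  have "D (D z) r = (\<Sum>i\<in>?A. \<Sum>l | dec i r l > 0. t i l)"
   by (simp add: D_op_def t_def E_sum sg_S E_S zS E_sg sg_sum)
  also have "... = (\<Sum>i\<in>?A. \<Sum>l\<in>?A. if i = l then 0 else t i l)"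
  proof (intro sum.cong[OF refl])
   fix i assume i: "i \<in> ?A"
   have ti: "t i i = 0" if "dec i r i > 0"
   proof -
    have "r i = Suc (dec i r i)" using i by simp
    then have "E i (r i) (E i (dec i r i) (z (dec i (dec i r)))) = 0" using E_E_Suc zS by metis
    then show ?thesis by (simp add: t_def)
   qed
   have "(\<Sum>l | dec i r l > 0. t i l) = (\<Sum>l | dec i r l > 0. if i = l then 0 else t i l)"
    by (rule sum.cong) (auto simp: ti)
   also have "... = (\<Sum>l\<in>?A. if i = l then 0 else t i l)"
    by (rule sum.mono_neutral_left[OF fin sub]) (auto simp: dec_def)
   finally show "(\<Sum>l | dec i r l > 0. t i l) = (\<Sum>l\<in>?A. if i = l then 0 else t i l)" .
  qed
  also have "... = (\<Sum>i\<in>?A. \<Sum>l\<in>?A. (if i < l then t i l else 0) + (if l < i then t i l else 0))"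
   by (intro sum.cong refl) auto
  also have "... = (\<Sum>i\<in>?A. \<Sum>l\<in>?A. if i < l then t i l else 0) + (\<Sum>i\<in>?A. \<Sum>l\<in>?A. if l < i then t i l else 0)"
   by (simp add: sum.distrib)
  also have "(\<Sum>i\<in>?A. \<Sum>l\<in>?A. if l < i then t i l else 0) = (\<Sum>i\<in>?A. \<Sum>l\<in>?A. if i < l then t l i else 0)"
   by (rule sum.swap)
  also have "(\<Sum>i\<in>?A. \<Sum>l\<in>?A. if i < l then t i l else 0) + ...
    = (\<Sum>i\<in>?A. \<Sum>l\<in>?A. if i < l then t i l + t l i else 0)"
   by (simp add: sum.distrib[symmetric] if_distrib cong: if_cong)
  also have "... = 0"
  proof (intro sum.neutral ballI)
   fix i l assume "i \<in> ?A" "l \<in> ?A"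
   then show "(if i < l then t i l + t l i else 0) = 0"
    by (simp add: t_def dec_commute[of l i] E_commute[OF zS, of i _ l] sg_dec sg_minus sg_commute[of l _ i])
  qed
  finally show ?thesis by simp
 qed
qed

lemma cobd_subset_cocyc: "cobd p e Wt q \<subseteq> cocyc p e Wt q"
 using D_chains[of _ "q - 1"] D_D by (auto simp: cobd_def cocyc_def)

end

section \<open>Homotopies in a single index\<close>

locale index_homotopy = graded_module p S e Wt
 for p :: nat and S :: "'a::ab_group_add set" and e Wt +
 fixes i :: nat and ho he :: "'a => 'a"
 assumes ho_S: "v \<in> S ==> ho v \<in> S" and he_S: "v \<in> S ==> he v \<in> S"
  and ho_add: "v \<in> S ==> w \<in> S ==> ho (v + w) = ho v + ho w"
  and he_add: "v \<in> S ==> w \<in> S ==> he (v + w) = he v + he w"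
  and ho_e: "v \<in> S ==> l \<noteq> i ==> ho (e l v) = e l (ho v)"
  and he_e: "v \<in> S ==> l \<noteq> i ==> he (e l v) = e l (he v)"
  and ho_Wt: "v \<in> Wt \<mu> ==> ho v \<in> Wt (\<mu> - 2 * int (p ^ i))"
  and he_Wt: "v \<in> Wt \<mu> ==> he v \<in> Wt (\<mu> - 2 * int (p ^ i * (p - 1)))"
begin

definition H :: "nat => 'a => 'a" where
 "H c v = (if odd c then ho v else he v)"

definition hh :: "((nat => nat) => 'a) => (nat => nat) => 'a" where
 "hh z r = sg i r (H (r i + 1) (z (inc i r)))"

text \<open>What remains of the identity after the homotopy in index \<open>i\<close>. The maps
  \<open>ho\<close> and \<open>he\<close> are meant as partial inverses of \<open>e i\<close> and of
  its power \<open>p - 1\<close>; no such relation is assumed, and the failure is recorded here. In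
  degree 0 nothing enters from below, hence the case distinction.\<close>

definition Pi :: "nat => 'a => 'a" where
 "Pi c v = v - (if c > 0 then E i c (H c v) else 0) - H (c + 1) (E i (c + 1) v)"

lemma H_S: "v \<in> S ==> H c v \<in> S"
 by (simp add: H_def ho_S he_S)

lemma H_add: "v \<in> S ==> w \<in> S ==> H c (v + w) = H c v + H c w"
 by (simp add: H_def ho_add he_add)

lemma H_0 [simp]: "H c 0 = 0"
 using H_add[OF S_0 S_0, of c] by simp

lemma H_minus: "v \<in> S ==> H c (- v) = - H c v"
 using H_add[of v "- v" c] S_minus by (simp add: add_eq_0_iff)

lemma H_sum: "(\<And>a. a \<in> A ==> f a \<in> S) ==> H c (sum f A) = (\<Sum>a\<in>A. H c (f a))"
 by (induction A rule: infinite_finite_induct) (auto simp: H_add S_sum)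

lemma H_sg: "v \<in> S ==> H c (sg j r v) = sg j r (H c v)"
 by (simp add: sg_def H_minus)

lemma H_epow: "v \<in> S ==> l \<noteq> i ==> H c ((e l ^^ n) v) = (e l ^^ n) (H c v)"
 by (induction n) (auto simp: H_def ho_e he_e epow_S)

lemma H_E: "v \<in> S ==> l \<noteq> i ==> H c (E l d v) = E l d (H c v)"
 using H_epow[of v l c 1] by (auto simp: E_op_def H_epow)

lemma Pi_0 [simp]: "Pi c 0 = 0"
 by (simp add: Pi_def)

lemma hh_chains:
 assumes z: "z \<in> Ch q"
 shows "hh z \<in> Ch (q - 1)"
proof -
 have nz: "z (inc i r) \<noteq> 0" if "hh z r \<noteq> 0" for r
  using that by (auto simp: hh_def)
 have "{r. hh z r \<noteq> 0} \<subseteq> dec i ` {r. z r \<noteq> 0}"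
  using nz by (auto intro!: image_eqI[of _ _ "inc i _"])
 then have 1: "finite {r. hh z r \<noteq> 0}"
  by (rule finite_subset) (simp add: chainsD(5)[OF z])
 have 2: "hh z r \<in> Wt (2 * int (wgt p r))" for r
 proof (cases "z (inc i r) = 0")
  case False
  then have f: "fin_supp r" using chainsD(3)[OF z, of "inc i r"] by simp
  have w: "z (inc i r) \<in> Wt (2 * int (wgt p r + p ^ i * (if even (r i) then 1 else p - 1)))"
   using chainsD(2)[OF z, of "inc i r"] wgt_inc[OF f, of p i] p2 by simp
  have "H (r i + 1) (z (inc i r)) \<in> Wt (2 * int (wgt p r))"
  proof (cases "even (r i)")
   case True
   then show ?thesis using ho_Wt[OF w] by (simp add: H_def)
  next
   case False
   then show ?thesis using he_Wt[OF w] by (simp add: H_def algebra_simps)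
  qed
  then show ?thesis by (simp add: hh_def sg_Wt)
 qed (simp add: hh_def Wt_0)
 have 3: "fin_supp r \<and> int (deg r) = q - 1" if "hh z r \<noteq> 0" for r
 proof -
  have "fin_supp (inc i r)" "int (deg (inc i r)) = q"
   using chainsD(3,4)[OF z, of "inc i r"] nz[OF that] by blast+
  then show ?thesis by (simp add: deg_inc)
 qed
 show ?thesis using 1 2 3 by (auto simp: chains_def)
qed

text \<open>For \<open>l \<noteq> i\<close> the homotopy commutes with \<open>E l\<close> while the
  Koszul signs differ, so the mixed terms cancel and only index \<open>i\<close>
  contributes.\<close>

lemma homotopy:
 assumes z: "z \<in> Ch q"
 shows "(z - D (hh z) - hh (D z)) r = Pi (r i) (z r)"
proof (cases "fin_supp r")
 case False
 have "H c (D z (inc i r)) = 0" for c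
  using chainsD(3)[OF D_chains[OF z], of "inc i r"] False by (cases "D z (inc i r) = 0") auto
 moreover have "z r = 0" using chainsD(3)[OF z] False by blast
 moreover have "D (hh z) r = 0" using False by (simp add: D_op_def fin_supp_def)
 ultimately show ?thesis by (simp add: hh_def)
next
 case True
 have zS: "z \<delta> \<in> S" for \<delta> using chainsD(1)[OF z] .
 let ?A = "{l. r l > 0} - {i}"
 have fin: "finite {l. r l > 0}" using True by (simp add: fin_supp_def)
 define t where "t l = sg l r (sg i (dec l r) (E l (r l) (H (r i + 1) (z (inc i (dec l r))))))" for l
 define u where "u l = sg l r (sg i (dec l r) (E l (r l) (H (dec l r i + 1) (z (inc i (dec l r))))))" for l
 define w where "w l = sg i r (sg l (inc i r) (H (r i + 1) (E l (inc i r l) (z (dec l (inc i r))))))" for l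
 have ut: "u l = t l" if "l \<noteq> i" for l
  using that by (simp add: u_def t_def)
 have wt: "w l = - t l" if "l \<in> ?A" for l
  using that by (cases "i < l")
   (auto simp: w_def t_def inc_dec_commute H_E zS sg_inc sg_dec sg_minus sg_commute[of l _ i])
 have "D (hh z) r = sum u {l. r l > 0}"
  by (simp add: D_op_def hh_def E_sg H_S zS u_def)
 then have 1: "D (hh z) r = (if r i > 0 then E i (r i) (H (r i) (z r)) else 0) + sum t ?A"
 proof (cases "r i > 0")
  case True
  have "sum u {l. r l > 0} = u i + sum u ?A"
   using fin True by (simp add: sum.remove)
  moreover have "u i = E i (r i) (H (r i) (z r))" using True by (simp add: u_def sg_dec)
  moreover have "sum u ?A = sum t ?A" by (rule sum.cong) (auto simp: ut)
  ultimately show ?thesis using True \<open>D (hh z) r = _\<close> by simp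
 next
  case False
  then have A: "?A = {l. r l > 0}" by auto
  have "sum u ?A = sum t ?A" by (rule sum.cong) (auto simp: ut)
  then show ?thesis using False A \<open>D (hh z) r = _\<close> by simp
 qed
 have "hh (D z) r = sum w (insert i {l. r l > 0})"
  by (simp add: hh_def D_op_def supp_inc H_sum sg_S E_S zS H_sg sg_sum w_def)
 also have "... = w i + sum w ?A"
  using fin by (rule sum.insert_remove)
 finally have "hh (D z) r = w i + sum w ?A" .
 moreover have "sum w ?A = (\<Sum>l\<in>?A. - t l)" by (rule sum.cong) (auto simp: wt)
 moreover have "w i = H (r i + 1) (E i (r i + 1) (z r))"
  by (simp add: w_def sg_inc[of i i])
 ultimately have 2: "hh (D z) r = H (r i + 1) (E i (r i + 1) (z r)) - sum t ?A"
  by (simp add: sum_negf)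
 show ?thesis using 1 2 by (simp add: Pi_def)
qed

end

primrec iterPi :: "(nat => nat => 'a => 'a) => nat => (nat => nat) => 'a => 'a" where
 "iterPi P 0 r v = v"
| "iterPi P (Suc N) r v = P N (r N) (iterPi P N r v)"

text \<open>Each step changes the cocycle by a coboundary, so the result is again a cocycle and the
  next index can be treated. Only finitely many indices are treated; \<open>N\<close> is later
  chosen beyond all supports.\<close>

lemma (in graded_module) iterate_homotopy:
 assumes hom: "\<And>i. index_homotopy p S e Wt i (ho i) (he i)"
  and P: "\<And>i c v. v \<in> S ==> P i c v = index_homotopy.Pi p e i (ho i) (he i) c v"
  and z: "z \<in> cocyc p e Wt q"
 shows "\<exists>y\<in>Ch (q - 1). z - D y = (\<lambda>r. iterPi P N r (z r))"
proof (induction N)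
 case 0
 have "D (\<lambda>a. 0) = (\<lambda>a. 0)" using D_0 by (simp add: zero_fun_def)
 then show ?case by (intro bexI[OF _ chains_0]) simp
next
 case (Suc N)
 then obtain y where y: "y \<in> Ch (q - 1)" "z - D y = (\<lambda>r. iterPi P N r (z r))" by blast
 interpret index_homotopy p S e Wt N "ho N" "he N" by (rule hom)
 have zc: "z \<in> Ch q" "D z = 0" using z by (auto simp: cocyc_def)
 have Dy: "D y \<in> Ch q" using D_chains[OF y(1)] by simp
 define w where "w = z - D y"
 have w: "w \<in> Ch q" unfolding w_def by (rule chains_diff[OF zc(1) Dy])
 have "D w = 0" unfolding w_def using D_diff[OF zc(1) Dy] D_D[OF y(1)] zc by simp
 then have "hh (D w) = 0" by (auto simp: hh_def sg_0)
 then have "(w - D (hh w)) r = Pi (r N) (w r)" for r using homotopy[OF w, of r] by simp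
 then have "w - D (hh w) = (\<lambda>r. P N (r N) (w r))"
  using P chainsD(1)[OF w] by auto
 moreover have "w = (\<lambda>r. iterPi P N r (z r))" using y w_def by simp
 ultimately have "z - D (y + hh w) = (\<lambda>r. iterPi P (Suc N) r (z r))"
  using D_add[OF y(1) hh_chains[OF w]] w_def by (simp add: diff_diff_eq[symmetric])
 then show ?case using chains_add[OF y(1) hh_chains[OF w]] by blast
qed

section \<open>Spaces of functions with values in the field, and dimensions of their
  quotients\<close>

definition fscale :: "'k::field => ('i => 'k) => 'i => 'k" where
 "fscale c v = (\<lambda>i. c * v i)"

definition cscale :: "'k::field => ('j => 'i => 'k) => 'j => 'i => 'k" where
 "cscale c z = (\<lambda>r. fscale c (z r))"

lemma fscale_apply [simp]: "fscale c v i = c * v i"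
 by (simp add: fscale_def)

lemma sum_fun_apply: "sum f A x = (\<Sum>a\<in>A. f a x)"
 for f :: "'a => 'b => 'c::comm_monoid_add"
 by (induction A rule: infinite_finite_induct) auto

lemma fscale_simps [simp]: "fscale 1 v = v" "fscale 0 v = 0" "fscale c 0 = 0" "fscale c (fscale d v) = fscale (c * d) v"
 by (auto simp: fscale_def)

lemma fscale_add: "fscale c (v + w) = fscale c v + fscale c w"
 and fscale_add_left: "fscale (c + d) v = fscale c v + fscale d v"
 and fscale_diff: "fscale c (v - w) = fscale c v - fscale c w"
 and fscale_minus: "fscale c (- v) = - fscale c v"
 by (auto simp: fscale_def algebra_simps)

lemma fscale_sum: "fscale c (sum f A) = (\<Sum>a\<in>A. fscale c (f a))"
 by (rule ext) (simp add: sum_fun_apply sum_distrib_left)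

text \<open>The dimension of \<open>A / B\<close>, expressed by representatives of a basis instead
  of a quotient object. The scaling \<open>s\<close> is a parameter because vectors and chains are
  both treated.\<close>

definition quot_dim :: "('k::field => 'a => 'a) => 'a set => 'a::ab_group_add set => nat => bool" where
 "quot_dim s A B n \<longleftrightarrow> (\<exists>x. (\<forall>l<n. x l \<in> A) \<and> (\<forall>a\<in>A. \<exists>c. a - (\<Sum>l<n. s (c l) (x l)) \<in> B) \<and>
   (\<forall>c. (\<Sum>l<n. s (c l) (x l)) \<in> B \<longrightarrow> (\<forall>l<n. c l = 0)))"

subsection \<open>Dimension shifting\<close>

text \<open>Isomorphisms of quotients such as connecting homomorphisms are given by linear relations.\<close>

lemma quot_dim_transfer:
 fixes s :: "'k::field => 'a::ab_group_add => 'a" and s' :: "'k => 'b::ab_group_add => 'b"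
 assumes "quot_dim s A B n"
  and R0: "R 0 0" and diff: "\<And>a b a' b'. R a b ==> R a' b' ==> R (a - a') (b - b')"
  and scale: "\<And>c a b. R a b ==> R (s c a) (s' c b)"
  and dom: "\<And>a b. R a b ==> b \<in> A'"
  and tot: "\<And>a. a \<in> A ==> \<exists>b. R a b" and surj: "\<And>b. b \<in> A' ==> \<exists>a\<in>A. R a b"
  and iff: "\<And>a b. R a b ==> a \<in> B \<longleftrightarrow> b \<in> B'"
 shows "quot_dim s' A' B' n"
proof -
 obtain x where x: "\<forall>l<n. x l \<in> A" "\<forall>a\<in>A. \<exists>c. a - (\<Sum>l<n. s (c l) (x l)) \<in> B"
  "\<forall>c. (\<Sum>l<n. s (c l) (x l)) \<in> B \<longrightarrow> (\<forall>l<n. c l = 0)"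
  using assms(1) unfolding quot_dim_def by blast
 define y where "y l = (SOME b. R (x l) b)" for l
 have y: "R (x l) (y l)" if "l < n" for l
  unfolding y_def using tot x(1) that by (blast intro: someI_ex)
 have add: "R (a + a') (b + b')" if "R a b" "R a' b'" for a b a' b'
  using diff[OF that(1) diff[OF R0 that(2)]] by simp
 have sm: "R (\<Sum>l<m. s (c l) (x l)) (\<Sum>l<m. s' (c l) (y l))" if "m \<le> n" for c m
  using that by (induction m) (auto simp: R0 intro!: add scale y)
 show ?thesis
  unfolding quot_dim_def
 proof (intro exI[of _ y] conjI allI impI ballI)
  fix l assume "l < n" then show "y l \<in> A'" using dom y by blast
 next
  fix b assume "b \<in> A'"
  then obtain a where a: "a \<in> A" "R a b" using surj by blast
  then obtain c where "a - (\<Sum>l<n. s (c l) (x l)) \<in> B" using x by blast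
  then show "\<exists>c. b - (\<Sum>l<n. s' (c l) (y l)) \<in> B'"
   using iff[OF diff[OF a(2) sm[of n c]]] by auto
 next
  fix c l assume "(\<Sum>l<n. s' (c l) (y l)) \<in> B'" "l < n"
  then show "c l = 0" using iff[OF sm[of n c]] x(3) by auto
 qed
qed

locale graded_space = graded_module p S e Wt
 for p :: nat and S :: "('i => 'k::field) set" and e Wt +
 assumes S_scale: "v \<in> S ==> fscale c v \<in> S"
  and e_scale: "v \<in> S ==> e i (fscale c v) = fscale c (e i v)"
  and Wt_scale: "v \<in> Wt \<mu> ==> fscale c v \<in> Wt \<mu>"

lemma additive_0: 
 fixes f :: "'a::ab_group_add => 'b::ab_group_add"
 assumes "0 \<in> S" "\<And>v w. v \<in> S ==> w \<in> S ==> f (v + w) = f v + f w"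
 shows "f 0 = 0"
 using assms(2)[OF assms(1) assms(1)] by simp

locale graded_map = A: graded_module p S e Wt + B: graded_module p S' e' Wt'
 for p :: nat and S :: "'a::ab_group_add set" and e Wt and S' :: "'b::ab_group_add set" and e' Wt' +
 fixes f :: "'a => 'b"
 assumes f_S: "v \<in> S ==> f v \<in> S'"
  and f_add: "v \<in> S ==> w \<in> S ==> f (v + w) = f v + f w"
  and f_e: "v \<in> S ==> f (e i v) = e' i (f v)"
  and f_Wt: "v \<in> Wt \<mu> ==> f v \<in> Wt' \<mu>"
begin

lemma f_0: "f 0 = 0"
 by (rule additive_0[OF A.S_0 f_add])

lemma f_minus: "v \<in> S ==> f (- v) = - f v"
 using f_add[of v "- v"] A.S_minus f_0 by (simp add: add_eq_0_iff)

lemma f_diff: "v \<in> S ==> w \<in> S ==> f (v - w) = f v - f w"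
 using f_add[of v "- w"] A.S_minus f_minus by simp

lemma f_sum: "(\<And>a. a \<in> X ==> g a \<in> S) ==> f (sum g X) = (\<Sum>a\<in>X. f (g a))"
 by (induction X rule: infinite_finite_induct) (auto simp: f_0 f_add A.S_sum)

lemma f_epow: "v \<in> S ==> f ((e i ^^ n) v) = (e' i ^^ n) (f v)"
 by (induction n) (auto simp: f_e A.epow_S)

lemma f_D:
 assumes "\<And>r. z r \<in> S"
 shows "D_op p e' (\<lambda>r. f (z r)) = (\<lambda>r. f (D_op p e z r))"
proof
 fix r
 have "f (sg i r (A.E i c v)) = sg i r (B.E i c (f v))" if "v \<in> S" for i c v
  using that by (simp add: sg_def E_op_def f_e f_epow f_minus A.epow_S A.e_S)
 then show "D_op p e' (\<lambda>r. f (z r)) r = f (D_op p e z r)"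
  unfolding D_op_def by (subst f_sum) (auto simp: assms A.E_S A.sg_S)
qed

lemma f_chains: "z \<in> A.Ch q ==> (\<lambda>r. f (z r)) \<in> B.Ch q"
proof -
 assume z: "z \<in> A.Ch q"
 have "f (z r) \<noteq> 0 ==> z r \<noteq> 0" for r using f_0 by auto
 then have "{r. f (z r) \<noteq> 0} \<subseteq> {r. z r \<noteq> 0}" by auto
 then have "finite {r. f (z r) \<noteq> 0}" using A.chainsD(5)[OF z] finite_subset by blast
 then show ?thesis using z f_Wt f_0 unfolding chains_def by auto metis+
qed

lemma f_cocyc: "z \<in> cocyc p e Wt q ==> (\<lambda>r. f (z r)) \<in> cocyc p e' Wt' q"
 using f_D[of z] A.chainsD(1) f_0 by (auto simp: cocyc_def f_chains)

lemma f_cobd: "z \<in> cobd p e Wt q ==> (\<lambda>r. f (z r)) \<in> cobd p e' Wt' q"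
proof -
 assume "z \<in> cobd p e Wt q"
 then obtain y where y: "y \<in> A.Ch (q - 1)" "z = D_op p e y" by (auto simp: cobd_def)
 then show ?thesis
  using f_D[of y] f_chains[OF y(1)] A.chainsD(1)[OF y(1)] unfolding cobd_def by (auto intro!: image_eqI)
qed

end

lemma (in graded_space) scale_map: "graded_map p S e Wt S e Wt (fscale c)"
 by unfold_locales (auto simp: S_scale e_scale Wt_scale fscale_add)

lemma (in graded_space) cscale_chains: "z \<in> Ch q ==> cscale c z \<in> Ch q"
 using graded_map.f_chains[OF scale_map] by (simp add: cscale_def)

lemma (in graded_space) cscale_D: "z \<in> Ch q ==> D (cscale c z) = cscale c (D z)"
 using graded_map.f_D[OF scale_map] chainsD(1) by (simp add: cscale_def)

lemma (in graded_module) cocyc_diff: "z \<in> cocyc p e Wt q ==> w \<in> cocyc p e Wt q ==> z - w \<in> cocyc p e Wt q"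
 by (auto simp: cocyc_def chains_diff D_diff)

lemma (in graded_module) cocyc_0: "0 \<in> cocyc p e Wt q"
 using D_0 chains_0 by (simp add: cocyc_def)

lemma (in graded_space) cocyc_scale: "z \<in> cocyc p e Wt q ==> cscale c z \<in> cocyc p e Wt q"
 by (auto simp: cocyc_def cscale_chains cscale_D) (auto simp: cscale_def)

text \<open>Lifting and membership are required weight by weight: \<open>d_lift\<close>,
  \<open>\<psi>_Wt\<close> and \<open>exact\<close> together make the sequences of chain groups
  exact.\<close>

locale short_exact =
 A: graded_space p S1 e1 W1 + B: graded_space p S2 e2 W2 + C: graded_space p S3 e3 W3 +
 i: graded_map p S1 e1 W1 S2 e2 W2 \<psi> + d: graded_map p S2 e2 W2 S3 e3 W3 d
 for p :: nat and S1 :: "('i1 => 'k::field) set" and e1 W1 and S2 :: "('i2 => 'k) set" and e2 W2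
  and S3 :: "('i3 => 'k) set" and e3 W3 and \<psi> and d +
 assumes \<psi>_inj: "v \<in> S1 ==> \<psi> v = 0 ==> v = 0"
  and \<psi>_Wt: "v \<in> S1 ==> \<psi> v \<in> W2 \<mu> ==> v \<in> W1 \<mu>"
  and \<psi>_scale: "v \<in> S1 ==> \<psi> (fscale c v) = fscale c (\<psi> v)"
  and d_scale: "x \<in> S2 ==> d (fscale c x) = fscale c (d x)"
  and d_lift: "u \<in> W3 \<mu> ==> \<exists>x\<in>W2 \<mu>. d x = u"
  and exact: "x \<in> S2 ==> d x = 0 \<longleftrightarrow> x \<in> \<psi> ` S1"
begin

lemma chain_lift:
 assumes u: "u \<in> C.Ch q"
 shows "\<exists>y\<in>B.Ch q. (\<lambda>r. d (y r)) = u"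
proof -
 \<comment> \<open>The value 0 over 0 keeps the support finite.\<close>
 define y where "y r = (if u r = 0 then 0 else SOME v. v \<in> W2 (2 * int (wgt p r)) \<and> d v = u r)" for r
 have y: "y r \<in> W2 (2 * int (wgt p r)) \<and> d (y r) = u r" for r
 proof (cases "u r = 0")
  case False
  have "\<exists>v. v \<in> W2 (2 * int (wgt p r)) \<and> d v = u r" using d_lift[OF C.chainsD(2)[OF u, of r]] by blast
  from someI_ex[OF this] show ?thesis using False by (simp add: y_def)
 qed (simp add: y_def B.Wt_0 d.f_0)
 have nz: "y r \<noteq> 0 ==> u r \<noteq> 0" for r by (auto simp: y_def)
 then have "{r. y r \<noteq> 0} \<subseteq> {r. u r \<noteq> 0}" by auto
 then have "finite {r. y r \<noteq> 0}" using C.chainsD(5)[OF u] finite_subset by blast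
 then have "y \<in> B.Ch q" using y nz C.chainsD[OF u] unfolding chains_def by auto
 then show ?thesis using y by blast
qed

lemma chain_pull:
 assumes y: "y \<in> B.Ch q" and 0: "\<And>r. d (y r) = 0"
 shows "\<exists>w\<in>A.Ch q. (\<lambda>r. \<psi> (w r)) = y"
proof -
 define w where "w r = (if y r = 0 then 0 else SOME v. v \<in> S1 \<and> \<psi> v = y r)" for r
 have w: "w r \<in> S1 \<and> \<psi> (w r) = y r" for r
 proof (cases "y r = 0")
  case False
  have "\<exists>v. v \<in> S1 \<and> \<psi> v = y r" using exact[OF B.chainsD(1)[OF y], of r] 0 by auto
  from someI_ex[OF this] show ?thesis using False by (simp add: w_def)
 qed (simp add: w_def A.S_0 i.f_0)
 have nz: "w r \<noteq> 0 ==> y r \<noteq> 0" for r by (auto simp: w_def)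
 then have "{r. w r \<noteq> 0} \<subseteq> {r. y r \<noteq> 0}" by auto
 then have "finite {r. w r \<noteq> 0}" using B.chainsD(5)[OF y] finite_subset by blast
 then have "w \<in> A.Ch q" using w nz B.chainsD[OF y] \<psi>_Wt unfolding chains_def by auto
 then show ?thesis using w by blast
qed

lemma \<psi>_eq: "v \<in> S1 ==> w \<in> S1 ==> \<psi> v = \<psi> w ==> v = w"
 using \<psi>_inj[of "v - w"] i.f_diff A.S_diff by (metis eq_iff_diff_eq_0)

lemma d\<psi>: "v \<in> S1 ==> d (\<psi> v) = 0"
 using exact[of "\<psi> v"] i.f_S by blast

text \<open>The denominator on the right consists of the images of the cocycles of the middle term
  and of the coboundaries. If the middle term is acyclic in degree \<open>q > 0\<close> too, it
  reduces to the coboundaries; for \<open>q = 0\<close> only the image of the invariants remains.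
  One statement serves both ends of the shifting.\<close>

lemma dimension_shift:
 assumes acyc: "cocyc p e2 W2 (q + 1) \<subseteq> cobd p e2 W2 (q + 1)"
  and qd: "quot_dim cscale (cocyc p e1 W1 (q + 1)) (cobd p e1 W1 (q + 1)) n"
 shows "quot_dim cscale (cocyc p e3 W3 q)
  {(\<lambda>r. d (y r)) + D_op p e3 w | y w. y \<in> cocyc p e2 W2 q \<and> w \<in> chains p W3 (q - 1)} n"
proof -
 \<comment> \<open>The connecting map as a relation: \<open>b\<close> lifts to a chain
   \<open>y\<close> whose differential comes from \<open>a\<close>. No choice of \<open>y\<close>
   has to be made.\<close>
 define R where "R a b \<longleftrightarrow> a \<in> cocyc p e1 W1 (q + 1) \<and>
  (\<exists>y\<in>B.Ch q. (\<lambda>r. d (y r)) = b \<and> B.D y = (\<lambda>r. \<psi> (a r)))" for a b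
 have dD: "C.D (\<lambda>r. d (y r)) = (\<lambda>r. d (B.D y r))" if "y \<in> B.Ch t" for y t
  using d.f_D[of y] B.chainsD(1)[OF that] by simp
 have iD: "B.D (\<lambda>r. \<psi> (y r)) = (\<lambda>r. \<psi> (A.D y r))" if "y \<in> A.Ch t" for y t
  using i.f_D[of y] A.chainsD(1)[OF that] by simp
 show ?thesis
 proof (rule quot_dim_transfer[OF qd, of R])
  show "R 0 0"
   unfolding R_def using A.cocyc_0 B.chains_0 i.f_0 d.f_0 B.D_0
   by (auto intro!: bexI[of _ 0] simp: zero_fun_def)
 next
  fix a b a' b' assume t: "R a b" "R a' b'"
  then obtain y y' where y: "y \<in> B.Ch q" "(\<lambda>r. d (y r)) = b" "B.D y = (\<lambda>r. \<psi> (a r))"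
   and y': "y' \<in> B.Ch q" "(\<lambda>r. d (y' r)) = b'" "B.D y' = (\<lambda>r. \<psi> (a' r))" by (auto simp: R_def)
  have a: "a \<in> A.Ch (q + 1)" "a' \<in> A.Ch (q + 1)" using t by (auto simp: R_def cocyc_def)
  have "(\<lambda>r. d ((y - y') r)) = b - b'"
   using d.f_diff B.chainsD(1) y y' by (auto simp: fun_eq_iff)
  moreover have "B.D (y - y') = (\<lambda>r. \<psi> ((a - a') r))"
   using B.D_diff[OF y(1) y'(1)] y(3) y'(3) i.f_diff A.chainsD(1) a by (auto simp: fun_eq_iff)
  ultimately show "R (a - a') (b - b')"
   using t A.cocyc_diff B.chains_diff[OF y(1) y'(1)] unfolding R_def by blast
 next
  fix c a b assume t: "R a b"
  then obtain y where y: "y \<in> B.Ch q" "(\<lambda>r. d (y r)) = b" "B.D y = (\<lambda>r. \<psi> (a r))" by (auto simp: R_def)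
  have a: "a \<in> A.Ch (q + 1)" using t by (auto simp: R_def cocyc_def)
  have "(\<lambda>r. d (cscale c y r)) = cscale c b"
   using d_scale B.chainsD(1) y by (auto simp: cscale_def)
  moreover have "B.D (cscale c y) = (\<lambda>r. \<psi> (cscale c a r))"
   using B.cscale_D[OF y(1)] y(3) \<psi>_scale A.chainsD(1)[OF a] by (auto simp: cscale_def)
  ultimately show "R (cscale c a) (cscale c b)"
   using t A.cocyc_scale B.cscale_chains[OF y(1)] unfolding R_def by blast
 next
  fix a b assume "R a b"
  then obtain y where y: "y \<in> B.Ch q" "(\<lambda>r. d (y r)) = b" "B.D y = (\<lambda>r. \<psi> (a r))"
   and a: "a \<in> A.Ch (q + 1)" by (auto simp: R_def cocyc_def)
  have "C.D b = 0" using dD[OF y(1)] y(2,3) d\<psi> A.chainsD(1)[OF a] by auto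
  then show "b \<in> cocyc p e3 W3 q" using d.f_chains[OF y(1)] y(2) by (auto simp: cocyc_def)
 next
  fix a assume a: "a \<in> cocyc p e1 W1 (q + 1)"
  then have "(\<lambda>r. \<psi> (a r)) \<in> cobd p e2 W2 (q + 1)" using i.f_cocyc acyc by blast
  then obtain y where "y \<in> B.Ch q" "B.D y = (\<lambda>r. \<psi> (a r))" by (auto simp: cobd_def)
  then show "\<exists>b. R a b" using a by (auto simp: R_def)
 next
  fix b assume b: "b \<in> cocyc p e3 W3 q"
  then obtain y where y: "y \<in> B.Ch q" "(\<lambda>r. d (y r)) = b" using chain_lift by (auto simp: cocyc_def)
  have "d (B.D y r) = 0" for r using dD[OF y(1)] y(2) b by (auto simp: cocyc_def fun_eq_iff)
  then obtain a where a: "a \<in> A.Ch (q + 1)" "(\<lambda>r. \<psi> (a r)) = B.D y"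
   using chain_pull[OF B.D_chains[OF y(1)]] by blast
  have "\<psi> (A.D a r) = 0" for r
   using iD[OF a(1)] B.D_D[OF y(1)] a(2) by (auto simp: fun_eq_iff)
  then have "A.D a = 0" using \<psi>_inj A.chainsD(1)[OF A.D_chains[OF a(1)]] by auto
  then show "\<exists>a\<in>cocyc p e1 W1 (q + 1). R a b"
   using a y by (intro bexI[of _ a]) (auto simp: R_def cocyc_def)
 next
  fix a b assume t: "R a b"
  then obtain y where y: "y \<in> B.Ch q" "(\<lambda>r. d (y r)) = b" "B.D y = (\<lambda>r. \<psi> (a r))"
   and a: "a \<in> A.Ch (q + 1)" by (auto simp: R_def cocyc_def)
  show "a \<in> cobd p e1 W1 (q + 1) \<longleftrightarrow>
   b \<in> {(\<lambda>r. d (y r)) + D_op p e3 w | y w. y \<in> cocyc p e2 W2 q \<and> w \<in> chains p W3 (q - 1)}" (is "_ \<longleftrightarrow> b \<in> ?B")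
  proof
   assume "a \<in> cobd p e1 W1 (q + 1)"
   then obtain w where w: "w \<in> A.Ch q" "a = A.D w" by (auto simp: cobd_def)
   let ?u = "\<lambda>r. \<psi> (w r)"
   have u: "?u \<in> B.Ch q" by (rule i.f_chains[OF w(1)])
   have "B.D (y - ?u) = 0" using B.D_diff[OF y(1) u] iD[OF w(1)] y(3) w(2) by auto
   then have c: "y - ?u \<in> cocyc p e2 W2 q" using B.chains_diff[OF y(1) u] by (simp add: cocyc_def)
   have "d (y r - \<psi> (w r)) = b r" for r
    using y(2) d.f_diff[of "y r" "\<psi> (w r)"] B.chainsD(1)[OF y(1)] B.chainsD(1)[OF u] d\<psi> A.chainsD(1)[OF w(1)] by auto
   then have "b = (\<lambda>r. d ((y - ?u) r)) + C.D 0" using C.D_0 by auto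
   then show "b \<in> ?B" using c C.chains_0 by blast
  next
   assume "b \<in> ?B"
   then obtain y0 w'' where y0: "y0 \<in> cocyc p e2 W2 q" and w'': "w'' \<in> C.Ch (q - 1)"
    and b: "b = (\<lambda>r. d (y0 r)) + C.D w''" by blast
   obtain w where w: "w \<in> B.Ch (q - 1)" "(\<lambda>r. d (w r)) = w''" using chain_lift[OF w''] by blast
   have y0': "y0 \<in> B.Ch q" "B.D y0 = 0" using y0 by (auto simp: cocyc_def)
   have Dw: "B.D w \<in> B.Ch q" using B.D_chains[OF w(1)] by simp
   \<comment> \<open>Corrected by a cocycle and a coboundary of the middle term, the lift
     \<open>y\<close> of \<open>b\<close> comes from the first term; the chain obtained there has
     differential \<open>a\<close>.\<close>
   let ?u = "y - y0 - B.D w"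
   have u: "?u \<in> B.Ch q" by (intro B.chains_diff y(1) y0' Dw)
   have "d (?u r) = 0" for r
   proof -
    have "d (?u r) = d (y r) - d (y0 r) - d (B.D w r)"
     using d.f_diff B.S_diff B.chainsD(1) y(1) y0' Dw by auto
    also have "d (B.D w r) = C.D w'' r" using dD[OF w(1)] w(2) by (auto simp: fun_eq_iff)
    also have "d (y r) = d (y0 r) + C.D w'' r" using fun_cong[OF y(2), of r] fun_cong[OF b, of r] by simp
    finally show ?thesis by (simp only: add_diff_cancel_left' diff_self)
   qed
   then obtain w' where w': "w' \<in> A.Ch q" "(\<lambda>r. \<psi> (w' r)) = ?u" using chain_pull[OF u] by blast
   have "B.D ?u = B.D y"
    using B.D_diff[OF B.chains_diff[OF y(1) y0'(1)] Dw] B.D_diff[OF y(1) y0'(1)] y0'(2) B.D_D[OF w(1)] by simp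
   then have "(\<lambda>r. \<psi> (A.D w' r)) = (\<lambda>r. \<psi> (a r))" using iD[OF w'(1)] w'(2) y(3) by simp
   then have "A.D w' = a"
    using \<psi>_eq A.chainsD(1)[OF A.D_chains[OF w'(1)]] A.chainsD(1)[OF a] by (metis ext)
   then show "a \<in> cobd p e1 W1 (q + 1)" using w'(1) by (auto simp: cobd_def)
  qed
 qed
qed

end

definition num :: "nat => (nat => nat) => nat" where
 "num p s = (\<Sum>i | s i > 0. p ^ i * s i)"

lemma num_inc: "fin_supp s ==> num p (inc i s) = num p s + p ^ i"
 using sum_supp_inc[of s "\<lambda>l c. p ^ l * c" i] by (simp add: num_def algebra_simps)

lemma num_upd: "fin_supp s ==> num p (s(i := s i + n)) = num p s + p ^ i * n"
proof (induction n)
 case (Suc n)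
 have "s(i := s i + Suc n) = inc i (s(i := s i + n))" by (auto simp: inc_def)
 moreover have "fin_supp (s(i := s i + n))"
  using Suc.prems unfolding fin_supp_def by (rule rev_finite_subset[of "insert i {l. s l > 0}", OF finite.insertI]) auto
 ultimately show ?case using Suc.IH[OF Suc.prems] num_inc[of "s(i := s i + n)" p i] by (simp only:) (simp add: algebra_simps)
qed simp

definition slice :: "('s \<times> 'j => 'k) => 's => 'j => 'k" where
 "slice f s = (\<lambda>j. f (s, j))"

subsection \<open>Tensor products of twisted symmetric powers\<close>

text \<open>Digit sequences \<open>s \<le> m\<close> index the basis of a tensor product over \<open>i\<close> of twisted symmetric powers
 of degree \<open>m i < p\<close>, with a multiplicity space \<open>V\<close>. For \<open>V = k\<close> this is the simple module of
 highest weight \<open>num p m\<close>; when all \<open>m i\<close> are \<open>p - 1\<close> it is the coordinate ring of the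
 unipotent group tensored with \<open>V\<close>.\<close>

definition digit_space :: "(nat => nat) => ('j => 'k::field) set => ((nat => nat) \<times> 'j => 'k) set" where
 "digit_space m V = {f. finite {s. slice f s \<noteq> 0} \<and> (\<forall>s. slice f s \<noteq> 0 \<longrightarrow> fin_supp s \<and> s \<le> m) \<and> (\<forall>s. slice f s \<in> V)}"

text \<open>The entry at \<open>s\<close> is the coefficient of the vector obtained from a highest
  weight vector by divided powers, of orders \<open>s i\<close>, of the lowering operators. On these
  vectors \<open>e i\<close> multiplies by \<open>m i - s i + 1\<close> and lowers
  \<open>s i\<close> by one.\<close>

definition digit_e :: "(nat => nat) => nat => ((nat => nat) \<times> 'j => 'k::field) => (nat => nat) \<times> 'j => 'k" where
 "digit_e m i f = (\<lambda>(s, j). of_nat (m i - s i) * f (inc i s, j))"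

text \<open>The basis vector at \<open>s\<close> lies \<open>2 * num p s\<close> below the top one,
  so its coefficient must have a weight larger by this amount.\<close>

definition digit_Wt :: "nat => (nat => nat) => ('j => 'k::field) set => (int => ('j => 'k) set) => int =>
  ((nat => nat) \<times> 'j => 'k) set" where
 "digit_Wt p m V VW \<mu> = {f \<in> digit_space m V. \<forall>s. slice f s \<in> VW (\<mu> + 2 * int (num p s))}"

text \<open>Inverts \<open>e i\<close> wherever it moves a basis vector to a nonzero multiple of
  another: the denominator is the factor on the way from \<open>s\<close> to
  \<open>dec i s\<close>.\<close>

definition digit_ho :: "(nat => nat) => nat => ((nat => nat) \<times> 'j => 'k::field) => (nat => nat) \<times> 'j => 'k" where
 "digit_ho m i f = (\<lambda>(s, j). if s \<le> m \<and> s i > 0 then f (dec i s, j) / of_nat (m i - s i + 1) else 0)"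

text \<open>The power \<open>p - 1\<close> of \<open>e i\<close> is zero unless
  \<open>m i = p - 1\<close>; then it moves the lowest vector to the highest with factor
  \<open>fact (p - 1)\<close>, which is inverted here.\<close>

definition digit_he :: "nat => (nat => nat) => nat => ((nat => nat) \<times> 'j => 'k::field) => (nat => nat) \<times> 'j => 'k" where
 "digit_he p m i f = (\<lambda>(s, j). if s \<le> m \<and> m i = p - 1 \<and> s i = p - 1 then f (s(i := 0), j) / of_nat (fact (p - 1)) else 0)"

lemma slice_ext: "(\<And>s. slice f s = slice g s) ==> f = g"
 by (auto simp: slice_def fun_eq_iff)

lemma slice_eq_0D: "slice f s = 0 ==> f (s, j) = 0"
 by (drule fun_cong[of _ _ j]) (simp add: slice_def)

lemma slice_simps [simp]:
 "slice 0 s = 0" "slice (f + g) s = slice f s + slice g s" "slice (- f) s = - slice f s"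
 "slice (fscale c f) s = fscale c (slice f s)"
 by (auto simp: slice_def)

lemma slice_e: "slice (digit_e m i f) s = fscale (of_nat (m i - s i)) (slice f (inc i s))"
 by (auto simp: slice_def digit_e_def)

lemma slice_ho: "slice (digit_ho m i f) s =
  (if s \<le> m \<and> s i > 0 then fscale (1 / of_nat (m i - s i + 1)) (slice f (dec i s)) else 0)"
 by (auto simp: slice_def digit_ho_def)

lemma slice_he: "slice (digit_he p m i f) s =
  (if s \<le> m \<and> m i = p - 1 \<and> s i = p - 1 then fscale (1 / of_nat (fact (p - 1))) (slice f (s(i := 0))) else 0)"
 by (auto simp: slice_def digit_he_def)

lemma slice_e_pow:
 "slice ((digit_e m i ^^ n) f) s = fscale (of_nat (\<Prod>k<n. m i - s i - k)) (slice f (s(i := s i + n)))"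
proof (induction n arbitrary: s)
 case (Suc n)
 have 1: "(inc i s)(i := inc i s i + n) = s(i := s i + Suc n)" by (auto simp: inc_def)
 have 2: "(\<Prod>k<n. m i - inc i s i - k) = (\<Prod>k<n. m i - s i - Suc k)"
  by (intro prod.cong) auto
 have "slice ((digit_e m i ^^ Suc n) f) s = fscale (of_nat (m i - s i)) (slice ((digit_e m i ^^ n) f) (inc i s))"
  by (simp add: slice_e)
 also have "... = fscale (of_nat ((m i - s i) * (\<Prod>k<n. m i - s i - Suc k))) (slice f (s(i := s i + Suc n)))"
  unfolding Suc.IH 1 2 fscale_simps of_nat_mult ..
 also have "(m i - s i) * (\<Prod>k<n. m i - s i - Suc k) = (\<Prod>k<Suc n. m i - s i - k)"
  by (simp only: prod.lessThan_Suc_shift) simp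
 finally show ?case .
qed simp

text \<open>The place of the surviving basis vector. In odd degree the cokernel of
  \<open>e i\<close> survives, spanned by the lowest vector \<open>s i = m i\<close>; in even degree
  its kernel, spanned by \<open>s i = 0\<close>.\<close>

definition odd_part :: "(nat => nat) => (nat => nat) => nat => nat" where
 "odd_part m r i = (if odd (r i) then m i else 0)"

text \<open>The sequences at which the surviving basis vector has the weight required of a chain. A
  position with \<open>m i = p - 1\<close> is free over \<open>k[e i] / (e i ^ p)\<close> and
  therefore contributes in degree 0 only.\<close>

definition solutions :: "nat => (nat => nat) => nat => (nat => nat) set" where
 "solutions p m q = {r. fin_supp r \<and> deg r = q \<and> (\<forall>i. m i = p - 1 \<longrightarrow> r i = 0) \<and>
   int (num p m) - 2 * int (num p (odd_part m r)) = 2 * int (wgt p r)}"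

lemma fact_nz:
 assumes "CHAR('k::field) = p" "prime p" "n < p"
 shows "(of_nat (fact n) :: 'k) \<noteq> 0"
proof -
 have "\<not> p dvd fact n" using assms by (simp add: prime_dvd_fact_iff)
 then show ?thesis using assms by (simp add: of_nat_eq_0_iff_char_dvd)
qed

lemma of_nat_nz:
 assumes "CHAR('k::field) = p" "0 < n" "n < p"
 shows "(of_nat n :: 'k) \<noteq> 0"
 using assms by (auto simp: of_nat_eq_0_iff_char_dvd dest: dvd_imp_le)

text \<open>\<open>V\<close> and its weight spaces \<open>VW\<close> are kept abstract, since they
  will be both \<open>k\<close> and the \<open>U\<close>-invariants of a localized coordinate
  ring.\<close>

locale digit_setup =
 fixes p :: nat and m :: "nat => nat" and V :: "('j => 'k::field) set" and VW :: "int => ('j => 'k) set"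
 assumes char: "CHAR('k) = p" and prime: "prime p" and m_less: "m i < p"
  and V_0: "0 \<in> V" and V_add: "v \<in> V ==> w \<in> V ==> v + w \<in> V" and V_scale: "v \<in> V ==> fscale c v \<in> V"
  and VW_0: "0 \<in> VW \<nu>" and VW_add: "v \<in> VW \<nu> ==> w \<in> VW \<nu> ==> v + w \<in> VW \<nu>"
  and VW_scale: "v \<in> VW \<nu> ==> fscale c v \<in> VW \<nu>"
begin

abbreviation "S \<equiv> digit_space m V"
abbreviation "Wt \<equiv> digit_Wt p m V VW"

lemma VW_sum: "(\<And>a. a \<in> X ==> f a \<in> VW \<nu>) ==> sum f X \<in> VW \<nu>"
 by (induction X rule: infinite_finite_induct) (simp_all only: sum.infinite sum.empty sum.insert VW_0 VW_add insert_iff simp_thms)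

lemma p_ge_2: "p \<ge> 2" using prime prime_ge_2_nat by blast

lemma fscale_neg: "- v = fscale (- 1) v" for v :: "'j => 'k"
 by (simp add: fun_eq_iff)

lemma inc_le: "inc i s \<le> m \<longleftrightarrow> s \<le> m \<and> s i < m i"
proof
 assume h: "inc i s \<le> m"
 have "s l \<le> m l" for l using le_funD[OF h, of l] by (cases "l = i") auto
 moreover have "s i < m i" using le_funD[OF h, of i] by simp
 ultimately show "s \<le> m \<and> s i < m i" by (simp add: le_fun_def)
qed (auto simp: le_fun_def inc_def)

lemma space0: "f \<in> S ==> \<not> s \<le> m ==> slice f s = 0"
 by (auto simp: digit_space_def)

lemma digit_e_pow_0:
 assumes "f \<in> S" "m i < s i + n"
 shows "slice ((digit_e m i ^^ n) f) s = 0"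
proof -
 have "\<not> s(i := s i + n) \<le> m" using assms(2) by (auto simp: le_fun_def not_le intro!: exI[of _ i])
 then show ?thesis using assms(1) by (simp add: slice_e_pow space0)
qed

lemma S_I:
 assumes "finite X" "\<And>s. slice f s \<noteq> 0 ==> s \<in> X \<and> fin_supp s \<and> s \<le> m" "\<And>s. slice f s \<in> V"
 shows "f \<in> S"
proof -
 have "finite {s. slice f s \<noteq> 0}" by (rule finite_subset[OF _ assms(1)]) (use assms(2) in auto)
 then show ?thesis using assms by (auto simp: digit_space_def)
qed

lemma S_D:
 assumes "f \<in> S"
 shows "finite {s. slice f s \<noteq> 0}" "slice f s \<noteq> 0 ==> fin_supp s" "slice f s \<noteq> 0 ==> s \<le> m" "slice f s \<in> V"
 using assms by (auto simp: digit_space_def)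

lemma e_in_S: "f \<in> S ==> digit_e m i f \<in> S"
proof (rule S_I[of "dec i ` {s. slice f s \<noteq> 0}"])
 assume f: "f \<in> S"
 show "finite (dec i ` {s. slice f s \<noteq> 0})" using S_D[OF f] by simp
 show "slice (digit_e m i f) s \<in> V" for s using S_D(4)[OF f] by (simp add: slice_e V_scale)
 fix s assume "slice (digit_e m i f) s \<noteq> 0"
 then have nz: "slice f (inc i s) \<noteq> 0" by (auto simp: slice_e)
 then show "s \<in> dec i ` {s. slice f s \<noteq> 0} \<and> fin_supp s \<and> s \<le> m"
  using S_D(2,3)[OF f nz] by (auto simp: inc_le intro!: image_eqI[of _ _ "inc i s"])
qed

lemma add_in_S: "f \<in> S ==> g \<in> S ==> f + g \<in> S"
proof (rule S_I[of "{s. slice f s \<noteq> 0} \<union> {s. slice g s \<noteq> 0}"])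
 assume f: "f \<in> S" and g: "g \<in> S"
 show "finite ({s. slice f s \<noteq> 0} \<union> {s. slice g s \<noteq> 0})" using S_D(1)[OF f] S_D(1)[OF g] by simp
 show "slice (f + g) s \<in> V" for s using S_D(4)[OF f] S_D(4)[OF g] by (simp add: V_add)
 fix s assume "slice (f + g) s \<noteq> 0"
 then have "slice f s \<noteq> 0 \<or> slice g s \<noteq> 0" by auto
 then show "s \<in> {s. slice f s \<noteq> 0} \<union> {s. slice g s \<noteq> 0} \<and> fin_supp s \<and> s \<le> m"
  using S_D(2,3)[OF f, of s] S_D(2,3)[OF g, of s] by auto
qed

lemma scale_in_S: "f \<in> S ==> fscale c f \<in> S"
proof (rule S_I[of "{s. slice f s \<noteq> 0}"])
 assume f: "f \<in> S"
 show "finite {s. slice f s \<noteq> 0}" using S_D(1)[OF f] .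
 show "slice (fscale c f) s \<in> V" for s using S_D(4)[OF f] by (simp add: V_scale)
 fix s assume "slice (fscale c f) s \<noteq> 0"
 then have "slice f s \<noteq> 0" by auto
 then show "s \<in> {s. slice f s \<noteq> 0} \<and> fin_supp s \<and> s \<le> m" using S_D(2,3)[OF f, of s] by auto
qed

lemma uminus_scale: "- f = fscale (- 1) f" for f :: "(nat => nat) \<times> 'j => 'k"
 by (simp add: fun_eq_iff)

sublocale graded_space p S "digit_e m" Wt
proof
 show "p \<ge> 2" by (rule p_ge_2)
 show "0 \<in> S" "0 \<in> Wt \<mu>" for \<mu> by (auto simp: digit_space_def digit_Wt_def V_0 VW_0)
 show "v + w \<in> S" if "v \<in> S" "w \<in> S" for v w using that by (rule add_in_S)
 show "- v \<in> S" if "v \<in> S" for v unfolding uminus_scale using that by (rule scale_in_S)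
 show "digit_e m i v \<in> S" if "v \<in> S" for v i using that by (rule e_in_S)
 show "digit_e m i (v + w) = digit_e m i v + digit_e m i w" for v w :: "(nat => nat) \<times> 'j => 'k" and i
  by (rule slice_ext) (simp add: slice_e fscale_add)
 show "digit_e m i (digit_e m j v) = digit_e m j (digit_e m i v)" for v :: "(nat => nat) \<times> 'j => 'k" and i j
 proof (cases "i = j")
  case False
  then have "inc i (inc j s) = inc j (inc i s)" for s by (auto simp: inc_def)
  then show ?thesis using False by (intro slice_ext) (simp add: slice_e mult.commute)
 qed simp
 show "(digit_e m i ^^ p) v = 0" if "v \<in> S" for v i
  by (rule slice_ext) (use digit_e_pow_0[OF that, of i _ p] m_less[of i] in simp)
 show "\<exists>N. \<forall>i\<ge>N. digit_e m i v = 0" if v: "v \<in> S" for v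
 proof -
  have "finite (\<Union>s\<in>{s. slice v s \<noteq> 0}. {i. s i > 0})"
   using S_D(1,2)[OF v] by (auto simp: fin_supp_def)
  then obtain N where N: "\<And>i. i \<in> (\<Union>s\<in>{s. slice v s \<noteq> 0}. {i. s i > 0}) ==> i < N"
   by (metis finite_nat_set_iff_bounded)
  have "digit_e m i v = 0" if "i \<ge> N" for i
  proof (rule slice_ext)
   fix s
   have "slice v (inc i s) = 0"
   proof (rule ccontr)
    assume "slice v (inc i s) \<noteq> 0"
    then have "i < N" by (intro N UN_I[of "inc i s"]) auto
    then show False using that by simp
   qed
   then show "slice (digit_e m i v) s = slice 0 s" by (simp add: slice_e)
  qed
  then show ?thesis by blast
 qed
 show "v \<in> S" if "v \<in> Wt \<mu>" for v \<mu> using that by (simp add: digit_Wt_def)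
 show "v + w \<in> Wt \<mu>" if "v \<in> Wt \<mu>" "w \<in> Wt \<mu>" for v w \<mu>
  using that by (auto simp: digit_Wt_def add_in_S VW_add)
 show sc: "fscale c v \<in> Wt \<mu>" if "v \<in> Wt \<mu>" for c v \<mu>
  using that by (auto simp: digit_Wt_def scale_in_S VW_scale)
 show "- v \<in> Wt \<mu>" if "v \<in> Wt \<mu>" for v \<mu> unfolding uminus_scale using that by (rule sc)
 show "digit_e m i v \<in> Wt (\<mu> + 2 * int (p ^ i))" if v: "v \<in> Wt \<mu>" for v \<mu> i
 proof -
  have vS: "v \<in> S" using v by (simp add: digit_Wt_def)
  have "slice v (inc i s) \<in> VW (\<mu> + 2 * int (p ^ i) + 2 * int (num p s))" for s
  proof (cases "slice v (inc i s) = 0")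
   case False
   then have "fin_supp s" using S_D(2)[OF vS False] by simp
   moreover have "slice v (inc i s) \<in> VW (\<mu> + 2 * int (num p (inc i s)))" using v by (simp add: digit_Wt_def)
   ultimately show ?thesis by (simp add: num_inc algebra_simps)
  qed (simp add: VW_0)
  then show ?thesis using e_in_S[OF vS] by (simp add: digit_Wt_def slice_e VW_scale del: of_nat_power)
 qed
 show "fscale c v \<in> S" if "v \<in> S" for c v using that by (rule scale_in_S)
 show "digit_e m i (fscale c v) = fscale c (digit_e m i v)" for i c and v :: "(nat => nat) \<times> 'j => 'k"
  by (rule slice_ext) (simp add: slice_e mult.commute)
qed

lemma ho_in_S: "f \<in> S ==> digit_ho m i f \<in> S"
proof (rule S_I[of "inc i ` {s. slice f s \<noteq> 0}"])
 assume f: "f \<in> S"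
 show "finite (inc i ` {s. slice f s \<noteq> 0})" using S_D(1)[OF f] by simp
 show "slice (digit_ho m i f) s \<in> V" for s using S_D(4)[OF f] by (simp add: slice_ho V_scale V_0)
 fix s assume "slice (digit_ho m i f) s \<noteq> 0"
 then have nz: "slice f (dec i s) \<noteq> 0" "s i > 0" "s \<le> m" by (auto simp: slice_ho split: if_splits)
 then have "s = inc i (dec i s)" "fin_supp (dec i s)" using S_D(2)[OF f nz(1)] by auto
 then show "s \<in> inc i ` {s. slice f s \<noteq> 0} \<and> fin_supp s \<and> s \<le> m"
  using nz by (metis (mono_tags, lifting) fin_supp_inc image_eqI mem_Collect_eq)
qed

lemma he_in_S: "f \<in> S ==> digit_he p m i f \<in> S"
proof (rule S_I[of "(\<lambda>s. s(i := p - 1)) ` {s. slice f s \<noteq> 0}"])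
 assume f: "f \<in> S"
 show "finite ((\<lambda>s. s(i := p - 1)) ` {s. slice f s \<noteq> 0})" using S_D(1)[OF f] by simp
 show "slice (digit_he p m i f) s \<in> V" for s using S_D(4)[OF f] by (simp add: slice_he V_scale V_0)
 fix s assume "slice (digit_he p m i f) s \<noteq> 0"
 then have nz: "slice f (s(i := 0)) \<noteq> 0" "s i = p - 1" "s \<le> m" by (auto simp: slice_he split: if_splits)
 then have s: "s = (s(i := 0))(i := p - 1)" by auto
 have "{l. s l > 0} \<subseteq> insert i {l. (s(i := 0)) l > 0}" by auto
 moreover have "finite {l. (s(i := 0)) l > 0}" using S_D(2)[OF f nz(1)] by (simp add: fin_supp_def)
 ultimately have "fin_supp s" unfolding fin_supp_def using finite_subset finite.insertI by blast
 then show "s \<in> (\<lambda>s. s(i := p - 1)) ` {s. slice f s \<noteq> 0} \<and> fin_supp s \<and> s \<le> m"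
  using nz s by (metis (mono_tags, lifting) image_eqI mem_Collect_eq)
qed

lemma hom: "index_homotopy p S (digit_e m) Wt i (digit_ho m i) (digit_he p m i)"
proof (unfold_locales, goal_cases)
 case (1 v) then show ?case by (rule ho_in_S)
next
 case (2 v) then show ?case by (rule he_in_S)
next
 case (3 v w) show ?case by (rule slice_ext) (auto simp: slice_ho fscale_add)
next
 case (4 v w) show ?case by (rule slice_ext) (auto simp: slice_he fscale_add)
next
 case (5 v l)
 have "slice (digit_ho m i (digit_e m l v)) s = slice (digit_e m l (digit_ho m i v)) s" for s
 proof (cases "s \<le> m \<and> s i > 0 \<and> s l < m l")
  case True
  then show ?thesis using 5 by (simp add: slice_ho slice_e inc_le inc_dec_commute mult.commute)
 next
  case False
  have "slice (digit_ho m i v) (inc l s) = 0 \<or> m l \<le> s l" using False 5 by (auto simp: slice_ho inc_le)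
  moreover have "slice (digit_ho m i (digit_e m l v)) s = 0" using False 5 by (auto simp: slice_ho slice_e)
  ultimately show ?thesis by (auto simp: slice_e)
 qed
 then show ?case by (rule slice_ext)
next
 case (6 v l)
 have upd: "inc l (s(i := 0)) = (inc l s)(i := 0)" for s using 6 by (auto simp: inc_def)
 have "slice (digit_he p m i (digit_e m l v)) s = slice (digit_e m l (digit_he p m i v)) s" for s
 proof (cases "s \<le> m \<and> m i = p - 1 \<and> s i = p - 1 \<and> s l < m l")
  case True
  then show ?thesis using 6 upd by (simp add: slice_he slice_e inc_le mult.commute)
 next
  case False
  have "slice (digit_he p m i v) (inc l s) = 0 \<or> m l \<le> s l" using False 6 by (auto simp: slice_he inc_le)
  moreover have "slice (digit_he p m i (digit_e m l v)) s = 0" using False 6 by (auto simp: slice_he slice_e)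
  ultimately show ?thesis by (auto simp: slice_e)
 qed
 then show ?case by (rule slice_ext)
next
 case (7 v \<mu>)
 then have v: "v \<in> S" by (simp add: digit_Wt_def)
 have "slice v (dec i s) \<in> VW (\<mu> - 2 * int (p ^ i) + 2 * int (num p s))" if "s i > 0" for s
 proof (cases "slice v (dec i s) = 0")
  case False
  have "slice v (dec i s) \<in> VW (\<mu> + 2 * int (num p (dec i s)))" using 7 by (simp add: digit_Wt_def)
  moreover have "int (num p s) = int (num p (dec i s)) + int (p ^ i)"
   using num_inc[of "dec i s" p i] S_D(2)[OF v False] that by simp
  then have "\<mu> - 2 * int (p ^ i) + 2 * int (num p s) = \<mu> + 2 * int (num p (dec i s))" by linarith
  ultimately show ?thesis by (simp only:)
 qed (simp add: VW_0)
 then show ?case using ho_in_S[OF v] by (simp add: digit_Wt_def slice_ho VW_scale VW_0 del: of_nat_power)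
next
 case (8 v \<mu>)
 then have v: "v \<in> S" by (simp add: digit_Wt_def)
 have "slice v (s(i := 0)) \<in> VW (\<mu> - 2 * int (p ^ i * (p - 1)) + 2 * int (num p s))" if "s i = p - 1" for s
 proof (cases "slice v (s(i := 0)) = 0")
  case False
  have "slice v (s(i := 0)) \<in> VW (\<mu> + 2 * int (num p (s(i := 0))))" using 8 by (simp add: digit_Wt_def)
  moreover have "(s(i := 0))(i := (s(i := 0)) i + (p - 1)) = s" using that by auto
  then have "int (num p s) = int (num p (s(i := 0))) + int (p ^ i * (p - 1))"
   using num_upd[of "s(i := 0)" p i "p - 1"] S_D(2)[OF v False] by simp
  then have "\<mu> - 2 * int (p ^ i * (p - 1)) + 2 * int (num p s) = \<mu> + 2 * int (num p (s(i := 0)))" by linarith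
  ultimately show ?thesis by (simp only:)
 qed (simp add: VW_0)
 then show ?case using he_in_S[OF v] by (simp add: digit_Wt_def slice_he VW_scale VW_0 del: of_nat_power of_nat_mult)
qed

text \<open>The pairs of degree and digit at which the cohomology of one Jordan block of size
  \<open>m i + 1\<close> lives.\<close>

definition harm :: "nat => nat => nat => bool" where
 "harm i c x \<longleftrightarrow> (if m i = p - 1 then c = 0 \<and> x = 0 else x = (if even c then 0 else m i))"

abbreviation "PP i \<equiv> index_homotopy.Pi p (digit_e m) i (digit_ho m i) (digit_he p m i)"

lemma PP_S:
 assumes "f \<in> S"
 shows "PP i c f \<in> S"
proof -
 interpret index_homotopy p S "digit_e m" Wt i "digit_ho m i" "digit_he p m i" by (rule hom)
 show ?thesis unfolding Pi_def using assms by (auto intro!: S_diff H_S E_S)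
qed

lemma slice_diff: "slice (f - g) s = slice f s - slice g s" for f g :: "(nat => nat) \<times> 'j => 'k"
 by (auto simp: slice_def)

text \<open>Away from the harmonic pairs exactly one of the two correction terms in
  \<open>Pi\<close> reproduces the slice, so the difference is 0. Facts 1 to 4 evaluate the four
  composites of an operator and its partial inverse.\<close>

lemma PP_support:
 assumes f: "f \<in> S" and nz: "slice (PP i c f) s \<noteq> 0"
 shows "slice f s \<noteq> 0 \<and> harm i c (s i)"
proof -
 interpret index_homotopy p S "digit_e m" Wt i "digit_ho m i" "digit_he p m i" by (rule hom)
 have mi: "m i \<le> p - 1" using m_less[of i] by simp
 show ?thesis
 proof (cases "s \<le> m")
  case False
  have "slice g s = 0" if "g \<in> S" for g using space0[OF that False] .
  then show ?thesis using nz PP_S[OF f] by blast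
 next
  case True
  then have si: "s i \<le> m i" by (simp add: le_fun_def)
  have 1: "slice (digit_e m i (digit_ho m i f)) s = (if s i < m i then slice f s else 0)"
  proof (cases "s i < m i")
   case True
   have "(of_nat (m i - s i) :: 'k) \<noteq> 0" using True mi p_ge_2 char by (intro of_nat_nz) auto
   moreover have "Suc (m i - Suc (s i)) = m i - s i" using True by simp
   ultimately show ?thesis using True \<open>s \<le> m\<close> by (simp add: slice_e slice_ho inc_le)
  qed (simp add: slice_e)
  have 2: "slice (digit_ho m i (digit_e m i f)) s = (if s i > 0 then slice f s else 0)"
  proof (cases "s i > 0")
   case True
   have "(of_nat (m i - s i + 1) :: 'k) \<noteq> 0" using True si m_less[of i] char by (intro of_nat_nz) auto
   moreover have "m i - (s i - 1) = m i - s i + 1" using True si by simp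
   ultimately show ?thesis using True \<open>s \<le> m\<close> by (simp add: slice_e slice_ho)
  qed (simp add: slice_ho)
  have facts: "(\<Prod>k<p - 1. p - 1 - k) = fact (p - 1)"
   by (simp add: fact_prod_rev lessThan_atLeast0)
  have fnz: "(of_nat (fact (p - 1)) :: 'k) \<noteq> 0" using char prime p_ge_2 by (intro fact_nz) auto
  have 3: "slice ((digit_e m i ^^ (p - 1)) (digit_he p m i f)) s = (if m i = p - 1 \<and> s i = 0 then slice f s else 0)"
  proof (cases "m i = p - 1 \<and> s i = 0")
   case True
   have "s(i := p - 1) \<le> m" using True \<open>s \<le> m\<close> by (auto simp: le_fun_def)
   moreover have "s(i := 0) = s" using True by auto
   ultimately show ?thesis using True facts fnz by (simp add: slice_e_pow slice_he)
  next
   case False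
   then have "m i < s i + (p - 1)" using mi si by auto
   then show ?thesis using False digit_e_pow_0[OF he_S[OF f]] by auto
  qed
  have 4: "slice (digit_he p m i ((digit_e m i ^^ (p - 1)) f)) s = (if m i = p - 1 \<and> s i = p - 1 then slice f s else 0)"
  proof (cases "m i = p - 1 \<and> s i = p - 1")
   case True
   have "s(i := p - 1) = s" using True by auto
   then show ?thesis using True \<open>s \<le> m\<close> facts fnz by (simp add: slice_e_pow slice_he)
  qed (auto simp: slice_he)
  have "p - 1 > 0" using p_ge_2 by simp
  then show ?thesis
   using nz si mi 1 2 3 4
   by (auto simp: Pi_def H_def E_op_def harm_def slice_diff split: if_splits)
 qed
qed

lemma iterPi_S: "f \<in> S ==> iterPi PP n r f \<in> S"
 by (induction n) (simp_all add: PP_S)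

lemma iterPi_support:
 assumes "f \<in> S" "slice (iterPi PP N r f) s \<noteq> 0"
 shows "slice f s \<noteq> 0 \<and> (\<forall>i<N. harm i (r i) (s i))"
 using assms(2)
proof (induction N)
 case (Suc N)
 have "slice (iterPi PP N r f) s \<noteq> 0 \<and> harm N (r N) (s N)"
  by (rule PP_support[OF iterPi_S[OF assms(1)]]) (use Suc.prems in \<open>simp only: iterPi.simps not_False_eq_True\<close>)
 then show ?case using Suc.IH less_Suc_eq by metis
qed simp

lemma slice_nz: "f \<noteq> 0 ==> \<exists>s. slice f s \<noteq> 0" for f :: "(nat => nat) \<times> 'j => 'k"
 using slice_ext[of f 0] by auto

text \<open>At a free position the only harmonic pair is degree 0 with the highest vector, so the
  iterated homotopy can leave a nonzero value only at the zero sequence, which has degree 0.\<close>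

theorem acyclic_if_free:
 assumes free: "\<And>i. m i = p - 1" and q: "q > 0"
 shows "cocyc p (digit_e m) Wt q \<subseteq> cobd p (digit_e m) Wt q"
proof
 fix z assume z: "z \<in> cocyc p (digit_e m) Wt q"
 then have zc: "z \<in> Ch q" by (simp add: cocyc_def)
 have "finite (\<Union>r\<in>{r. z r \<noteq> 0}. {i. r i > 0})"
  using chainsD(3,5)[OF zc] by (auto simp: fin_supp_def)
 \<comment> \<open>\<open>N\<close> lies beyond all positions used by \<open>z\<close>, so
   \<open>N\<close> homotopies are enough.\<close>
 then obtain N where N: "\<And>i. i \<in> (\<Union>r\<in>{r. z r \<noteq> 0}. {i. r i > 0}) ==> i < N"
  by (metis finite_nat_set_iff_bounded)
 obtain y where y: "y \<in> Ch (q - 1)" "z - D y = (\<lambda>r. iterPi PP N r (z r))"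
  using iterate_homotopy[OF hom _ z, of PP N] by blast
 have "iterPi PP N r (z r) = 0" for r
 proof (rule ccontr)
  assume "iterPi PP N r (z r) \<noteq> 0"
  then obtain s where s: "slice (iterPi PP N r (z r)) s \<noteq> 0" using slice_nz by blast
  then have "slice (z r) s \<noteq> 0" and h: "\<And>i. i < N ==> harm i (r i) (s i)"
   using iterPi_support[OF chainsD(1)[OF zc] s] by auto
  then have nz: "z r \<noteq> 0" by auto
  have "r i = 0" for i
  proof (rule ccontr)
   assume "r i \<noteq> 0"
   then have "i < N" using nz by (intro N) auto
   then show False using h[of i] free \<open>r i \<noteq> 0\<close> by (simp add: harm_def)
  qed
  then have "deg r = 0" by (simp add: deg_def)
  then show False using chainsD(4)[OF zc, of r] nz q by simp
 qed
 then have "z = D y" using y(2) by (simp add: fun_eq_iff)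
 then show "z \<in> cobd p (digit_e m) Wt q" using y(1) by (auto simp: cobd_def)
qed

end

text \<open>Functions on \<open>unit\<close> stand for the one-dimensional multiplicity space; its
  only weight is that of the highest vector.\<close>

locale simple_digit_setup = digit_setup p m "UNIV :: (unit => 'k::field) set" "\<lambda>\<nu>. if \<nu> = int (num p m) then UNIV else {0}"
 for p and m :: "nat => nat" +
 assumes m_fin: "fin_supp m"
begin

abbreviation "low \<equiv> odd_part m"
abbreviation "sols \<equiv> solutions p m"

lemma low_le: "low r \<le> m"
 by (auto simp: odd_part_def le_fun_def)

lemma fin_le: "s \<le> m ==> fin_supp s"
 using m_fin unfolding fin_supp_def by (rule rev_finite_subset) (auto simp: le_fun_def intro: less_le_trans)

definition basic :: "(nat => nat) => (nat => nat) => (nat => nat) \<times> unit => 'k" where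
 "basic \<delta> = (\<lambda>r (s, j). if r = \<delta> \<and> s = low \<delta> then 1 else 0)"

lemma slice_basic: "slice (basic \<delta> r) s = (if r = \<delta> \<and> s = low \<delta> then (\<lambda>j. 1) else 0)"
 by (auto simp: slice_def basic_def)

text \<open>Every outgoing operator kills the vector at \<open>low \<delta>\<close>: for an even
  entry it is the highest vector in that position, and for an odd one \<open>m i < p - 1\<close>
  makes the power \<open>p - 1\<close> of \<open>e i\<close> vanish.\<close>

lemma basic_cocyc:
 assumes "\<delta> \<in> sols q"
 shows "basic \<delta> \<in> cocyc p (digit_e m) Wt (int q)"
proof -
 have nz: "r = \<delta> \<and> s = low \<delta>" if "slice (basic \<delta> r) s \<noteq> 0" for r s
  using that by (auto simp: slice_basic split: if_splits)
 have bS: "basic \<delta> r \<in> S" for r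
  by (rule S_I[of "{low \<delta>}"]) (use nz low_le fin_le in auto)
 have nz': "r = \<delta>" if "basic \<delta> r \<noteq> 0" for r
  using slice_nz[OF that] nz by blast
 then have "{r. basic \<delta> r \<noteq> 0} \<subseteq> {\<delta>}" by auto
 then have "finite {r. basic \<delta> r \<noteq> 0}" by (rule finite_subset) simp
 moreover have "basic \<delta> r \<in> Wt (2 * int (wgt p r))" for r
  using assms bS by (auto simp: digit_Wt_def solutions_def slice_basic)
 moreover have "fin_supp r \<and> int (deg r) = int q" if "basic \<delta> r \<noteq> 0" for r
  using nz'[OF that] assms by (auto simp: solutions_def)
 ultimately have c: "basic \<delta> \<in> Ch (int q)" by (simp add: chains_def)
 have "E i (r i) (basic \<delta> (dec i r)) = 0" if "r i > 0" for r i
 proof (rule ccontr)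
  assume nz0: "E i (r i) (basic \<delta> (dec i r)) \<noteq> 0"
  then obtain s where nzs: "slice (E i (r i) (basic \<delta> (dec i r))) s \<noteq> 0" using slice_nz by blast
  have d: "dec i r = \<delta>" using nz'[of "dec i r"] nz0 by (cases "basic \<delta> (dec i r) = 0") auto
  show False
  proof (cases "odd (r i)")
   case True
   then have "even (\<delta> i)" using d that by auto
   then have "low \<delta> i = 0" by (simp add: odd_part_def)
   then have "inc i s \<noteq> low \<delta>" by (metis inc_simps(1) add_is_0 zero_neq_one)
   then show False using nzs True by (auto simp: E_op_def slice_e slice_basic)
  next
   case False
   then have "odd (\<delta> i)" using d that by auto
   then have "m i \<noteq> p - 1" using assms by (auto simp: solutions_def)
   then have "m i < s i + (p - 1)" using m_less[of i] by auto
   then show False using digit_e_pow_0[OF bS] nzs False by (auto simp: E_op_def)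
  qed
 qed
 then have "D (basic \<delta>) r = 0" for r
  unfolding D_op_def by (intro sum.neutral) simp
 then have "D (basic \<delta>) = 0" by (intro ext) simp
 then show ?thesis using c by (simp add: cocyc_def)
qed

text \<open>No incoming operator reaches \<open>low \<delta>\<close>: for an odd entry it is the
  lowest vector, where the factor of \<open>e i\<close> is 0, and for a positive even one the power
  \<open>p - 1\<close> vanishes. Evaluation at these places thus separates the classes from the
  coboundaries.\<close>

lemma D_at_low:
 assumes "\<delta> \<in> sols q" "w \<in> Ch r"
 shows "D w \<delta> (low \<delta>, ()) = 0"
proof -
 have sl: "slice (E i (\<delta> i) (w (dec i \<delta>))) (low \<delta>) = 0" if "\<delta> i > 0" for i
 proof (cases "odd (\<delta> i)")
  case False
  then have "m i \<noteq> p - 1" using assms that by (auto simp: solutions_def)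
  then have "m i < low \<delta> i + (p - 1)" using m_less[of i] by auto
  then show ?thesis using digit_e_pow_0 chainsD(1)[OF assms(2)] False by (auto simp: E_op_def)
 qed (simp add: E_op_def slice_e odd_part_def)
 have "E i (\<delta> i) (w (dec i \<delta>)) (low \<delta>, ()) = 0" if "\<delta> i > 0" for i
  by (rule slice_eq_0D[OF sl[OF that]])
 then have "sg i \<delta> (E i (\<delta> i) (w (dec i \<delta>))) (low \<delta>, ()) = 0" if "\<delta> i > 0" for i
  using that by (simp add: sg_def)
 then show ?thesis by (simp add: D_op_def sum_fun_apply)
qed

text \<open>The cocycles \<open>basic \<delta>\<close> are representatives: the homotopies push
  every cocycle onto the harmonic places, where the weights leave only the solutions, and
  \<open>D_at_low\<close> gives independence.\<close>

theorem quot_dim_digit: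
 assumes fin: "finite (sols q)"
 shows "quot_dim cscale (cocyc p (digit_e m) Wt (int q)) (cobd p (digit_e m) Wt (int q)) (card (sols q))"
proof -
 let ?n = "card (sols q)"
 obtain x where x: "bij_betw x {..<?n} (sols q)"
  using ex_bij_betw_nat_finite[OF fin] by (auto simp: lessThan_atLeast0)
 have xs: "x l \<in> sols q" if "l < ?n" for l using x that by (auto simp: bij_betw_def)
 have val: "(\<Sum>l<?n. cscale (c l) (basic (x l))) r (s, j) =
  (\<Sum>l<?n. if x l = r \<and> s = low r then c l else 0)" for c r s j
  by (simp add: sum_fun_apply cscale_def basic_def) (intro sum.cong refl, auto)
 have val_x: "(\<Sum>l<?n. cscale (c l) (basic (x l))) (x k) (low (x k), j) = c k" if "k < ?n" for c k j
 proof -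
  have "x l = x k \<longleftrightarrow> l = k" if "l < ?n" for l
   using x that \<open>k < ?n\<close> by (auto simp: bij_betw_def inj_on_def)
  then have "(\<Sum>l<?n. if x l = x k then c l else 0) = (\<Sum>l<?n. if l = k then c l else 0)"
   by (intro sum.cong) auto
  then show ?thesis unfolding val using that by simp
 qed
 show ?thesis
  unfolding quot_dim_def
 proof (intro exI[of _ "\<lambda>l. basic (x l)"] conjI allI impI ballI)
  fix l assume "l < ?n"
  then show "basic (x l) \<in> cocyc p (digit_e m) Wt (int q)" using basic_cocyc xs by blast
 next
  fix c l assume "(\<Sum>l<?n. cscale (c l) (basic (x l))) \<in> cobd p (digit_e m) Wt (int q)" "l < ?n"
  then obtain w where w: "w \<in> Ch (int q - 1)" "(\<Sum>l<?n. cscale (c l) (basic (x l))) = D w"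
   by (auto simp: cobd_def)
  have "c l = D w (x l) (low (x l), ())" using val_x[OF \<open>l < ?n\<close>, of c] w(2) by simp
  then show "c l = 0" using D_at_low[OF xs[OF \<open>l < ?n\<close>] w(1)] by simp
 next
  fix a assume a: "a \<in> cocyc p (digit_e m) Wt (int q)"
  then have ac: "a \<in> Ch (int q)" by (simp add: cocyc_def)
  have "finite ((\<Union>r\<in>{r. a r \<noteq> 0}. {i. r i > 0}) \<union> {i. m i > 0})"
   using chainsD(3,5)[OF ac] m_fin by (auto simp: fin_supp_def)
  \<comment> \<open>\<open>N\<close> also bounds the nonzero digits: beyond it
    \<open>m i = 0\<close>, so that \<open>s i = 0 = low r i\<close> holds without any
    homotopy.\<close>
  then obtain N where N: "\<And>i. i \<in> (\<Union>r\<in>{r. a r \<noteq> 0}. {i. r i > 0}) \<union> {i. m i > 0} ==> i < N"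
   by (metis finite_nat_set_iff_bounded)
  have mN: "m i = 0" if "i \<ge> N" for i
  proof (rule ccontr)
   assume "m i \<noteq> 0"
   then have "i < N" by (intro N) auto
   then show False using that by simp
  qed
  obtain y where y: "y \<in> Ch (int q - 1)" "a - D y = (\<lambda>r. iterPi PP N r (a r))"
   using iterate_homotopy[OF hom _ a, of PP N] by blast
  define w where "w = a - D y"
  have w: "r \<in> sols q \<and> s = low r" if "slice (w r) s \<noteq> 0" for r s
  proof -
   have "slice (iterPi PP N r (a r)) s \<noteq> 0" using that y w_def by simp
   then have nz: "slice (a r) s \<noteq> 0" and h: "\<And>i. i < N ==> harm i (r i) (s i)"
    using iterPi_support[OF chainsD(1)[OF ac]] by auto
   have anz: "a r \<noteq> 0" using nz by auto
   have wt: "a r \<in> Wt (2 * int (wgt p r))" by (rule chainsD(2)[OF ac])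
   then have sm: "s \<le> m" and "slice (a r) s \<in> (if 2 * int (wgt p r) + 2 * int (num p s) = int (num p m) then UNIV else {0})"
    using nz by (auto simp: digit_Wt_def digit_space_def)
   then have ws: "int (num p m) - 2 * int (num p s) = 2 * int (wgt p r)"
    using nz by (auto split: if_splits)
   have "s i = low r i \<and> (m i = p - 1 \<longrightarrow> r i = 0)" for i
   proof (cases "i < N")
    case True
    then show ?thesis using h[OF True] by (auto simp: harm_def odd_part_def split: if_splits)
   next
    case False
    have "s i \<le> m i" using sm by (simp add: le_fun_def)
    then show ?thesis using False mN[of i] p_ge_2 by (auto simp: odd_part_def)
   qed
   then have "s = low r" "\<forall>i. m i = p - 1 \<longrightarrow> r i = 0" by auto
   moreover have "fin_supp r" "deg r = q" using chainsD(3,4)[OF ac, of r] anz by auto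
   ultimately show ?thesis using ws by (auto simp: solutions_def)
  qed
  define c where "c l = w (x l) (low (x l), ())" for l
  have "(\<Sum>l<?n. cscale (c l) (basic (x l))) r (s, ()) = w r (s, ())" for r s
  proof (cases "r \<in> sols q \<and> s = low r")
   case True
   then obtain k where "k < ?n" "r = x k" using x by (auto simp: bij_betw_def)
   then show ?thesis using True val_x[of k c] by (simp add: c_def)
  next
   case False
   then have "slice (w r) s = 0" using w by blast
   then have "w r (s, ()) = 0" by (rule slice_eq_0D)
   moreover have "(\<Sum>l<?n. if x l = r \<and> s = low r then c l else 0) = 0"
    using False xs by (intro sum.neutral) auto
   ultimately show ?thesis unfolding val by simp
  qed
  then have "(\<Sum>l<?n. cscale (c l) (basic (x l))) r t = w r t" for r t
   by (cases t) simp
  then have "(\<Sum>l<?n. cscale (c l) (basic (x l))) = w" by blast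
  then have "a - (\<Sum>l<?n. cscale (c l) (basic (x l))) = D y" by (simp add: w_def)
  then show "\<exists>c. a - (\<Sum>l<?n. cscale (c l) (basic (x l))) \<in> cobd p (digit_e m) Wt (int q)"
   using y(1) by (auto simp: cobd_def)
 qed
qed

end

subsection \<open>Counting the solutions of the weight equation\<close>

text \<open>The coefficient of \<open>p ^ i\<close> in the weight equation with everything on one
  side. \<open>bounded_solutions\<close> allows a value \<open>a\<close> in place of 0, because
  carries arise when digits are peeled off.\<close>

definition twisted_digit :: "nat => (nat => nat) => (nat => nat) => nat => int" where
 "twisted_digit p m r i = (if odd (r i) then - int (m i) else int (m i)) - 2 * int (omega p (r i))"

definition bounded_solutions :: "nat => nat => nat => nat => (nat => nat) => (nat => nat) set" where
 "bounded_solutions p N n a m = {r. (\<forall>i\<ge>N. r i = 0) \<and> (\<Sum>i<N. r i) = n \<and> (\<forall>i. m i = p - 1 \<longrightarrow> r i = 0) \<and>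
   int a = (\<Sum>i<N. int (p ^ i) * twisted_digit p m r i)}"

text \<open>The congruence modulo \<open>p\<close> between the carry \<open>a\<close> and the bottom
  term of the equation: it is \<open>c\<close> for an even entry and \<open>- c - 2\<close> for an
  odd one, the latter written without subtraction.\<close>

definition admissible :: "nat => nat => nat => nat => bool" where
 "admissible p a c j \<longleftrightarrow> (if even j then a mod p = c else a mod p + c + 2 = p)"

text \<open>Reading the digits from the bottom, \<open>a\<close> is the carry: it becomes \<open>a div p + j\<close> when the
 entry \<open>j\<close> is chosen.\<close>

fun count_paths :: "nat => nat => nat => nat => (nat => nat) => nat" where
 "count_paths p 0 n a m = (if n = 0 \<and> a = 0 then 1 else 0)"
| "count_paths p (Suc N) n a m =
   (\<Sum>j\<le>n. if admissible p a (m 0) j then count_paths p N (n - j) (a div p + j) (\<lambda>i. m (Suc i)) else 0)"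

declare count_paths.simps(2) [simp del]

text \<open>The bottom term is \<open>m 0 - 2 p k\<close> for \<open>r 0 = 2 k\<close> and
  \<open>(p - 2 - m 0) - p (2 k + 1)\<close> for \<open>r 0 = 2 k + 1\<close>; division by
  \<open>p\<close> leaves the carry \<open>a div p + r 0\<close> in both cases. Excluding
  \<open>m 0 = p - 1\<close> for odd entries keeps the second remainder nonnegative.\<close>

lemma carry_step:
 assumes p: "p \<ge> 3" and m: "m (0::nat) < p" and x: "m 0 = p - 1 \<longrightarrow> r 0 = 0"
  and a: "int a = twisted_digit p m r 0 + int p * b"
 shows "admissible p a (m 0) (r 0) \<and> b = int (a div p + r 0)"
proof (cases "even (r 0)")
 case True
 then obtain k where k: "r 0 = 2 * k" by (auto elim: evenE)
 have "int a = int (m 0) + int p * (b - 2 * int k)"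
  using a k by (simp add: twisted_digit_def omega_def algebra_simps)
 then have "int a mod int p = int (m 0)" "int a div int p = b - 2 * int k"
  using m by (simp_all)
 then have "a mod p = m 0" "b = int (a div p) + 2 * int k"
  by (simp_all flip: zmod_int zdiv_int)
 then show ?thesis using True k by (auto simp: admissible_def)
next
 case False
 then obtain k where k: "r 0 = 2 * k + 1" by (auto elim: oddE)
 have mp: "m 0 + 2 \<le> p" using m x k by auto
 have om: "omega p (r 0) = p * k + 1" by (simp add: omega_def k)
 have "int a = int (p - 2 - m 0) + int p * (b - 1 - 2 * int k)"
  using a False mp by (simp add: twisted_digit_def om algebra_simps of_nat_diff)
 then have "int a mod int p = int (p - 2 - m 0)" "int a div int p = b - 1 - 2 * int k"
  using p by (simp_all)
 then have "a mod p = p - 2 - m 0" "b = int (a div p) + 1 + 2 * int k"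
  by (simp_all flip: zmod_int zdiv_int)
 then show ?thesis using False k mp by (auto simp: admissible_def)
qed

text \<open>A solution is determined by its bottom entry and its shift, and the shift solves the
  equation with the new carry.\<close>

lemma card_bounded_solutions:
 assumes p: "p \<ge> 3" and m: "\<And>i. m i < p"
 shows "finite (bounded_solutions p N n a m) \<and> card (bounded_solutions p N n a m) \<le> count_paths p N n a m"
 using m
proof (induction N arbitrary: n a m)
 case 0
 have sub: "bounded_solutions p 0 n a m \<subseteq> {\<lambda>i. 0}"
  and emp: "n \<noteq> 0 \<or> a \<noteq> 0 ==> bounded_solutions p 0 n a m = {}"
  by (auto simp: bounded_solutions_def)
 show ?case using finite_subset[OF sub] card_mono[OF _ sub] emp by auto
next
 case (Suc N)
 let ?J = "{j. j \<le> n \<and> admissible p a (m 0) j}"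
 let ?m = "\<lambda>i. m (Suc i)"
 let ?B = "\<lambda>j. bounded_solutions p N (n - j) (a div p + j) ?m"
 let ?f = "\<lambda>r::nat => nat. (r 0, \<lambda>i. r (Suc i))"
 have IH: "finite (?B j) \<and> card (?B j) \<le> count_paths p N (n - j) (a div p + j) ?m" for j
  by (rule Suc.IH) (rule Suc.prems)
 have inj: "inj ?f"
  by (rule injI) (auto simp: fun_eq_iff, metis not0_implies_Suc)
 have sub: "?f ` bounded_solutions p (Suc N) n a m \<subseteq> Sigma ?J ?B"
 proof (rule image_subsetI)
  fix r assume g: "r \<in> bounded_solutions p (Suc N) n a m"
  let ?r = "\<lambda>i. r (Suc i)"
  define b where "b = (\<Sum>i<N. int (p ^ i) * twisted_digit p ?m ?r i)"
  have n: "n = r 0 + (\<Sum>i<N. r (Suc i))"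
   using g by (simp add: bounded_solutions_def sum.lessThan_Suc_shift del: sum.lessThan_Suc)
  have "int a = (\<Sum>i<Suc N. int (p ^ i) * twisted_digit p m r i)"
   using g by (simp add: bounded_solutions_def)
  also have "... = twisted_digit p m r 0 + int p * b"
   unfolding b_def by (simp add: sum.lessThan_Suc_shift sum_distrib_left twisted_digit_def mult.assoc del: sum.lessThan_Suc)
  finally have "admissible p a (m 0) (r 0) \<and> b = int (a div p + r 0)"
   using g by (intro carry_step p Suc.prems) (auto simp: bounded_solutions_def)
  then show "?f r \<in> Sigma ?J ?B"
   using g n by (auto simp: bounded_solutions_def b_def)
 qed
 have fin: "finite (Sigma ?J ?B)" using IH by auto
 have "finite (bounded_solutions p (Suc N) n a m)"
  using finite_imageD[OF finite_subset[OF sub fin]] inj inj_on_subset by blast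
 moreover have "card (bounded_solutions p (Suc N) n a m) = card (?f ` bounded_solutions p (Suc N) n a m)"
  by (rule card_image[symmetric, OF inj_on_subset[OF inj]]) simp
 moreover have "... \<le> card (Sigma ?J ?B)" using sub fin by (rule card_mono[rotated])
 moreover have "card (Sigma ?J ?B) = (\<Sum>j\<in>?J. card (?B j))" using IH by (intro card_SigmaI) auto
 moreover have "... \<le> (\<Sum>j\<in>?J. count_paths p N (n - j) (a div p + j) ?m)" using IH by (intro sum_mono) auto
 moreover have "... = count_paths p (Suc N) n a m"
  by (simp add: count_paths.simps(2) sum.If_cases) (intro sum.cong, auto)
 ultimately show ?case by simp
qed

lemma sum_tenth: "(\<Sum>j=1..n. (1/10::real) ^ j) \<le> 1 / 9"
proof -
 have "(\<Sum>j=1..n. (1/10::real) ^ j) = (1 - (1/10) ^ n) / 9" by (induction n) auto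
 then show ?thesis by simp
qed

text \<open>The step \<open>j = 0\<close> may keep the carry \<open>0\<close> without lowering \<open>n\<close>, so a bound with a single constant does
 not survive the induction on \<open>N\<close>; the weighted sum \<open>F + G / 2\<close> of the two constants does.\<close>

lemma count_paths_bound:
 assumes p: "p \<ge> 3" and m: "\<And>i. m i < p"
 shows "\<exists>F G::real. F \<ge> 0 \<and> G \<ge> 0 \<and> F + G / 2 \<le> 1 \<and>
  (\<forall>n. real (count_paths p N n 0 m) \<le> F * 20 ^ n) \<and>
  (\<forall>n. \<forall>a\<ge>1. real (count_paths p N n a m) \<le> G * 20 ^ n * 2 ^ a)"
 using m
proof (induction N arbitrary: m)
 case 0
 show ?case by (intro exI[of _ 1] exI[of _ 0]) auto
next
 case (Suc N)
 let ?m = "\<lambda>i. m (Suc i)"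
 obtain F G :: real where FG: "F \<ge> 0" "G \<ge> 0" "F + G / 2 \<le> 1"
  and F: "\<And>n. real (count_paths p N n 0 ?m) \<le> F * 20 ^ n"
  and G: "\<And>n a. a \<ge> 1 ==> real (count_paths p N n a ?m) \<le> G * 20 ^ n * 2 ^ a"
  using Suc.IH[of ?m] Suc.prems by blast
 define r where "r n a = real (\<Sum>j=1..n. if admissible p a (m 0) j then count_paths p N (n - j) (a div p + j) ?m else 0)" for n a
 have split: "real (count_paths p (Suc N) n a m) =
   (if admissible p a (m 0) 0 then real (count_paths p N n (a div p) ?m) else 0) + r n a" for n a
 proof -
  have "{..n} = insert 0 {1..n}" by auto
  then show ?thesis by (simp add: r_def count_paths.simps(2))
 qed
 have r: "r n a \<le> G * 20 ^ n * 2 ^ (a div p) / 9" for n a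
 proof -
  \<comment> \<open>The entry \<open>j\<close> saves a factor \<open>20 ^ j\<close> in the degree
    and costs \<open>2 ^ j\<close> in the carry: a geometric series with ratio
    \<open>1 / 10\<close>.\<close>
  have "r n a \<le> (\<Sum>j=1..n. G * 20 ^ n * 2 ^ (a div p) * (1/10) ^ j)"
   unfolding r_def of_nat_sum
  proof (rule sum_mono)
   fix j assume j: "j \<in> {1..n}"
   have "real (count_paths p N (n - j) (a div p + j) ?m) \<le> G * 20 ^ (n - j) * 2 ^ (a div p + j)"
    using j by (intro G) auto
   also have "... = G * 20 ^ n * 2 ^ (a div p) * (1/10) ^ j"
   proof -
    have "(20::real) ^ n = 20 ^ (n - j) * 20 ^ j" using j by (simp flip: power_add)
    moreover have "(20::real) ^ j = 2 ^ j * 10 ^ j" by (simp flip: power_mult_distrib)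
    ultimately show ?thesis by (simp add: power_add power_divide)
   qed
   finally show "real (if admissible p a (m 0) j then count_paths p N (n - j) (a div p + j) ?m else 0)
    \<le> G * 20 ^ n * 2 ^ (a div p) * (1/10) ^ j" using FG by auto
  qed
  also have "... = G * 20 ^ n * 2 ^ (a div p) * (\<Sum>j=1..n. (1/10) ^ j)" by (simp add: sum_distrib_left)
  also have "... \<le> G * 20 ^ n * 2 ^ (a div p) * (1 / 9)"
   using FG sum_tenth by (intro mult_left_mono) auto
  finally show ?thesis by simp
 qed
 have half: "2 ^ (a div p) \<le> (2::real) ^ a / 2" if "a \<ge> 1" for a
 proof -
  have "a div p < a" using that p by (intro div_less_dividend) auto
  then have "(2::real) ^ Suc (a div p) \<le> 2 ^ a" by (intro power_increasing) auto
  then show ?thesis by simp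
 qed
 show ?case
 proof (cases "m 0 = 0")
  case True
  have 1: "real (count_paths p (Suc N) n 0 m) \<le> (F + G / 9) * 20 ^ n" for n
   using F[of n] r[of n 0] True split[of n 0] by (simp add: admissible_def algebra_simps)
  have 2: "real (count_paths p (Suc N) n a m) \<le> (5 / 9 * G) * 20 ^ n * 2 ^ a" if a: "a \<ge> 1" for n a
  proof -
   have c: "real (count_paths p N n (a div p) ?m) \<le> G * 20 ^ n * 2 ^ (a div p)" if "a mod p = 0"
   proof (rule G)
    have "p \<le> a" using a that by (intro dvd_imp_le) (auto simp: dvd_eq_mod_eq_0)
    then have "a div p > 0" using p by (simp add: div_greater_zero_iff)
    then show "a div p \<ge> 1" by simp
   qed
   have pos: "0 \<le> G * 20 ^ n * 2 ^ (a div p)" using FG by auto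
   have "real (count_paths p (Suc N) n a m) \<le> G * 20 ^ n * 2 ^ (a div p) * (10 / 9)"
    using c r[of n a] True split[of n a] pos by (auto simp: admissible_def)
   also have "... \<le> G * 20 ^ n * (2 ^ a / 2) * (10 / 9)"
    using half[OF a] FG by (intro mult_right_mono mult_left_mono) auto
   finally show ?thesis by (simp add: mult_ac)
  qed
  \<comment> \<open>The weighted sum becomes \<open>F + (1 / 9 + 5 / 18) * G\<close>, and
    \<open>1 / 9 + 5 / 18 < 1 / 2\<close>.\<close>
  show ?thesis
   using FG 1 2 by (rule_tac exI[of _ "F + G / 9"], rule_tac exI[of _ "5 / 9 * G"]) auto
 next
  case False
  \<comment> \<open>The carry 0 does not match a nonzero digit, so \<open>j = 0\<close> is not
    admissible and \<open>F\<close> does not enter.\<close>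
  have 1: "real (count_paths p (Suc N) n 0 m) \<le> (G / 9) * 20 ^ n" for n
   using r[of n 0] False split[of n 0] by (simp add: admissible_def)
  have 2: "real (count_paths p (Suc N) n a m) \<le> (F / 2 + 5 / 9 * G) * 20 ^ n * 2 ^ a" if a: "a \<ge> 1" for n a
  proof -
   have pos: "0 \<le> G * 20 ^ n * 2 ^ (a div p)" "0 \<le> F * 20 ^ n" using FG by auto
   have "real (count_paths p N n (a div p) ?m) \<le> F * 20 ^ n + G * 20 ^ n * 2 ^ (a div p)"
    using F[of n] G[of "a div p" n] pos by (cases "a div p = 0") auto
   then have "real (count_paths p (Suc N) n a m) \<le> F * 20 ^ n + G * 20 ^ n * 2 ^ (a div p) * (10 / 9)"
    using r[of n a] split[of n a] pos by auto
   also have "... \<le> F * 20 ^ n * (2 ^ a / 2) + G * 20 ^ n * (2 ^ a / 2) * (10 / 9)"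
   proof (rule add_mono)
    have "(1::real) \<le> 2 ^ a / 2" using half[OF a] one_le_power[of "2::real" "a div p"] by linarith
    then show "F * 20 ^ n \<le> F * 20 ^ n * (2 ^ a / 2)"
     using pos(2) by (rule mult_left_mono[of 1 _ "F * 20 ^ n", simplified])
    show "G * 20 ^ n * 2 ^ (a div p) * (10 / 9) \<le> G * 20 ^ n * (2 ^ a / 2) * (10 / 9)"
     using half[OF a] FG by (intro mult_right_mono mult_left_mono) auto
   qed
   finally show ?thesis by (simp add: algebra_simps)
  qed
  have "G / 9 + (F / 2 + 5 / 9 * G) / 2 = (F + G / 2) - (3 / 4 * F + G / 9)" by (simp add: field_simps)
  moreover have "3 / 4 * F + G / 9 \<ge> 0" using FG by simp
  ultimately have "G / 9 + (F / 2 + 5 / 9 * G) / 2 \<le> 1" using FG by linarith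
  moreover have "F / 2 + 5 / 9 * G \<ge> 0" using FG by simp
  ultimately show ?thesis
   using FG 1 2 by (rule_tac exI[of _ "G / 9"], rule_tac exI[of _ "F / 2 + 5 / 9 * G"]) auto
 qed
qed

lemma sum_supp:
 fixes f :: "nat => nat => nat"
 assumes "finite X" "\<And>i. s i > 0 ==> i \<in> X" "\<And>i. f i 0 = 0"
 shows "(\<Sum>i | s i > 0. f i (s i)) = (\<Sum>i\<in>X. f i (s i))"
 by (rule sum.mono_neutral_left) (use assms in auto)

text \<open>Finiteness is part of the claim, since the positions of a solution are unbounded. Every
  finite set of solutions lives below some \<open>N\<close>, and the bound is independent of
  \<open>N\<close>; so there are no arbitrarily large finite subsets.\<close>

theorem card_solutions_le:
 assumes p: "p \<ge> 3" and m: "\<And>i. m i < p" and fin: "fin_supp m"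
 shows "finite (solutions p m n) \<and> card (solutions p m n) \<le> 20 ^ n"
proof -
 have bound: "finite X \<and> card X \<le> 20 ^ n" if X: "finite X" "X \<subseteq> solutions p m n" for X
 proof -
  have "finite ((\<Union>r\<in>X. {i. r i > 0}) \<union> {i. m i > 0})"
   using X fin by (auto simp: solutions_def fin_supp_def)
  then obtain N where N: "\<And>i. i \<in> (\<Union>r\<in>X. {i. r i > 0}) \<union> {i. m i > 0} ==> i < N"
   by (metis finite_nat_set_iff_bounded)
  have "X \<subseteq> bounded_solutions p N n 0 m"
  proof
   fix r assume r: "r \<in> X"
   have s: "r \<in> solutions p m n" using r X by blast
   have gN: "r i > 0 ==> i \<in> {..<N}" for i using N r by auto
   have mN: "m i > 0 ==> i \<in> {..<N}" for i using N by auto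
   have oN: "odd_part m r i > 0 ==> i \<in> {..<N}" for i using mN[of i] by (auto simp: odd_part_def split: if_splits)
   have d: "deg r = (\<Sum>i<N. r i)" using sum_supp[of "{..<N}" r "\<lambda>i c. c"] gN by (simp add: deg_def)
   have w: "wgt p r = (\<Sum>i<N. p ^ i * omega p (r i))"
    using sum_supp[of "{..<N}" r "\<lambda>i c. p ^ i * omega p c"] gN by (simp add: wgt_def omega_def)
   have n1: "num p m = (\<Sum>i<N. p ^ i * m i)"
    using sum_supp[of "{..<N}" m "\<lambda>i c. p ^ i * c"] mN by (simp add: num_def)
   have n2: "num p (odd_part m r) = (\<Sum>i<N. p ^ i * odd_part m r i)"
    using sum_supp[of "{..<N}" "odd_part m r" "\<lambda>i c. p ^ i * c"] oN by (simp add: num_def)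
   have "(\<Sum>i<N. int (p ^ i) * twisted_digit p m r i) =
     (\<Sum>i<N. int (p ^ i * m i) - 2 * int (p ^ i * odd_part m r i) - 2 * int (p ^ i * omega p (r i)))"
    by (intro sum.cong refl) (auto simp: twisted_digit_def odd_part_def algebra_simps)
   also have "... = int (num p m) - 2 * int (num p (odd_part m r)) - 2 * int (wgt p r)"
    unfolding w n1 n2 by (simp add: sum_subtractf sum_distrib_left)
   also have "... = 0" using s by (simp add: solutions_def)
   finally have "(\<Sum>i<N. int (p ^ i) * twisted_digit p m r i) = 0" .
   moreover have "r i = 0" if "i \<ge> N" for i
   proof (rule ccontr)
    assume "r i \<noteq> 0"
    then have "i \<in> {..<N}" by (intro gN) simp
    then show False using that by simp
   qed
   ultimately show "r \<in> bounded_solutions p N n 0 m"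
    using s d by (simp add: bounded_solutions_def solutions_def)
  qed
  moreover have b: "finite (bounded_solutions p N n 0 m)" "card (bounded_solutions p N n 0 m) \<le> count_paths p N n 0 m"
   using card_bounded_solutions[OF p m] by auto
  ultimately have "card X \<le> count_paths p N n 0 m" using card_mono[OF b(1)] by (meson le_trans)
  then have "real (card X) \<le> real (count_paths p N n 0 m)" by simp
  moreover obtain F G :: real where "F \<ge> 0" "G \<ge> 0" "F + G / 2 \<le> 1" "real (count_paths p N n 0 m) \<le> F * 20 ^ n"
   using count_paths_bound[of p m N, OF p m] by blast
  moreover have "F * 20 ^ n \<le> 1 * 20 ^ n" if "F \<le> 1" using that by (intro mult_right_mono) auto
  ultimately have "real (card X) \<le> 20 ^ n" by linarith
  then show ?thesis using X(1) by (metis of_nat_le_iff of_nat_numeral of_nat_power)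
 qed
 have "finite (solutions p m n)"
 proof (rule ccontr)
  assume "infinite (solutions p m n)"
  then obtain X where "finite X" "X \<subseteq> solutions p m n" "card X = Suc (20 ^ n)"
   using infinite_arbitrarily_large by blast
  then show False using bound[of X] by simp
 qed
 then show ?thesis using bound by blast
qed

text \<open>Many solutions: each of the blocks \<open>l = 1..R\<close> contributes \<open>2 p\<^sup>3\<^sup>l\<^sup>+\<^sup>1\<close> to the weight, either as one
 entry \<open>2\<close> at position \<open>3 l\<close> or as one entry \<open>2 p\<close> at position \<open>3 l - 1\<close>.\<close>

definition block_digits :: "nat => nat => nat" where
 "block_digits R i = (if i mod 3 = 1 \<and> i div 3 \<in> {1..R} then 2 else 0)"

definition block_entries :: "nat => nat => nat set => nat => nat" where
 "block_entries p R A i = (if i mod 3 = 0 \<and> i div 3 \<in> {1..R} - A then 2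
   else if i mod 3 = 2 \<and> (i + 1) div 3 \<in> A then 2 * p else 0)"

lemma div_mod_3: "(3 * l) mod 3 = (0::nat)" "(3 * l) div 3 = l" "(3 * l + 1) mod 3 = (1::nat)" "(3 * l + 1) div 3 = l"
  "l \<ge> 1 ==> (3 * l - 1) mod 3 = (2::nat)" "l \<ge> 1 ==> (3 * l - 1 + 1) div 3 = l"
proof -
 show "(3 * l - 1) mod 3 = (2::nat)" if "l \<ge> 1"
 proof -
  have "3 * l - 1 = 2 + 3 * (l - 1)" using that by simp
  then show ?thesis by (simp only: mod_mult_self2) simp
 qed
qed simp_all

lemma sum_block_entries:
 fixes f :: "nat => nat => nat"
 assumes A: "A \<subseteq> {1..R}" and f: "\<And>i. f i 0 = 0"
 shows "fin_supp (block_entries p R A)"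
  and "(\<Sum>i | block_entries p R A i > 0. f i (block_entries p R A i)) =
   (\<Sum>l=1..R. if l \<in> A then f (3 * l - 1) (2 * p) else f (3 * l) 2)"
proof -
 let ?g = "block_entries p R A"
 let ?X = "(\<lambda>l. 3 * l) ` {1..R}" and ?Y = "(\<lambda>l. 3 * l - 1) ` {1..R}"
 have fin: "finite (?X \<union> ?Y)" by auto
 have sub: "i \<in> ?X \<union> ?Y" if g: "?g i > 0" for i
 proof (cases "i mod 3 = 0")
  case True
  then have "i = 3 * (i div 3)" "i div 3 \<in> {1..R}" using g by (auto simp: block_entries_def split: if_splits)
  then show ?thesis by blast
 next
  case False
  then have "i mod 3 = 2" "(i + 1) div 3 \<in> {1..R}" using g A by (auto simp: block_entries_def split: if_splits)
  moreover from this have "i = 3 * ((i + 1) div 3) - 1" by presburger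
  ultimately show ?thesis by blast
 qed
 then have "{i. ?g i > 0} \<subseteq> ?X \<union> ?Y" by blast
 then show "fin_supp ?g" unfolding fin_supp_def using fin finite_subset by blast
 have "?X \<inter> ?Y = {}"
 proof (rule ccontr)
  assume "?X \<inter> ?Y \<noteq> {}"
  then obtain a b where "3 * a = 3 * b - (1::nat)" "b \<ge> 1" by auto
  then show False by presburger
 qed
 then have "(\<Sum>i\<in>?X \<union> ?Y. f i (?g i)) = (\<Sum>i\<in>?X. f i (?g i)) + (\<Sum>i\<in>?Y. f i (?g i))"
  by (intro sum.union_disjoint) auto
 also have "(\<Sum>i\<in>?X. f i (?g i)) = (\<Sum>l=1..R. if l \<in> A then 0 else f (3 * l) 2)"
  by (subst sum.reindex) (auto simp: inj_on_def block_entries_def f div_mod_3 intro!: sum.cong)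
 also have "(\<Sum>i\<in>?Y. f i (?g i)) = (\<Sum>l=1..R. if l \<in> A then f (3 * l - 1) (2 * p) else 0)"
 proof (subst sum.reindex)
  show "inj_on (\<lambda>l. 3 * l - 1) {1..R}" by (auto simp: inj_on_def)
  show "sum ((\<lambda>i. f i (?g i)) \<circ> (\<lambda>l. 3 * l - 1)) {1..R} = (\<Sum>l=1..R. if l \<in> A then f (3 * l - 1) (2 * p) else 0)"
  proof (rule sum.cong[OF refl])
   fix l assume "l \<in> {1..R}"
   then have "(3 * l - 1) mod 3 = 2" "(3 * l - 1 + 1) div 3 = l" using div_mod_3(5,6) by auto
   then show "((\<lambda>i. f i (?g i)) \<circ> (\<lambda>l. 3 * l - 1)) l = (if l \<in> A then f (3 * l - 1) (2 * p) else 0)"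
    using f by (simp add: block_entries_def)
  qed
 qed
 also have "(\<Sum>l=1..R. if l \<in> A then 0 else f (3 * l) 2) + ... =
   (\<Sum>l=1..R. if l \<in> A then f (3 * l - 1) (2 * p) else f (3 * l) 2)"
  unfolding sum.distrib[symmetric] by (intro sum.cong) auto
 finally show "(\<Sum>i | ?g i > 0. f i (?g i)) = (\<Sum>l=1..R. if l \<in> A then f (3 * l - 1) (2 * p) else f (3 * l) 2)"
  using sum_supp[of "?X \<union> ?Y" ?g f, OF fin sub f] by (rule trans[rotated])
qed

lemma num_block_digits:
 "fin_supp (block_digits R)" "num p (block_digits R) = (\<Sum>l=1..R. 2 * p ^ (3 * l + 1))"
proof -
 let ?X = "(\<lambda>l. 3 * l + 1) ` {1..R}"
 have sub: "i \<in> ?X" if "block_digits R i > 0" for i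
 proof -
  have "i mod 3 = 1" "i div 3 \<in> {1..R}" using that by (auto simp: block_digits_def split: if_splits)
  moreover from this have "i = 3 * (i div 3) + 1" by presburger
  ultimately show ?thesis by blast
 qed
 then have "{i. block_digits R i > 0} \<subseteq> ?X" by blast
 then show "fin_supp (block_digits R)" unfolding fin_supp_def by (rule finite_subset) auto
 have "num p (block_digits R) = (\<Sum>i\<in>?X. p ^ i * block_digits R i)"
  unfolding num_def by (rule sum_supp) (use sub in auto)
 also have "... = (\<Sum>l=1..R. 2 * p ^ (3 * l + 1))"
  by (subst sum.reindex) (auto simp: inj_on_def block_digits_def div_mod_3 intro!: sum.cong)
 finally show "num p (block_digits R) = (\<Sum>l=1..R. 2 * p ^ (3 * l + 1))" .
qed

text \<open>Both forms of a block have the same weight because \<open>omega p 2 = p\<close> and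
  \<open>omega p (2 * p) = p * p\<close>, while their degrees differ by \<open>2 * (p - 1)\<close>.
  The third fact matters for \<open>p = 3\<close>, where the digit 2 is
  \<open>p - 1\<close>.\<close>

lemma block_entries_facts:
 assumes A: "A \<subseteq> {1..R}" and p: "p \<ge> 3"
 shows "deg (block_entries p R A) = 2 * R + 2 * (p - 1) * card A"
  and "2 * wgt p (block_entries p R A) = num p (block_digits R)"
  and "block_digits R i > 0 ==> block_entries p R A i = 0"
  and "even (block_entries p R A i)"
proof -
 have "(\<Sum>l=1..R. if l \<in> A then 2 * p else 2) = (\<Sum>l=1..R. 2 + (if l \<in> A then 2 * (p - 1) else 0))"
  using p by (intro sum.cong) auto
 also have "... = (\<Sum>l=1..R. 2) + (\<Sum>l=1..R. if l \<in> A then 2 * (p - 1) else 0)"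
  by (rule sum.distrib)
 also have "... = 2 * R + (\<Sum>l\<in>{1..R} \<inter> A. 2 * (p - 1))"
  by (subst sum.inter_restrict) auto
 also have "{1..R} \<inter> A = A" using A by blast
 finally show "deg (block_entries p R A) = 2 * R + 2 * (p - 1) * card A"
  using sum_block_entries(2)[OF A, of "\<lambda>i c. c" p] by (simp add: deg_def mult.commute)
 have "wgt p (block_entries p R A) = (\<Sum>l=1..R. if l \<in> A then p ^ (3 * l - 1) * omega p (2 * p) else p ^ (3 * l) * omega p 2)"
  unfolding wgt_def by (rule sum_block_entries(2)[OF A]) (simp add: omega_def)
 also have "... = (\<Sum>l=1..R. p ^ (3 * l + 1))"
 proof (rule sum.cong[OF refl])
  fix l assume "l \<in> {1..R}"
  then have "3 * l + 1 = (3 * l - 1) + 2" by auto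
  then have "p ^ (3 * l + 1) = p ^ (3 * l - 1) * (p * p)" by (simp only: power_add power2_eq_square)
  moreover have "omega p (2 * p) = p * p" "omega p 2 = p" "p ^ (3 * l + 1) = p ^ (3 * l) * p" by (simp_all add: omega_def)
  ultimately show "(if l \<in> A then p ^ (3 * l - 1) * omega p (2 * p) else p ^ (3 * l) * omega p 2) = p ^ (3 * l + 1)"
   by presburger
 qed
 finally show "2 * wgt p (block_entries p R A) = num p (block_digits R)"
  unfolding num_block_digits by (simp add: sum_distrib_left)
qed (auto simp: block_digits_def block_entries_def split: if_splits)

lemma block_solution:
 assumes A: "A \<subseteq> {1..R}" and p: "p \<ge> 3"
 shows "block_entries p R A \<in> solutions p (block_digits R) (2 * R + 2 * (p - 1) * card A)"
proof -
 have "odd_part (block_digits R) (block_entries p R A) = (\<lambda>i. 0)"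
  using block_entries_facts(4)[OF A p] by (auto simp: odd_part_def)
 moreover have "block_entries p R A i = 0" if "block_digits R i = p - 1" for i
  using that p block_entries_facts(3)[OF A p, of i] by simp
 ultimately show ?thesis
  using sum_block_entries(1)[OF A, of "\<lambda>i c. 0"] block_entries_facts(1,2)[OF A p]
  by (simp add: solutions_def num_def[of p "\<lambda>i. 0"])
qed

lemma sum_shift:
 fixes f :: "nat => nat => nat"
 assumes "fin_supp (\<lambda>i. s (Suc i))" "\<And>i. f i 0 = 0"
 shows "fin_supp s" "(\<Sum>i | s i > 0. f i (s i)) = f 0 (s 0) + (\<Sum>i | s (Suc i) > 0. f (Suc i) (s (Suc i)))"
proof -
 let ?X = "{i. s (Suc i) > 0}"
 have fin: "finite ?X" using assms(1) by (simp add: fin_supp_def)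
 have sub: "i \<in> insert 0 (Suc ` ?X)" if "s i > 0" for i using that by (cases i) auto
 then have "{i. s i > 0} \<subseteq> insert 0 (Suc ` ?X)" by blast
 then show "fin_supp s" unfolding fin_supp_def using fin finite_subset by blast
 have "(\<Sum>i | s i > 0. f i (s i)) = (\<Sum>i\<in>insert 0 (Suc ` ?X). f i (s i))"
  by (rule sum_supp) (use fin sub assms in auto)
 then show "(\<Sum>i | s i > 0. f i (s i)) = f 0 (s 0) + (\<Sum>i\<in>?X. f (Suc i) (s (Suc i)))"
  using fin by (simp add: sum.reindex)
qed

lemma num_shift: "fin_supp (\<lambda>i. s (Suc i)) ==> num p s = s 0 + p * num p (\<lambda>i. s (Suc i))"
 using sum_shift(2)[of s "\<lambda>i c. p ^ i * c"] by (simp add: num_def sum_distrib_left mult.assoc)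

lemma wgt_shift: "fin_supp (\<lambda>i. s (Suc i)) ==> wgt p s = omega p (s 0) + p * wgt p (\<lambda>i. s (Suc i))"
 using sum_shift(2)[of s "\<lambda>i c. p ^ i * omega p c"] by (simp add: wgt_def omega_def sum_distrib_left mult.assoc)

lemma deg_shift: "fin_supp (\<lambda>i. s (Suc i)) ==> deg s = s 0 + deg (\<lambda>i. s (Suc i))"
 using sum_shift(2)[of s "\<lambda>i c. c"] by (simp add: deg_def)

text \<open>For odd degrees a bottom position with digit \<open>p - 2\<close> and entry 1 is added.
  It contributes \<open>- (p - 2) - 2 = - p\<close> to the equation, which the additional 1 in the
  next digit compensates.\<close>

definition odd_block_digits :: "nat => nat => nat => nat" where
 "odd_block_digits p R i = (case i of 0 => p - 2 | Suc j => (inc 0 (block_digits R)) j)"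

definition odd_block_entries :: "nat => nat => nat set => nat => nat" where
 "odd_block_entries p R A i = (case i of 0 => 1 | Suc j => block_entries p R A j)"

lemma odd_block_solution:
 assumes A: "A \<subseteq> {1..R}" and p: "p \<ge> 3"
 shows "odd_block_entries p R A \<in> solutions p (odd_block_digits p R) (2 * R + 2 * (p - 1) * card A + 1)"
proof -
 let ?g = "odd_block_entries p R A" and ?m = "odd_block_digits p R"
 have g: "fin_supp (\<lambda>i. ?g (Suc i))" "(\<lambda>i. ?g (Suc i)) = block_entries p R A"
  using sum_block_entries(1)[OF A, of "\<lambda>i c. 0" p] by (auto simp: odd_block_entries_def)
 have m: "fin_supp (\<lambda>i. ?m (Suc i))" "(\<lambda>i. ?m (Suc i)) = inc 0 (block_digits R)"
  using num_block_digits(1)[of R] by (auto simp: odd_block_digits_def)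
 have o: "odd_part ?m ?g = (\<lambda>i. if i = 0 then p - 2 else 0)"
  using block_entries_facts(4)[OF A p] by (auto simp: odd_part_def odd_block_digits_def odd_block_entries_def split: nat.splits)
 have no: "num p (odd_part ?m ?g) = p - 2"
  unfolding o by (subst num_shift) (auto simp: fin_supp_def num_def)
 have nm: "num p ?m = (p - 2) + p * (1 + num p (block_digits R))"
  unfolding num_shift[OF m(1), of p] m(2) num_inc[OF num_block_digits(1)[of R], of p 0]
  by (simp add: odd_block_digits_def)
 have wg: "wgt p ?g = 1 + p * wgt p (block_entries p R A)"
  unfolding wgt_shift[OF g(1), of p] g(2) by (simp add: odd_block_entries_def omega_def)
 have dg: "deg ?g = 1 + (2 * R + 2 * (p - 1) * card A)"
  unfolding deg_shift[OF g(1)] g(2) block_entries_facts(1)[OF A p] by (simp add: odd_block_entries_def)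
 have z: "?g i = 0" if "?m i = p - 1" for i
 proof (cases i)
  case 0
  then show ?thesis using that p by (simp add: odd_block_digits_def)
 next
  case (Suc j)
  have "block_digits R j > 0"
  proof (cases "j = 0")
   case True
   then show ?thesis using that Suc p by (simp add: odd_block_digits_def block_digits_def)
  next
   case False
   then show ?thesis using that Suc p by (simp add: odd_block_digits_def)
  qed
  then show ?thesis using Suc block_entries_facts(3)[OF A p, of j] by (simp add: odd_block_entries_def)
 qed
 have "int (num p ?m) - 2 * int (num p (odd_part ?m ?g)) = 2 * int (wgt p ?g)"
 proof -
  have "int p * int (num p (block_digits R)) = 2 * (int p * int (wgt p (block_entries p R A)))"
   using arg_cong[OF block_entries_facts(2)[OF A p], of int] by (simp add: algebra_simps)
  then show ?thesis using p unfolding no nm wg by (simp add: algebra_simps of_nat_diff)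
 qed
 then show ?thesis
  using z dg sum_shift(1)[OF g(1), of "\<lambda>i c. 0"] by (simp add: solutions_def)
qed

lemma central_binomial_ge: "2 ^ s \<le> (2 * s) choose s"
proof -
 have "(2 * s) choose s = (\<Sum>k\<le>s. (s choose k)\<^sup>2)" by (simp add: choose_square_sum)
 also have "... \<ge> (\<Sum>k\<le>s. s choose k)" by (intro sum_mono) (simp add: power2_eq_square Suc_le_eq)
 also have "(\<Sum>k\<le>s. s choose k) = 2 ^ s" by (rule choose_row_sum)
 finally show ?thesis by simp
qed

text \<open>Half of the first \<open>2 * s\<close> blocks take the form of larger degree. This fixes
  the degree, and the choices are counted by a central binomial coefficient.\<close>

theorem solutions_exponential:
 assumes p: "p \<ge> 3"
 shows "\<exists>m. (\<forall>i. m i < p) \<and> fin_supp m \<and> 2 ^ (n div (2 * (p + 1))) \<le> card (solutions p m n)"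
proof -
 define s where "s = n div 2 div (p + 1)"
 define x where "x = n div 2 mod (p + 1)"
 \<comment> \<open>The \<open>x\<close> further blocks adjust the degree:
   \<open>2 * (2 * s + x) + 2 * (p - 1) * s = 2 * (s * (p + 1) + x)\<close>.\<close>
 define R where "R = 2 * s + x"
 have n2: "n div 2 = s * (p + 1) + x" by (simp only: s_def x_def div_mult_mod_eq)
 define F where "F = {A. A \<subseteq> {1..2 * s} \<and> card A = s}"
 have cF: "2 ^ s \<le> card F" using central_binomial_ge[of s] by (simp add: F_def n_subsets)
 have FR: "A \<subseteq> {1..R}" if "A \<in> F" for A using that by (auto simp: F_def R_def)
 have d: "2 * R + 2 * (p - 1) * card A = 2 * (n div 2)" if "A \<in> F" for A
 proof -
  have "card A = s" using that by (simp add: F_def)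
  moreover have "(p - 1) * s + 2 * s = s * (p + 1)" using p by (cases p) (auto simp: algebra_simps)
  ultimately show ?thesis unfolding R_def n2 by (simp add: algebra_simps)
 qed
 have inj: "A = B" if "A \<in> F" "B \<in> F" "block_entries p R A = block_entries p R B" for A B
 proof -
  have "A = {l\<in>{1..R}. block_entries p R A (3 * l) = 0}" if "A \<in> F" for A
   using FR[OF that] by (auto simp: block_entries_def)
  then show ?thesis using that by metis
 qed
 have s_eq: "s = n div (2 * (p + 1))" unfolding s_def by (rule div_mult2_eq[symmetric])
 have bl: "block_digits R i < p" for i using p by (simp add: block_digits_def)
 show ?thesis
 proof (cases "even n")
  case True
  let ?m = "block_digits R"
  have "block_entries p R ` F \<subseteq> solutions p ?m n"
   using block_solution[OF FR p] d True by fastforce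
  moreover have "finite (solutions p ?m n)" using card_solutions_le[OF p bl num_block_digits(1)] by blast
  ultimately have "card (block_entries p R ` F) \<le> card (solutions p ?m n)" by (metis card_mono)
  moreover have "card (block_entries p R ` F) = card F" using inj by (intro card_image) (auto simp: inj_on_def)
  ultimately show ?thesis using cF bl num_block_digits(1)[of R] s_eq by (intro exI[of _ ?m]) auto
 next
  case False
  let ?m = "odd_block_digits p R"
  have ml: "?m i < p" for i
   using p bl by (auto simp: odd_block_digits_def inc_def block_digits_def split: nat.splits)
  have mf: "fin_supp ?m"
   using sum_shift(1)[of ?m "\<lambda>i c. 0"] num_block_digits(1)[of R] by (simp add: odd_block_digits_def)
  have "odd_block_entries p R ` F \<subseteq> solutions p ?m n"
   using odd_block_solution[OF FR p] d False by (fastforce simp: odd_two_times_div_two_succ)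
  moreover have "finite (solutions p ?m n)" using card_solutions_le[OF p ml mf] by blast
  ultimately have "card (odd_block_entries p R ` F) \<le> card (solutions p ?m n)" by (metis card_mono)
  moreover have "card (odd_block_entries p R ` F) = card F"
  proof (rule card_image, rule inj_onI)
   fix A B assume AB: "A \<in> F" "B \<in> F" "odd_block_entries p R A = odd_block_entries p R B"
   have "block_entries p R A i = block_entries p R B i" for i
    using fun_cong[OF AB(3), of "Suc i"] by (simp add: odd_block_entries_def)
   then show "A = B" using inj AB by blast
  qed
  ultimately show ?thesis using cF ml mf s_eq by (intro exI[of _ ?m]) auto
 qed
qed

subsection \<open>Coefficients of polynomial maps\<close>

text \<open>Over a finite field, 1 plus the product of all \<open>X - a\<close> has no root.\<close>

lemma infinite_alg_closed: "infinite (UNIV :: 'k::alg_closed_field set)"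
proof
 assume fin: "finite (UNIV :: 'k set)"
 let ?P = "(\<Prod>a\<in>UNIV. [:- a, 1:]) + 1 :: 'k poly"
 have v: "poly ?P x = 1" for x
  using fin by (auto simp: poly_prod prod_zero_iff)
 have "degree (\<Prod>a\<in>(UNIV :: 'k set). [:- a, 1:]) = card (UNIV :: 'k set)"
  by (subst degree_prod_eq_sum_degree) auto
 moreover have "card (UNIV :: 'k set) > 0" using fin by (simp add: card_gt_0_iff)
 ultimately have "degree ?P > 0" by (subst degree_add_eq_left) auto
 then obtain x where "poly ?P x = 0" using alg_closed_imp_poly_has_root by blast
 then show False using v by simp
qed

lemma poly_zeroI:
 fixes P :: "'k::alg_closed_field poly"
 assumes "\<And>u. u \<noteq> 0 ==> poly P u = 0"
 shows "P = 0"
proof (rule ccontr)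
 assume "P \<noteq> 0"
 then have "finite {u. poly P u = 0}" by (rule poly_roots_finite)
 moreover have "UNIV - {0} \<subseteq> {u. poly P u = 0}" using assms by auto
 ultimately have "finite (UNIV - {0 :: 'k})" by (rule rev_finite_subset)
 then show False using infinite_alg_closed[where 'k = 'k] by simp
qed

text \<open>Only nonzero points are compared, so that the lemma applies to torus parameters.\<close>

lemma power_sum_unique:
 fixes c d :: "nat => 'k::alg_closed_field"
 assumes "\<And>u. u \<noteq> 0 ==> (\<Sum>n\<le>N. u ^ n * c n) = (\<Sum>n\<le>N. u ^ n * d n)" "n \<le> N"
 shows "c n = d n"
proof -
 have "(\<Sum>n\<le>N. Polynomial.monom (c n - d n) n) = 0"
 proof (rule poly_zeroI)
  fix u :: 'k assume "u \<noteq> 0"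
  then show "poly (\<Sum>n\<le>N. Polynomial.monom (c n - d n) n) u = 0"
   using assms(1)[of u] by (simp add: poly_sum poly_monom algebra_simps sum_subtractf)
 qed
 then have "coeff (\<Sum>n\<le>N. Polynomial.monom (c n - d n) n) n = 0" by simp
 then show ?thesis using assms(2) by (simp add: coeff_sum_monom)
qed

lemma vpower_sum_unique:
 fixes c d :: "nat => 'i => 'k::alg_closed_field"
 assumes "\<And>u. u \<noteq> 0 ==> (\<Sum>n\<le>N. fscale (u ^ n) (c n)) = (\<Sum>n\<le>N. fscale (u ^ n) (d n))" "n \<le> N"
 shows "c n = d n"
proof
 fix i
 have "(\<Sum>n\<le>N. u ^ n * c n i) = (\<Sum>n\<le>N. u ^ n * d n i)" if "u \<noteq> 0" for u
  using fun_cong[OF assms(1)[OF that], of i] by (simp add: sum_fun_apply)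
 then show "c n i = d n i" using power_sum_unique[where N = N and c = "\<lambda>n. c n i" and d = "\<lambda>n. d n i"] assms(2) by blast
qed

text \<open>The tail is forced to vanish, which makes the coefficient sequence unique and
  independent of the bound \<open>N\<close>.\<close>

definition vexpansion :: "('k::field => 'i => 'k) => nat => (nat => 'i => 'k) => bool" where
 "vexpansion q N c \<longleftrightarrow> (\<forall>n>N. c n = 0) \<and> (\<forall>u. q u = (\<Sum>n\<le>N. fscale (u ^ n) (c n)))"

definition vcoef :: "('k::field => 'i => 'k) => nat => 'i => 'k" where
 "vcoef q = (SOME c. \<exists>N. vexpansion q N c)"

lemma vexpansion_mono:
 assumes "vexpansion q N c" "N \<le> M"
 shows "vexpansion q M c"
proof -
 have "(\<Sum>n\<le>N. fscale (u ^ n) (c n)) = (\<Sum>n\<le>M. fscale (u ^ n) (c n))" for u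
  using assms by (intro sum.mono_neutral_left) (auto simp: vexpansion_def)
 then show ?thesis using assms by (auto simp: vexpansion_def)
qed

lemma vcoef_eq:
 fixes q :: "'k::alg_closed_field => 'i => 'k"
 assumes "vexpansion q N c"
 shows "vcoef q = c"
proof -
 obtain M where M: "vexpansion q M (vcoef q)"
  using someI_ex[of "\<lambda>c. \<exists>N. vexpansion q N c"] assms unfolding vcoef_def by blast
 let ?K = "max N M"
 have 1: "vexpansion q ?K (vcoef q)" "vexpansion q ?K c"
  using vexpansion_mono M assms by (metis max.cobounded1 max.cobounded2)+
 show ?thesis
 proof
  fix n show "vcoef q n = c n"
  proof (cases "n \<le> ?K")
   case True
   show ?thesis
    by (rule vpower_sum_unique[OF _ True]) (use 1 in \<open>unfold vexpansion_def, metis\<close>)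
  qed (use 1 in \<open>unfold vexpansion_def, metis not_le\<close>)
 qed
qed

lemma vexpansion_cut:
 assumes "\<And>u. q u = (\<Sum>n\<le>N. fscale (u ^ n) (c n))"
 shows "vexpansion q N (\<lambda>n. if n \<le> N then c n else 0)"
 using assms by (auto simp: vexpansion_def)

subsection \<open>Binomial coefficients modulo p\<close>

text \<open>Compare coefficients in \<open>(u + 1) ^ (p ^ i) = u ^ (p ^ i) + 1\<close>.\<close>

lemma choose_prime_power:
 assumes char: "CHAR('k::alg_closed_field) = p" and prime: "prime p" and k: "0 < k" "k < p ^ i"
 shows "(of_nat (p ^ i choose k) :: 'k) = 0"
proof -
 let ?P = "p ^ i"
 have eq: "(\<Sum>n\<le>?P. u ^ n * of_nat (?P choose n)) = (\<Sum>n\<le>?P. u ^ n * (if n = 0 \<or> n = ?P then 1 else 0))" for u :: 'k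
 proof -
  have "(\<Sum>n\<le>?P. u ^ n * of_nat (?P choose n)) = (u + 1) ^ ?P"
   by (simp add: binomial_ring mult.commute)
  also have "... = u ^ ?P + 1 ^ ?P" by (rule freshmans_dream') (use char prime in auto)
  also have "... = (\<Sum>n\<in>{0, ?P}. u ^ n * (if n = 0 \<or> n = ?P then 1 else 0))"
   using prime by (simp add: prime_gt_0_nat)
  also have "... = (\<Sum>n\<le>?P. u ^ n * (if n = 0 \<or> n = ?P then 1 else 0))"
   by (intro sum.mono_neutral_left) auto
  finally show ?thesis .
 qed
 have "(of_nat (?P choose k) :: 'k) = (if k = 0 \<or> k = ?P then 1 else 0)"
  by (rule power_sum_unique[where N = ?P and c = "\<lambda>k. of_nat (?P choose k)" and d = "\<lambda>k. if k = 0 \<or> k = ?P then 1 else 0"])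
   (rule eq, use k in simp)
 then show ?thesis using k by simp
qed

text \<open>A case of Lucas' theorem: in Vandermonde's formula for \<open>a + p ^ i\<close> only the
  two extreme terms survive, so adding \<open>p ^ i\<close> to the upper argument adds 1 to the
  value.\<close>

lemma choose_prime_power_div:
 assumes char: "CHAR('k::alg_closed_field) = p" and prime: "prime p"
 shows "(of_nat (n choose (p ^ i)) :: 'k) = of_nat (n div p ^ i)"
proof (induction n rule: less_induct)
 case (less n)
 let ?P = "p ^ i"
 have P: "?P > 0" using prime by (simp add: prime_gt_0_nat)
 show ?case
 proof (cases "n < ?P")
  case False
  define a where "a = n - ?P"
  have n: "n = a + ?P" and an: "a < n" using False P by (simp_all add: a_def del: nat_zero_less_power_iff)
  have "(of_nat (n choose ?P) :: 'k) = (\<Sum>k\<le>?P. of_nat (a choose k) * of_nat (?P choose (?P - k)))"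
   unfolding n by (simp add: vandermonde[symmetric])
  also have "... = (\<Sum>k\<in>{0, ?P}. of_nat (a choose k) * of_nat (?P choose (?P - k)))"
  proof (intro sum.mono_neutral_right ballI)
   fix k assume "k \<in> {..?P} - {0, ?P}"
   then have "0 < ?P - k" "?P - k < ?P" by auto
   then have "(of_nat (?P choose (?P - k)) :: 'k) = 0" by (rule choose_prime_power[OF char prime])
   then show "(of_nat (a choose k) * of_nat (?P choose (?P - k)) :: 'k) = 0" by (simp only: mult_zero_right)
  qed auto
  also have "... = 1 + of_nat (a choose ?P)" using P by simp
  also have "... = of_nat (1 + a div ?P)" using less[OF an] by simp
  also have "1 + a div ?P = n div ?P" using P by (simp add: n)
  finally show ?thesis .
 qed (simp add: binomial_eq_0)
qed

subsection \<open>Two by two matrices\<close>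

definition mat2 :: "'k => 'k => 'k => 'k => 'k::comm_ring_1 mat" where
 "mat2 a b c d = mat 2 2 (\<lambda>(i, j). if i = 0 then (if j = 0 then a else b) else (if j = 0 then c else d))"

lemma mat2_carrier [simp]: "mat2 a b c d \<in> carrier_mat 2 2"
 by (simp add: mat2_def)

lemma mat2_index [simp]: "mat2 a b c d $$ (0, 0) = a" "mat2 a b c d $$ (0, Suc 0) = b"
 "mat2 a b c d $$ (Suc 0, 0) = c" "mat2 a b c d $$ (Suc 0, Suc 0) = d"
 by (simp_all add: mat2_def)

lemma less_2: "i < (2::nat) \<longleftrightarrow> i = 0 \<or> i = Suc 0"
 by auto

lemma mat2_eta:
 assumes "g \<in> carrier_mat 2 2"
 shows "g = mat2 (g $$ (0, 0)) (g $$ (0, 1)) (g $$ (1, 0)) (g $$ (1, 1))"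
 by (rule eq_matI) (use assms in \<open>auto simp: mat2_def less_2\<close>)

lemma mat2_eq [simp]: "mat2 a b c d = mat2 a' b' c' d' \<longleftrightarrow> a = a' \<and> b = b' \<and> c = c' \<and> d = d'"
proof
 assume h: "mat2 a b c d = mat2 a' b' c' d'"
 show "a = a' \<and> b = b' \<and> c = c' \<and> d = d'"
  using arg_cong[OF h, of "\<lambda>g. g $$ (0, 0)"] arg_cong[OF h, of "\<lambda>g. g $$ (0, Suc 0)"]
   arg_cong[OF h, of "\<lambda>g. g $$ (Suc 0, 0)"] arg_cong[OF h, of "\<lambda>g. g $$ (Suc 0, Suc 0)"] by simp
qed simp

lemma mult_index:
 assumes "g \<in> carrier_mat 2 2" "h \<in> carrier_mat 2 2" "i < 2" "j < 2"
 shows "(g * h) $$ (i, j) = g $$ (i, 0) * h $$ (0, j) + g $$ (i, 1) * h $$ (1, j)"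
proof -
 have "{0..<2} = {0, 1 :: nat}" by auto
 then show ?thesis using assms by (auto simp: scalar_prod_def)
qed

lemma mat2_mult [simp]:
 "mat2 a b c d * mat2 a' b' c' d' = mat2 (a * a' + b * c') (a * b' + b * d') (c * a' + d * c') (c * b' + d * d')"
proof (rule eq_matI)
 let ?r = "mat2 (a * a' + b * c') (a * b' + b * d') (c * a' + d * c') (c * b' + d * d')"
 fix i j assume "i < dim_row ?r" "j < dim_col ?r"
 then have ij: "i < 2" "j < 2" by (simp_all add: mat2_def)
 show "(mat2 a b c d * mat2 a' b' c' d') $$ (i, j) = ?r $$ (i, j)"
  unfolding mult_index[OF mat2_carrier mat2_carrier ij] using ij by (auto simp: less_2)
qed (simp_all add: mat2_def)

lemma det_mat2 [simp]: "det (mat2 a b c d) = a * d - b * c"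
proof -
 have d: "det (mat_delete (mat2 a b c d) 0 j) = (if j = 0 then d else c)" if "j < 2" for j
 proof -
  have "mat_delete (mat2 a b c d) 0 j \<in> carrier_mat 1 1" by (auto simp: mat_delete_def mat2_def)
  then have "det (mat_delete (mat2 a b c d) 0 j) = mat_delete (mat2 a b c d) 0 j $$ (0, 0)" by (rule det_single)
  also have "... = (if j = 0 then d else c)" using that by (auto simp: mat_delete_def mat2_def)
  finally show ?thesis .
 qed
 have "{..<2} = {0, 1 :: nat}" by auto
 then show ?thesis
  using laplace_expansion_row[OF mat2_carrier[of a b c d], of 0] d[of 0] d[of 1] by (simp add: cofactor_def)
qed

lemma mat2_SL2 [simp]: "mat2 a b c d \<in> SL2 \<longleftrightarrow> a * d - b * c = 1"
 by (simp add: SL2_def)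

lemma SL2_cases:
 assumes "g \<in> SL2"
 obtains a b c d where "g = mat2 a b c d" "a * d - b * c = 1"
proof -
 have g: "g \<in> carrier_mat 2 2" "det g = 1" using assms by (auto simp: SL2_def)
 show thesis
  by (rule that[OF mat2_eta[OF g(1)]]) (use g(2) in \<open>subst (asm) mat2_eta[OF g(1)], simp\<close>)
qed

lemma one_mat2: "1\<^sub>m 2 = mat2 1 0 0 1"
 by (rule eq_matI) (auto simp: mat2_def less_2)

lemma SL2_mult: "g \<in> SL2 ==> h \<in> SL2 ==> g * h \<in> SL2"
 by (auto simp: SL2_def det_mult)

definition upsilon :: "'k => 'k::comm_ring_1 mat" where
 "upsilon u = mat2 1 u 0 1"

definition tau :: "'k => 'k::field mat" where
 "tau t = mat2 t 0 0 (inverse t)"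

lemma upsilon_SL2 [simp]: "upsilon u \<in> SL2" by (simp add: upsilon_def)
lemma tau_SL2 [simp]: "t \<noteq> 0 ==> tau t \<in> SL2" by (simp add: tau_def)

lemma tau_eq: "mat_of_rows_list 2 [[t, 0], [0, inverse t]] = tau t"
 by (rule eq_matI) (auto simp: mat_of_rows_list_def tau_def mat2_def less_2)

subsection \<open>Regular functions\<close>

lemma reg_sum: "(\<And>l. l \<in> A ==> f l \<in> regular_functions) ==> (\<lambda>g. \<Sum>l\<in>A. f l g) \<in> regular_functions"
 by (induction A rule: infinite_finite_induct) (auto intro: regular_functions.intros)

lemma reg_power: "f \<in> regular_functions ==> (\<lambda>g. f g ^ n) \<in> regular_functions"
 by (induction n) (auto intro: regular_functions.intros)

lemma reg_uminus: "f \<in> regular_functions ==> (\<lambda>g. - f g) \<in> regular_functions"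
 using regular_functions.mult[OF regular_functions.const[of "-1"]] by simp

lemmas reg_intros = regular_functions.mult regular_functions.const reg_power reg_uminus

text \<open>Restriction along a polynomial curve of matrices; used for unipotent subgroups and for
  the charts of the projective line.\<close>

lemma reg_poly:
 assumes "r \<in> regular_functions"
 shows "\<exists>P. \<forall>u. r (mat2 (poly A u) (poly B u) (poly C u) (poly D u)) = poly P u"
 using assms
proof (induction r)
 case (const c)
 show ?case by (intro exI[of _ "[:c:]"]) simp
next
 case (entry i j)
 then show ?case by (auto simp: less_2)
next
 case (add f h)
 then show ?case by (metis poly_add)
next
 case (mult f h)
 then show ?case by (metis poly_mult)
qed

lemma reg_laurent:
 assumes "r \<in> regular_functions"
 shows "\<exists>n P. \<forall>t\<noteq>0. t ^ n * r (tau t) = poly P t"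
 using assms
proof (induction r)
 case (const c)
 show ?case by (intro exI[of _ 0] exI[of _ "[:c:]"]) simp
next
 case (entry i j)
 have "t ^ 1 * tau t $$ (i, j) = poly (if i = 0 \<and> j = 0 then [:0, 0, 1:] else if i = 1 \<and> j = 1 then 1 else 0) t" if "t \<noteq> 0" for t :: 'a
  using entry that by (auto simp: less_2 tau_def)
 then show ?case by blast
next
 case (add f h)
 then obtain n P m Q where P: "\<And>t. t \<noteq> 0 ==> t ^ n * f (tau t) = poly P t"
  and Q: "\<And>t. t \<noteq> 0 ==> t ^ m * h (tau t) = poly Q t" by metis
 have "t ^ (n + m) * (f (tau t) + h (tau t)) = poly (Polynomial.monom 1 m * P + Polynomial.monom 1 n * Q) t" if "t \<noteq> 0" for t
  using P[OF that] Q[OF that] by (simp add: poly_monom power_add algebra_simps flip: P[OF that] Q[OF that])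
 then show ?case by blast
next
 case (mult f h)
 then obtain n P m Q where P: "\<And>t. t \<noteq> 0 ==> t ^ n * f (tau t) = poly P t"
  and Q: "\<And>t. t \<noteq> 0 ==> t ^ m * h (tau t) = poly Q t" by metis
 have "t ^ (n + m) * (f (tau t) * h (tau t)) = poly (P * Q) t" if "t \<noteq> 0" for t
  by (simp add: power_add algebra_simps flip: P[OF that] Q[OF that])
 then show ?case by blast
qed

text \<open>The comultiplication of \<open>k[G]\<close>, given on entries by the matrix product. A
  sum of functions concatenates the index ranges; a product pairs them by \<open>div\<close> and
  \<open>mod\<close>.\<close>

lemma reg_comult:
 assumes "r \<in> regular_functions"
 shows "\<exists>(N::nat) f h. (\<forall>l. f l \<in> regular_functions \<and> h l \<in> regular_functions) \<and>
  (\<forall>g\<in>carrier_mat 2 2. \<forall>k\<in>carrier_mat 2 2. r (g * k) = (\<Sum>l<N. f l g * h l k))"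
 using assms
proof (induction r)
 case (const c)
 show ?case
  by (intro exI[of _ "1::nat"] exI[of _ "\<lambda>l g. c"] exI[of _ "\<lambda>l g. 1"]) (auto intro: regular_functions.intros)
next
 case (entry i j)
 let ?f = "\<lambda>l g. if l = 0 then g $$ (i, 0) else g $$ (i, 1)"
 let ?h = "\<lambda>l k. if l = 0 then k $$ (0, j) else k $$ (1, j)"
 have "?f l \<in> regular_functions \<and> ?h l \<in> regular_functions" for l :: nat
  using entry by (cases "l = 0") (auto intro: regular_functions.intros)
 moreover have "(g * k) $$ (i, j) = (\<Sum>l<2::nat. ?f l g * ?h l k)" if "g \<in> carrier_mat 2 2" "k \<in> carrier_mat 2 2" for g k :: "'a mat"
  using mult_index[OF that entry] by (simp add: numeral_2_eq_2)
 ultimately show ?case by (intro exI[of _ "2::nat"] exI[of _ ?f] exI[of _ ?h]) auto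
next
 case (add r s)
 obtain N :: nat and f h where F: "\<forall>l. f l \<in> regular_functions \<and> h l \<in> regular_functions"
  "\<forall>g\<in>carrier_mat 2 2. \<forall>k\<in>carrier_mat 2 2. r (g * k) = (\<Sum>l<N. f l g * h l k)"
  using add.IH(1) by blast
 obtain M :: nat and f' h' where F': "\<forall>l. f' l \<in> regular_functions \<and> h' l \<in> regular_functions"
  "\<forall>g\<in>carrier_mat 2 2. \<forall>k\<in>carrier_mat 2 2. s (g * k) = (\<Sum>l<M. f' l g * h' l k)"
  using add.IH(2) by blast
 let ?f = "\<lambda>l. if l < N then f l else f' (l - N)" and ?h = "\<lambda>l. if l < N then h l else h' (l - N)"
 have "(\<Sum>l<N + M. ?f l g * ?h l k) = (\<Sum>l<N. f l g * h l k) + (\<Sum>l<M. f' l g * h' l k)" for g k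
 proof -
  have "(\<Sum>l<N + M. ?f l g * ?h l k) = (\<Sum>l<N. ?f l g * ?h l k) + (\<Sum>l=N..<N + M. ?f l g * ?h l k)"
   unfolding lessThan_atLeast0 by (rule sum.atLeastLessThan_concat[symmetric]) auto
  also have "(\<Sum>l=N..<N + M. ?f l g * ?h l k) = (\<Sum>l<M. f' l g * h' l k)"
   by (rule sum.reindex_bij_witness[of _ "\<lambda>l. l + N" "\<lambda>l. l - N"]) auto
  finally show ?thesis by simp
 qed
 then show ?case
  using F F' by (intro exI[of _ "N + M"] exI[of _ ?f] exI[of _ ?h]) auto
next
 case (mult r s)
 obtain N :: nat and f h where F: "\<forall>l. f l \<in> regular_functions \<and> h l \<in> regular_functions"
  "\<forall>g\<in>carrier_mat 2 2. \<forall>k\<in>carrier_mat 2 2. r (g * k) = (\<Sum>l<N. f l g * h l k)"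
  using mult.IH(1) by blast
 obtain M :: nat and f' h' where F': "\<forall>l. f' l \<in> regular_functions \<and> h' l \<in> regular_functions"
  "\<forall>g\<in>carrier_mat 2 2. \<forall>k\<in>carrier_mat 2 2. s (g * k) = (\<Sum>l<M. f' l g * h' l k)"
  using mult.IH(2) by blast
 let ?f = "\<lambda>l g. f (l div M) g * f' (l mod M) g" and ?h = "\<lambda>l k. h (l div M) k * h' (l mod M) k"
 have "(\<Sum>l<N * M. ?f l g * ?h l k) = (\<Sum>l<N. f l g * h l k) * (\<Sum>l<M. f' l g * h' l k)" for g k
 proof -
  have "(\<Sum>l<N * M. ?f l g * ?h l k) = (\<Sum>i<N. \<Sum>l=i * M..<i * M + M. ?f l g * ?h l k)"
   by (rule sum.nat_group[symmetric])
  also have "... = (\<Sum>i<N. \<Sum>j<M. (f i g * h i k) * (f' j g * h' j k))"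
  proof (rule sum.cong[OF refl])
   fix i
   have "(\<Sum>l=i * M..<i * M + M. ?f l g * ?h l k) = (\<Sum>j<M. ?f (i * M + j) g * ?h (i * M + j) k)"
    by (rule sum.reindex_bij_witness[of _ "\<lambda>j. i * M + j" "\<lambda>l. l - i * M"]) auto
   also have "... = (\<Sum>j<M. (f i g * h i k) * (f' j g * h' j k))"
    by (rule sum.cong) (auto simp: mult_ac)
   finally show "(\<Sum>l=i * M..<i * M + M. ?f l g * ?h l k) = (\<Sum>j<M. (f i g * h i k) * (f' j g * h' j k))" .
  qed
  also have "... = (\<Sum>i<N. f i g * h i k) * (\<Sum>j<M. f' j g * h' j k)"
   by (simp add: sum_product)
  finally show ?thesis .
 qed
 moreover have "?f l \<in> regular_functions \<and> ?h l \<in> regular_functions" for l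
  using F F' by (auto intro!: regular_functions.mult)
 ultimately show ?case
  using F F' by (intro exI[of _ "N * M"] exI[of _ ?f] exI[of _ ?h]) auto
qed

section \<open>Divided powers of the root operator\<close>

definition divpow :: "('k::field mat => ('i => 'k) => 'i => 'k) => nat => ('i => 'k) => 'i => 'k" where
 "divpow \<rho> n v = vcoef (\<lambda>u. \<rho> (upsilon u) v) n"

text \<open>In characteristic 0, \<open>divpow \<rho> n\<close> would be
  \<open>e ^ n / fact n\<close>. Orders \<open>p ^ i\<close> suffice because a vector killed by all
  of these is killed in every positive order (\<open>eop_all_0\<close>).\<close>

definition eop :: "nat => ('k::field mat => ('i => 'k) => 'i => 'k) => nat => ('i => 'k) => 'i => 'k" where
 "eop p \<rho> i = divpow \<rho> (p ^ i)"

definition wtsp :: "('i => 'k::field) set => ('k mat => ('i => 'k) => 'i => 'k) => int => ('i => 'k) set" where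
 "wtsp S \<rho> \<mu> = {v \<in> S. \<forall>t. t \<noteq> 0 \<longrightarrow> \<rho> (tau t) v = fscale (t powi \<mu>) v}"

text \<open>Only the Borel subgroup acts: a localization of the coordinate ring at an entry of the
  first column is stable under right translation by it, but not by \<open>G\<close>. Stability under
  \<open>upsilon\<close> is contained in \<open>u_exp\<close>.\<close>

locale bmod =
 fixes S :: "('i => 'k::alg_closed_field) set" and \<rho> :: "'k mat => ('i => 'k) => 'i => 'k"
 assumes zero: "0 \<in> S" and add: "v \<in> S ==> w \<in> S ==> v + w \<in> S" and scale: "v \<in> S ==> fscale c v \<in> S"
  and u_add: "v \<in> S ==> w \<in> S ==> \<rho> (upsilon u) (v + w) = \<rho> (upsilon u) v + \<rho> (upsilon u) w"
  and u_scale: "v \<in> S ==> \<rho> (upsilon u) (fscale c v) = fscale c (\<rho> (upsilon u) v)"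
  and t_S: "v \<in> S ==> t \<noteq> 0 ==> \<rho> (tau t) v \<in> S"
  and t_add: "v \<in> S ==> w \<in> S ==> t \<noteq> 0 ==> \<rho> (tau t) (v + w) = \<rho> (tau t) v + \<rho> (tau t) w"
  and t_scale: "v \<in> S ==> t \<noteq> 0 ==> \<rho> (tau t) (fscale c v) = fscale c (\<rho> (tau t) v)"
  and u_zero: "v \<in> S ==> \<rho> (upsilon 0) v = v"
  and u_mult: "v \<in> S ==> \<rho> (upsilon u) (\<rho> (upsilon s) v) = \<rho> (upsilon (u + s)) v"
  and t_u: "v \<in> S ==> t \<noteq> 0 ==> \<rho> (tau t) (\<rho> (upsilon u) v) = \<rho> (upsilon (t\<^sup>2 * u)) (\<rho> (tau t) v)"
  and u_exp: "v \<in> S ==> \<exists>N c. (\<forall>n. c n \<in> S) \<and> vexpansion (\<lambda>u. \<rho> (upsilon u) v) N c"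
begin

lemma sum_S: "(\<And>a. a \<in> A ==> f a \<in> S) ==> sum f A \<in> S"
 by (induction A rule: infinite_finite_induct) (auto simp: zero add)

lemma fscale_neg: "fscale (- 1) v = - v" for v :: "'i => 'k"
 by (simp add: fun_eq_iff)

lemma uminus_S: "v \<in> S ==> - v \<in> S"
 using scale[of v "- 1"] by (simp add: fscale_neg)

lemma diff_S: "v \<in> S ==> w \<in> S ==> v - w \<in> S"
 using add[of v "- w"] uminus_S by simp

lemma u_0: "\<rho> (upsilon u) 0 = 0"
 using u_add[OF zero zero, of u] by simp

lemma t_0: "t \<noteq> 0 ==> \<rho> (tau t) 0 = 0"
 using t_add[OF zero zero, of t] by simp

lemma u_sum: "(\<And>a. a \<in> A ==> f a \<in> S) ==> \<rho> (upsilon u) (sum f A) = (\<Sum>a\<in>A. \<rho> (upsilon u) (f a))"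
 by (induction A rule: infinite_finite_induct) (auto simp: u_0 u_add sum_S)

lemma t_sum: "(\<And>a. a \<in> A ==> f a \<in> S) ==> t \<noteq> 0 ==> \<rho> (tau t) (sum f A) = (\<Sum>a\<in>A. \<rho> (tau t) (f a))"
 by (induction A rule: infinite_finite_induct) (auto simp: t_0 t_add sum_S)

lemma divpow_eq: "vexpansion (\<lambda>u. \<rho> (upsilon u) v) N c ==> divpow \<rho> n v = c n"
 by (simp add: divpow_def vcoef_eq)

lemma divpow_exp:
 assumes "v \<in> S"
 shows "\<exists>N. vexpansion (\<lambda>u. \<rho> (upsilon u) v) N (\<lambda>n. divpow \<rho> n v)"
proof -
 obtain N c where "vexpansion (\<lambda>u. \<rho> (upsilon u) v) N c" using u_exp[OF assms] by blast
 then show ?thesis using divpow_eq by (metis ext)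
qed

lemma divpow_S: "v \<in> S ==> divpow \<rho> n v \<in> S"
 using u_exp divpow_eq by metis

lemma divpow_add:
 assumes "v \<in> S" "w \<in> S"
 shows "divpow \<rho> n (v + w) = divpow \<rho> n v + divpow \<rho> n w"
proof -
 obtain N M where "vexpansion (\<lambda>u. \<rho> (upsilon u) v) N (\<lambda>n. divpow \<rho> n v)"
  "vexpansion (\<lambda>u. \<rho> (upsilon u) w) M (\<lambda>n. divpow \<rho> n w)" using divpow_exp assms by blast
 then have "vexpansion (\<lambda>u. \<rho> (upsilon u) v) (max N M) (\<lambda>n. divpow \<rho> n v)"
  "vexpansion (\<lambda>u. \<rho> (upsilon u) w) (max N M) (\<lambda>n. divpow \<rho> n w)" by (auto intro: vexpansion_mono)
 then have "vexpansion (\<lambda>u. \<rho> (upsilon u) (v + w)) (max N M) (\<lambda>n. divpow \<rho> n v + divpow \<rho> n w)"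
  by (auto simp: vexpansion_def u_add assms fscale_add sum.distrib)
 then show ?thesis by (rule divpow_eq)
qed

lemma divpow_scale:
 assumes "v \<in> S"
 shows "divpow \<rho> n (fscale c v) = fscale c (divpow \<rho> n v)"
proof -
 obtain N where "vexpansion (\<lambda>u. \<rho> (upsilon u) v) N (\<lambda>n. divpow \<rho> n v)" using divpow_exp assms by blast
 then have "vexpansion (\<lambda>u. \<rho> (upsilon u) (fscale c v)) N (\<lambda>n. fscale c (divpow \<rho> n v))"
  by (auto simp: vexpansion_def u_scale assms fscale_sum mult.commute)
 then show ?thesis by (rule divpow_eq)
qed

lemma divpow_zero: "v \<in> S ==> divpow \<rho> 0 v = v"
proof -
 assume v: "v \<in> S"
 obtain N where "vexpansion (\<lambda>u. \<rho> (upsilon u) v) N (\<lambda>n. divpow \<rho> n v)" using divpow_exp v by blast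
 then have "\<rho> (upsilon 0) v = (\<Sum>n\<le>N. fscale (0 ^ n) (divpow \<rho> n v))" by (simp add: vexpansion_def)
 also have "... = (\<Sum>n\<in>{0}. fscale (0 ^ n) (divpow \<rho> n v))"
  by (rule sum.mono_neutral_right) (auto simp: power_0_left)
 finally show ?thesis using u_zero[OF v] by simp
qed

text \<open>Compare the coefficients of \<open>u ^ m * w ^ n\<close> in the action of
  \<open>upsilon u * upsilon w = upsilon (u + w)\<close>.\<close>

lemma divpow_comp:
 assumes v: "v \<in> S"
 shows "divpow \<rho> m (divpow \<rho> n v) = fscale (of_nat ((m + n) choose m)) (divpow \<rho> (m + n) v)"
proof -
 obtain N where N: "vexpansion (\<lambda>u. \<rho> (upsilon u) v) N (\<lambda>n. divpow \<rho> n v)" using divpow_exp v by blast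
 define K where "K = N + m + n"
 have dS: "divpow \<rho> j v \<in> S" for j by (rule divpow_S[OF v])
 have NK: "vexpansion (\<lambda>u. \<rho> (upsilon u) v) K (\<lambda>n. divpow \<rho> n v)"
  by (rule vexpansion_mono[OF N]) (simp add: K_def)
 let ?b = "\<lambda>m n. fscale (of_nat ((m + n) choose m)) (divpow \<rho> (m + n) v)"
 have zb: "?b i j = 0" if "i + j > K" for i j using NK that by (simp add: vexpansion_def)
 \<comment> \<open>The powers of \<open>w\<close> are separated first, for fixed \<open>u\<close>;
   the coefficients are then expansions in \<open>u\<close>.\<close>
 have eq: "(\<Sum>j\<le>K. fscale (w ^ j) (\<rho> (upsilon u) (divpow \<rho> j v))) =
   (\<Sum>j\<le>K. fscale (w ^ j) (\<Sum>i\<le>K. fscale (u ^ i) (?b i j)))" for u w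
 proof -
  have "(\<Sum>j\<le>K. fscale (w ^ j) (\<rho> (upsilon u) (divpow \<rho> j v))) = \<rho> (upsilon u) (\<Sum>j\<le>K. fscale (w ^ j) (divpow \<rho> j v))"
   by (simp add: u_sum u_scale scale dS)
  also have "... = \<rho> (upsilon u) (\<rho> (upsilon w) v)" using NK by (simp add: vexpansion_def)
  also have "... = (\<Sum>l\<le>K. fscale ((u + w) ^ l) (divpow \<rho> l v))"
   using NK u_mult[OF v] by (simp add: vexpansion_def)
  also have "... = (\<Sum>l\<le>K. \<Sum>i\<le>l. fscale (of_nat (l choose i) * u ^ i * w ^ (l - i)) (divpow \<rho> l v))"
   by (intro sum.cong refl, rule ext) (simp add: binomial_ring sum_fun_apply sum_distrib_right)
  also have "... = (\<Sum>(l, i)\<in>(SIGMA l:{..K}. {..l}). fscale (of_nat (l choose i) * u ^ i * w ^ (l - i)) (divpow \<rho> l v))"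
   by (simp add: sum.Sigma)
  also have "... = (\<Sum>(j, i)\<in>{(j, i). j + i \<le> K}. fscale (w ^ j * u ^ i) (?b i j))"
   by (rule sum.reindex_bij_witness[of _ "\<lambda>(j, i). (i + j, i)" "\<lambda>(l, i). (l - i, i)"]) (auto simp: mult_ac)
  also have "... = (\<Sum>(j, i)\<in>{..K} \<times> {..K}. fscale (w ^ j * u ^ i) (?b i j))"
  proof (intro sum.mono_neutral_left ballI)
   fix x assume x: "x \<in> {..K} \<times> {..K} - {(j, i). j + i \<le> K}"
   obtain j i where ji: "x = (j, i)" by (cases x)
   have "?b i j = 0" using x ji by (intro zb) auto
   then show "(case x of (j, i) => fscale (w ^ j * u ^ i) (?b i j)) = 0"
    using arg_cong[of "?b i j" 0 "fscale (w ^ j * u ^ i)"] by (simp only: ji split fscale_simps(3))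
  qed auto
  also have "... = (\<Sum>j\<le>K. \<Sum>i\<le>K. fscale (w ^ j * u ^ i) (?b i j))" by (simp add: sum.cartesian_product)
  also have "... = (\<Sum>j\<le>K. fscale (w ^ j) (\<Sum>i\<le>K. fscale (u ^ i) (?b i j)))" by (simp add: fscale_sum mult.assoc)
  finally show ?thesis .
 qed
 have "\<rho> (upsilon u) (divpow \<rho> n v) = (\<Sum>i\<le>K. fscale (u ^ i) (?b i n))" for u
  by (rule vpower_sum_unique[where N = K and c = "\<lambda>j. \<rho> (upsilon u) (divpow \<rho> j v)"
    and d = "\<lambda>j. \<Sum>i\<le>K. fscale (u ^ i) (?b i j)"]) (rule eq, simp add: K_def)
 then have "vexpansion (\<lambda>u. \<rho> (upsilon u) (divpow \<rho> n v)) K (\<lambda>i. ?b i n)"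
  using zb by (simp add: vexpansion_def)
 then show ?thesis by (rule divpow_eq)
qed

text \<open>\<open>tau t\<close> conjugates \<open>upsilon u\<close> to the element with parameter
  \<open>t ^ 2 * u\<close>, so the coefficient of \<open>u ^ n\<close> gains the factor
  \<open>t ^ (2 n)\<close>.\<close>

lemma divpow_wt:
 assumes v: "v \<in> wtsp S \<rho> \<mu>"
 shows "divpow \<rho> n v \<in> wtsp S \<rho> (\<mu> + 2 * int n)"
proof -
 have vS: "v \<in> S" using v by (simp add: wtsp_def)
 obtain N where N: "vexpansion (\<lambda>u. \<rho> (upsilon u) v) N (\<lambda>n. divpow \<rho> n v)" using divpow_exp vS by blast
 have dS: "divpow \<rho> j v \<in> S" for j by (rule divpow_S[OF vS])
 have "\<rho> (tau t) (divpow \<rho> n v) = fscale (t powi (\<mu> + 2 * int n)) (divpow \<rho> n v)" if t: "t \<noteq> 0" for t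
 proof -
  have NK: "vexpansion (\<lambda>u. \<rho> (upsilon u) v) (N + n) (\<lambda>n. divpow \<rho> n v)"
   by (rule vexpansion_mono[OF N]) simp
  have eq: "(\<Sum>j\<le>N + n. fscale (u ^ j) (\<rho> (tau t) (divpow \<rho> j v))) =
   (\<Sum>j\<le>N + n. fscale (u ^ j) (fscale (t powi (\<mu> + 2 * int j)) (divpow \<rho> j v)))" for u
  proof -
   have "(\<Sum>j\<le>N + n. fscale (u ^ j) (\<rho> (tau t) (divpow \<rho> j v))) = \<rho> (tau t) (\<rho> (upsilon u) v)"
    using NK by (simp add: vexpansion_def t_sum t_scale scale dS t)
   also have "... = fscale (t powi \<mu>) (\<rho> (upsilon (t\<^sup>2 * u)) v)"
    using t_u[OF vS t] v t u_scale[OF vS] by (simp add: wtsp_def)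
   also have "... = (\<Sum>j\<le>N + n. fscale (t powi \<mu> * (t\<^sup>2 * u) ^ j) (divpow \<rho> j v))"
    using NK by (simp add: vexpansion_def fscale_sum)
   also have "... = (\<Sum>j\<le>N + n. fscale (u ^ j) (fscale (t powi (\<mu> + 2 * int j)) (divpow \<rho> j v)))"
   proof (rule sum.cong[OF refl])
    fix j
    have "t powi (\<mu> + 2 * int j) = t powi \<mu> * (t\<^sup>2) ^ j"
    proof -
     have "t powi (\<mu> + 2 * int j) = t powi \<mu> * t powi (int (2 * j))" using t by (simp add: power_int_add)
     also have "t powi (int (2 * j)) = t ^ (2 * j)" by (rule power_int_of_nat)
     finally show ?thesis by (simp add: power_mult)
    qed
    then show "fscale (t powi \<mu> * (t\<^sup>2 * u) ^ j) (divpow \<rho> j v) = fscale (u ^ j) (fscale (t powi (\<mu> + 2 * int j)) (divpow \<rho> j v))"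
     by (simp add: power_mult_distrib mult_ac)
   qed
   finally show ?thesis .
  qed
  show ?thesis
   by (rule vpower_sum_unique[where N = "N + n" and c = "\<lambda>j. \<rho> (tau t) (divpow \<rho> j v)"
     and d = "\<lambda>j. fscale (t powi (\<mu> + 2 * int j)) (divpow \<rho> j v)"]) (rule eq, simp)
 qed
 then show ?thesis using dS by (simp add: wtsp_def)
qed

end

locale bmod_char = bmod S \<rho> for S :: "('i => 'k::alg_closed_field) set" and \<rho> +
 fixes p :: nat
 assumes char: "CHAR('k) = p" and prime: "prime p"
begin

lemma p_pos: "p > 0" using prime prime_gt_0_nat by blast

lemma eop_pow: "v \<in> S ==> \<exists>c. (eop p \<rho> i ^^ n) v = fscale c (divpow \<rho> (n * p ^ i) v)"
proof (induction n)
 case 0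
 then show ?case by (intro exI[of _ 1]) (simp add: divpow_zero)
next
 case (Suc n)
 then obtain c where "(eop p \<rho> i ^^ n) v = fscale c (divpow \<rho> (n * p ^ i) v)" by blast
 then show ?case
  using Suc.prems by (auto simp: eop_def divpow_scale divpow_S divpow_comp)
qed

text \<open>The last factor brings in the binomial coefficient of \<open>p ^ Suc i\<close> over
  \<open>p ^ i\<close>, which is \<open>p = 0\<close> in the field.\<close>

lemma eop_nilp: "v \<in> S ==> (eop p \<rho> i ^^ p) v = 0"
proof -
 assume v: "v \<in> S"
 obtain c where c: "(eop p \<rho> i ^^ (p - 1)) v = fscale c (divpow \<rho> ((p - 1) * p ^ i) v)" using eop_pow[OF v] by blast
 have sp: "p ^ i + (p - 1) * p ^ i = p ^ Suc i" using p_pos by (cases p) auto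
 have "p ^ Suc i div p ^ i = p" using p_pos by simp
 then have "(of_nat (p ^ Suc i choose p ^ i) :: 'k) = 0"
  using choose_prime_power_div[OF char prime, of "p ^ Suc i" i] char by (simp add: of_nat_eq_0_iff_char_dvd del: power_Suc)
 moreover have "(eop p \<rho> i ^^ p) v = eop p \<rho> i ((eop p \<rho> i ^^ (p - 1)) v)"
  using p_pos by (cases p) auto
 moreover have "eop p \<rho> i (divpow \<rho> ((p - 1) * p ^ i) v) = fscale (of_nat (p ^ Suc i choose p ^ i)) (divpow \<rho> (p ^ Suc i) v)"
  unfolding eop_def divpow_comp[OF v] sp ..
 ultimately have "eop p \<rho> i (divpow \<rho> ((p - 1) * p ^ i) v) = 0" by (simp only: fscale_simps)
 then have "eop p \<rho> i ((eop p \<rho> i ^^ (p - 1)) v) = 0"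
  unfolding c by (simp only: eop_def divpow_scale divpow_S v fscale_simps)
 then show ?thesis using \<open>(eop p \<rho> i ^^ p) v = _\<close> by (simp only:)
qed

lemma divpow_add0: "divpow \<rho> n 0 = 0"
 using divpow_add[OF zero zero, of n] by simp

text \<open>If \<open>p ^ i\<close> is the exact power of \<open>p\<close> in \<open>n\<close>, then
  \<open>divpow \<rho> (n - p ^ i)\<close> after \<open>eop p \<rho> i\<close> is
  \<open>n div p ^ i\<close> times \<open>divpow \<rho> n\<close>, and this factor is a
  unit.\<close>

lemma eop_all_0:
 assumes v: "v \<in> S" and e: "\<And>i. eop p \<rho> i v = 0"
 shows "\<rho> (upsilon u) v = v"
proof -
 have d0: "divpow \<rho> n v = 0" if n: "n > 0" for n
 proof -
  define i where "i = multiplicity p n"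
  have dv: "p ^ i dvd n" unfolding i_def by (rule multiplicity_dvd)
  have nd: "\<not> p dvd n div p ^ i"
   unfolding i_def using n prime by (intro multiplicity_decompose) (auto simp: prime_nat_iff)
  have le: "p ^ i \<le> n" using dv n by (rule dvd_imp_le)
  have "divpow \<rho> (n - p ^ i) (eop p \<rho> i v) = fscale (of_nat (n choose (n - p ^ i))) (divpow \<rho> n v)"
   using divpow_comp[OF v, of "n - p ^ i" "p ^ i"] le by (simp add: eop_def)
  also have "n choose (n - p ^ i) = n choose p ^ i" using le by (simp add: binomial_symmetric[symmetric])
  finally have "fscale (of_nat (n div p ^ i)) (divpow \<rho> n v) = 0"
   unfolding e divpow_add0 choose_prime_power_div[OF char prime, of n i] by (rule sym)
  moreover have "(of_nat (n div p ^ i) :: 'k) \<noteq> 0" using nd char by (simp add: of_nat_eq_0_iff_char_dvd)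
  ultimately show ?thesis by (auto simp: fun_eq_iff)
 qed
 obtain N where N: "vexpansion (\<lambda>u. \<rho> (upsilon u) v) N (\<lambda>n. divpow \<rho> n v)" using divpow_exp v by blast
 have "\<rho> (upsilon u) v = (\<Sum>n\<le>N. fscale (u ^ n) (divpow \<rho> n v))" using N by (simp add: vexpansion_def)
 also have "... = (\<Sum>n\<in>{0}. fscale (u ^ n) (divpow \<rho> n v))"
  by (rule sum.mono_neutral_right) (auto simp: d0)
 finally show ?thesis by (simp add: divpow_zero[OF v])
qed

sublocale graded_space p S "eop p \<rho>" "wtsp S \<rho>"
proof
 show "p \<ge> 2" using prime prime_ge_2_nat by blast
 show "0 \<in> S" by (rule zero)
 show "v + w \<in> S" if "v \<in> S" "w \<in> S" for v w using that by (rule add)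
 show "- v \<in> S" if "v \<in> S" for v using that by (rule uminus_S)
 show "eop p \<rho> i v \<in> S" if "v \<in> S" for v i using that by (simp add: eop_def divpow_S)
 show "eop p \<rho> i (v + w) = eop p \<rho> i v + eop p \<rho> i w" if "v \<in> S" "w \<in> S" for v w i
  using that by (simp add: eop_def divpow_add)
 show "eop p \<rho> i (eop p \<rho> j v) = eop p \<rho> j (eop p \<rho> i v)" if "v \<in> S" for v i j
  using that binomial_symmetric[of "p ^ i" "p ^ i + p ^ j"] by (simp add: eop_def divpow_comp add.commute)
 show "(eop p \<rho> i ^^ p) v = 0" if "v \<in> S" for v i using that by (rule eop_nilp)
 show "\<exists>N. \<forall>i\<ge>N. eop p \<rho> i v = 0" if v: "v \<in> S" for v
 proof -
  obtain N where N: "vexpansion (\<lambda>u. \<rho> (upsilon u) v) N (\<lambda>n. divpow \<rho> n v)" using divpow_exp[OF v] by blast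
  have "eop p \<rho> i v = 0" if "i \<ge> Suc N" for i
  proof -
   have "i < p ^ i" using prime by (intro power_gt_expt) (auto simp: prime_gt_Suc_0_nat)
   then have "N < p ^ i" using that by simp
   then show ?thesis using N by (simp add: eop_def vexpansion_def)
  qed
  then show ?thesis by blast
 qed
 show "v \<in> S" if "v \<in> wtsp S \<rho> \<mu>" for v \<mu> using that by (simp add: wtsp_def)
 show "0 \<in> wtsp S \<rho> \<mu>" for \<mu> by (simp add: wtsp_def zero t_0)
 show "v + w \<in> wtsp S \<rho> \<mu>" if "v \<in> wtsp S \<rho> \<mu>" "w \<in> wtsp S \<rho> \<mu>" for v w \<mu>
  using that by (auto simp: wtsp_def add t_add fscale_add)
 show sc: "fscale c v \<in> wtsp S \<rho> \<mu>" if "v \<in> wtsp S \<rho> \<mu>" for v \<mu> c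
  using that by (auto simp: wtsp_def scale t_scale mult.commute)
 show "- v \<in> wtsp S \<rho> \<mu>" if "v \<in> wtsp S \<rho> \<mu>" for v \<mu>
  using sc[OF that, of "- 1"] by (simp add: fscale_neg)
 show "eop p \<rho> i v \<in> wtsp S \<rho> (\<mu> + 2 * int (p ^ i))" if "v \<in> wtsp S \<rho> \<mu>" for v \<mu> i
  using divpow_wt[OF that, of "p ^ i"] by (simp only: eop_def)
 show "fscale c v \<in> S" if "v \<in> S" for v c using that by (rule scale)
 show "eop p \<rho> i (fscale c v) = fscale c (eop p \<rho> i v)" if "v \<in> S" for v i c
  using that by (simp add: eop_def divpow_scale)
qed

end

locale bmod_hom = A: bmod_char S \<rho> p + B: bmod_char S' \<rho>' p
 for S :: "('i => 'k::alg_closed_field) set" and \<rho> and S' :: "('j => 'k) set" and \<rho>' and p +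
 fixes f :: "('i => 'k) => 'j => 'k"
 assumes f_mem: "v \<in> S ==> f v \<in> S'"
  and f_plus: "v \<in> S ==> w \<in> S ==> f (v + w) = f v + f w"
  and f_scale: "v \<in> S ==> f (fscale c v) = fscale c (f v)"
  and f_u: "v \<in> S ==> f (\<rho> (upsilon u) v) = \<rho>' (upsilon u) (f v)"
  and f_t: "v \<in> S ==> t \<noteq> 0 ==> f (\<rho> (tau t) v) = \<rho>' (tau t) (f v)"
begin

lemma f_divpow:
 assumes v: "v \<in> S"
 shows "f (divpow \<rho> n v) = divpow \<rho>' n (f v)"
proof -
 have f0: "f 0 = 0" using f_plus[OF A.zero A.zero] by simp
 have fs: "f (sum g X) = (\<Sum>x\<in>X. f (g x))" if "\<And>x. x \<in> X ==> g x \<in> S" for g and X :: "nat set"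
  using that by (induction X rule: infinite_finite_induct) (auto simp: f0 f_plus A.sum_S)
 obtain N where N: "vexpansion (\<lambda>u. \<rho> (upsilon u) v) N (\<lambda>n. divpow \<rho> n v)" using A.divpow_exp v by blast
 have "\<rho>' (upsilon u) (f v) = (\<Sum>n\<le>N. fscale (u ^ n) (f (divpow \<rho> n v)))" for u
 proof -
  have "\<rho>' (upsilon u) (f v) = f (\<Sum>n\<le>N. fscale (u ^ n) (divpow \<rho> n v))"
   using f_u[OF v] N by (simp add: vexpansion_def)
  then show ?thesis by (simp add: fs A.scale A.divpow_S v f_scale)
 qed
 then have "vexpansion (\<lambda>u. \<rho>' (upsilon u) (f v)) N (\<lambda>n. f (divpow \<rho> n v))"
  using N f0 by (simp add: vexpansion_def)
 then show ?thesis using B.divpow_eq by metis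
qed

lemma f_wtsp: "v \<in> wtsp S \<rho> \<mu> ==> f v \<in> wtsp S' \<rho>' \<mu>"
 using f_mem f_t f_scale by (auto simp: wtsp_def) metis

sublocale graded_map p S "eop p \<rho>" "wtsp S \<rho>" S' "eop p \<rho>'" "wtsp S' \<rho>'" f
 by unfold_locales (auto simp: f_mem f_plus eop_def f_divpow f_wtsp)

end

subsection \<open>Rational modules\<close>

text \<open>Modules whose elements are functions with values in the field. Every rational module is isomorphic to one of
 these, and then addition, scalar multiplication and finite sums are those of the function type.\<close>

locale gmod =
 fixes S :: "('i => 'k::alg_closed_field) set" and \<rho> :: "'k mat => ('i => 'k) => 'i => 'k"
 assumes S_zero: "0 \<in> S" and S_plus: "v \<in> S ==> w \<in> S ==> v + w \<in> S" and S_fscale: "v \<in> S ==> fscale c v \<in> S"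
  and \<rho>_S: "g \<in> SL2 ==> v \<in> S ==> \<rho> g v \<in> S"
  and \<rho>_add: "g \<in> SL2 ==> v \<in> S ==> w \<in> S ==> \<rho> g (v + w) = \<rho> g v + \<rho> g w"
  and \<rho>_scale: "g \<in> SL2 ==> v \<in> S ==> \<rho> g (fscale c v) = fscale c (\<rho> g v)"
  and \<rho>_one: "v \<in> S ==> \<rho> (1\<^sub>m 2) v = v"
  and \<rho>_mult: "g \<in> SL2 ==> h \<in> SL2 ==> v \<in> S ==> \<rho> (g * h) v = \<rho> g (\<rho> h v)"
  and \<rho>_rational: "v \<in> S ==> \<exists>(N::nat) r a. (\<forall>l<N. r l \<in> regular_functions \<and> a l \<in> S) \<and>
   (\<forall>g\<in>SL2. \<rho> g v = (\<Sum>l<N. fscale (r l g) (a l)))"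
begin

lemma S_sum0: "(\<And>a. a \<in> A ==> f a \<in> S) ==> sum f A \<in> S"
 by (induction A rule: infinite_finite_induct) (auto simp: S_zero S_plus)

text \<open>The coefficients need to be polynomial on \<open>X\<close> only; for the torus
  \<open>X\<close> omits 0.\<close>

lemma poly_family:
 fixes f :: "nat => 'k => 'k"
 assumes "\<And>l. l < N ==> \<exists>P. \<forall>u. u \<in> X \<longrightarrow> f l u = poly P u" "\<And>l. l < N ==> a l \<in> S"
 shows "\<exists>K c. (\<forall>n. c n \<in> S) \<and> (\<forall>u. u \<in> X \<longrightarrow> (\<Sum>l<N. fscale (f l u) (a l)) = (\<Sum>n\<le>K. fscale (u ^ n) (c n)))"
proof -
 obtain P where P: "\<And>l u. l < N ==> u \<in> X ==> f l u = poly (P l) u" using assms(1) by metis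
 define K where "K = Max (insert 0 (degree ` P ` {..<N}))"
 have K: "degree (P l) \<le> K" if "l < N" for l unfolding K_def using that by (intro Max_ge) auto
 define c where "c n = (\<Sum>l<N. fscale (coeff (P l) n) (a l))" for n
 have "(\<Sum>l<N. fscale (f l u) (a l)) = (\<Sum>n\<le>K. fscale (u ^ n) (c n))" if u: "u \<in> X" for u
 proof -
  have "(\<Sum>l<N. fscale (f l u) (a l)) = (\<Sum>l<N. \<Sum>n\<le>K. fscale (u ^ n) (fscale (coeff (P l) n) (a l)))"
  proof (rule sum.cong[OF refl])
   fix l assume "l \<in> {..<N}"
   then have l: "l < N" by simp
   have "poly (P l) u = (\<Sum>n\<le>degree (P l). coeff (P l) n * u ^ n)" by (simp add: poly_altdef)
   also have "... = (\<Sum>n\<le>K. coeff (P l) n * u ^ n)"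
    using K[OF l] by (intro sum.mono_neutral_left) (auto simp: coeff_eq_0)
   finally show "fscale (f l u) (a l) = (\<Sum>n\<le>K. fscale (u ^ n) (fscale (coeff (P l) n) (a l)))"
    using P[OF l u] by (simp add: fun_eq_iff sum_fun_apply sum_distrib_left sum_distrib_right mult_ac)
  qed
  also have "... = (\<Sum>n\<le>K. \<Sum>l<N. fscale (u ^ n) (fscale (coeff (P l) n) (a l)))" by (rule sum.swap)
  finally show ?thesis by (simp add: c_def fscale_sum)
 qed
 moreover have "c n \<in> S" for n unfolding c_def using assms(2) by (intro S_sum0 S_fscale) auto
 ultimately show ?thesis by blast
qed

sublocale bmod S \<rho>
proof
 show "\<rho> (upsilon 0) v = v" if "v \<in> S" for v using \<rho>_one[OF that] by (simp add: one_mat2 upsilon_def)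
 show "\<rho> (upsilon u) (\<rho> (upsilon w) v) = \<rho> (upsilon (u + w)) v" if "v \<in> S" for v u w
  using \<rho>_mult[OF upsilon_SL2 upsilon_SL2 that, of u w] by (simp add: upsilon_def add.commute)
 show "\<rho> (tau t) (\<rho> (upsilon u) v) = \<rho> (upsilon (t\<^sup>2 * u)) (\<rho> (tau t) v)" if "v \<in> S" "t \<noteq> 0" for v t u
 proof -
  have "tau t * upsilon u = upsilon (t\<^sup>2 * u) * tau t" using that by (simp add: upsilon_def tau_def power2_eq_square)
  then show ?thesis using that \<rho>_mult[of "tau t" "upsilon u" v] \<rho>_mult[of "upsilon (t\<^sup>2 * u)" "tau t" v] by simp
 qed
 show "\<exists>N c. (\<forall>n. c n \<in> S) \<and> vexpansion (\<lambda>u. \<rho> (upsilon u) v) N c" if v: "v \<in> S" for v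
 proof -
  obtain N :: nat and r a where ra: "\<forall>l<N. r l \<in> regular_functions \<and> a l \<in> S"
   "\<forall>g\<in>SL2. \<rho> g v = (\<Sum>l<N. fscale (r l g) (a l))" using \<rho>_rational[OF v] by blast
  have "\<exists>P. \<forall>u. u \<in> UNIV \<longrightarrow> r l (upsilon u) = poly P u" if "l < N" for l
   using reg_poly[of "r l" "1" "[:0, 1:]" 0 1] ra that by (simp add: upsilon_def)
  then obtain K c where c: "\<forall>n. c n \<in> S" "\<forall>u. u \<in> UNIV \<longrightarrow> (\<Sum>l<N. fscale (r l (upsilon u)) (a l)) = (\<Sum>n\<le>K. fscale (u ^ n) (c n))"
   using poly_family[of N UNIV "\<lambda>l u. r l (upsilon u)" a] ra(1) by auto
  then have "vexpansion (\<lambda>u. \<rho> (upsilon u) v) K (\<lambda>n. if n \<le> K then c n else 0)"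
   using ra(2) by (intro vexpansion_cut) auto
  then show ?thesis using c(1) S_zero
   by (intro exI[of _ K] exI[of _ "\<lambda>n. if n \<le> K then c n else 0"]) auto
 qed
qed (auto simp: S_zero S_plus S_fscale \<rho>_S \<rho>_add \<rho>_scale)

text \<open>After multiplication by \<open>t ^ N\<close> the action of \<open>tau t\<close> is
  polynomial in \<open>t\<close>. Comparing powers of \<open>t\<close> in
  \<open>tau s * tau t = tau (s * t)\<close> shows that its coefficients are weight vectors, and at
  \<open>t = 1\<close> they add up to \<open>v\<close>.\<close>

lemma weight_decomposition:
 assumes v: "v \<in> S"
 shows "\<exists>N K c. (\<forall>n. c n \<in> wtsp S \<rho> (int n - int N)) \<and> v = (\<Sum>n\<le>(K::nat). c n)"
proof -
 obtain M :: nat and r a where ra: "\<forall>l<M. r l \<in> regular_functions \<and> a l \<in> S"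
  "\<forall>g\<in>SL2. \<rho> g v = (\<Sum>l<M. fscale (r l g) (a l))" using \<rho>_rational[OF v] by blast
 have "\<forall>l<M. \<exists>n P. \<forall>t\<noteq>0. t ^ n * r l (tau t) = poly P t" using reg_laurent ra(1) by blast
 then obtain n P where nP: "\<And>l t. l < M ==> t \<noteq> 0 ==> t ^ n l * r l (tau t) = poly (P l) t" by metis
 define N where "N = (\<Sum>l<M. n l)"
 have "\<exists>Q. \<forall>t. t \<in> - {0} \<longrightarrow> t ^ N * r l (tau t) = poly Q t" if "l < M" for l
 proof -
  have "n l \<le> N" unfolding N_def using that by (intro member_le_sum) auto
  then have "t ^ N * r l (tau t) = poly (Polynomial.monom 1 (N - n l) * P l) t" if "t \<noteq> 0" for t
   using nP[OF \<open>l < M\<close> that] that by (simp add: poly_monom flip: power_add mult.assoc nP[OF \<open>l < M\<close> that])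
  then show ?thesis by blast
 qed
 then obtain K c where c: "\<forall>n. c n \<in> S"
  "\<forall>t. t \<in> - {0} \<longrightarrow> (\<Sum>l<M. fscale (t ^ N * r l (tau t)) (a l)) = (\<Sum>n\<le>K. fscale (t ^ n) (c n))"
  using poly_family[of M "- {0}" "\<lambda>l t. t ^ N * r l (tau t)" a] ra(1) by auto
 have ct: "fscale (t ^ N) (\<rho> (tau t) v) = (\<Sum>n\<le>K. fscale (t ^ n) (c n))" if "t \<noteq> 0" for t
  using c(2) ra(2) that by (simp add: fscale_sum)
 define d where "d n = (if n \<le> K then c n else 0)" for n
 have "d n \<in> wtsp S \<rho> (int n - int N)" for n
 proof (cases "n \<le> K")
  case True
  have "\<rho> (tau s) (c n) = fscale (s powi (int n - int N)) (c n)" if s: "s \<noteq> 0" for s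
  proof (rule vpower_sum_unique[where N = K and c = "\<lambda>n. \<rho> (tau s) (c n)" and d = "\<lambda>n. fscale (s powi (int n - int N)) (c n)", OF _ True])
   fix t :: 'k assume t: "t \<noteq> 0"
   have st: "tau s * tau t = tau (s * t)" by (simp add: tau_def)
   have "(\<Sum>n\<le>K. fscale (t ^ n) (\<rho> (tau s) (c n))) = \<rho> (tau s) (\<Sum>n\<le>K. fscale (t ^ n) (c n))"
    using c(1) s by (simp add: t_sum t_scale scale)
   also have "... = fscale (t ^ N) (\<rho> (tau s) (\<rho> (tau t) v))"
    using ct[OF t] s t v by (simp add: \<rho>_S t_scale flip: ct[OF t])
   also have "\<rho> (tau s) (\<rho> (tau t) v) = \<rho> (tau (s * t)) v" using \<rho>_mult[of "tau s" "tau t" v] s t v st by simp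
   also have "fscale (t ^ N) (\<rho> (tau (s * t)) v) = fscale (inverse s ^ N) (fscale ((s * t) ^ N) (\<rho> (tau (s * t)) v))"
    using s by (simp add: power_mult_distrib field_simps)
   also have "... = fscale (inverse s ^ N) (\<Sum>n\<le>K. fscale ((s * t) ^ n) (c n))"
    using ct[of "s * t"] s t by simp
   also have "... = (\<Sum>n\<le>K. fscale (t ^ n) (fscale (s powi (int n - int N)) (c n)))"
    using s by (simp add: fscale_sum power_mult_distrib power_int_diff field_simps)
   finally show "(\<Sum>n\<le>K. fscale (t ^ n) (\<rho> (tau s) (c n))) = (\<Sum>n\<le>K. fscale (t ^ n) (fscale (s powi (int n - int N)) (c n)))" .
  qed
  then show ?thesis using True c(1) by (simp add: wtsp_def d_def)
 qed (simp add: d_def wtsp_def S_zero t_0)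
 moreover have "v = (\<Sum>n\<le>K. d n)"
 proof -
  have "tau 1 = (1\<^sub>m 2 :: 'k mat)" by (simp add: tau_def one_mat2)
  then have "v = (\<Sum>n\<le>K. c n)" using ct[of 1] \<rho>_one[OF v] by simp
  then show ?thesis by (simp add: d_def)
 qed
 ultimately show ?thesis by blast
qed

end

text \<open>Such a function lives on \<open>G / B\<close>, the projective line. \<open>P\<close> and
  \<open>Q\<close> are its expressions in the two affine charts, and \<open>P(s) = Q(1 / s)\<close>
  forces both to be constant.\<close>

lemma reg_constant:
 fixes r :: "'k::alg_closed_field mat => 'k"
 assumes r: "r \<in> regular_functions"
  and u: "\<And>g u. g \<in> SL2 ==> r (g * upsilon u) = r g"
  and t: "\<And>g t. g \<in> SL2 ==> t \<noteq> 0 ==> r (g * tau t) = r g"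
  and g: "g \<in> SL2"
 shows "r g = r (1\<^sub>m 2)"
proof -
 obtain P where P: "\<And>s. r (mat2 1 0 s 1) = poly P s"
  using reg_poly[OF r, of 1 0 "[:0, 1:]" 1] by auto
 obtain Q where Q: "\<And>s. r (mat2 s (- 1) 1 0) = poly Q s"
  using reg_poly[OF r, of "[:0, 1:]" "- 1" 1 0] by auto
 have PQ: "poly P s = poly Q (inverse s)" if "s \<noteq> 0" for s
 proof -
  let ?g = "mat2 (inverse s) (- 1) 1 0"
  have "?g \<in> SL2" by simp
  then have "r (?g * tau s * upsilon (inverse s)) = r ?g"
   using u[of "?g * tau s"] t[of ?g s] that SL2_mult[of ?g "tau s"] by simp
  moreover have "?g * tau s * upsilon (inverse s) = mat2 1 0 s 1" using that by (simp add: tau_def upsilon_def)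
  ultimately show ?thesis using P Q by simp
 qed
 \<comment> \<open>The reversed polynomial has degree at most \<open>degree Q\<close>, whereas the
   left side has degree \<open>degree Q + degree P\<close> unless \<open>P = 0\<close>.\<close>
 have "Polynomial.monom 1 (degree Q) * P = reflect_poly Q"
 proof -
  have "Polynomial.monom 1 (degree Q) * P - reflect_poly Q = 0"
   by (rule poly_zeroI) (simp add: poly_monom poly_reflect_poly_nz PQ)
  then show ?thesis by simp
 qed
 then have "degree P = 0"
  using degree_reflect_poly_le[of Q] by (cases "P = 0") (auto simp: degree_mult_eq degree_monom_eq monom_eq_0_iff dest!: arg_cong[of _ _ degree])
 then obtain k where k: "P = [:k:]" by (auto elim: degree_eq_zeroE)
 have "Q - [:k:] = 0"
  by (rule poly_zeroI) (use PQ[of "inverse _"] k in auto)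
 then have Qk: "Q = [:k:]" by simp
 obtain a b c d where abcd: "g = mat2 a b c d" "a * d - b * c = 1" using g by (rule SL2_cases)
 have "r g = k"
 proof (cases "a = 0")
  case False
  let ?g = "mat2 1 0 (c / a) 1"
  have "?g \<in> SL2" by simp
  then have "r (?g * tau a * upsilon (b / a)) = r ?g"
   using u[of "?g * tau a"] t[of ?g a] False SL2_mult[of ?g "tau a"] by simp
  moreover have "?g * tau a * upsilon (b / a) = g" using False abcd by (simp add: tau_def upsilon_def field_simps)
  ultimately show ?thesis using P k by simp
 next
  case True
  then have c: "c \<noteq> 0" using abcd by auto
  let ?g = "mat2 (a / c) (- 1) 1 0"
  have "?g \<in> SL2" by simp
  then have "r (?g * tau c * upsilon (d / c)) = r ?g"
   using u[of "?g * tau c"] t[of ?g c] c SL2_mult[of ?g "tau c"] by simp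
  moreover have "?g * tau c * upsilon (d / c) = g" using c abcd by (simp add: tau_def upsilon_def field_simps)
  ultimately show ?thesis using Q Qk by simp
 qed
 moreover have "r (1\<^sub>m 2) = k" using P[of 0] k by (simp add: one_mat2)
 ultimately show ?thesis by simp
qed

text \<open>Every coordinate of \<open>\<rho> g v\<close> is a regular function of \<open>g\<close>
  invariant under right translation by \<open>B\<close>, hence constant.\<close>

lemma (in gmod) invariant:
 assumes v: "v \<in> S" and u: "\<And>u. \<rho> (upsilon u) v = v" and t: "\<And>t. t \<noteq> 0 ==> \<rho> (tau t) v = v" and g: "g \<in> SL2"
 shows "\<rho> g v = v"
proof
 fix i
 obtain N :: nat and r a where ra: "\<forall>l<N. r l \<in> regular_functions \<and> a l \<in> S"
  "\<forall>g\<in>SL2. \<rho> g v = (\<Sum>l<N. fscale (r l g) (a l))" using \<rho>_rational[OF v] by blast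
 define s where "s g = (\<Sum>l<N. r l g * a l i)" for g
 have s: "\<rho> g v i = s g" if "g \<in> SL2" for g using ra(2) that by (simp add: s_def sum_fun_apply)
 have sr: "s \<in> regular_functions"
  unfolding s_def using ra(1) by (intro reg_sum regular_functions.mult) (auto intro: regular_functions.const)
 have "s g = s (1\<^sub>m 2)"
 proof (rule reg_constant[OF sr _ _ g])
  show "s (g * upsilon w) = s g" if "g \<in> SL2" for g w
   using s[OF that] s[OF SL2_mult[OF that upsilon_SL2]] \<rho>_mult[OF that upsilon_SL2 v] u by simp
  show "s (g * tau w) = s g" if "g \<in> SL2" "w \<noteq> 0" for g w
   using s[OF that(1)] s[OF SL2_mult[OF that(1) tau_SL2[OF that(2)]]] \<rho>_mult[OF that(1) tau_SL2[OF that(2)] v] t that by simp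
 qed
 then show "\<rho> g v i = v i" using s[OF g] s[of "1\<^sub>m 2"] \<rho>_one[OF v] by (simp add: one_mat2)
qed

section \<open>Digits in base p\<close>

definition dg :: "nat => nat => nat => nat" where
 "dg p n i = n div p ^ i mod p"

lemma dg_Suc: "dg p n (Suc i) = dg p (n div p) i"
 by (simp add: dg_def div_mult2_eq)

lemma dg_facts:
 assumes "p \<ge> 2"
 shows "fin_supp (dg p n) \<and> num p (dg p n) = n"
proof (induction n rule: less_induct)
 case (less n)
 show ?case
 proof (cases "n = 0")
  case True
  then show ?thesis by (simp add: fin_supp_def num_def dg_def)
 next
  case False
  then have IH: "fin_supp (dg p (n div p))" "num p (dg p (n div p)) = n div p"
   using less[of "n div p"] assms by auto
  have e: "(\<lambda>i. dg p n (Suc i)) = dg p (n div p)" by (simp add: dg_Suc fun_eq_iff)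
  have "fin_supp (dg p n)" using sum_shift(1)[of "dg p n" "\<lambda>i c. 0"] IH e by simp
  moreover have "num p (dg p n) = n mod p + p * (n div p)"
   using num_shift[of "dg p n" p] IH e by (simp add: dg_def)
  ultimately show ?thesis by simp
 qed
qed

lemma fin_supp_shift: "fin_supp s ==> fin_supp (\<lambda>i. s (Suc i))"
 using finite_vimageI[of "{i. s i > 0}" Suc] by (simp add: fin_supp_def vimage_def)

lemma dg_num:
 assumes "\<And>i. s i < p" "fin_supp s"
 shows "dg p (num p s) i = s i"
 using assms
proof (induction i arbitrary: s)
 case 0
 then show ?case using num_shift[OF fin_supp_shift[OF 0(2)], of p] by (simp add: dg_def)
next
 case (Suc i)
 have "num p s div p = num p (\<lambda>i. s (Suc i))"
  using num_shift[OF fin_supp_shift[OF Suc(3)], of p] Suc.prems(1)[of 0] by simp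
 then show ?case using Suc.IH[of "\<lambda>i. s (Suc i)"] Suc.prems fin_supp_shift by (simp add: dg_Suc)
qed

text \<open>With \<open>choose_prime_power_div\<close> this turns binomial coefficients over
  \<open>p ^ i\<close> into digits.\<close>

lemma num_div_pow:
 assumes "\<And>i. s i < p" "fin_supp s" "CHAR('k::semiring_1) = p"
 shows "(of_nat (num p s div p ^ i) :: 'k) = of_nat (s i)"
proof -
 have "(of_nat (num p s div p ^ i) :: 'k) = of_nat (num p s div p ^ i mod p + p * (num p s div p ^ i div p))"
  by simp
 also have "... = of_nat (num p s div p ^ i mod p)"
  using assms(3) by (simp only: of_nat_add of_nat_mult) (metis add.right_neutral mult_zero_left of_nat_CHAR)
 finally show ?thesis using dg_num[OF assms(1,2), of i] by (simp add: dg_def)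
qed

lemma sum_concat:
 "(\<Sum>l<N + M. if l < N then f l else g (l - N)) = (\<Sum>l<N. f l) + (\<Sum>l<M. g l)"
 for N M :: nat and f g :: "nat => 'a::comm_monoid_add"
proof -
 have "(\<Sum>l<N + M. if l < N then f l else g (l - N)) =
  (\<Sum>l<N. if l < N then f l else g (l - N)) + (\<Sum>l=N..<N + M. if l < N then f l else g (l - N))"
  unfolding lessThan_atLeast0 by (rule sum.atLeastLessThan_concat[symmetric]) auto
 also have "(\<Sum>l=N..<N + M. if l < N then f l else g (l - N)) = (\<Sum>l<M. g l)"
  by (rule sum.reindex_bij_witness[of _ "\<lambda>l. l + N" "\<lambda>l. l - N"]) auto
 finally show ?thesis by simp
qed

subsection \<open>Regular maps into a vector space\<close>

definition rtrans :: "'k::field mat => ('k mat \<times> 'i => 'k) => 'k mat \<times> 'i => 'k" where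
 "rtrans h f = (\<lambda>(g, i). if g \<in> SL2 then f (g * h, i) else 0)"

definition mulf :: "('k::field mat => 'k) => ('k mat \<times> 'i => 'k) => 'k mat \<times> 'i => 'k" where
 "mulf r f = (\<lambda>(g, i). r g * f (g, i))"

definition pure_fn :: "('k::field mat => 'k) => ('i => 'k) => 'k mat \<times> 'i => 'k" where
 "pure_fn r w = (\<lambda>(g, i). if g \<in> SL2 then r g * w i else 0)"

text \<open>\<open>W \<otimes> k[G]\<close> as functions of a group element and a coordinate, put to
  0 off \<open>SL2\<close>. The group acts by right translation only, not on
  \<open>W\<close>.\<close>

definition reg_maps :: "('i => 'k::field) set => ('k mat \<times> 'i => 'k) set" where
 "reg_maps W = {f. \<exists>(N::nat) r w. (\<forall>l<N. r l \<in> regular_functions \<and> w l \<in> W) \<and> f = (\<Sum>l<N. pure_fn (r l) (w l))}"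

lemma reg_maps_zero: "0 \<in> reg_maps W"
 unfolding reg_maps_def by (intro CollectI exI[of _ "0::nat"]) simp

lemma reg_maps_step:
 assumes "f \<in> reg_maps W" "s \<in> regular_functions" "v \<in> W"
 shows "f + pure_fn s v \<in> reg_maps W"
proof -
 obtain N :: nat and r w where "\<forall>l<N. r l \<in> regular_functions \<and> w l \<in> W" "f = (\<Sum>l<N. pure_fn (r l) (w l))"
  using assms(1) by (auto simp: reg_maps_def)
 then have "\<forall>l<Suc N. (r(N := s)) l \<in> regular_functions \<and> (w(N := v)) l \<in> W"
  "f + pure_fn s v = (\<Sum>l<Suc N. pure_fn ((r(N := s)) l) ((w(N := v)) l))"
  using assms by (auto simp: less_Suc_eq intro!: sum.cong)
 then show ?thesis unfolding reg_maps_def by blast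
qed

lemma reg_maps_induct [consumes 1, case_names zero step]:
 assumes "f \<in> reg_maps W" "P 0"
  and step: "\<And>f r w. f \<in> reg_maps W ==> r \<in> regular_functions ==> w \<in> W ==> P f ==> P (f + pure_fn r w)"
 shows "P f"
proof -
 obtain N :: nat and r w where rw: "\<forall>l<N. r l \<in> regular_functions \<and> w l \<in> W" "f = (\<Sum>l<N. pure_fn (r l) (w l))"
  using assms(1) by (auto simp: reg_maps_def)
 have "(\<Sum>l<n. pure_fn (r l) (w l)) \<in> reg_maps W \<and> P (\<Sum>l<n. pure_fn (r l) (w l))" if "n \<le> N" for n
  using that
 proof (induction n)
  case (Suc n)
  then have "(\<Sum>l<n. pure_fn (r l) (w l)) \<in> reg_maps W" "P (\<Sum>l<n. pure_fn (r l) (w l))" "n < N" by auto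
  then show ?case unfolding sum.lessThan_Suc using rw(1) by (intro conjI reg_maps_step step) auto
 next
  case 0
  then show ?case using reg_maps_zero assms(2) by (simp only: lessThan_0 sum.empty) blast
 qed
 then show ?thesis using rw(2) by blast
qed

lemma rtrans_simps [simp]:
 "rtrans h 0 = 0" "rtrans h (f + f') = rtrans h f + rtrans h f'" "rtrans h (fscale c f) = fscale c (rtrans h f)"
 by (auto simp: rtrans_def fun_eq_iff)

lemma rtrans_0 [simp]: "rtrans h (\<lambda>a. 0) = (\<lambda>a. 0)"
 by (auto simp: rtrans_def)

lemma mulf_simps [simp]:
 "mulf r 0 = 0" "mulf r (f + f') = mulf r f + mulf r f'" "mulf r (fscale c f) = fscale c (mulf r f)"
 "mulf r (mulf s f) = mulf (\<lambda>g. r g * s g) f" "mulf (\<lambda>g. 1) f = f"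
 by (auto simp: mulf_def fun_eq_iff algebra_simps)

lemma mulf_const: "mulf (\<lambda>g. c) f = fscale c f"
 by (auto simp: mulf_def fun_eq_iff)

lemma mulf_pure: "mulf r (pure_fn s w) = pure_fn (\<lambda>g. r g * s g) w"
 by (auto simp: mulf_def pure_fn_def fun_eq_iff)

lemma rtrans_comp:
 assumes "g \<in> SL2" "h \<in> SL2"
 shows "rtrans g (rtrans h f) = rtrans (g * h) f"
proof -
 have "x * g * h = x * (g * h)" if "x \<in> SL2" for x
  using that assms by (auto simp: SL2_def intro!: assoc_mult_mat)
 then show ?thesis using SL2_mult[OF _ assms(1)] by (auto simp: rtrans_def fun_eq_iff)
qed

lemma rtrans_one: "(\<And>g i. g \<notin> SL2 ==> f (g, i) = 0) ==> rtrans (1\<^sub>m 2) f = f"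
 by (auto simp: rtrans_def fun_eq_iff SL2_def)

lemma reg_maps_add:
 assumes f: "f \<in> reg_maps W" and "f' \<in> reg_maps W"
 shows "f + f' \<in> reg_maps W"
 using assms(2)
proof (induction f' rule: reg_maps_induct)
 case (step f' r w)
 have "(f + f') + pure_fn r w \<in> reg_maps W" by (rule reg_maps_step[OF step.IH step.hyps(2,3)])
 then show ?case by (simp only: add.assoc)
qed (simp add: f)

lemma reg_maps_sum: "(\<And>a. a \<in> A ==> f a \<in> reg_maps W) ==> sum f A \<in> reg_maps W"
 by (induction A rule: infinite_finite_induct) (auto intro: reg_maps_add reg_maps_zero)

lemma reg_maps_pure: "r \<in> regular_functions ==> w \<in> W ==> pure_fn r w \<in> reg_maps W"
 using reg_maps_step[OF reg_maps_zero, of r w W] by simp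

lemma reg_maps_mulf: "f \<in> reg_maps W ==> s \<in> regular_functions ==> mulf s f \<in> reg_maps W"
proof (induction f rule: reg_maps_induct)
 case (step f r w)
 then have "mulf s f + pure_fn (\<lambda>g. s g * r g) w \<in> reg_maps W" by (intro reg_maps_step regular_functions.mult) auto
 then show ?case by (simp only: mulf_simps mulf_pure)
next
 case zero
 show ?case by (simp only: mulf_simps reg_maps_zero)
qed

lemma reg_maps_off: "f \<in> reg_maps W ==> g \<notin> SL2 ==> f (g, i) = 0"
 by (induction f rule: reg_maps_induct) (auto simp: pure_fn_def)

lemma reg_maps_scale: "f \<in> reg_maps W ==> fscale c f \<in> reg_maps W"
 using reg_maps_mulf[of f W "\<lambda>g. c"] regular_functions.const by (auto simp: mulf_const)

text \<open>The comultiplication is applied to the scalar factor of each pure tensor.\<close>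

lemma reg_maps_rational:
 assumes "f \<in> reg_maps W"
 shows "\<exists>(N::nat) r a. (\<forall>l<N. r l \<in> regular_functions \<and> a l \<in> reg_maps W) \<and>
   (\<forall>g\<in>SL2. rtrans g f = (\<Sum>l<N. fscale (r l g) (a l)))"
 using assms
proof (induction f rule: reg_maps_induct)
 case zero
 show ?case by (intro exI[of _ "0::nat"]) simp
next
 case (step f s w)
 obtain N :: nat and r a where ra: "\<forall>l<N. r l \<in> regular_functions \<and> a l \<in> reg_maps W"
  "\<forall>g\<in>SL2. rtrans g f = (\<Sum>l<N. fscale (r l g) (a l))" using step.IH by blast
 obtain M :: nat and x y where xy: "\<forall>l. x l \<in> regular_functions \<and> y l \<in> regular_functions"
  "\<forall>g\<in>carrier_mat 2 2. \<forall>k\<in>carrier_mat 2 2. s (g * k) = (\<Sum>l<M. x l g * y l k)"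
  using reg_comult[OF step.hyps(2)] by blast
 have p: "rtrans h (pure_fn s w) = (\<Sum>l<M. fscale (y l h) (pure_fn (x l) w))" if h: "h \<in> SL2" for h
 proof -
  have "s (g * h) = (\<Sum>l<M. x l g * y l h)" if "g \<in> SL2" for g
   using xy(2) that h by (auto simp: SL2_def)
  then show ?thesis using SL2_mult[OF _ h]
   by (auto simp: fun_eq_iff sum_fun_apply rtrans_def pure_fn_def sum_distrib_right sum_distrib_left mult_ac)
 qed
 let ?r = "\<lambda>l. if l < N then r l else y (l - N)" and ?a = "\<lambda>l. if l < N then a l else pure_fn (x (l - N)) w"
 have "rtrans g (f + pure_fn s w) = (\<Sum>l<N + M. fscale (?r l g) (?a l))" if g: "g \<in> SL2" for g
 proof -
  have "(\<Sum>l<N + M. fscale (?r l g) (?a l)) =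
    (\<Sum>l<N + M. if l < N then fscale (r l g) (a l) else fscale (y (l - N) g) (pure_fn (x (l - N)) w))"
   by (intro sum.cong) auto
  also have "... = (\<Sum>l<N. fscale (r l g) (a l)) + (\<Sum>l<M. fscale (y l g) (pure_fn (x l) w))"
   by (rule sum_concat)
  finally show ?thesis using p[OF g] ra(2) g by simp
 qed
 moreover have "?r l \<in> regular_functions \<and> ?a l \<in> reg_maps W" if "l < N + M" for l
  using ra(1) xy(1) step.hyps(3) by (auto intro!: reg_maps_pure)
 ultimately show ?case by (intro exI[of _ "N + M"] exI[of _ ?r] exI[of _ ?a]) blast
qed

lemma gmod_reg_maps: "gmod (reg_maps W) rtrans" for W :: "('i => 'k::alg_closed_field) set"
proof
 show "rtrans g v \<in> reg_maps W" if g: "g \<in> SL2" and v: "v \<in> reg_maps W" for g v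
 proof -
  obtain N :: nat and r a where ra: "\<forall>l<N. r l \<in> regular_functions \<and> a l \<in> reg_maps W"
   "\<forall>g\<in>SL2. rtrans g v = (\<Sum>l<N. fscale (r l g) (a l))" using reg_maps_rational[OF v] by blast
  then show ?thesis using g by (auto intro!: reg_maps_sum reg_maps_scale)
 qed
 show "rtrans (1\<^sub>m 2) v = v" if "v \<in> reg_maps W" for v
  using that by (intro rtrans_one reg_maps_off)
 show "rtrans (g * h) v = rtrans g (rtrans h v)" if "g \<in> SL2" "h \<in> SL2" for g h v
  by (rule rtrans_comp[OF that, symmetric])
qed (auto simp: reg_maps_zero reg_maps_add reg_maps_scale reg_maps_rational)

subsection \<open>Localizations of the coordinate ring\<close>

text \<open>\<open>W\<close>-valued functions on the open set \<open>q \<noteq> 0\<close>, with a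
  power of \<open>q\<close> as denominator and extended by 0.\<close>

definition loc :: "('k::field mat => 'k) => ('i => 'k) set => ('k mat \<times> 'i => 'k) set" where
 "loc q W = {f. (\<forall>g i. g \<notin> SL2 \<or> q g = 0 \<longrightarrow> f (g, i) = 0) \<and> (\<exists>n. mulf (\<lambda>g. q g ^ n) f \<in> reg_maps W)}"

text \<open>\<open>q\<close> is invariant under \<open>U\<close> and of weight \<open>k\<close>, so
  denominators pass through expansions in \<open>u\<close> and through the torus action.\<close>

locale loc_setup =
 fixes p :: nat and W :: "('i => 'k::alg_closed_field) set" and q :: "'k mat => 'k" and k :: nat
 assumes char: "CHAR('k) = p" and prime: "prime p"
  and q_reg: "q \<in> regular_functions" and q_u: "g \<in> SL2 ==> q (g * upsilon u) = q g"
  and q_t: "g \<in> SL2 ==> t \<noteq> 0 ==> q (g * tau t) = t ^ k * q g"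
begin

lemma loc_off: "f \<in> loc q W ==> g \<notin> SL2 \<or> q g = 0 ==> f (g, i) = 0"
 unfolding loc_def by blast

lemma loc_pow:
 assumes "f \<in> loc q W"
 shows "\<exists>n0. \<forall>n\<ge>n0. mulf (\<lambda>g. q g ^ n) f \<in> reg_maps W"
proof -
 obtain n0 where n0: "mulf (\<lambda>g. q g ^ n0) f \<in> reg_maps W" using assms by (auto simp: loc_def)
 have "mulf (\<lambda>g. q g ^ n) f \<in> reg_maps W" if "n \<ge> n0" for n
 proof -
  have "mulf (\<lambda>g. q g ^ (n - n0)) (mulf (\<lambda>g. q g ^ n0) f) \<in> reg_maps W"
   by (intro reg_maps_mulf n0 reg_power q_reg)
  then show ?thesis using that by (simp flip: power_add)
 qed
 then show ?thesis by blast
qed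

lemma loc_zero: "0 \<in> loc q W"
 by (auto simp: loc_def reg_maps_zero)

lemma loc_add:
 assumes "f \<in> loc q W" "f' \<in> loc q W"
 shows "f + f' \<in> loc q W"
proof -
 obtain n m where "\<forall>l\<ge>n. mulf (\<lambda>g. q g ^ l) f \<in> reg_maps W" "\<forall>l\<ge>m. mulf (\<lambda>g. q g ^ l) f' \<in> reg_maps W"
  using loc_pow assms by meson
 then have "mulf (\<lambda>g. q g ^ (n + m)) (f + f') \<in> reg_maps W" by (auto intro!: reg_maps_add)
 moreover have "(f + f') (g, i) = 0" if "g \<notin> SL2 \<or> q g = 0" for g i
  using loc_off[OF assms(1) that] loc_off[OF assms(2) that] by simp
 ultimately show ?thesis unfolding loc_def by blast
qed

lemma loc_mulf:
 assumes "f \<in> loc q W" "r \<in> regular_functions"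
 shows "mulf r f \<in> loc q W"
proof -
 obtain n where "mulf (\<lambda>g. q g ^ n) f \<in> reg_maps W" using assms by (auto simp: loc_def)
 then have "mulf r (mulf (\<lambda>g. q g ^ n) f) \<in> reg_maps W" by (rule reg_maps_mulf[OF _ assms(2)])
 then have "mulf (\<lambda>g. q g ^ n) (mulf r f) \<in> reg_maps W" by (simp add: mult.commute)
 moreover have "(mulf r f) (g, i) = 0" if "g \<notin> SL2 \<or> q g = 0" for g i
  using loc_off[OF assms(1) that] by (simp add: mulf_def)
 ultimately show ?thesis unfolding loc_def by blast
qed

lemma loc_scale: "f \<in> loc q W ==> fscale c f \<in> loc q W"
 using loc_mulf[of f "\<lambda>g. c"] regular_functions.const by (auto simp: mulf_const)

lemma loc_t:
 assumes f: "f \<in> loc q W" and t: "t \<noteq> 0"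
 shows "rtrans (tau t) f \<in> loc q W"
proof -
 obtain n where n: "mulf (\<lambda>g. q g ^ n) f \<in> reg_maps W" using f by (auto simp: loc_def)
 interpret R: gmod "reg_maps W" rtrans by (rule gmod_reg_maps)
 have "mulf (\<lambda>g. q g ^ n) (rtrans (tau t) f) = fscale (inverse (t ^ k) ^ n) (rtrans (tau t) (mulf (\<lambda>g. q g ^ n) f))"
  using t by (auto simp: fun_eq_iff mulf_def rtrans_def q_t power_mult_distrib field_simps)
 moreover have "fscale (inverse (t ^ k) ^ n) (rtrans (tau t) (mulf (\<lambda>g. q g ^ n) f)) \<in> reg_maps W"
  using n t by (intro reg_maps_scale R.t_S) auto
 ultimately have "mulf (\<lambda>g. q g ^ n) (rtrans (tau t) f) \<in> reg_maps W" by (simp only:)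
 moreover have "rtrans (tau t) f (g, i) = 0" if "g \<notin> SL2 \<or> q g = 0" for g i
  using that loc_off[OF f] q_t[of g t] t by (auto simp: rtrans_def)
 ultimately show ?thesis unfolding loc_def by blast
qed

lemma loc_exp:
 assumes f: "f \<in> loc q W"
 shows "\<exists>N c. (\<forall>n. c n \<in> loc q W) \<and> vexpansion (\<lambda>u. rtrans (upsilon u) f) N c"
proof -
 obtain n where n: "mulf (\<lambda>g. q g ^ n) f \<in> reg_maps W" using f by (auto simp: loc_def)
 interpret R: gmod "reg_maps W" rtrans by (rule gmod_reg_maps)
 obtain N c where c: "\<forall>j. c j \<in> reg_maps W" and ex: "vexpansion (\<lambda>u. rtrans (upsilon u) (mulf (\<lambda>g. q g ^ n) f)) N c"
  using R.u_exp[OF n] by blast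
 define d where "d j = mulf (\<lambda>g. if q g = 0 then 0 else inverse (q g ^ n)) (c j)" for j
 have "d j \<in> loc q W" for j
 proof -
  \<comment> \<open>One factor \<open>q\<close> more than \<open>f\<close> needs: it makes both
    sides vanish on \<open>q = 0\<close>, where \<open>c j\<close> need not vanish.\<close>
  have "mulf (\<lambda>g. q g ^ (n + 1)) (d j) = mulf q (c j)"
   by (auto simp: d_def mulf_def fun_eq_iff)
  also have "... \<in> reg_maps W" using c q_reg by (intro reg_maps_mulf) auto
  finally have "mulf (\<lambda>g. q g ^ (n + 1)) (d j) \<in> reg_maps W" .
  moreover have "d j (g, i) = 0" if "g \<notin> SL2 \<or> q g = 0" for g i
   using reg_maps_off[of "c j" W] c that by (auto simp: d_def mulf_def)
  ultimately show ?thesis unfolding loc_def by blast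
 qed
 moreover have "vexpansion (\<lambda>u. rtrans (upsilon u) f) N d"
  unfolding vexpansion_def
 proof (intro conjI allI impI)
  fix j assume "j > N"
  then show "d j = 0" using ex by (simp add: vexpansion_def d_def)
 next
  fix u
  show "rtrans (upsilon u) f = (\<Sum>n\<le>N. fscale (u ^ n) (d n))"
  proof
  fix x :: "'k mat \<times> 'i"
  obtain g i where x: "x = (g, i)" by (cases x)
  show "rtrans (upsilon u) f x = (\<Sum>n\<le>N. fscale (u ^ n) (d n)) x"
  proof (cases "g \<in> SL2 \<and> q g \<noteq> 0")
   case True
   have "q g ^ n * f (g * upsilon u, i) = rtrans (upsilon u) (mulf (\<lambda>g. q g ^ n) f) (g, i)"
    using True by (simp add: rtrans_def mulf_def q_u)
   also have "... = (\<Sum>j\<le>N. u ^ j * c j (g, i))"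
    using ex by (simp add: vexpansion_def sum_fun_apply)
   finally have "f (g * upsilon u, i) = inverse (q g ^ n) * (\<Sum>j\<le>N. u ^ j * c j (g, i))"
    using True by (simp add: field_simps)
   then show ?thesis using True
    by (simp add: x rtrans_def d_def mulf_def sum_fun_apply sum_distrib_left mult_ac)
  next
   case False
   then have "rtrans (upsilon u) f (g, i) = 0" using loc_off[OF f] q_u by (auto simp: rtrans_def)
   moreover have "d j (g, i) = 0" for j using False loc_off[OF \<open>d j \<in> loc q W\<close>] by blast
   ultimately show ?thesis by (simp add: x sum_fun_apply)
  qed
  qed
 qed
 ultimately show ?thesis by blast
qed

sublocale bmod_char "loc q W" rtrans p
proof unfold_locales
 show "rtrans (upsilon 0) v = v" if "v \<in> loc q W" for v
  using rtrans_one[of v] loc_off[OF that] by (simp add: upsilon_def one_mat2)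
 show "rtrans (upsilon u) (rtrans (upsilon s) v) = rtrans (upsilon (u + s)) v" for u s :: 'k and v :: "'k mat \<times> 'i => 'k"
  by (simp add: rtrans_comp) (simp add: upsilon_def add.commute)
 show "rtrans (tau t) (rtrans (upsilon u) v) = rtrans (upsilon (t\<^sup>2 * u)) (rtrans (tau t) v)" if "t \<noteq> 0"
  for t u :: 'k and v :: "'k mat \<times> 'i => 'k"
  using that by (simp add: rtrans_comp) (simp add: upsilon_def tau_def power2_eq_square field_simps)
qed (auto simp: loc_zero loc_add loc_scale loc_t loc_exp char prime)

end

lemma SL2_assoc: "a \<in> SL2 ==> b \<in> SL2 ==> c \<in> SL2 ==> a * b * c = a * (b * c)"
 by (auto simp: SL2_def intro!: assoc_mult_mat)

text \<open>The functions \<open>x ^ n\<close> with \<open>x (g * upsilon u) = x g + u\<close> form a basis of the localization over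
 its \<open>U\<close>-invariants.\<close>

locale free_setup = loc_setup p W q k for p and W :: "('i => 'k::alg_closed_field) set" and q k +
 fixes x y :: "'k mat => 'k"
 assumes p3: "p \<ge> 3" and y_reg: "y \<in> regular_functions"
  and qx: "g \<in> SL2 ==> q g \<noteq> 0 ==> q g * x g = y g"
  and x_u: "g \<in> SL2 ==> q g \<noteq> 0 ==> x (g * upsilon u) = x g + u"
  and x_t: "g \<in> SL2 ==> q g \<noteq> 0 ==> t \<noteq> 0 ==> x (g * tau t) = x g / t\<^sup>2"
begin

abbreviation "XP n f \<equiv> mulf (\<lambda>g. (- x g) ^ n) f"

lemma loc_x: "f \<in> loc q W ==> mulf (\<lambda>g. - x g) f \<in> loc q W"
proof -
 assume f: "f \<in> loc q W"
 obtain n where n: "mulf (\<lambda>g. q g ^ n) f \<in> reg_maps W" using f by (auto simp: loc_def)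
 have "mulf (\<lambda>g. - y g) (mulf (\<lambda>g. q g ^ n) f) \<in> reg_maps W"
  by (intro reg_maps_mulf n reg_uminus y_reg)
 moreover have "mulf (\<lambda>g. q g ^ Suc n) (mulf (\<lambda>g. - x g) f) = mulf (\<lambda>g. - y g) (mulf (\<lambda>g. q g ^ n) f)"
 proof (rule ext, clarify)
  fix g i
  show "mulf (\<lambda>g. q g ^ Suc n) (mulf (\<lambda>g. - x g) f) (g, i) = mulf (\<lambda>g. - y g) (mulf (\<lambda>g. q g ^ n) f) (g, i)"
  proof (cases "g \<in> SL2 \<and> q g \<noteq> 0")
   case True
   then have "y g = q g * x g" using qx by simp
   then show ?thesis by (simp add: mulf_def)
  next
   case False
   then have "f (g, i) = 0" using loc_off[OF f] by blast
   then show ?thesis by (simp add: mulf_def)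
  qed
 qed
 ultimately have "mulf (\<lambda>g. q g ^ Suc n) (mulf (\<lambda>g. - x g) f) \<in> reg_maps W" by (simp only:)
 moreover have "mulf (\<lambda>g. - x g) f (g, i) = 0" if "g \<notin> SL2 \<or> q g = 0" for g i
  using loc_off[OF f that] by (simp add: mulf_def)
 ultimately show ?thesis unfolding loc_def by blast
qed

lemma XP_S: "f \<in> loc q W ==> XP n f \<in> loc q W"
proof (induction n)
 case 0
 then show ?case by simp
next
 case (Suc n)
 then have "mulf (\<lambda>g. - x g) (XP n f) \<in> loc q W" by (intro loc_x) auto
 then show ?case by simp
qed

text \<open>Evaluation after moving \<open>g\<close> along its \<open>U\<close>-orbit to the slice
  \<open>x = 0\<close>; this projects onto the \<open>U\<close>-invariants.\<close>

definition P0 :: "('k mat \<times> 'i => 'k) => 'k mat \<times> 'i => 'k" where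
 "P0 h = (\<lambda>(g, i). if g \<in> SL2 \<and> q g \<noteq> 0 then h (g * upsilon (- x g), i) else 0)"

text \<open>This shows that \<open>P0\<close> preserves the localization: \<open>x\<close> is itself
  a fraction with denominator \<open>q\<close>.\<close>

lemma P0_sum:
 assumes h: "h \<in> loc q W" and N: "vexpansion (\<lambda>u. rtrans (upsilon u) h) N c" and cS: "\<And>n. c n \<in> loc q W"
 shows "P0 h = (\<Sum>n\<le>N. XP n (c n))"
proof (rule ext, clarify)
 fix g i
 show "P0 h (g, i) = (\<Sum>n\<le>N. XP n (c n)) (g, i)"
 proof (cases "g \<in> SL2 \<and> q g \<noteq> 0")
  case True
  then have "P0 h (g, i) = rtrans (upsilon (- x g)) h (g, i)" by (simp add: P0_def rtrans_def)
  also have "... = (\<Sum>n\<le>N. fscale ((- x g) ^ n) (c n)) (g, i)" using N by (simp add: vexpansion_def)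
  finally show ?thesis by (simp add: sum_fun_apply mulf_def)
 next
  case False
  then have "c n (g, i) = 0" for n using loc_off[OF cS] by blast
  moreover have "P0 h (g, i) = 0" using False by (auto simp: P0_def)
  ultimately show ?thesis by (simp add: sum_fun_apply mulf_def)
 qed
qed

lemma P0_S: "h \<in> loc q W ==> P0 h \<in> loc q W"
 using divpow_exp[of h] P0_sum[of h _ "\<lambda>n. divpow rtrans n h"] by (auto simp: divpow_S intro!: sum_S XP_S)

lemma P0_simps: "P0 (h + h') = P0 h + P0 h'" "P0 (fscale c h) = fscale c (P0 h)" "P0 0 = 0"
 by (auto simp: P0_def fun_eq_iff)

lemma ups_add: "g \<in> SL2 ==> g * upsilon u * upsilon w = g * upsilon (u + w)"
 by (simp add: SL2_assoc) (simp add: upsilon_def add.commute)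

lemma ups_0: "g \<in> SL2 ==> g * upsilon 0 = g"
 by (erule SL2_cases) (simp add: upsilon_def)

lemma P0_u: "rtrans (upsilon u) (P0 h) = P0 h"
 by (auto simp: fun_eq_iff rtrans_def P0_def q_u x_u ups_add SL2_mult)

lemma P0_t: "t \<noteq> 0 ==> rtrans (tau t) (P0 h) = P0 (rtrans (tau t) h)"
proof (rule ext, clarify)
 fix g i assume t: "t \<noteq> 0"
 show "rtrans (tau t) (P0 h) (g, i) = P0 (rtrans (tau t) h) (g, i)"
 proof (cases "g \<in> SL2 \<and> q g \<noteq> 0")
  case True
  have "tau t * upsilon (- (x g / t\<^sup>2)) = upsilon (- x g) * tau t"
   using t by (simp add: tau_def upsilon_def power2_eq_square field_simps)
  then have "g * tau t * upsilon (- (x g / t\<^sup>2)) = g * upsilon (- x g) * tau t"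
   using True t by (simp add: SL2_assoc)
  then show ?thesis using True t by (simp add: rtrans_def P0_def q_t x_t SL2_mult)
 qed (use t in \<open>auto simp: rtrans_def P0_def q_t\<close>)
qed

definition L0 :: "('k mat \<times> 'i => 'k) set" where
 "L0 = {f \<in> loc q W. \<forall>u. rtrans (upsilon u) f = f}"

abbreviation "VW \<nu> \<equiv> wtsp (loc q W) rtrans \<nu> \<inter> L0"
abbreviation "m0 \<equiv> \<lambda>i::nat. p - Suc 0"

sublocale dig: digit_setup p m0 L0 VW
proof
 show "CHAR('k) = p" "prime p" by (rule char, rule prime)
 show "p - Suc 0 < p" using p3 by simp
 show "0 \<in> L0" by (auto simp: L0_def loc_zero)
 show "v + w \<in> L0" if "v \<in> L0" "w \<in> L0" for v w using that by (auto simp: L0_def loc_add)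
 show s: "fscale c v \<in> L0" if "v \<in> L0" for v c using that by (auto simp: L0_def loc_scale)
 show "0 \<in> VW \<nu>" for \<nu> using Wt_0 \<open>0 \<in> L0\<close> by blast
 show "v + w \<in> VW \<nu>" if "v \<in> VW \<nu>" "w \<in> VW \<nu>" for v w \<nu>
  using that Wt_add \<open>\<And>v w. v \<in> L0 ==> w \<in> L0 ==> v + w \<in> L0\<close> by blast
 show "fscale c v \<in> VW \<nu>" if "v \<in> VW \<nu>" for v \<nu> c
  using that Wt_scale s by blast
qed

lemma P0_L0: "h \<in> loc q W ==> P0 h \<in> L0"
 by (simp add: L0_def P0_S P0_u)

lemma P0_VW: "h \<in> wtsp (loc q W) rtrans \<nu> ==> P0 h \<in> VW \<nu>"
 using P0_L0[of h] by (auto simp: wtsp_def P0_S P0_t P0_simps)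

text \<open>Taylor coefficients along the \<open>U\<close>-orbits, indexed by the digits of their
  order. The sign belongs to the powers of \<open>- x\<close> in \<open>XP\<close> and matches
  \<open>p - 1 - s i = - (s i + 1)\<close> modulo \<open>p\<close> in
  \<open>digit_e\<close>.\<close>

definition Phi :: "('k mat \<times> 'i => 'k) => (nat => nat) \<times> ('k mat \<times> 'i) => 'k" where
 "Phi f = (\<lambda>(s, j). if fin_supp s \<and> s \<le> m0 then (- 1) ^ num p s * P0 (divpow rtrans (num p s) f) j else 0)"

lemma slice_Phi: "slice (Phi f) s = (if fin_supp s \<and> s \<le> m0 then fscale ((- 1) ^ num p s) (P0 (divpow rtrans (num p s) f)) else 0)"
 by (auto simp: slice_def Phi_def)

lemma le_m0: "s \<le> m0 \<longleftrightarrow> (\<forall>i. s i < p)"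
 using p3 by (auto simp: le_fun_def less_Suc_eq_le[symmetric] Suc_diff_Suc)

lemma p_gt: "p \<ge> 2" "p > 0" using p3 by auto

lemma dg_le: "fin_supp (dg p n) \<and> dg p n \<le> m0"
 using dg_facts[OF p_gt(1)] p_gt by (simp add: le_m0 dg_def)

lemma Phi_space: "f \<in> loc q W ==> Phi f \<in> digit_space m0 L0"
proof -
 assume f: "f \<in> loc q W"
 obtain N where N: "vexpansion (\<lambda>u. rtrans (upsilon u) f) N (\<lambda>n. divpow rtrans n f)" using divpow_exp[OF f] by blast
 show ?thesis
 proof (rule dig.S_I[of "dg p ` {..N}"])
  show "slice (Phi f) s \<in> L0" for s
   using f dig.V_0 by (auto simp: slice_Phi intro!: dig.V_scale P0_L0 divpow_S)
  fix s assume nz: "slice (Phi f) s \<noteq> 0"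
  then have s: "fin_supp s" "s \<le> m0" "divpow rtrans (num p s) f \<noteq> 0"
   by (auto simp: slice_Phi P0_simps split: if_splits)
  then have "num p s \<le> N" using N by (auto simp: vexpansion_def not_less[symmetric])
  moreover have "s = dg p (num p s)" using dg_num[of s p] s by (auto simp: fun_eq_iff le_m0)
  ultimately show "s \<in> dg p ` {..N} \<and> fin_supp s \<and> s \<le> m0" using s by auto
 qed simp
qed

lemma neg_odd: "odd n ==> (- 1 :: 'k) ^ (m + n) = - ((- 1) ^ m)"
 by (simp add: power_add)

lemma p_odd: "odd (p ^ i)"
 using prime p3 by (simp add: prime_odd_nat)

lemma num_choose:
 assumes "fin_supp s" "s \<le> m0"
 shows "(of_nat (num p s choose p ^ i) :: 'k) = of_nat (s i)"
  and "(of_nat ((num p s + p ^ i) choose p ^ i) :: 'k) = of_nat (s i) + 1"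
proof -
 have s: "\<And>i. s i < p" using assms by (simp add: le_m0)
 show "(of_nat (num p s choose p ^ i) :: 'k) = of_nat (s i)"
  using choose_prime_power_div[OF char prime, of "num p s" i] num_div_pow[where 'k='k, OF s assms(1) char, of i] by simp
 have "(num p s + p ^ i) div p ^ i = num p s div p ^ i + 1" using p3 by simp
 then show "(of_nat ((num p s + p ^ i) choose p ^ i) :: 'k) = of_nat (s i) + 1"
  using choose_prime_power_div[OF char prime, of "num p s + p ^ i" i] num_div_pow[where 'k='k, OF s assms(1) char, of i]
  by simp
qed

lemma of_p: "of_nat p = (0 :: 'k)" using of_nat_CHAR[where 'a = 'k] char by simp

text \<open>Both sides involve the order \<open>num p s + p ^ i\<close>. The binomial coefficient on
  the left is \<open>s i + 1\<close>; on the right \<open>p - 1 - s i = - (s i + 1)\<close> meets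
  the sign of the odd number \<open>p ^ i\<close>. At \<open>s i = p - 1\<close>, where a carry
  would occur, both factors are 0.\<close>

lemma Phi_e:
 assumes f: "f \<in> loc q W"
 shows "Phi (eop p rtrans i f) = digit_e m0 i (Phi f)"
proof (rule slice_ext)
 fix s
 let ?n = "num p s"
 show "slice (Phi (eop p rtrans i f)) s = slice (digit_e m0 i (Phi f)) s"
 proof (cases "fin_supp s \<and> s \<le> m0")
  case False
  then have "\<not> (fin_supp (inc i s) \<and> inc i s \<le> m0)" using dig.inc_le[of i s] by auto
  then show ?thesis using False by (auto simp: slice_Phi slice_e)
 next
  case True
  then have s: "\<And>i. s i < p" by (simp add: le_m0)
  have "divpow rtrans ?n (eop p rtrans i f) = fscale (of_nat ((?n + p ^ i) choose ?n)) (divpow rtrans (?n + p ^ i) f)"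
   unfolding eop_def by (rule divpow_comp[OF f])
  also have "(?n + p ^ i) choose ?n = (?n + p ^ i) choose p ^ i" using binomial_symmetric[of ?n "?n + p ^ i"] by simp
  also have "of_nat ((?n + p ^ i) choose p ^ i) = (of_nat (s i) + 1 :: 'k)" using True num_choose(2) by blast
  finally have 1: "slice (Phi (eop p rtrans i f)) s =
    fscale ((- 1) ^ ?n * (of_nat (s i) + 1)) (P0 (divpow rtrans (?n + p ^ i) f))"
   using True by (simp only: slice_Phi P0_simps fscale_simps if_True simp_thms)
  show ?thesis
  proof (cases "s i = p - 1")
   case True
   then have "(of_nat (s i) + 1 :: 'k) = of_nat p" using p3 by (simp add: of_nat_diff)
   then show ?thesis using 1 True of_p by (simp add: slice_e)
  next
   case False
   then have si: "s i < p - 1" using s[of i] by simp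
   have "inc i s \<le> m0" using dig.inc_le[of i s] si True by simp
   then have "slice (digit_e m0 i (Phi f)) s =
     fscale (of_nat (p - 1 - s i) * (- 1) ^ (?n + p ^ i)) (P0 (divpow rtrans (?n + p ^ i) f))"
    using True by (simp add: slice_e slice_Phi num_inc)
   moreover have "of_nat (p - 1 - s i) = (- (of_nat (s i) + 1) :: 'k)"
   proof -
    have "of_nat (p - 1 - s i) + (of_nat (s i) + 1 :: 'k) = of_nat (p - 1 - s i + (s i + 1))" by simp
    also have "p - 1 - s i + (s i + 1) = p" using si by simp
    finally show ?thesis by (simp only: eq_neg_iff_add_eq_0 of_p)
   qed
   ultimately show ?thesis using 1 by (simp only: neg_odd[OF p_odd] minus_mult_minus mult.commute)
  qed
 qed
qed

lemma Phi_Wt: "f \<in> wtsp (loc q W) rtrans \<mu> ==> Phi f \<in> digit_Wt p m0 L0 VW \<mu>"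
proof -
 assume f: "f \<in> wtsp (loc q W) rtrans \<mu>"
 have "slice (Phi f) s \<in> VW (\<mu> + 2 * int (num p s))" for s
 proof (cases "fin_supp s \<and> s \<le> m0")
  case True
  then show ?thesis using P0_VW[OF divpow_wt[OF f, of "num p s"]] dig.VW_scale by (simp only: slice_Phi if_True simp_thms)
 next
  case False
  then show ?thesis using dig.VW_0 by (simp only: slice_Phi if_False simp_thms)
 qed
 then show ?thesis using Phi_space f by (simp add: digit_Wt_def wtsp_def)
qed

definition Psi :: "((nat => nat) \<times> ('k mat \<times> 'i) => 'k) => 'k mat \<times> 'i => 'k" where
 "Psi c = (\<Sum>s | slice c s \<noteq> 0. XP (num p s) (slice c s))"

lemma Psi_eq:
 assumes "finite X" "{s. slice c s \<noteq> 0} \<subseteq> X"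
 shows "Psi c = (\<Sum>s\<in>X. XP (num p s) (slice c s))"
 unfolding Psi_def using assms by (intro sum.mono_neutral_left) auto

lemma Psi_S: "c \<in> digit_space m0 L0 ==> Psi c \<in> loc q W"
 unfolding Psi_def using dig.S_D(4)[of c] by (intro sum_S XP_S) (auto simp: L0_def)

text \<open>Taylor's formula from \<open>g * upsilon (- x g)\<close>, where \<open>x\<close>
  vanishes, back to \<open>g\<close>.\<close>

lemma Psi_Phi: "f \<in> loc q W ==> Psi (Phi f) = f"
proof -
 assume f: "f \<in> loc q W"
 obtain N where N: "vexpansion (\<lambda>u. rtrans (upsilon u) f) N (\<lambda>n. divpow rtrans n f)" using divpow_exp[OF f] by blast
 have "Psi (Phi f) = (\<Sum>s\<in>dg p ` {..N}. XP (num p s) (slice (Phi f) s))"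
 proof (rule Psi_eq)
  show "{s. slice (Phi f) s \<noteq> 0} \<subseteq> dg p ` {..N}"
  proof
   fix s assume "s \<in> {s. slice (Phi f) s \<noteq> 0}"
   then have s: "fin_supp s" "s \<le> m0" "divpow rtrans (num p s) f \<noteq> 0"
    by (auto simp: slice_Phi P0_simps split: if_splits)
   then have "num p s \<le> N" using N by (auto simp: vexpansion_def not_less[symmetric])
   moreover have "s = dg p (num p s)" using dg_num[of s p] s by (auto simp: fun_eq_iff le_m0)
   ultimately show "s \<in> dg p ` {..N}" by auto
  qed
 qed simp
 also have "... = (\<Sum>n\<le>N. XP (num p (dg p n)) (slice (Phi f) (dg p n)))"
  by (rule sum.reindex_cong[OF _ refl]) (auto intro!: inj_onI dest!: arg_cong[of _ _ "num p"] simp: dg_facts[OF p_gt(1)])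
 also have "... = (\<Sum>n\<le>N. mulf (\<lambda>g. x g ^ n) (P0 (divpow rtrans n f)))"
 proof (rule sum.cong[OF refl])
  fix n
  have "XP n (fscale ((- 1) ^ n) h) = mulf (\<lambda>g. x g ^ n) h" for h :: "'k mat \<times> 'i => 'k"
   by (simp add: fun_eq_iff mulf_def mult.assoc[symmetric] flip: power_mult_distrib)
  then show "XP (num p (dg p n)) (slice (Phi f) (dg p n)) = mulf (\<lambda>g. x g ^ n) (P0 (divpow rtrans n f))"
   using dg_le[of n] dg_facts[OF p_gt(1), of n] by (simp only: slice_Phi) simp
 qed
 also have "... = f"
 proof (rule ext, clarify)
  fix g i
  show "(\<Sum>n\<le>N. mulf (\<lambda>g. x g ^ n) (P0 (divpow rtrans n f))) (g, i) = f (g, i)"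
  proof (cases "g \<in> SL2 \<and> q g \<noteq> 0")
   case True
   let ?h = "g * upsilon (- x g)"
   have h: "?h \<in> SL2" using True by (simp add: SL2_mult)
   have "f (g, i) = rtrans (upsilon (x g)) f (?h, i)"
    using True h by (simp add: rtrans_def ups_add ups_0)
   also have "... = (\<Sum>n\<le>N. fscale (x g ^ n) (divpow rtrans n f)) (?h, i)" using N by (simp add: vexpansion_def)
   finally show ?thesis using True by (simp add: sum_fun_apply mulf_def P0_def)
  next
   case False
   then have "f (g, i) = 0" using loc_off[OF f] by blast
   moreover have "P0 h (g, i) = 0" for h using False by (auto simp: P0_def)
   ultimately show ?thesis by (simp add: sum_fun_apply mulf_def)
  qed
 qed
 finally show ?thesis .
qed

text \<open>\<open>upsilon u\<close> replaces \<open>- x\<close> by \<open>- x - u\<close> and fixes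
  \<open>v\<close>; the powers of \<open>u\<close> are read off from the binomial expansion.\<close>

lemma XP_divpow:
 assumes v: "v \<in> L0"
 shows "divpow rtrans j (XP n v) = (if j \<le> n then fscale ((- 1) ^ j * of_nat (n choose j)) (XP (n - j) v) else 0)"
proof -
 have E: "vexpansion (\<lambda>u. rtrans (upsilon u) (XP n v)) n (\<lambda>j. if j \<le> n then fscale ((- 1) ^ j * of_nat (n choose j)) (XP (n - j) v) else 0)"
 proof (rule vexpansion_cut, rule ext, clarify)
  fix u g i
  show "rtrans (upsilon u) (XP n v) (g, i) = (\<Sum>j\<le>n. fscale (u ^ j) (fscale ((- 1) ^ j * of_nat (n choose j)) (XP (n - j) v))) (g, i)"
  proof (cases "g \<in> SL2 \<and> q g \<noteq> 0")
   case True
   have "v (g * upsilon u, i) = rtrans (upsilon u) v (g, i)" using True by (simp add: rtrans_def)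
   also have "... = v (g, i)" using v by (simp add: L0_def)
   finally have vg: "v (g * upsilon u, i) = v (g, i)" .
   have "(- x g - u) ^ n = (- u + - x g) ^ n" by (simp only: add.commute[of "- u"] diff_conv_add_uminus)
   also have "... = (\<Sum>j\<le>n. of_nat (n choose j) * (- u) ^ j * (- x g) ^ (n - j))" by (rule binomial_ring)
   finally have "(- x g - u) ^ n * v (g, i) = (\<Sum>j\<le>n. u ^ j * ((- 1) ^ j * of_nat (n choose j) * ((- x g) ^ (n - j) * v (g, i))))"
    by (simp add: sum_distrib_right sum_distrib_left power_minus[of u] mult_ac)
   then show ?thesis using True vg x_u[of g u] by (simp add: rtrans_def mulf_def sum_fun_apply mult.assoc)
  next
   case False
   have "v \<in> loc q W" using v by (simp add: L0_def)
   then have "v (g, i) = 0" "g \<in> SL2 ==> v (g * upsilon u, i) = 0" using False loc_off q_u by auto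
   then show ?thesis by (auto simp: rtrans_def mulf_def sum_fun_apply)
  qed
 qed
 show ?thesis by (rule divpow_eq[OF E])
qed

lemma XP_wt:
 assumes v: "v \<in> wtsp (loc q W) rtrans (\<mu> + 2 * int n)"
 shows "XP n v \<in> wtsp (loc q W) rtrans \<mu>"
proof -
 have vS: "v \<in> loc q W" using v by (simp add: wtsp_def)
 have "rtrans (tau t) (XP n v) (g, i) = fscale (t powi \<mu>) (XP n v) (g, i)" if t: "t \<noteq> 0" for t g i
 proof (cases "g \<in> SL2 \<and> q g \<noteq> 0")
  case True
  have "v (g * tau t, i) = rtrans (tau t) v (g, i)" using True by (simp add: rtrans_def)
  also have "... = t powi (\<mu> + 2 * int n) * v (g, i)" using v t by (simp add: wtsp_def)
  also have "t powi (\<mu> + 2 * int n) = t powi \<mu> * t powi (int (2 * n))" using t by (simp add: power_int_add)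
  also have "t powi (int (2 * n)) = (t\<^sup>2) ^ n" by (simp only: power_int_of_nat power_mult)
  finally have "v (g * tau t, i) = t powi \<mu> * (t\<^sup>2) ^ n * v (g, i)" .
  then have "(- (x g / t\<^sup>2)) ^ n * v (g * tau t, i) = t powi \<mu> * (((- (x g / t\<^sup>2)) ^ n * (t\<^sup>2) ^ n) * v (g, i))"
   by (simp only: mult_ac)
  also have "(- (x g / t\<^sup>2)) ^ n * (t\<^sup>2) ^ n = (- x g) ^ n" using t by (simp flip: power_mult_distrib)
  finally have "(- (x g / t\<^sup>2)) ^ n * v (g * tau t, i) = t powi \<mu> * ((- x g) ^ n * v (g, i))" .
  then show ?thesis using True t x_t[of g t] by (simp add: rtrans_def mulf_def)
 next
  case False
  then have "v (g, i) = 0" "g \<in> SL2 ==> v (g * tau t, i) = 0" using loc_off[OF vS] q_t t by auto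
  then show ?thesis by (auto simp: rtrans_def mulf_def)
 qed
 then show ?thesis using XP_S[OF vS] by (auto simp: wtsp_def fun_eq_iff)
qed

lemma Psi_add:
 assumes "c \<in> digit_space m0 L0" "d \<in> digit_space m0 L0"
 shows "Psi (c + d) = Psi c + Psi d"
proof -
 let ?X = "{s. slice c s \<noteq> 0} \<union> {s. slice d s \<noteq> 0}"
 have X: "finite ?X" using dig.S_D(1)[OF assms(1)] dig.S_D(1)[OF assms(2)] by simp
 have "Psi (c + d) = (\<Sum>s\<in>?X. XP (num p s) (slice (c + d) s))" by (rule Psi_eq[OF X]) auto
 moreover have "Psi c = (\<Sum>s\<in>?X. XP (num p s) (slice c s))" by (rule Psi_eq[OF X]) auto
 moreover have "Psi d = (\<Sum>s\<in>?X. XP (num p s) (slice d s))" by (rule Psi_eq[OF X]) auto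
 ultimately show ?thesis by (simp only: slice_simps mulf_simps sum.distrib)
qed

lemma divpow_sum: "(\<And>a. a \<in> A ==> f a \<in> loc q W) ==> divpow rtrans n (sum f A) = (\<Sum>a\<in>A. divpow rtrans n (f a))"
 by (induction A rule: infinite_finite_induct) (auto simp: divpow_add0 divpow_add sum_S)

lemma Psi_e:
 assumes c: "c \<in> digit_space m0 L0"
 shows "Psi (digit_e m0 i c) = eop p rtrans i (Psi c)"
proof -
 let ?X = "{s. slice c s \<noteq> 0}"
 let ?t = "\<lambda>s. if s i > 0 then fscale (of_nat (p - s i)) (XP (num p s - p ^ i) (slice c s)) else 0"
 have X: "finite ?X" using dig.S_D(1)[OF c] .
 have cL: "slice c s \<in> L0" for s using dig.S_D(4)[OF c] .
 have t: "eop p rtrans i (XP (num p s) (slice c s)) = ?t s" if s: "s \<in> ?X" for s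
 proof -
  have sf: "fin_supp s" "s \<le> m0" using dig.S_D(2,3)[OF c, of s] s by auto
  have "of_nat (p - s i) = (- of_nat (s i) :: 'k)"
  proof -
   have "of_nat (p - s i) + (of_nat (s i) :: 'k) = of_nat (p - s i + s i)" by simp
   also have "p - s i + s i = p" using sf(2) by (simp add: le_m0 less_imp_le)
   finally show ?thesis using of_p by (simp add: eq_neg_iff_add_eq_0)
  qed
  moreover have "p ^ i \<le> num p s" if "s i > 0"
  proof -
   have "num p s = num p (dec i s) + p ^ i"
    using num_inc[of "dec i s" p i] that sf(1) by (metis fin_supp_inc inc_dec)
   then show ?thesis by simp
  qed
  ultimately show ?thesis
   using num_choose(1)[OF sf, of i] p_odd[of i] by (simp add: eop_def XP_divpow[OF cL])
 qed
 have "eop p rtrans i (Psi c) = (\<Sum>s\<in>?X. eop p rtrans i (XP (num p s) (slice c s)))"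
  unfolding Psi_def eop_def using cL by (intro divpow_sum XP_S) (auto simp: L0_def)
 also have "... = (\<Sum>s\<in>?X. ?t s)" by (rule sum.cong[OF refl t])
 also have "... = (\<Sum>s\<in>{s\<in>?X. s i > 0}. ?t s)"
  using X by (intro sum.mono_neutral_right) auto
 also have "... = (\<Sum>s\<in>dec i ` {s\<in>?X. s i > 0}. XP (num p s) (slice (digit_e m0 i c) s))"
 proof (rule sum.reindex_cong[symmetric, where l = "dec i"])
  show "inj_on (dec i) {s\<in>?X. s i > 0}" by (rule inj_on_inverseI[of _ "inc i"]) auto
  fix s assume s: "s \<in> {s\<in>?X. s i > 0}"
  then have sf: "fin_supp s" using dig.S_D(2)[OF c, of s] by auto
  have "num p s = num p (dec i s) + p ^ i"
   using num_inc[of "dec i s" p i] s sf by (metis (mono_tags, lifting) fin_supp_inc inc_dec mem_Collect_eq)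
  moreover have "p - 1 - dec i s i = p - s i" using s by simp
  ultimately show "XP (num p (dec i s)) (slice (digit_e m0 i c) (dec i s)) = ?t s"
   using s by (simp add: slice_e)
 qed simp
 also have "... = Psi (digit_e m0 i c)"
 proof (rule Psi_eq[symmetric])
  show "{s. slice (digit_e m0 i c) s \<noteq> 0} \<subseteq> dec i ` {s\<in>?X. s i > 0}"
  proof
   fix s assume "s \<in> {s. slice (digit_e m0 i c) s \<noteq> 0}"
   then have "slice c (inc i s) \<noteq> 0" by (auto simp: slice_e)
   then show "s \<in> dec i ` {s\<in>?X. s i > 0}" by (intro image_eqI[of _ _ "inc i s"]) auto
  qed
 qed (use X in simp)
 finally show ?thesis by (rule sym)
qed

lemma Psi_Wt:
 assumes c: "c \<in> digit_Wt p m0 L0 VW \<mu>"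
 shows "Psi c \<in> wtsp (loc q W) rtrans \<mu>"
proof -
 have "slice c s \<in> wtsp (loc q W) rtrans (\<mu> + 2 * int (num p s))" for s
  using c by (auto simp: digit_Wt_def)
 then show ?thesis unfolding Psi_def by (intro Wt_sum XP_wt)
qed

sublocale Phi: graded_map p "loc q W" "eop p rtrans" "wtsp (loc q W) rtrans" "digit_space m0 L0" "digit_e m0" "digit_Wt p m0 L0 VW" Phi
proof unfold_locales
 show "Phi (v + w) = Phi v + Phi w" if "v \<in> loc q W" "w \<in> loc q W" for v w
  by (rule slice_ext) (use that in \<open>simp add: slice_Phi divpow_add P0_simps fscale_add\<close>)
qed (simp_all add: Phi_space Phi_e Phi_Wt)

sublocale Psi: graded_map p "digit_space m0 L0" "digit_e m0" "digit_Wt p m0 L0 VW" "loc q W" "eop p rtrans" "wtsp (loc q W) rtrans" Psi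
proof unfold_locales
qed (fact Psi_S Psi_add Psi_e Psi_Wt)+

text \<open>\<open>Phi\<close> and \<open>Psi\<close> make the localization a retract of a digit
  space with all digits \<open>p - 1\<close>, and acyclicity passes to retracts.\<close>

theorem loc_acyclic:
 assumes "n > 0"
 shows "cocyc p (eop p rtrans) (wtsp (loc q W) rtrans) n \<subseteq> cobd p (eop p rtrans) (wtsp (loc q W) rtrans) n"
proof
 fix z assume z: "z \<in> cocyc p (eop p rtrans) (wtsp (loc q W) rtrans) n"
 then have zS: "z r \<in> loc q W" for r using chainsD(1) by (auto simp: cocyc_def)
 have "(\<lambda>r. Phi (z r)) \<in> cobd p (digit_e m0) (digit_Wt p m0 L0 VW) n"
  using dig.acyclic_if_free[OF _ assms] Phi.f_cocyc[OF z] by (simp add: subset_eq)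
 then have "(\<lambda>r. Psi (Phi (z r))) \<in> cobd p (eop p rtrans) (wtsp (loc q W) rtrans) n"
  by (rule Psi.f_cobd)
 then show "z \<in> cobd p (eop p rtrans) (wtsp (loc q W) rtrans) n" by (simp add: Psi_Phi zS)
qed

end

subsection \<open>Acyclicity of the coordinate ring\<close>

definition ea :: "'k::field mat => 'k" where "ea g = g $$ (0, 0)"
definition eb :: "'k::field mat => 'k" where "eb g = g $$ (0, 1)"
definition ec :: "'k::field mat => 'k" where "ec g = g $$ (1, 0)"
definition ed :: "'k::field mat => 'k" where "ed g = g $$ (1, 1)"

lemma entries_mat2 [simp]:
 "ea (mat2 a b c d) = a" "eb (mat2 a b c d) = b" "ec (mat2 a b c d) = c" "ed (mat2 a b c d) = d"
 by (simp_all add: ea_def eb_def ec_def ed_def)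

lemma entries_reg: "ea \<in> regular_functions" "eb \<in> regular_functions" "ec \<in> regular_functions" "ed \<in> regular_functions"
 using regular_functions.entry[of 0 0] regular_functions.entry[of 0 1] regular_functions.entry[of 1 0] regular_functions.entry[of 1 1]
 by (simp_all add: ea_def[abs_def] eb_def[abs_def] ec_def[abs_def] ed_def[abs_def])

lemma entries_upsilon:
 assumes "g \<in> SL2"
 shows "ea (g * upsilon u) = ea g" "eb (g * upsilon u) = eb g + u * ea g" "ec (g * upsilon u) = ec g" "ed (g * upsilon u) = ed g + u * ec g"
 using assms by (auto elim!: SL2_cases simp: upsilon_def)

lemma entries_tau:
 assumes "g \<in> SL2"
 shows "ea (g * tau t) = t * ea g" "eb (g * tau t) = eb g / t" "ec (g * tau t) = t * ec g" "ed (g * tau t) = ed g / t"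
 using assms by (auto elim!: SL2_cases simp: tau_def divide_inverse)

lemma entries_det: "g \<in> SL2 ==> ea g * ed g - eb g * ec g = 1"
 by (auto elim!: SL2_cases)

definition eac :: "'k::field mat => 'k" where "eac g = ea g * ec g"

definition restr :: "('k::field mat => 'k) => ('k mat \<times> 'i => 'k) => 'k mat \<times> 'i => 'k" where
 "restr q f = (\<lambda>(g, i). if q g = 0 then 0 else f (g, i))"

lemma restr_reg: "f \<in> reg_maps W ==> q \<in> regular_functions ==> restr q f \<in> loc q W"
proof -
 assume f: "f \<in> reg_maps W" and q: "q \<in> regular_functions"
 have "mulf (\<lambda>g. q g ^ 1) (restr q f) = mulf q f" by (auto simp: restr_def mulf_def fun_eq_iff)
 then have "mulf (\<lambda>g. q g ^ 1) (restr q f) \<in> reg_maps W" using reg_maps_mulf[OF f q] by (simp only:)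
 moreover have "restr q f (g, i) = 0" if "g \<notin> SL2 \<or> q g = 0" for g i
  using that reg_maps_off[OF f] by (auto simp: restr_def)
 ultimately show ?thesis unfolding loc_def by blast
qed

lemma restr_loc:
 assumes f: "f \<in> loc q W" and q: "q \<in> regular_functions" "r \<in> regular_functions" and s: "\<And>g. s g = q g * r g"
 shows "restr s f \<in> loc s W"
proof -
 obtain n where n: "mulf (\<lambda>g. q g ^ n) f \<in> reg_maps W" using f by (auto simp: loc_def)
 have "mulf (\<lambda>g. s g ^ Suc n) (restr s f) = mulf (\<lambda>g. r g ^ Suc n * q g) (mulf (\<lambda>g. q g ^ n) f)"
  by (auto simp: restr_def mulf_def fun_eq_iff s power_mult_distrib)
 moreover have "mulf (\<lambda>g. r g ^ Suc n * q g) (mulf (\<lambda>g. q g ^ n) f) \<in> reg_maps W"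
  by (intro reg_maps_mulf n regular_functions.mult reg_power q)
 ultimately have "mulf (\<lambda>g. s g ^ Suc n) (restr s f) \<in> reg_maps W" by (simp only:)
 moreover have "restr s f (g, i) = 0" if "g \<notin> SL2 \<or> s g = 0" for g i
  using that f by (auto simp: restr_def loc_def)
 ultimately show ?thesis unfolding loc_def by blast
qed

lemma restr_hom:
 assumes "bmod_char S rtrans p" "bmod_char S' rtrans p" "\<And>v. v \<in> S ==> restr q v \<in> S'"
  and q: "\<And>g u. g \<in> SL2 ==> q (g * upsilon u) = q g" "\<And>g t. g \<in> SL2 ==> t \<noteq> 0 ==> q (g * tau t) = t ^ k * q g"
 shows "bmod_hom S rtrans S' rtrans p (restr q)"
proof -
 interpret A: bmod_char S rtrans p by (rule assms(1))
 interpret B: bmod_char S' rtrans p by (rule assms(2))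
 show ?thesis
 proof unfold_locales
  show "restr q v \<in> S'" if "v \<in> S" for v using that by (rule assms(3))
 qed (auto simp: restr_def rtrans_def fun_eq_iff q)
qed

lemma (in bmod_char) inv_eop:
 assumes v: "v \<in> S" and u: "\<And>u. \<rho> (upsilon u) v = v"
 shows "eop p \<rho> i v = 0"
proof -
 have "vexpansion (\<lambda>u. \<rho> (upsilon u) v) 0 (\<lambda>n. if n \<le> 0 then v else 0)"
  by (rule vexpansion_cut) (simp add: u)
 from divpow_eq[OF this, of "p ^ i"] show ?thesis using p_pos by (simp add: eop_def)
qed

text \<open>In degree 0 only the zero sequence occurs, and the differential at the sequence with a
  single 1 in position \<open>i\<close> is \<open>e i\<close>.\<close>

lemma (in graded_module) cocyc_0_iff:
 "z \<in> cocyc p e Wt 0 \<longleftrightarrow> (\<exists>v\<in>Wt 0. (\<forall>i. e i v = 0) \<and> z = (\<lambda>r. if r = (\<lambda>_. 0) then v else 0))"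
proof
 assume "z \<in> cocyc p e Wt 0"
 then have z: "z \<in> Ch 0" "D z = 0" by (auto simp: cocyc_def)
 have "z r = 0" if ne: "r \<noteq> (\<lambda>_. 0)" for r
 proof (rule ccontr)
  assume nz: "z r \<noteq> 0"
  have "fin_supp r" "int (deg r) = 0" using chainsD(3)[OF z(1), of r] chainsD(4)[OF z(1), of r] nz by blast+
  then have "fin_supp r" "deg r = 0" by simp_all
  then have "r i = 0" for i by (auto simp: deg_def fin_supp_def)
  then show False using ne by auto
 qed
 moreover have "z (\<lambda>_. 0) \<in> Wt 0" using chainsD(2)[OF z(1), of "\<lambda>_. 0"] by (simp add: wgt_def)
 moreover have "e i (z (\<lambda>_. 0)) = 0" for i
 proof -
  have "{l. inc i (\<lambda>_. 0) l > 0} = {i}" by (auto simp: inc_def)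
  then have "D z (inc i (\<lambda>_. 0)) = sg i (inc i (\<lambda>_. 0)) (e i (z (\<lambda>_. 0)))" by (simp add: D_op_def E_op_def)
  then show ?thesis using z(2) by simp
 qed
 ultimately show "\<exists>v\<in>Wt 0. (\<forall>i. e i v = 0) \<and> z = (\<lambda>r. if r = (\<lambda>_. 0) then v else 0)"
  by (intro bexI[of _ "z (\<lambda>_. 0)"]) auto
next
 assume "\<exists>v\<in>Wt 0. (\<forall>i. e i v = 0) \<and> z = (\<lambda>r. if r = (\<lambda>_. 0) then v else 0)"
 then obtain v where v: "v \<in> Wt 0" "\<And>i. e i v = 0" and z: "z = (\<lambda>r. if r = (\<lambda>_. 0) then v else 0)" by blast
 have "finite {r. z r \<noteq> 0}" by (rule finite_subset[of _ "{\<lambda>_. 0}"]) (auto simp: z)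
 then have zc: "z \<in> Ch 0" using v(1) by (auto simp: chains_def z Wt_0 wgt_def fin_supp_def deg_def)
 have "E i (r i) (z (dec i r)) = 0" if "r i > 0" for i r
 proof (cases "dec i r = (\<lambda>_. 0)")
  case True
  then have "r i = 1" using that dec_simps(1)[of i r] by simp
  then show ?thesis using True v(2) by (simp add: z E_op_def)
 qed (simp add: z)
 then have "D z = 0" by (auto simp: D_op_def fun_eq_iff)
 then show "z \<in> cocyc p e Wt 0" using zc by (simp add: cocyc_def)
qed

section \<open>Cech argument on the cover by a \<noteq> 0 and c \<noteq> 0\<close>

locale cech =
 fixes p :: nat and W :: "('i => 'k::alg_closed_field) set"
 assumes chark: "CHAR('k) = p" and primep: "prime p" and p_ge3: "p \<ge> 3"
begin

text \<open>Right translation by \<open>upsilon u\<close> adds \<open>u\<close> times the first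
  column to the second, so the quotient of the two entries of a row is a coordinate along
  \<open>U\<close> wherever the denominator is nonzero.\<close>

sublocale A: free_setup p W ea 1 "\<lambda>g. eb g / ea g" eb
 by unfold_locales (auto simp: chark primep p_ge3 entries_reg entries_upsilon entries_tau field_simps power2_eq_square)

sublocale C: free_setup p W ec 1 "\<lambda>g. ed g / ec g" ed
 by unfold_locales (auto simp: chark primep p_ge3 entries_reg entries_upsilon entries_tau field_simps power2_eq_square)

sublocale AC: free_setup p W eac 2 "\<lambda>g. eb g / ea g" "\<lambda>g. eb g * ec g"
 by unfold_locales (auto simp: eac_def[abs_def] chark primep p_ge3 entries_reg entries_upsilon entries_tau field_simps power2_eq_square
   intro!: regular_functions.mult)

sublocale R: bmod_char "reg_maps W" rtrans p
proof -
 interpret gmod "reg_maps W" rtrans by (rule gmod_reg_maps)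
 show "bmod_char (reg_maps W) rtrans p" by unfold_locales (rule chark, rule primep)
qed

sublocale RA: bmod_hom "reg_maps W" rtrans "loc ea W" rtrans p "restr ea"
 by (rule restr_hom[where k = 1])
  (auto simp: R.bmod_char_axioms A.bmod_char_axioms restr_reg entries_reg entries_upsilon entries_tau)

sublocale RC: bmod_hom "reg_maps W" rtrans "loc ec W" rtrans p "restr ec"
 by (rule restr_hom[where k = 1])
  (auto simp: R.bmod_char_axioms C.bmod_char_axioms restr_reg entries_reg entries_upsilon entries_tau)

sublocale AR: bmod_hom "loc ea W" rtrans "loc eac W" rtrans p "restr eac"
proof (rule restr_hom[where k = 2])
 show "restr eac v \<in> loc eac W" if "v \<in> loc ea W" for v
  by (rule restr_loc[OF that entries_reg(1,3)]) (simp add: eac_def)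
qed (auto simp: A.bmod_char_axioms AC.bmod_char_axioms AC.q_u AC.q_t)

sublocale CR: bmod_hom "loc ec W" rtrans "loc eac W" rtrans p "restr eac"
proof (rule restr_hom[where k = 2])
 show "restr eac v \<in> loc eac W" if "v \<in> loc ec W" for v
  by (rule restr_loc[OF that entries_reg(3,1)]) (simp add: eac_def)
qed (auto simp: C.bmod_char_axioms AC.bmod_char_axioms AC.q_u AC.q_t)

abbreviation "WA \<equiv> wtsp (loc ea W) rtrans"
abbreviation "WC \<equiv> wtsp (loc ec W) rtrans"
abbreviation "WAC \<equiv> wtsp (loc eac W) rtrans"
abbreviation "WR \<equiv> wtsp (reg_maps W) rtrans"
abbreviation "ee \<equiv> eop p (rtrans :: 'k mat => ('k mat \<times> 'i => 'k) => 'k mat \<times> 'i => 'k)"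

text \<open>A partition of unity: for large \<open>n\<close> every term is divisible by a high power
  of \<open>ea\<close> or by a high power of \<open>ec\<close>.\<close>

lemma binomial_unity:
 assumes "g \<in> SL2"
 shows "(\<Sum>j\<le>n. of_nat (n choose j) * (ea g * ed g) ^ j * (- (eb g * ec g)) ^ (n - j)) = 1"
 using binomial_ring[of "ea g * ed g" "- (eb g * ec g)" n] entries_det[OF assms] by simp

text \<open>In the expansion for \<open>2 * n0\<close> the terms with \<open>j \<le> n0\<close>
  clear the denominator \<open>ec ^ n0\<close>, the others clear \<open>ea ^ n0\<close>. The factors
  have weight 0 but are not \<open>U\<close>-invariant, so this splits chains, not cocycles.\<close>

lemma split_wt:
 assumes v: "v \<in> WAC \<mu>"
 shows "\<exists>f1\<in>WA \<mu>. \<exists>f2\<in>WC \<mu>. restr eac f1 - restr eac f2 = v"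
proof -
 have vS: "v \<in> loc eac W" using v by (simp add: wtsp_def)
 obtain n0 where "\<forall>n\<ge>n0. mulf (\<lambda>g. eac g ^ n) v \<in> reg_maps W" using AC.loc_pow[OF vS] by blast
 then have n: "mulf (\<lambda>g. eac g ^ n0) v \<in> reg_maps W" by simp
 let ?r = "\<lambda>j g. of_nat (2 * n0 choose j) * (ea g * ed g) ^ j * (- (eb g * ec g)) ^ (2 * n0 - j)"
 have van: "v (g, i) = 0" if "g \<notin> SL2 \<or> ea g = 0 \<or> ec g = 0" for g i
  using AC.loc_off[OF vS, of g i] that by (auto simp: eac_def)
 have zero: "mulf (?r j) v (g, i) = 0" if "g \<notin> SL2 \<or> ea g = 0 \<or> ec g = 0" for g i j
  using van[OF that] by (simp add: mulf_def)
 have wt: "rtrans (tau t) (mulf (?r j) v) = fscale (t powi \<mu>) (mulf (?r j) v)" if t: "t \<noteq> 0" for t j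
 proof (rule ext, clarify)
  fix g i
  have "rtrans (tau t) v (g, i) = t powi \<mu> * v (g, i)" using v t by (simp add: wtsp_def)
  then show "rtrans (tau t) (mulf (?r j) v) (g, i) = fscale (t powi \<mu>) (mulf (?r j) v) (g, i)"
   using t van[of g i] by (auto simp: rtrans_def mulf_def entries_tau)
 qed
 have A: "mulf (?r j) v \<in> WA \<mu>" if j: "j \<le> n0" for j
 proof -
  let ?s = "\<lambda>g. of_nat (2 * n0 choose j) * (ea g * ed g) ^ j * (- eb g) ^ (2 * n0 - j) * ec g ^ (n0 - j)"
  have "ec g ^ (2 * n0 - j) = ec g ^ (n0 - j) * ec g ^ n0" for g using j by (simp flip: power_add add: mult_2)
  then have "mulf (\<lambda>g. ea g ^ n0) (mulf (?r j) v) = mulf ?s (mulf (\<lambda>g. eac g ^ n0) v)"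
   by (auto simp: mulf_def fun_eq_iff eac_def power_mult_distrib power_minus[of "_ * _"] power_minus[of "eb _"] mult_ac)
  moreover have "mulf ?s (mulf (\<lambda>g. eac g ^ n0) v) \<in> reg_maps W"
   by (intro reg_maps_mulf n reg_intros entries_reg)
  ultimately have "mulf (\<lambda>g. ea g ^ n0) (mulf (?r j) v) \<in> reg_maps W" by (simp only:)
  then have "mulf (?r j) v \<in> loc ea W" using zero unfolding loc_def by blast
  then show ?thesis using wt by (simp add: wtsp_def)
 qed
 have C: "mulf (?r j) v \<in> WC \<mu>" if j: "j > n0" for j
 proof -
  let ?s = "\<lambda>g. of_nat (2 * n0 choose j) * ed g ^ j * ea g ^ (j - n0) * (- (eb g * ec g)) ^ (2 * n0 - j)"
  have "ea g ^ j = ea g ^ (j - n0) * ea g ^ n0" for g using j by (simp flip: power_add)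
  then have "mulf (\<lambda>g. ec g ^ n0) (mulf (?r j) v) = mulf ?s (mulf (\<lambda>g. eac g ^ n0) v)"
   by (auto simp: mulf_def fun_eq_iff eac_def power_mult_distrib mult_ac)
  moreover have "mulf ?s (mulf (\<lambda>g. eac g ^ n0) v) \<in> reg_maps W"
   by (intro reg_maps_mulf n reg_intros entries_reg)
  ultimately have "mulf (\<lambda>g. ec g ^ n0) (mulf (?r j) v) \<in> reg_maps W" by (simp only:)
  then have "mulf (?r j) v \<in> loc ec W" using zero unfolding loc_def by blast
  then show ?thesis using wt by (simp add: wtsp_def)
 qed
 define f1 where "f1 = (\<Sum>j\<le>n0. mulf (?r j) v)"
 define f2 where "f2 = - (\<Sum>j\<in>{n0<..2 * n0}. mulf (?r j) v)"
 have "f1 \<in> WA \<mu>" unfolding f1_def using A by (intro A.Wt_sum) auto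
 moreover have "f2 \<in> WC \<mu>" unfolding f2_def using C by (intro C.Wt_minus C.Wt_sum) auto
 moreover have "restr eac f1 - restr eac f2 = v"
 proof (rule ext, clarify)
  fix g i
  have z0: "mulf (?r j) v (g, i) = 0" if "g \<notin> SL2 \<or> ea g = 0 \<or> ec g = 0" for j by (rule zero[OF that])
  have "(restr eac f1 - restr eac f2) (g, i) = (\<Sum>j\<in>{..n0} \<union> {n0<..2 * n0}. mulf (?r j) v (g, i))"
   using z0 by (subst sum.union_disjoint) (auto simp: restr_def f1_def f2_def sum_fun_apply eac_def)
  also have "{..n0} \<union> {n0<..2 * n0} = {..2 * n0}" by auto
  also have "(\<Sum>j\<le>2 * n0. mulf (?r j) v (g, i)) = v (g, i)"
  proof (cases "g \<in> SL2")
   case True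
   then show ?thesis using binomial_unity[OF True, of "2 * n0"] by (simp add: mulf_def flip: sum_distrib_right)
  qed (simp add: zero van)
  finally show "(restr eac f1 - restr eac f2) (g, i) = v (g, i)" .
 qed
 ultimately show ?thesis by blast
qed

text \<open>Each term of \<open>binomial_unity\<close> contains a high power of \<open>ea\<close> or
  of \<open>ec\<close>; multiplied by that power the glued function may be replaced by
  \<open>f1\<close> or \<open>f2\<close>, which makes the product regular.\<close>

lemma glue:
 assumes f1: "f1 \<in> loc ea W" and f2: "f2 \<in> loc ec W" and agree: "restr eac f1 = restr eac f2"
 shows "\<exists>f\<in>reg_maps W. restr ea f = f1 \<and> restr ec f = f2"
proof -
 obtain n1 n2 where n12: "\<forall>n\<ge>n1. mulf (\<lambda>g. ea g ^ n) f1 \<in> reg_maps W" "\<forall>n\<ge>n2. mulf (\<lambda>g. ec g ^ n) f2 \<in> reg_maps W"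
  using A.loc_pow[OF f1] C.loc_pow[OF f2] by blast
 \<comment> \<open>Positivity of \<open>n\<close> ensures that each term really contains the entry
   in question and so vanishes where that entry is 0.\<close>
 define n where "n = Suc (n1 + n2)"
 have n: "mulf (\<lambda>g. ea g ^ j) f1 \<in> reg_maps W" "mulf (\<lambda>g. ec g ^ j) f2 \<in> reg_maps W" if "j \<ge> n" for j
  using n12 that by (auto simp: n_def)
 define f where "f = (\<lambda>(g, i). if ea g \<noteq> 0 then f1 (g, i) else f2 (g, i))"
 have fa: "f (g, i) = f1 (g, i)" if "ea g \<noteq> 0" for g i using that by (simp add: f_def)
 have fc: "f (g, i) = f2 (g, i)" if "ec g \<noteq> 0" for g i
  using fun_cong[OF agree, of "(g, i)"] that by (auto simp: f_def restr_def eac_def split: if_splits)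
 have ag: "f1 (g, i) = 0" "f2 (g, i) = 0" if "g \<notin> SL2" for g i using A.loc_off[OF f1] C.loc_off[OF f2] that by auto
 let ?r = "\<lambda>j g. of_nat (2 * n choose j) * (ea g * ed g) ^ j * (- (eb g * ec g)) ^ (2 * n - j)"
 have "mulf (?r j) f \<in> reg_maps W" for j
 proof (cases "j \<ge> n")
  case True
  then have "j > 0" by (simp add: n_def)
  then have "mulf (?r j) f = mulf (\<lambda>g. of_nat (2 * n choose j) * ed g ^ j * (- (eb g * ec g)) ^ (2 * n - j)) (mulf (\<lambda>g. ea g ^ j) f1)"
   using fa by (auto simp: mulf_def fun_eq_iff power_mult_distrib power_0_left)
  moreover have "... \<in> reg_maps W"
   by (intro reg_maps_mulf n True reg_intros entries_reg)
  ultimately show ?thesis by (simp only:)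
 next
  case False
  then have j: "2 * n - j > 0" "2 * n - j \<ge> n" by auto
  then have "mulf (?r j) f = mulf (\<lambda>g. of_nat (2 * n choose j) * (ea g * ed g) ^ j * (- eb g) ^ (2 * n - j)) (mulf (\<lambda>g. ec g ^ (2 * n - j)) f2)"
   using fc by (auto simp: mulf_def fun_eq_iff power_mult_distrib power_0_left power_minus[of "_ * _"] power_minus[of "eb _"])
  moreover have "... \<in> reg_maps W"
   by (intro reg_maps_mulf n(2) j reg_intros entries_reg)
  ultimately show ?thesis by (simp only:)
 qed
 then have "(\<Sum>j\<le>2 * n. mulf (?r j) f) \<in> reg_maps W" by (intro reg_maps_sum)
 moreover have "(\<Sum>j\<le>2 * n. mulf (?r j) f) = f"
 proof (rule ext, clarify)
  fix g i
  show "(\<Sum>j\<le>2 * n. mulf (?r j) f) (g, i) = f (g, i)"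
  proof (cases "g \<in> SL2")
   case True
   then show ?thesis using binomial_unity[OF True, of "2 * n"] by (simp add: mulf_def sum_fun_apply flip: sum_distrib_right)
  qed (simp add: mulf_def sum_fun_apply f_def ag)
 qed
 ultimately have "f \<in> reg_maps W" by simp
 moreover have "restr ea f = f1"
  using fa A.loc_off[OF f1] by (auto simp: restr_def fun_eq_iff)
 moreover have "restr ec f = f2"
  using fc C.loc_off[OF f2] by (auto simp: restr_def fun_eq_iff)
 ultimately show ?thesis by blast
qed

text \<open>Powers of the coordinate of the projective line, with coefficient \<open>w\<close>; for
  entries of the first column they are \<open>B\<close>-invariant.\<close>

definition ratio_fn :: "('k mat => 'k) => ('k mat => 'k) => nat => ('i => 'k) => 'k mat \<times> 'i => 'k" where
 "ratio_fn q q' n w = (\<lambda>(g, i). if g \<in> SL2 \<and> q g \<noteq> 0 then (q' g / q g) ^ n * w i else 0)"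

abbreviation "TA \<equiv> ratio_fn ea ec"
abbreviation "TC \<equiv> ratio_fn ec ea"

lemma ratio_fn:
 assumes w: "w \<in> W" and q: "q \<in> regular_functions" "q' \<in> regular_functions"
  and u: "\<And>g u. g \<in> SL2 ==> q (g * upsilon u) = q g" "\<And>g u. g \<in> SL2 ==> q' (g * upsilon u) = q' g"
  and t: "\<And>g t. g \<in> SL2 ==> q (g * tau t) = t * q g" "\<And>g t. g \<in> SL2 ==> q' (g * tau t) = t * q' g"
 shows "ratio_fn q q' n w \<in> loc q W" "rtrans (upsilon u) (ratio_fn q q' n w) = ratio_fn q q' n w"
  "t \<noteq> 0 ==> rtrans (tau t) (ratio_fn q q' n w) = ratio_fn q q' n w"
proof -
 have "mulf (\<lambda>g. q g ^ Suc n) (ratio_fn q q' n w) = pure_fn (\<lambda>g. q g * q' g ^ n) w"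
  by (auto simp: mulf_def ratio_fn_def pure_fn_def fun_eq_iff power_divide)
 moreover have "pure_fn (\<lambda>g. q g * q' g ^ n) w \<in> reg_maps W"
  by (intro reg_maps_pure w regular_functions.mult reg_power q)
 ultimately have "mulf (\<lambda>g. q g ^ Suc n) (ratio_fn q q' n w) \<in> reg_maps W" by (simp only:)
 moreover have "ratio_fn q q' n w (g, i) = 0" if "g \<notin> SL2 \<or> q g = 0" for g i using that by (auto simp: ratio_fn_def)
 ultimately show "ratio_fn q q' n w \<in> loc q W" unfolding loc_def by blast
 show "rtrans (upsilon u) (ratio_fn q q' n w) = ratio_fn q q' n w"
  by (auto simp: rtrans_def ratio_fn_def fun_eq_iff SL2_mult u)
 show "rtrans (tau t) (ratio_fn q q' n w) = ratio_fn q q' n w" if "t \<noteq> 0"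
  using that by (auto simp: rtrans_def ratio_fn_def fun_eq_iff SL2_mult t)
qed

lemma ratio_VW: "w \<in> W ==> TA n w \<in> A.VW 0" "w \<in> W ==> TC n w \<in> C.VW 0"
 by (auto simp: wtsp_def A.L0_def C.L0_def intro!: ratio_fn simp: entries_reg entries_upsilon entries_tau)

text \<open>A \<open>B\<close>-invariant function on the intersection depends only on
  \<open>c / a\<close>, and as a Laurent polynomial it splits by the sign of the exponents. This is
  the vanishing of the first cohomology of the structure sheaf of the projective line.\<close>

lemma split_invariant:
 assumes v: "v \<in> WAC 0" and e: "\<And>i. ee i v = 0"
 shows "\<exists>f1\<in>A.VW 0. \<exists>f2\<in>C.VW 0. restr eac f1 - restr eac f2 = v"
proof -
 have vS: "v \<in> loc eac W" using v by (simp add: wtsp_def)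
 have vu: "rtrans (upsilon u) v = v" for u by (rule AC.eop_all_0[OF vS e])
 have vt: "rtrans (tau t) v = v" if "t \<noteq> 0" for t using v that by (simp add: wtsp_def)
 have low: "v (g, i) = v (mat2 1 0 (ec g / ea g) 1, i)" if g: "g \<in> SL2" "ea g \<noteq> 0" for g i
 proof -
  have "g * upsilon (- (eb g / ea g)) * tau (1 / ea g) = mat2 1 0 (ec g / ea g) 1"
   using g by (auto elim!: SL2_cases simp: upsilon_def tau_def field_simps)
  moreover have "v (g, i) = v (g * upsilon (- (eb g / ea g)), i)"
   using fun_cong[OF vu[of "- (eb g / ea g)"], of "(g, i)"] g by (simp add: rtrans_def)
  moreover have "... = v (g * upsilon (- (eb g / ea g)) * tau (1 / ea g), i)"
   using fun_cong[OF vt[of "1 / ea g"], of "(g * upsilon (- (eb g / ea g)), i)"] g by (simp add: rtrans_def SL2_mult)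
  ultimately show ?thesis by simp
 qed
 obtain n where "mulf (\<lambda>g. eac g ^ n) v \<in> reg_maps W" using vS by (auto simp: loc_def)
 then obtain M :: nat and r w where rw: "\<And>l. l < M ==> r l \<in> regular_functions \<and> w l \<in> W"
  "mulf (\<lambda>g. eac g ^ n) v = (\<Sum>l<M. pure_fn (r l) (w l))" by (auto simp: reg_maps_def)
 have "\<forall>l<M. \<exists>P. \<forall>s. r l (mat2 1 0 s 1) = poly P s"
  using reg_poly[of "r _" 1 0 "[:0, 1:]" 1] rw(1) by auto
 then obtain P where P: "\<And>l s. l < M ==> r l (mat2 1 0 s 1) = poly (P l) s" by metis
 \<comment> \<open>Including \<open>n\<close> in the maximum makes \<open>{..K}\<close> the disjoint
   union of \<open>{n..K}\<close> and \<open>{..<n}\<close>.\<close>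
 define K where "K = Max (insert n (degree ` P ` {..<M}))"
 have K: "degree (P l) \<le> K" if "l < M" for l unfolding K_def using that by (intro Max_ge) auto
 have nK: "n \<le> K" unfolding K_def by (intro Max_ge) auto
 define f1 where "f1 = (\<Sum>l<M. \<Sum>m\<in>{n..K}. fscale (coeff (P l) m) (TA (m - n) (w l)))"
 \<comment> \<open>The sign anticipates the difference in the Cech map.\<close>
 define f2 where "f2 = fscale (- 1) (\<Sum>l<M. \<Sum>m<n. fscale (coeff (P l) m) (TC (n - m) (w l)))"
 have "f1 \<in> A.VW 0"
  unfolding f1_def by (intro A.dig.VW_sum A.dig.VW_scale ratio_VW) (use rw(1) in auto)
 moreover have "f2 \<in> C.VW 0"
  unfolding f2_def by (intro C.dig.VW_sum C.dig.VW_scale ratio_VW) (use rw(1) in auto)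
 moreover have "restr eac f1 - restr eac f2 = v"
 proof (rule ext, clarify)
  fix g i
  show "(restr eac f1 - restr eac f2) (g, i) = v (g, i)"
  proof (cases "g \<in> SL2 \<and> eac g \<noteq> 0")
   case False
   then have "v (g, i) = 0" using AC.loc_off[OF vS] by blast
   then show ?thesis using False by (auto simp: restr_def f1_def f2_def ratio_fn_def sum_fun_apply)
  next
   case True
   define s where "s = ec g / ea g"
   have nz: "ea g \<noteq> 0" "ec g \<noteq> 0" "g \<in> SL2" "s \<noteq> 0" using True by (auto simp: eac_def s_def)
   let ?h = "mat2 1 0 s 1"
   have "s ^ n * v (?h, i) = (\<Sum>l<M. poly (P l) s * w l i)"
    using fun_cong[OF rw(2), of "(?h, i)"] by (simp add: mulf_def eac_def sum_fun_apply pure_fn_def P)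
   also have "... = (\<Sum>l<M. (\<Sum>m\<le>K. coeff (P l) m * s ^ m) * w l i)"
   proof (intro sum.cong refl arg_cong2[where f = "(*)"])
    fix l assume "l \<in> {..<M}"
    then have "degree (P l) \<le> K" using K by simp
    then show "poly (P l) s = (\<Sum>m\<le>K. coeff (P l) m * s ^ m)"
     unfolding poly_altdef by (intro sum.mono_neutral_left) (auto simp: coeff_eq_0)
   qed
   finally have "v (?h, i) = (\<Sum>l<M. (\<Sum>m\<le>K. coeff (P l) m * s ^ m) * w l i) / s ^ n" using nz by (simp add: field_simps)
   also have "... = (\<Sum>l<M. \<Sum>m\<le>K. coeff (P l) m * (s ^ m / s ^ n) * w l i)"
    by (simp add: sum_divide_distrib sum_distrib_right sum_distrib_left mult_ac)
   also have "... = (\<Sum>l<M. (\<Sum>m\<in>{n..K}. coeff (P l) m * (s ^ (m - n) * w l i)) + (\<Sum>m<n. coeff (P l) m * ((1 / s) ^ (n - m) * w l i)))"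
   proof (intro sum.cong refl)
    fix l
    have "{..K} = {n..K} \<union> {..<n}" using nK by auto
    then have "(\<Sum>m\<le>K. coeff (P l) m * (s ^ m / s ^ n) * w l i) =
      (\<Sum>m\<in>{n..K}. coeff (P l) m * (s ^ m / s ^ n) * w l i) + (\<Sum>m<n. coeff (P l) m * (s ^ m / s ^ n) * w l i)"
     by (subst \<open>{..K} = _\<close>, subst sum.union_disjoint) auto
    also have "(\<Sum>m\<in>{n..K}. coeff (P l) m * (s ^ m / s ^ n) * w l i) = (\<Sum>m\<in>{n..K}. coeff (P l) m * (s ^ (m - n) * w l i))"
     using nz by (intro sum.cong) (auto simp: power_diff)
    also have "(\<Sum>m<n. coeff (P l) m * (s ^ m / s ^ n) * w l i) = (\<Sum>m<n. coeff (P l) m * ((1 / s) ^ (n - m) * w l i))"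
     using nz by (intro sum.cong) (auto simp: power_diff power_divide)
    finally show "(\<Sum>m\<le>K. coeff (P l) m * (s ^ m / s ^ n) * w l i) = (\<Sum>m\<in>{n..K}. coeff (P l) m * (s ^ (m - n) * w l i)) + (\<Sum>m<n. coeff (P l) m * ((1 / s) ^ (n - m) * w l i))" .
   qed
   also have "... = (restr eac f1 - restr eac f2) (g, i)"
    using True nz by (simp add: restr_def f1_def f2_def ratio_fn_def sum_fun_apply sum.distrib s_def)
   finally show ?thesis using low[OF nz(3,1)] by (simp add: s_def)
  qed
 qed
 ultimately show ?thesis by blast
qed

lemma split_chain:
 assumes v: "v \<in> chains p WAC m"
 shows "\<exists>y1\<in>chains p WA m. \<exists>y2\<in>chains p WC m. (\<lambda>r. restr eac (y1 r)) - (\<lambda>r. restr eac (y2 r)) = v"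
proof -
 have "\<forall>r. \<exists>f. fst f \<in> WA (2 * int (wgt p r)) \<and> snd f \<in> WC (2 * int (wgt p r)) \<and>
   restr eac (fst f) - restr eac (snd f) = v r \<and> (v r = 0 \<longrightarrow> f = (0, 0))"
 proof
  fix r
  show "\<exists>f. fst f \<in> WA (2 * int (wgt p r)) \<and> snd f \<in> WC (2 * int (wgt p r)) \<and>
   restr eac (fst f) - restr eac (snd f) = v r \<and> (v r = 0 \<longrightarrow> f = (0, 0))"
  proof (cases "v r = 0")
   case True
   then show ?thesis by (intro exI[of _ "(0, 0)"]) (simp add: A.Wt_0 C.Wt_0)
  next
   case False
   obtain f1 f2 where "f1 \<in> WA (2 * int (wgt p r))" "f2 \<in> WC (2 * int (wgt p r))" "restr eac f1 - restr eac f2 = v r"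
    using split_wt[OF AC.chainsD(2)[OF v, of r]] by blast
   then show ?thesis using False by (intro exI[of _ "(f1, f2)"]) simp
  qed
 qed
 from choice[OF this] obtain f where f: "\<And>r. fst (f r) \<in> WA (2 * int (wgt p r))" "\<And>r. snd (f r) \<in> WC (2 * int (wgt p r))"
   "\<And>r. restr eac (fst (f r)) - restr eac (snd (f r)) = v r" "\<And>r. v r = 0 ==> f r = (0, 0)"
  by blast
 have nz: "v r \<noteq> 0" if "fst (f r) \<noteq> 0 \<or> snd (f r) \<noteq> 0" for r using f(4) that by auto
 have "finite {r. fst (f r) \<noteq> 0}" "finite {r. snd (f r) \<noteq> 0}"
  by (rule finite_subset[OF _ AC.chainsD(5)[OF v]], use nz in blast)+
 moreover have "fin_supp r \<and> int (deg r) = m" if "v r \<noteq> 0" for r using v that by (auto simp: chains_def)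
 ultimately have "(\<lambda>r. fst (f r)) \<in> chains p WA m" "(\<lambda>r. snd (f r)) \<in> chains p WC m"
  using f(1,2) nz unfolding chains_def by blast+
 moreover have "(\<lambda>r. restr eac (fst (f r))) - (\<lambda>r. restr eac (snd (f r))) = v" using f(3) by (auto simp: fun_eq_iff)
 ultimately show ?thesis
  by - (rule bexI[where x = "\<lambda>r. fst (f r)"], rule bexI[where x = "\<lambda>r. snd (f r)"])
qed

text \<open>In positive degree the cocycle is a coboundary on the intersection: the bounding chain
  is split, and the differentials of its parts are cocycles. Degree 0 has no bounding chain and
  needs \<open>split_invariant\<close>.\<close>

lemma split_cocycle:
 assumes w: "w \<in> cocyc p ee WAC m" and m: "m \<ge> 0"
 shows "\<exists>y1\<in>cocyc p ee WA m. \<exists>y2\<in>cocyc p ee WC m. (\<lambda>r. restr eac (y1 r)) - (\<lambda>r. restr eac (y2 r)) = w"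
proof (cases "m = 0")
 case True
 then obtain v where v: "v \<in> WAC 0" "\<And>i. ee i v = 0" and w': "w = (\<lambda>r. if r = (\<lambda>_. 0) then v else 0)"
  using w by (auto simp: AC.cocyc_0_iff)
 obtain f1 f2 where f: "f1 \<in> A.VW 0" "f2 \<in> C.VW 0" "restr eac f1 - restr eac f2 = v"
  using split_invariant[OF v] by blast
 have "ee i f1 = 0" "ee i f2 = 0" for i using f A.inv_eop C.inv_eop by (auto simp: A.L0_def C.L0_def)
 then have "(\<lambda>r. if r = (\<lambda>_. 0) then f1 else 0) \<in> cocyc p ee WA m"
  "(\<lambda>r. if r = (\<lambda>_. 0) then f2 else 0) \<in> cocyc p ee WC m"
  using f(1,2) True by (auto simp: A.cocyc_0_iff C.cocyc_0_iff)
 moreover have "(\<lambda>r. restr eac ((if r = (\<lambda>_. 0) then f1 else 0))) - (\<lambda>r. restr eac ((if r = (\<lambda>_. 0) then f2 else 0))) = w"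
  unfolding w' using f(3) AR.f_0 by (intro ext) auto
 ultimately show ?thesis by (intro bexI)
next
 case False
 then have "w \<in> cobd p ee WAC m" using AC.loc_acyclic[of m] m w by auto
 then obtain v where v: "v \<in> chains p WAC (m - 1)" "w = D_op p ee v" by (auto simp: cobd_def)
 obtain y1 y2 where y: "y1 \<in> chains p WA (m - 1)" "y2 \<in> chains p WC (m - 1)" "(\<lambda>r. restr eac (y1 r)) - (\<lambda>r. restr eac (y2 r)) = v"
  using split_chain[OF v(1)] by blast
 have "D_op p ee y1 \<in> cocyc p ee WA m" "D_op p ee y2 \<in> cocyc p ee WC m"
  using A.cobd_subset_cocyc[of m] C.cobd_subset_cocyc[of m] y(1,2) unfolding cobd_def by blast+
 moreover have "(\<lambda>r. restr eac (D_op p ee y1 r)) - (\<lambda>r. restr eac (D_op p ee y2 r)) = w"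
 proof -
  have "(\<lambda>r. restr eac (D_op p ee y1 r)) = D_op p ee (\<lambda>r. restr eac (y1 r))"
   by (rule AR.f_D[symmetric]) (rule A.chainsD(1)[OF y(1)])
  moreover have "(\<lambda>r. restr eac (D_op p ee y2 r)) = D_op p ee (\<lambda>r. restr eac (y2 r))"
   by (rule CR.f_D[symmetric]) (rule C.chainsD(1)[OF y(2)])
  ultimately show ?thesis using AC.D_diff[OF AR.f_chains[OF y(1)] CR.f_chains[OF y(2)]] y(3) v(2) by simp
 qed
 ultimately show ?thesis by blast
qed

lemma glue_wt:
 assumes f1: "f1 \<in> WA \<mu>" and f2: "f2 \<in> WC \<mu>" and agree: "restr eac f1 = restr eac f2"
 shows "\<exists>f\<in>WR \<mu>. restr ea f = f1 \<and> restr ec f = f2 \<and> (f1 = 0 \<and> f2 = 0 \<longrightarrow> f = 0)"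
proof -
 obtain f where f: "f \<in> reg_maps W" "restr ea f = f1" "restr ec f = f2"
  using glue[OF _ _ agree] f1 f2 by (auto simp: wtsp_def)
 have nz: "ea g \<noteq> 0 \<or> ec g \<noteq> 0" if "g \<in> SL2" for g using entries_det[OF that] by auto
 have "rtrans (tau t) f (g, i) = fscale (t powi \<mu>) f (g, i)" if t: "t \<noteq> 0" for t g i
 proof (cases "g \<in> SL2")
  case True
  have "rtrans (tau t) (restr ea f) = fscale (t powi \<mu>) (restr ea f)" "rtrans (tau t) (restr ec f) = fscale (t powi \<mu>) (restr ec f)"
   using f f1 f2 t by (auto simp: wtsp_def)
  from fun_cong[OF this(1), of "(g, i)"] fun_cong[OF this(2), of "(g, i)"]
  show ?thesis using nz[OF True] True t by (auto simp: rtrans_def restr_def entries_tau)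
 qed (simp add: rtrans_def reg_maps_off[OF f(1)])
 then have "f \<in> WR \<mu>" using f(1) by (auto simp: wtsp_def fun_eq_iff)
 moreover have "f = 0" if "f1 = 0 \<and> f2 = 0"
 proof (rule ext, clarify)
  fix g i
  show "f (g, i) = 0 (g, i)"
   using nz[of g] reg_maps_off[OF f(1), of g i] fun_cong[OF f(2), of "(g, i)"] fun_cong[OF f(3), of "(g, i)"] that
   by (cases "g \<in> SL2") (auto simp: restr_def)
 qed
 ultimately show ?thesis using f by blast
qed

text \<open>The chase in \<open>0 \<rightarrow> R \<rightarrow> A \<oplus> C \<rightarrow> AC
  \<rightarrow> 0\<close>: bound \<open>z\<close> on both open sets, correct the two bounding chains
  by cocycles until they agree on the intersection, and glue them.\<close>

theorem reg_maps_acyclic: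
 assumes n: "n > 0"
 shows "cocyc p ee WR n \<subseteq> cobd p ee WR n"
proof
 fix z assume z: "z \<in> cocyc p ee WR n"
 then have zc: "z \<in> chains p WR n" "D_op p ee z = 0" by (auto simp: cocyc_def)
 obtain y1 where y1: "y1 \<in> chains p WA (n - 1)" "(\<lambda>r. restr ea (z r)) = D_op p ee y1"
  using RA.f_cocyc[OF z] A.loc_acyclic[OF n] by (auto simp: cobd_def)
 obtain y2 where y2: "y2 \<in> chains p WC (n - 1)" "(\<lambda>r. restr ec (z r)) = D_op p ee y2"
  using RC.f_cocyc[OF z] C.loc_acyclic[OF n] by (auto simp: cobd_def)
 let ?w = "(\<lambda>r. restr eac (y1 r)) - (\<lambda>r. restr eac (y2 r))"
 have "D_op p ee ?w = (\<lambda>r. restr eac (D_op p ee y1 r)) - (\<lambda>r. restr eac (D_op p ee y2 r))"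
  using AC.D_diff[OF AR.f_chains[OF y1(1)] CR.f_chains[OF y2(1)]] AR.f_D[OF A.chainsD(1)[OF y1(1)]] CR.f_D[OF C.chainsD(1)[OF y2(1)]]
  by simp
 also have "... = 0"
  unfolding y1(2)[symmetric] y2(2)[symmetric] by (auto simp: restr_def eac_def fun_eq_iff)
 finally have "?w \<in> cocyc p ee WAC (n - 1)"
  using AC.chains_diff[OF AR.f_chains[OF y1(1)] CR.f_chains[OF y2(1)]] by (simp add: cocyc_def)
 then obtain x1 x2 where x: "x1 \<in> cocyc p ee WA (n - 1)" "x2 \<in> cocyc p ee WC (n - 1)"
  "(\<lambda>r. restr eac (x1 r)) - (\<lambda>r. restr eac (x2 r)) = ?w"
  using split_cocycle[of ?w "n - 1"] n by auto
 then have xc: "x1 \<in> chains p WA (n - 1)" "D_op p ee x1 = 0" "x2 \<in> chains p WC (n - 1)" "D_op p ee x2 = 0" by (auto simp: cocyc_def)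
 define u1 where "u1 = y1 - x1"
 define u2 where "u2 = y2 - x2"
 have u1: "u1 \<in> chains p WA (n - 1)" "D_op p ee u1 = (\<lambda>r. restr ea (z r))"
  unfolding u1_def using A.chains_diff[OF y1(1) xc(1)] A.D_diff[OF y1(1) xc(1)] y1(2) xc(2) by simp_all
 have u2: "u2 \<in> chains p WC (n - 1)" "D_op p ee u2 = (\<lambda>r. restr ec (z r))"
  unfolding u2_def using C.chains_diff[OF y2(1) xc(3)] C.D_diff[OF y2(1) xc(3)] y2(2) xc(4) by simp_all
 have agree: "restr eac (u1 r) = restr eac (u2 r)" for r
 proof -
  have "restr eac (x1 r) - restr eac (x2 r) = restr eac (y1 r) - restr eac (y2 r)" using fun_cong[OF x(3), of r] by simp
  moreover have "restr eac (u1 r) = restr eac (y1 r) - restr eac (x1 r)"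
   using AR.f_diff[OF A.chainsD(1)[OF y1(1)] A.chainsD(1)[OF xc(1)]] by (simp add: u1_def)
  moreover have "restr eac (u2 r) = restr eac (y2 r) - restr eac (x2 r)"
   using CR.f_diff[OF C.chainsD(1)[OF y2(1)] C.chainsD(1)[OF xc(3)]] by (simp add: u2_def)
  moreover have "restr eac (y1 r) - restr eac (x1 r) =
    (restr eac (y1 r) - restr eac (y2 r)) - (restr eac (x1 r) - restr eac (x2 r)) + (restr eac (y2 r) - restr eac (x2 r))"
   by (simp add: algebra_simps)
  ultimately show ?thesis by simp
 qed
 have "\<forall>r. \<exists>f. f \<in> WR (2 * int (wgt p r)) \<and> restr ea f = u1 r \<and> restr ec f = u2 r \<and> (u1 r = 0 \<and> u2 r = 0 \<longrightarrow> f = 0)"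
  using glue_wt[OF A.chainsD(2)[OF u1(1)] C.chainsD(2)[OF u2(1)] agree] by blast
 from choice[OF this] obtain y where y: "\<And>r. y r \<in> WR (2 * int (wgt p r))" "\<And>r. restr ea (y r) = u1 r" "\<And>r. restr ec (y r) = u2 r"
  "\<And>r. u1 r = 0 ==> u2 r = 0 ==> y r = 0" by blast
 have "{r. y r \<noteq> 0} \<subseteq> {r. u1 r \<noteq> 0} \<union> {r. u2 r \<noteq> 0}" using y(4) by blast
 then have "finite {r. y r \<noteq> 0}" using A.chainsD(5)[OF u1(1)] C.chainsD(5)[OF u2(1)] by (rule finite_subset[OF _ finite_UnI])
 moreover have "fin_supp r \<and> int (deg r) = n - 1" if "y r \<noteq> 0" for r
 proof -
  have "u1 r \<noteq> 0 \<or> u2 r \<noteq> 0" using y(4) that by blast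
  then show ?thesis using u1(1) u2(1) by (auto simp: chains_def)
 qed
 ultimately have yc: "y \<in> chains p WR (n - 1)" using y(1) by (auto simp: chains_def)
 have yS: "y r \<in> reg_maps W" for r using R.chainsD(1)[OF yc] .
 have DS: "D_op p ee y r \<in> reg_maps W" for r using R.chainsD(1)[OF R.D_chains[OF yc]] .
 have 1: "restr ea (D_op p ee y r) = restr ea (z r)" for r
  using fun_cong[OF RA.f_D[of y, OF yS], of r] fun_cong[OF u1(2), of r] y(2) by simp
 have 2: "restr ec (D_op p ee y r) = restr ec (z r)" for r
  using fun_cong[OF RC.f_D[of y, OF yS], of r] fun_cong[OF u2(2), of r] y(3) by simp
 have "D_op p ee y r (g, i) = z r (g, i)" for r g i
 proof (cases "g \<in> SL2")
  case True
  then have "ea g \<noteq> 0 \<or> ec g \<noteq> 0" using entries_det[OF True] by auto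
  then show ?thesis using fun_cong[OF 1[of r], of "(g, i)"] fun_cong[OF 2[of r], of "(g, i)"] by (auto simp: restr_def)
 next
  case False
  then show ?thesis using reg_maps_off[OF DS[of r]] reg_maps_off[OF R.chainsD(1)[OF zc(1), of r]] by simp
 qed
 then have "D_op p ee y = z" by (auto simp: fun_eq_iff)
 then show "z \<in> cobd p ee WR n" using yc by (auto simp: cobd_def)
qed

end

subsection \<open>Simple modules\<close>

text \<open>Surjectivity is required on weight spaces, so that chains lift together with their
  weights.\<close>

lemma (in graded_map) quot_dim_iso:
 fixes s :: "'k::field => 'a => 'a" and s' :: "'k => 'b => 'b"
 assumes inj: "\<And>v. v \<in> S ==> f v = 0 ==> v = 0" and surj: "\<And>w \<mu>. w \<in> Wt' \<mu> ==> \<exists>v\<in>Wt \<mu>. f v = w"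
  and f_s: "\<And>c v. v \<in> S ==> f (s c v) = s' c (f v)"
  and s_cocyc: "\<And>c z. z \<in> cocyc p e Wt q ==> (\<lambda>r. s c (z r)) \<in> cocyc p e Wt q"
  and qd: "quot_dim (\<lambda>c z r. s c (z r)) (cocyc p e Wt q) (cobd p e Wt q) n"
 shows "quot_dim (\<lambda>c z r. s' c (z r)) (cocyc p e' Wt' q) (cobd p e' Wt' q) n"
proof -
 have lift: "\<exists>y\<in>A.Ch t. (\<lambda>r. f (y r)) = u" if u: "u \<in> B.Ch t" for u t
 proof -
  have "\<forall>r. \<exists>v. v \<in> Wt (2 * int (wgt p r)) \<and> f v = u r \<and> (u r = 0 \<longrightarrow> v = 0)"
   using surj[OF B.chainsD(2)[OF u]] inj A.Wt_S by metis
  from choice[OF this] obtain y where y: "\<And>r. y r \<in> Wt (2 * int (wgt p r))" "\<And>r. f (y r) = u r" "\<And>r. u r = 0 ==> y r = 0"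
   by blast
  then have nz: "u r \<noteq> 0" if "y r \<noteq> 0" for r using that by auto
  then have "finite {r. y r \<noteq> 0}" by (intro finite_subset[OF _ B.chainsD(5)[OF u]]) auto
  moreover have "fin_supp r \<and> int (deg r) = t" if "u r \<noteq> 0" for r using u that by (auto simp: chains_def)
  ultimately have "y \<in> A.Ch t" using y(1) nz unfolding chains_def by blast
  then show ?thesis using y(2) by auto
 qed
 define R where "R a b \<longleftrightarrow> a \<in> cocyc p e Wt q \<and> b = (\<lambda>r. f (a r))" for a b
 have cS: "a r \<in> S" if "a \<in> cocyc p e Wt q" for a r using that A.chainsD(1) by (auto simp: cocyc_def)
 show ?thesis
 proof (rule quot_dim_transfer[OF qd, of R])
  show "R 0 0" using A.cocyc_0 f_0 by (auto simp: R_def)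
  show "R (a - a') (b - b')" if "R a b" "R a' b'" for a b a' b'
   using that A.cocyc_diff f_diff cS by (auto simp: R_def fun_eq_iff)
  show "R (\<lambda>r. s c (a r)) (\<lambda>r. s' c (b r))" if "R a b" for c a b
   using that s_cocyc f_s cS by (auto simp: R_def fun_eq_iff)
  show "b \<in> cocyc p e' Wt' q" if "R a b" for a b using that f_cocyc by (auto simp: R_def)
  show "\<exists>b. R a b" if "a \<in> cocyc p e Wt q" for a using that by (auto simp: R_def)
  show "\<exists>a\<in>cocyc p e Wt q. R a b" if b: "b \<in> cocyc p e' Wt' q" for b
  proof -
   obtain a where a: "a \<in> A.Ch q" "(\<lambda>r. f (a r)) = b" using lift b by (auto simp: cocyc_def)
   have "f (A.D a r) = 0" for r
    using fun_cong[OF f_D[of a, OF A.chainsD(1)[OF a(1)]], of r] a(2) b by (simp add: cocyc_def)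
   then have "A.D a = 0" using inj A.chainsD(1)[OF A.D_chains[OF a(1)]] by auto
   then show ?thesis using a by (auto simp: R_def cocyc_def)
  qed
  show "a \<in> cobd p e Wt q \<longleftrightarrow> b \<in> cobd p e' Wt' q" if t: "R a b" for a b
  proof
   assume "a \<in> cobd p e Wt q"
   then show "b \<in> cobd p e' Wt' q" using f_cobd t by (auto simp: R_def)
  next
   assume "b \<in> cobd p e' Wt' q"
   then obtain y where y: "y \<in> B.Ch (q - 1)" "b = B.D y" by (auto simp: cobd_def)
   obtain x where x: "x \<in> A.Ch (q - 1)" "(\<lambda>r. f (x r)) = y" using lift y(1) by blast
   have "f (A.D x r) = f (a r)" for r
    using fun_cong[OF f_D[of x, OF A.chainsD(1)[OF x(1)]], of r] x(2) y(2) t by (simp add: R_def fun_eq_iff)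
   then have "f (A.D x r - a r) = 0" for r
    using f_diff[OF A.chainsD(1)[OF A.D_chains[OF x(1)]], of "a r" r] cS t by (simp add: R_def)
   moreover have "a r \<in> S" for r using cS t by (simp add: R_def)
   ultimately have "A.D x r - a r = 0" for r
    by (intro inj A.S_diff A.chainsD(1)[OF A.D_chains[OF x(1)]])
   then have "a = A.D x" by (auto simp: fun_eq_iff)
   then show "a \<in> cobd p e Wt q" using x(1) by (auto simp: cobd_def)
  qed
 qed
qed

lemma powi_indep:
 fixes c :: "'x => 'k::alg_closed_field"
 assumes X: "finite X" "inj_on f X" and eq: "\<And>t. t \<noteq> 0 ==> (\<Sum>x\<in>X. t powi (f x) * c x) = t powi \<mu> * d"
  and x: "x \<in> X" "f x \<noteq> \<mu>"
 shows "c x = 0"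
proof -
 \<comment> \<open>A shift that makes all exponents nonnegative.\<close>
 define L where "L = \<bar>\<mu>\<bar> + (\<Sum>x\<in>X. \<bar>f x\<bar>)"
 have L: "f y + L \<ge> 0" if "y \<in> X" for y
 proof -
  have "\<bar>f y\<bar> \<le> (\<Sum>x\<in>X. \<bar>f x\<bar>)" using X(1) that by (intro member_le_sum) auto
  then show ?thesis unfolding L_def by linarith
 qed
 have L\<mu>: "\<mu> + L \<ge> 0"
 proof -
  have "0 \<le> (\<Sum>x\<in>X. \<bar>f x\<bar>)" by (intro sum_nonneg) auto
  then show ?thesis unfolding L_def by linarith
 qed
 let ?P = "(\<Sum>x\<in>X. Polynomial.monom (c x) (nat (f x + L))) - Polynomial.monom d (nat (\<mu> + L))"
 have "?P = 0"
 proof (rule poly_zeroI)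
  fix t :: 'k assume t: "t \<noteq> 0"
  have e: "t ^ nat (k + L) = t powi L * t powi k" if "k + L \<ge> 0" for k
  proof -
   have "t ^ nat (k + L) = t powi (k + L)" using that by (simp add: power_int_def)
   then show ?thesis using t by (simp add: power_int_add mult.commute)
  qed
  have "poly ?P t = (\<Sum>x\<in>X. t powi L * (t powi f x * c x)) - t powi L * (t powi \<mu> * d)"
   using L L\<mu> by (simp add: poly_sum poly_monom e mult_ac cong: sum.cong)
  then show "poly ?P t = 0" using eq[OF t] by (simp flip: sum_distrib_left)
 qed
 then have "coeff ?P (nat (f x + L)) = 0" by simp
 moreover have "nat (\<mu> + L) \<noteq> nat (f x + L)" using L[OF x(1)] L\<mu> x(2) by auto
 moreover have "nat (f y + L) = nat (f x + L) \<longleftrightarrow> y = x" if "y \<in> X" for y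
  using L[OF x(1)] L[OF that] inj_onD[OF X(2) _ that x(1)] by auto
 ultimately show ?thesis using X(1) x(1) by (simp add: coeff_sum cong: sum.cong)
qed

text \<open>For the sum 0, which has every weight, this is the independence of weight spaces; the
  general form also extracts the component of weight \<open>\<mu>\<close>.\<close>

lemma (in bmod) wt_indep:
 assumes X: "finite X" "inj_on f X" and c: "\<And>x. x \<in> X ==> c x \<in> wtsp S \<rho> (f x)"
  and sum: "(\<Sum>x\<in>X. c x) \<in> wtsp S \<rho> \<mu>" and x: "x \<in> X" "f x \<noteq> \<mu>"
 shows "c x = 0"
proof
 fix i
 have "(\<Sum>x\<in>X. t powi (f x) * c x i) = t powi \<mu> * (\<Sum>x\<in>X. c x i)" if t: "t \<noteq> 0" for t
 proof -
  have "(\<Sum>x\<in>X. fscale (t powi f x) (c x)) = (\<Sum>x\<in>X. \<rho> (tau t) (c x))"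
   using c t by (intro sum.cong) (auto simp: wtsp_def)
  also have "... = \<rho> (tau t) (\<Sum>x\<in>X. c x)" using c t by (intro t_sum[symmetric]) (auto simp: wtsp_def)
  also have "... = fscale (t powi \<mu>) (\<Sum>x\<in>X. c x)" using sum t by (simp add: wtsp_def)
  finally show ?thesis by (simp add: fun_eq_iff sum_fun_apply)
 qed
 from powi_indep[OF X this x] show "c x i = 0 i" by simp
qed

section \<open>The Weyl group and the big cell\<close>

definition lower :: "'k::field => 'k mat" where "lower s = mat2 1 0 s 1"
definition weyl :: "'k::field mat" where "weyl = mat2 0 (- 1) 1 0"
definition weyl' :: "'k::field mat" where "weyl' = mat2 0 1 (- 1) 0"

lemma (in bmod_char) divpow_sum:
 "(\<And>a. a \<in> A ==> f a \<in> S) ==> divpow \<rho> n (sum f A) = (\<Sum>a\<in>A. divpow \<rho> n (f a))"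
 by (induction A rule: infinite_finite_induct) (auto simp: divpow_add0 divpow_add sum_S)

lemma weyl_SL2 [simp]: "weyl \<in> SL2" "weyl' \<in> SL2" "lower s \<in> SL2"
 by (simp_all add: weyl_def weyl'_def lower_def)

context gmod
begin

lemma \<rho>_0: "g \<in> SL2 ==> \<rho> g 0 = 0"
 using \<rho>_add[OF _ S_zero S_zero, of g] by simp

lemma \<rho>_sum: "g \<in> SL2 ==> (\<And>a. a \<in> A ==> f a \<in> S) ==> \<rho> g (sum f A) = (\<Sum>a\<in>A. \<rho> g (f a))"
 by (induction A rule: infinite_finite_induct) (auto simp: \<rho>_0 \<rho>_add S_sum0)

lemma wt_conj:
 assumes w: "w \<in> SL2" "\<And>t. t \<noteq> 0 ==> tau t * w = w * tau (1 / t)" and v: "v \<in> wtsp S \<rho> \<mu>"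
 shows "\<rho> w v \<in> wtsp S \<rho> (- \<mu>)"
proof -
 have vS: "v \<in> S" using v by (simp add: wtsp_def)
 have "\<rho> (tau t) (\<rho> w v) = fscale (t powi (- \<mu>)) (\<rho> w v)" if t: "t \<noteq> 0" for t
 proof -
  have "\<rho> (tau t) (\<rho> w v) = \<rho> w (\<rho> (tau (1 / t)) v)"
   using \<rho>_mult[OF _ w(1) vS, of "tau t"] \<rho>_mult[OF w(1) _ vS, of "tau (1 / t)"] w(2)[OF t] t by simp
  also have "\<rho> (tau (1 / t)) v = fscale ((1 / t) powi \<mu>) v" using v t by (simp add: wtsp_def)
  also have "(1 / t) powi \<mu> = t powi (- \<mu>)" by (simp add: power_int_minus power_int_divide_distrib divide_inverse power_int_inverse)
  finally show ?thesis by (simp only: \<rho>_scale[OF w(1) vS])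
 qed
 then show ?thesis using \<rho>_S[OF w(1) vS] by (simp add: wtsp_def)
qed

lemma wt_weyl: "v \<in> wtsp S \<rho> \<mu> ==> \<rho> weyl v \<in> wtsp S \<rho> (- \<mu>)"
 and wt_weyl': "v \<in> wtsp S \<rho> \<mu> ==> \<rho> weyl' v \<in> wtsp S \<rho> (- \<mu>)"
 by (auto intro!: wt_conj simp: tau_def weyl_def weyl'_def divide_inverse)

lemma weyl_weyl': "v \<in> S ==> \<rho> weyl (\<rho> weyl' v) = v"
 using \<rho>_mult[of weyl weyl' v] \<rho>_one[of v] by (simp add: weyl_def weyl'_def one_mat2)

lemma weyl'_weyl: "v \<in> S ==> \<rho> weyl' (\<rho> weyl v) = v"
 using \<rho>_mult[of weyl' weyl v] \<rho>_one[of v] by (simp add: weyl_def weyl'_def one_mat2)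

text \<open>The divided powers of the opposite root operator, as conjugates of those of the root operator under the
 Weyl group.\<close>

definition fop :: "nat => ('i => 'k) => 'i => 'k" where
 "fop n v = fscale ((- 1) ^ n) (\<rho> weyl (divpow \<rho> n (\<rho> weyl' v)))"

lemma fop_0: "v \<in> S ==> fop 0 v = v"
 by (simp add: fop_def divpow_zero \<rho>_S weyl_weyl')

lemma fop_wt:
 assumes "v \<in> wtsp S \<rho> \<mu>"
 shows "fop n v \<in> wtsp S \<rho> (\<mu> - 2 * int n)"
proof -
 have "\<rho> weyl (divpow \<rho> n (\<rho> weyl' v)) \<in> wtsp S \<rho> (- (- \<mu> + 2 * int n))"
  by (intro wt_weyl divpow_wt wt_weyl' assms)
 then show ?thesis by (auto simp: fop_def wtsp_def S_fscale \<rho>_scale mult.commute)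
qed

lemma lower_exp:
 assumes v: "v \<in> S"
 shows "\<exists>K. vexpansion (\<lambda>s. \<rho> (lower s) v) K (\<lambda>n. fop n v)"
proof -
 have wv: "\<rho> weyl' v \<in> S" using v by (simp add: \<rho>_S)
 obtain K where K: "vexpansion (\<lambda>u. \<rho> (upsilon u) (\<rho> weyl' v)) K (\<lambda>n. divpow \<rho> n (\<rho> weyl' v))"
  using divpow_exp[OF wv] by blast
 have "\<rho> (lower s) v = (\<Sum>n\<le>K. fscale (s ^ n) (fop n v))" for s
 proof -
  have "lower s = weyl * (upsilon (- s) * weyl')" by (simp add: lower_def weyl_def upsilon_def weyl'_def)
  then have "\<rho> (lower s) v = \<rho> weyl (\<rho> (upsilon (- s)) (\<rho> weyl' v))"
   using \<rho>_mult[of weyl "upsilon (- s) * weyl'" v] \<rho>_mult[of "upsilon (- s)" weyl' v] v by (simp add: SL2_mult)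
  also have "... = \<rho> weyl (\<Sum>n\<le>K. fscale ((- s) ^ n) (divpow \<rho> n (\<rho> weyl' v)))" using K by (simp add: vexpansion_def)
  also have "... = (\<Sum>n\<le>K. fscale ((- s) ^ n) (\<rho> weyl (divpow \<rho> n (\<rho> weyl' v))))"
   using wv by (simp add: \<rho>_sum \<rho>_scale S_fscale divpow_S)
  finally show ?thesis by (simp add: fop_def power_minus[of s] mult.commute)
 qed
 moreover have "fop n v = 0" if "n > K" for n using K that by (simp add: vexpansion_def fop_def \<rho>_0)
 ultimately show ?thesis by (auto simp: vexpansion_def)
qed

text \<open>For \<open>a \<noteq> 0\<close> the matrix factors into a lower unipotent, a diagonal
  and an upper unipotent one; the last fixes \<open>v\<close> and the second scales it.\<close>

lemma big_cell:
 assumes v: "v \<in> wtsp S \<rho> \<mu>" and u: "\<And>u. \<rho> (upsilon u) v = v" and g: "g \<in> SL2" "ea g \<noteq> 0"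
 shows "\<rho> g v = fscale (ea g powi \<mu>) (\<rho> (lower (ec g / ea g)) v)"
proof -
 have vS: "v \<in> S" using v by (simp add: wtsp_def)
 have "g = lower (ec g / ea g) * (tau (ea g) * upsilon (eb g / ea g))"
  using g by (auto elim!: SL2_cases simp: lower_def tau_def upsilon_def field_simps)
 then have "\<rho> g v = \<rho> (lower (ec g / ea g)) (\<rho> (tau (ea g)) (\<rho> (upsilon (eb g / ea g)) v))"
  using \<rho>_mult[of "lower (ec g / ea g)" "tau (ea g) * upsilon (eb g / ea g)" v]
   \<rho>_mult[of "tau (ea g)" "upsilon (eb g / ea g)" v] g vS by (simp add: SL2_mult)
 then show ?thesis using u v g \<rho>_scale[OF _ vS] by (simp add: wtsp_def)
qed

end

lemma num_add:
 assumes "fin_supp s" "fin_supp t"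
 shows "num p (\<lambda>i. s i + t i) = num p s + num p t"
proof -
 let ?X = "{i. s i > 0} \<union> {i. t i > 0}"
 have X: "finite ?X" using assms by (simp add: fin_supp_def)
 have n: "num p r = (\<Sum>i\<in>?X. p ^ i * r i)" if "{i. r i > 0} \<subseteq> ?X" for r :: "nat => nat"
  unfolding num_def using that X by (intro sum.mono_neutral_left) auto
 have "num p (\<lambda>i. s i + t i) = (\<Sum>i\<in>?X. p ^ i * (s i + t i))" by (rule n) auto
 also have "... = (\<Sum>i\<in>?X. p ^ i * s i) + (\<Sum>i\<in>?X. p ^ i * t i)" by (simp add: algebra_simps sum.distrib)
 also have "(\<Sum>i\<in>?X. p ^ i * s i) = num p s" by (rule n[symmetric]) auto
 also have "(\<Sum>i\<in>?X. p ^ i * t i) = num p t" by (rule n[symmetric]) auto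
 finally show ?thesis .
qed

locale simple_gmod = gmod S \<rho> for S :: "('i => 'k::alg_closed_field) set" and \<rho> +
 fixes p M :: nat and v0 :: "'i => 'k"
 assumes chark: "CHAR('k) = p" and primep: "prime p"
  and simple: "T \<subseteq> S ==> 0 \<in> T ==> (\<And>v w. v \<in> T ==> w \<in> T ==> v + w \<in> T) ==> (\<And>c v. v \<in> T ==> fscale c v \<in> T) ==>
   (\<And>g v. g \<in> SL2 ==> v \<in> T ==> \<rho> g v \<in> T) ==> T = {0} \<or> T = S"
  and v0: "v0 \<in> wtsp S \<rho> (int M)" "v0 \<noteq> 0"
  and highest: "v \<in> wtsp S \<rho> \<mu> ==> v \<noteq> 0 ==> \<exists>j::nat. \<mu> = int M - 2 * int j"
begin

sublocale bmod_char S \<rho> p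
 by unfold_locales (rule chark, rule primep)

abbreviation "m \<equiv> dg p M"

lemma v0_S: "v0 \<in> S" using v0 by (simp add: wtsp_def)

text \<open>The operators \<open>e i\<close> would move \<open>v0\<close> to a weight above the
  highest one.\<close>

lemma v0_u: "\<rho> (upsilon u) v0 = v0"
proof (rule eop_all_0[OF v0_S])
 fix i
 have w: "divpow \<rho> (p ^ i) v0 \<in> wtsp S \<rho> (int M + 2 * int (p ^ i))" by (rule divpow_wt[OF v0(1)])
 show "eop p \<rho> i v0 = 0"
 proof (rule ccontr)
  assume "eop p \<rho> i v0 \<noteq> 0"
  then have "divpow \<rho> (p ^ i) v0 \<noteq> 0" by (simp only: eop_def not_False_eq_True)
  then obtain j where "int M + 2 * int (p ^ i) = int M - 2 * int j" using highest[OF w] by blast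
  moreover have "int (p ^ i) > 0" using p_pos by simp
  ultimately show False by linarith
 qed
qed

text \<open>The linear combinations of translates of \<open>v\<close> form a nonzero
  submodule.\<close>

lemma generated: 
 assumes v: "v \<in> S" "v \<noteq> 0" and w: "w \<in> S"
 shows "\<exists>(N::nat) c g. (\<forall>l<N. g l \<in> SL2) \<and> w = (\<Sum>l<N. fscale (c l) (\<rho> (g l) v))"
proof -
 define T where "T = {w. \<exists>(N::nat) c g. (\<forall>l<N. g l \<in> SL2) \<and> w = (\<Sum>l<N. fscale (c l) (\<rho> (g l) v))}"
 have "T = {0} \<or> T = S"
 proof (rule simple)
  show "T \<subseteq> S" unfolding T_def using v by (auto intro!: S_sum0 S_fscale \<rho>_S)
  show "0 \<in> T" unfolding T_def by (intro CollectI exI[of _ "0::nat"]) simp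
  show "x + y \<in> T" if x: "x \<in> T" and y: "y \<in> T" for x y
  proof -
   obtain N :: nat and c g where 1: "\<forall>l<N. g l \<in> SL2" "x = (\<Sum>l<N. fscale (c l) (\<rho> (g l) v))" using x by (auto simp: T_def)
   obtain K :: nat and d h where 2: "\<forall>l<K. h l \<in> SL2" "y = (\<Sum>l<K. fscale (d l) (\<rho> (h l) v))" using y by (auto simp: T_def)
   let ?c = "\<lambda>l. if l < N then c l else d (l - N)" and ?g = "\<lambda>l. if l < N then g l else h (l - N)"
   have "x + y = (\<Sum>l<N + K. if l < N then fscale (c l) (\<rho> (g l) v) else fscale (d (l - N)) (\<rho> (h (l - N)) v))"
    unfolding 1(2) 2(2) by (rule sum_concat[symmetric])
   also have "... = (\<Sum>l<N + K. fscale (?c l) (\<rho> (?g l) v))" by (intro sum.cong) auto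
   finally show ?thesis unfolding T_def using 1(1) 2(1)
    by (intro CollectI exI[of _ "N + K"] exI[of _ ?c] exI[of _ ?g]) auto
  qed
  show "fscale a x \<in> T" if x: "x \<in> T" for a x
  proof -
   obtain N :: nat and c g where 1: "\<forall>l<N. g l \<in> SL2" "x = (\<Sum>l<N. fscale (c l) (\<rho> (g l) v))" using x by (auto simp: T_def)
   then show ?thesis unfolding T_def
    by (intro CollectI exI[of _ N] exI[of _ "\<lambda>l. a * c l"] exI[of _ g]) (simp add: fscale_sum)
  qed
  show "\<rho> h x \<in> T" if h: "h \<in> SL2" and x: "x \<in> T" for h x
  proof -
   obtain N :: nat and c g where 1: "\<forall>l<N. g l \<in> SL2" "x = (\<Sum>l<N. fscale (c l) (\<rho> (g l) v))" using x by (auto simp: T_def)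
   then have "\<rho> h x = (\<Sum>l<N. fscale (c l) (\<rho> (h * g l) v))"
    unfolding 1(2) using h v(1) by (subst \<rho>_sum) (auto simp: S_fscale \<rho>_S \<rho>_scale \<rho>_mult intro!: sum.cong)
   then show ?thesis unfolding T_def using 1 h
    by (intro CollectI exI[of _ N] exI[of _ c] exI[of _ "\<lambda>l. h * g l"]) (simp add: SL2_mult)
  qed
 qed
 moreover have "v \<in> T"
  unfolding T_def using \<rho>_one[OF v(1)]
  by (intro CollectI exI[of _ "1::nat"] exI[of _ "\<lambda>_. 1"] exI[of _ "\<lambda>_. 1\<^sub>m 2"]) (simp add: one_mat2)
 ultimately show ?thesis using v(2) w unfolding T_def by blast
qed

text \<open>A vector fixed by \<open>U\<close> of weight \<open>\<mu> < M\<close> would generate a submodule avoiding \<open>v0\<close>. Only the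
 big cell \<open>a \<noteq> 0\<close> has to be considered, since \<open>v0\<close> is fixed by \<open>upsilon t\<close> and a generic translate of finitely
 many group elements lies in the big cell.\<close>

lemma invariant_weight:
 assumes v: "v \<in> wtsp S \<rho> \<mu>" "v \<noteq> 0" and u: "\<And>u. \<rho> (upsilon u) v = v"
 shows "\<mu> = int M"
proof (rule ccontr)
 assume ne: "\<mu> \<noteq> int M"
 have vS: "v \<in> S" using v by (simp add: wtsp_def)
 obtain j where j: "\<mu> = int M - 2 * int j" using highest[OF v] by blast
 have j0: "j > 0" using ne j by (cases j) auto
 obtain N :: nat and c g where cg: "\<And>l. l < N ==> g l \<in> SL2" "v0 = (\<Sum>l<N. fscale (c l) (\<rho> (g l) v))"
  using generated[OF vS v(2) v0_S] by blast
 obtain K where K: "vexpansion (\<lambda>s. \<rho> (lower s) v) K (\<lambda>n. fop n v)" using lower_exp[OF vS] by blast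
 obtain t where t: "t \<notin> (\<lambda>l. - ea (g l) / ec (g l)) ` {..<N}"
  using infinite_alg_closed[where 'k = 'k] ex_new_if_finite[of "(\<lambda>l. - ea (g l) / ec (g l)) ` {..<N}"] by auto
 let ?h = "\<lambda>l. upsilon t * g l"
 have h: "?h l \<in> SL2" "ea (?h l) \<noteq> 0" if l: "l < N" for l
 proof -
  show "?h l \<in> SL2" using cg(1)[OF l] by (simp add: SL2_mult)
  have "ea (?h l) = ea (g l) + t * ec (g l)" using cg(1)[OF l] by (auto elim!: SL2_cases simp: upsilon_def)
  moreover have "ea (g l) * ed (g l) - eb (g l) * ec (g l) = 1" using entries_det cg(1)[OF l] by blast
  moreover have "t \<noteq> - ea (g l) / ec (g l)" using t l by blast
  ultimately show "ea (?h l) \<noteq> 0"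
   by (cases "ec (g l) = 0") (auto simp: field_simps add_eq_0_iff)
 qed
 define d where "d n = (\<Sum>l<N. c l * (ea (?h l) powi \<mu> * (ec (?h l) / ea (?h l)) ^ n))" for n
 have "v0 = \<rho> (upsilon t) v0" by (simp add: v0_u)
 also have "... = (\<Sum>l<N. fscale (c l) (\<rho> (?h l) v))"
  unfolding cg(2)
  by (subst \<rho>_sum) (auto simp: cg(1) vS S_fscale \<rho>_S \<rho>_scale \<rho>_mult intro!: sum.cong)
 also have "... = (\<Sum>l<N. \<Sum>n\<le>K. fscale (c l * (ea (?h l) powi \<mu> * (ec (?h l) / ea (?h l)) ^ n)) (fop n v))"
 proof (rule sum.cong[OF refl])
  fix l assume "l \<in> {..<N}"
  then have l: "?h l \<in> SL2" "ea (?h l) \<noteq> 0" using h by auto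
  show "fscale (c l) (\<rho> (?h l) v) = (\<Sum>n\<le>K. fscale (c l * (ea (?h l) powi \<mu> * (ec (?h l) / ea (?h l)) ^ n)) (fop n v))"
   unfolding big_cell[OF v(1) u l] using K by (simp add: vexpansion_def fscale_sum)
 qed
 also have "... = (\<Sum>n\<le>K. \<Sum>l<N. fscale (c l * (ea (?h l) powi \<mu> * (ec (?h l) / ea (?h l)) ^ n)) (fop n v))"
  by (rule sum.swap)
 also have "... = (\<Sum>n\<le>K. fscale (d n) (fop n v))"
  by (intro sum.cong refl) (auto simp: d_def fun_eq_iff sum_fun_apply sum_distrib_right)
 finally have eq: "v0 = (\<Sum>n\<le>K. fscale (d n) (fop n v))" .
 \<comment> \<open>All terms have weight at most \<open>\<mu> < M\<close>, whereas their sum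
   \<open>v0\<close> has weight \<open>M\<close>.\<close>
 have "fscale (d n) (fop n v) = 0" if "n \<le> K" for n
 proof (rule wt_indep[where X = "{..K}" and f = "\<lambda>n. \<mu> - 2 * int n" and c = "\<lambda>n. fscale (d n) (fop n v)" and \<mu> = "int M"])
  show "(\<Sum>n\<le>K. fscale (d n) (fop n v)) \<in> wtsp S \<rho> (int M)" using v0(1) eq by simp
  show "fscale (d n) (fop n v) \<in> wtsp S \<rho> (\<mu> - 2 * int n)" for n by (intro Wt_scale fop_wt v)
  show "\<mu> - 2 * int n \<noteq> int M" using j j0 by simp
 qed (use that in \<open>auto simp: inj_on_def\<close>)
 then show False using eq v0(2) by simp
qed

abbreviation "vv n \<equiv> fop n v0"

lemma vv_wt: "vv n \<in> wtsp S \<rho> (int M - 2 * int n)"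
 by (rule fop_wt[OF v0(1)])

lemma vv_S: "vv n \<in> S"
 using vv_wt by (simp add: wtsp_def)

text \<open>The Weyl group would reflect the weight \<open>M - 2 n\<close> to
  \<open>2 n - M > M\<close>.\<close>

lemma vv_big:
 assumes "n > M"
 shows "vv n = 0"
proof (rule ccontr)
 assume nz: "vv n \<noteq> 0"
 then have "\<rho> weyl (vv n) \<noteq> 0" using weyl'_weyl[OF vv_S[of n]] \<rho>_0[of weyl'] by auto
 moreover have "\<rho> weyl (vv n) \<in> wtsp S \<rho> (- (int M - 2 * int n))" by (rule wt_weyl[OF vv_wt])
 ultimately obtain j where "- (int M - 2 * int n) = int M - 2 * int j" using highest by blast
 then show False using assms by simp
qed

lemma vv_low: "\<rho> (lower s) v0 = (\<Sum>n\<le>M. fscale (s ^ n) (vv n))"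
proof -
 obtain K where "vexpansion (\<lambda>s. \<rho> (lower s) v0) K vv" using lower_exp[OF v0_S] by blast
 then have "vexpansion (\<lambda>s. \<rho> (lower s) v0) (max K M) vv" by (rule vexpansion_mono) simp
 then have "\<rho> (lower s) v0 = (\<Sum>n\<le>max K M. fscale (s ^ n) (vv n))" by (simp add: vexpansion_def)
 also have "... = (\<Sum>n\<le>M. fscale (s ^ n) (vv n))"
  by (rule sum.mono_neutral_right) (auto simp: vv_big)
 finally show ?thesis .
qed

lemma action_v0_big:
 assumes g: "g \<in> SL2" "ea g \<noteq> 0"
 shows "\<rho> g v0 = (\<Sum>n\<le>M. fscale (ea g ^ (M - n) * ec g ^ n) (vv n))"
 unfolding big_cell[OF v0(1) v0_u g] vv_low fscale_sum fscale_simps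
 using g by (intro sum.cong refl) (simp add: power_divide power_diff)

text \<open>Off the big cell the formula is obtained as a limit: for \<open>t \<noteq> 0\<close> the
  translate by \<open>upsilon t\<close> lies in the big cell, and the constant terms of two
  polynomials in \<open>t\<close> are compared.\<close>

lemma action_v0:
 assumes g: "g \<in> SL2"
 shows "\<rho> g v0 = (\<Sum>n\<le>M. fscale (ea g ^ (M - n) * ec g ^ n) (vv n))"
proof (cases "ea g = 0")
 case False
 then show ?thesis by (rule action_v0_big[OF g])
next
 case True
 have c: "ec g \<noteq> 0" using entries_det[OF g] True by auto
 have gS: "\<rho> g v0 \<in> S" using g v0_S by (simp add: \<rho>_S)
 obtain N where "vexpansion (\<lambda>u. \<rho> (upsilon u) (\<rho> g v0)) N (\<lambda>n. divpow \<rho> n (\<rho> g v0))"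
  using divpow_exp[OF gS] by blast
 then have N: "vexpansion (\<lambda>u. \<rho> (upsilon u) (\<rho> g v0)) (max N M) (\<lambda>n. divpow \<rho> n (\<rho> g v0))"
  by (rule vexpansion_mono) simp
 define y where "y n = (if n \<le> M then fscale (ec g ^ M) (vv (M - n)) else 0)" for n
 have "divpow \<rho> 0 (\<rho> g v0) = y 0"
 proof (rule vpower_sum_unique[where N = "max N M" and n = 0])
  fix t :: 'k assume t: "t \<noteq> 0"
  have h: "upsilon t * g \<in> SL2" "ea (upsilon t * g) = t * ec g" "ec (upsilon t * g) = ec g"
   using g True by (auto simp: SL2_mult, auto elim!: SL2_cases simp: upsilon_def)
  have "(\<Sum>n\<le>max N M. fscale (t ^ n) (divpow \<rho> n (\<rho> g v0))) = \<rho> (upsilon t * g) v0"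
   using N \<rho>_mult[OF _ g v0_S, of "upsilon t"] by (simp add: vexpansion_def)
  also have "... = (\<Sum>n\<le>M. fscale ((t * ec g) ^ (M - n) * ec g ^ n) (vv n))"
   using action_v0_big[OF h(1)] h c t by simp
  also have "... = (\<Sum>n\<le>M. fscale (t ^ n) (fscale (ec g ^ M) (vv (M - n))))"
   by (rule sum.reindex_bij_witness[of _ "\<lambda>n. M - n" "\<lambda>n. M - n"])
    (auto simp: power_mult_distrib mult.assoc simp flip: power_add)
  also have "... = (\<Sum>n\<le>max N M. fscale (t ^ n) (y n))"
   by (rule sum.mono_neutral_cong_left) (auto simp: y_def)
  finally show "(\<Sum>n\<le>max N M. fscale (t ^ n) (divpow \<rho> n (\<rho> g v0))) = (\<Sum>n\<le>max N M. fscale (t ^ n) (y n))" .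
 qed simp
 then have "\<rho> g v0 = fscale (ec g ^ M) (vv M)" using divpow_zero[OF gS] by (simp add: y_def)
 also have "... = (\<Sum>n\<in>{M}. fscale (ea g ^ (M - n) * ec g ^ n) (vv n))" by simp
 also have "... = (\<Sum>n\<le>M. fscale (ea g ^ (M - n) * ec g ^ n) (vv n))"
  by (rule sum.mono_neutral_left) (auto simp: True power_0_left)
 finally show ?thesis .
qed

lemma spanned:
 assumes w: "w \<in> S"
 shows "\<exists>c. w = (\<Sum>n\<le>M. fscale (c n) (vv n))"
proof -
 obtain N :: nat and c g where cg: "\<And>l. l < N ==> g l \<in> SL2" "w = (\<Sum>l<N. fscale (c l) (\<rho> (g l) v0))"
  using generated[OF v0_S v0(2) w] by blast
 have "w = (\<Sum>l<N. \<Sum>n\<le>M. fscale (c l * (ea (g l) ^ (M - n) * ec (g l) ^ n)) (vv n))"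
  unfolding cg(2) by (intro sum.cong refl) (simp add: action_v0 cg(1) fscale_sum)
 also have "... = (\<Sum>n\<le>M. \<Sum>l<N. fscale (c l * (ea (g l) ^ (M - n) * ec (g l) ^ n)) (vv n))" by (rule sum.swap)
 also have "... = (\<Sum>n\<le>M. fscale (\<Sum>l<N. c l * (ea (g l) ^ (M - n) * ec (g l) ^ n)) (vv n))"
  by (intro sum.cong refl) (auto simp: fun_eq_iff sum_fun_apply sum_distrib_right)
 finally show ?thesis by (intro exI[of _ "\<lambda>n. \<Sum>l<N. c l * (ea (g l) ^ (M - n) * ec (g l) ^ n)"])
qed

text \<open>Both sides are the coefficients of \<open>s ^ N\<close> in the action of
  \<open>upsilon u * lower s\<close> on \<open>v0\<close>.\<close>

lemma action_vv:
 assumes N: "N \<le> M"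
 shows "\<rho> (upsilon u) (vv N) = (\<Sum>k\<le>N. fscale (u ^ k) (fscale (of_nat ((M - N + k) choose k)) (vv (N - k))))"
proof (rule vpower_sum_unique[where N = M and c = "\<lambda>N. \<rho> (upsilon u) (vv N)"
   and d = "\<lambda>N. \<Sum>k\<le>N. fscale (u ^ k) (fscale (of_nat ((M - N + k) choose k)) (vv (N - k)))", OF _ N])
 fix s :: 'k
 let ?g = "upsilon u * lower s"
 have "(\<Sum>n\<le>M. fscale (s ^ n) (\<rho> (upsilon u) (vv n))) = \<rho> (upsilon u) (\<rho> (lower s) v0)"
  by (simp add: vv_low \<rho>_sum \<rho>_scale S_fscale vv_S)
 also have "... = \<rho> ?g v0" by (rule \<rho>_mult[symmetric]) (auto simp: v0_S)
 also have "... = (\<Sum>n\<le>M. fscale ((u * s + 1) ^ (M - n) * s ^ n) (vv n))"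
  using action_v0[of ?g] by (simp add: SL2_mult) (simp add: upsilon_def lower_def add.commute)
 also have "... = (\<Sum>n\<le>M. \<Sum>k\<le>M - n. fscale (s ^ (n + k) * (u ^ k * of_nat ((M - n) choose k))) (vv n))"
  by (intro sum.cong refl) (auto simp: binomial_ring fun_eq_iff sum_fun_apply sum_distrib_right sum_distrib_left power_mult_distrib power_add mult_ac)
 also have "... = (\<Sum>(n, k)\<in>(SIGMA n:{..M}. {..M - n}). fscale (s ^ (n + k) * (u ^ k * of_nat ((M - n) choose k))) (vv n))"
  by (simp add: sum.Sigma)
 also have "... = (\<Sum>(N, k)\<in>(SIGMA N:{..M}. {..N}). fscale (s ^ N * (u ^ k * of_nat ((M - N + k) choose k))) (vv (N - k)))"
  by (rule sum.reindex_bij_witness[of _ "\<lambda>(N, k). (N - k, k)" "\<lambda>(n, k). (n + k, k)"]) auto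
 also have "... = (\<Sum>N\<le>M. \<Sum>k\<le>N. fscale (s ^ N * (u ^ k * of_nat ((M - N + k) choose k))) (vv (N - k)))"
  by (rule sum.Sigma[symmetric]) auto
 also have "... = (\<Sum>N\<le>M. fscale (s ^ N) (\<Sum>k\<le>N. fscale (u ^ k) (fscale (of_nat ((M - N + k) choose k)) (vv (N - k)))))"
  by (simp add: fscale_sum)
 finally show "(\<Sum>n\<le>M. fscale (s ^ n) (\<rho> (upsilon u) (vv n))) =
   (\<Sum>N\<le>M. fscale (s ^ N) (\<Sum>k\<le>N. fscale (u ^ k) (fscale (of_nat ((M - N + k) choose k)) (vv (N - k)))))" .
qed

lemma eop_vv:
 assumes N: "N \<le> M"
 shows "eop p \<rho> i (vv N) = (if p ^ i \<le> N then fscale (of_nat ((M - (N - p ^ i)) div p ^ i)) (vv (N - p ^ i)) else 0)"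
proof -
 have "vexpansion (\<lambda>u. \<rho> (upsilon u) (vv N)) N (\<lambda>k. if k \<le> N then fscale (of_nat ((M - N + k) choose k)) (vv (N - k)) else 0)"
  by (rule vexpansion_cut) (rule action_vv[OF N])
 from divpow_eq[OF this, of "p ^ i"]
 have "eop p \<rho> i (vv N) = (if p ^ i \<le> N then fscale (of_nat ((M - N + p ^ i) choose p ^ i)) (vv (N - p ^ i)) else 0)"
  by (simp only: eop_def)
 moreover have "M - N + p ^ i = M - (N - p ^ i)" if "p ^ i \<le> N" using N that by simp
 ultimately show ?thesis
  unfolding choose_prime_power_div[OF chark primep, of "M - N + p ^ i" i] by (cases "p ^ i \<le> N") (simp_all only: if_True if_False simp_thms)
qed

lemma p_ge2: "p \<ge> 2" using primep prime_ge_2_nat by blast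

lemma m_facts: "fin_supp m" "num p m = M" "m i < p"
 using dg_facts[OF p_ge2, of M] p_pos by (auto simp: dg_def)

text \<open>For \<open>s \<le> m\<close> the subtraction of \<open>num p s\<close> from
  \<open>M\<close> needs no borrow, so the difference has the digits
  \<open>m i - s i\<close>.\<close>

lemma le_digits:
 assumes "s \<le> m"
 shows "fin_supp s" "s i < p" "dg p (num p s) = s" "num p s \<le> M" "(of_nat ((M - num p s) div p ^ i) :: 'k) = of_nat (m i - s i)"
proof -
 show s: "fin_supp s" unfolding fin_supp_def
 proof (rule finite_subset)
  show "{i. s i > 0} \<subseteq> {i. m i > 0}" using assms by (auto simp: le_fun_def intro: less_le_trans)
  show "finite {i. m i > 0}" using m_facts(1) by (simp add: fin_supp_def)
 qed
 have sp: "s i < p" for i using le_funD[OF assms, of i] m_facts(3)[of i] by linarith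
 then show "s i < p" .
 show "dg p (num p s) = s" by (rule ext) (rule dg_num[OF sp s])
 define r where "r i = m i - s i" for i
 have r: "fin_supp r" unfolding fin_supp_def
 proof (rule finite_subset)
  show "{i. r i > 0} \<subseteq> {i. m i > 0}" by (auto simp: r_def)
  show "finite {i. m i > 0}" using m_facts(1) by (simp add: fin_supp_def)
 qed
 have "(\<lambda>i. s i + r i) = m" using assms by (auto simp: r_def le_fun_def fun_eq_iff)
 then have M: "M = num p s + num p r" using num_add[OF s r, of p] m_facts(2) by simp
 then show "num p s \<le> M" by simp
 have "r i < p" for i using m_facts(3)[of i] by (simp add: r_def less_imp_diff_less)
 from num_div_pow[where 'k = 'k, OF this r chark, of i]
 show "(of_nat ((M - num p s) div p ^ i) :: 'k) = of_nat (m i - s i)" using M by (simp add: r_def)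
qed

lemma inc_le: "inc i s \<le> m \<longleftrightarrow> s \<le> m \<and> s i < m i"
proof
 assume h: "inc i s \<le> m"
 have "s l \<le> m l" for l using le_funD[OF h, of l] by (cases "l = i") auto
 moreover have "s i < m i" using le_funD[OF h, of i] by simp
 ultimately show "s \<le> m \<and> s i < m i" by (simp add: le_fun_def)
qed (auto simp: le_fun_def inc_def)

lemma of_digit_0: "(of_nat (m i - s i) :: 'k) = 0 \<longleftrightarrow> m i - s i = 0"
 using of_nat_nz[OF chark, of "m i - s i"] m_facts(3)[of i] by (cases "m i - s i = 0") auto

text \<open>A nonzero factor in \<open>eop_vv\<close> means that digit \<open>i\<close> is still
  below \<open>m i\<close>; adding \<open>p ^ i\<close> then causes no carry.\<close>

lemma step_up:
 assumes N: "N \<le> M" "p ^ i \<le> N" and le: "dg p (N - p ^ i) \<le> m" and c: "(of_nat ((M - (N - p ^ i)) div p ^ i) :: 'k) \<noteq> 0"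
 shows "dg p N = inc i (dg p (N - p ^ i))" "dg p N \<le> m"
proof -
 let ?s = "dg p (N - p ^ i)"
 have n: "num p ?s = N - p ^ i" using dg_facts[OF p_ge2] by blast
 have "m i - ?s i \<noteq> 0" using c le_digits(5)[OF le, of i] of_digit_0[of i ?s] unfolding n by simp
 then have il: "inc i ?s \<le> m" using le by (simp add: inc_le)
 have "num p (inc i ?s) = N" using num_inc[OF le_digits(1)[OF le], of p i] n N(2) by simp
 then show "dg p N = inc i ?s" using le_digits(3)[OF il] by simp
 then show "dg p N \<le> m" using il by simp
qed

text \<open>For \<open>N > 0\<close> a nonzero \<open>vv N\<close> has weight below \<open>M\<close>
  and is therefore not fixed by \<open>U\<close>. Some \<open>e i\<close> moves it to a nonzero
  multiple of \<open>vv (N - p ^ i)\<close>, whose digits are known by induction. With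
  \<open>vv_nz\<close> this takes the place of Steinberg's tensor product theorem.\<close>

lemma vv_support: "vv N \<noteq> 0 ==> dg p N \<le> m"
proof (induction N rule: less_induct)
 case (less N)
 have N: "N \<le> M" using less.prems vv_big by (meson not_le)
 show ?case
 proof (cases "N = 0")
  case True
  then show ?thesis by (simp add: dg_def le_fun_def)
 next
  case False
  have "\<exists>i. eop p \<rho> i (vv N) \<noteq> 0"
  proof (rule ccontr)
   assume "\<not> ?thesis"
   then have "\<rho> (upsilon u) (vv N) = vv N" for u by (intro eop_all_0 vv_S) blast
   from invariant_weight[OF vv_wt less.prems this] False show False by simp
  qed
  then obtain i where nz: "eop p \<rho> i (vv N) \<noteq> 0" by blast
  then have i: "p ^ i \<le> N" "eop p \<rho> i (vv N) = fscale (of_nat ((M - (N - p ^ i)) div p ^ i)) (vv (N - p ^ i))"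
   using eop_vv[OF N, of i] by (auto split: if_splits)
  then have "(of_nat ((M - (N - p ^ i)) div p ^ i) :: 'k) \<noteq> 0" "vv (N - p ^ i) \<noteq> 0" using nz by auto
  moreover have "N - p ^ i < N" using False p_pos by simp
  ultimately show ?thesis using step_up(2)[OF N i(1)] less.IH by blast
 qed
qed

text \<open>Lowering one digit at a time with the operators \<open>e i\<close> multiplies by units
  and ends at \<open>v0\<close>.\<close>

lemma vv_nz: "s \<le> m ==> vv (num p s) \<noteq> 0"
proof (induction "num p s" arbitrary: s rule: less_induct)
 case less
 note sf = le_digits(1)[OF less.prems]
 show ?case
 proof (cases "\<exists>i. s i > 0")
  case False
  then have "num p s = 0" by (simp add: num_def)
  then show ?thesis using v0(2) fop_0[OF v0_S] by simp
 next
  case True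
  then obtain i where i: "s i > 0" by blast
  let ?s = "dec i s"
  have eq: "inc i ?s = s" using i by simp
  then have dl: "?s \<le> m" "?s i < m i" using less.prems inc_le[of i ?s] by auto
  have fs: "fin_supp ?s" using sf fin_supp_inc[of i ?s] eq by simp
  have n: "num p s = num p ?s + p ^ i" using num_inc[OF fs, of p i] eq by simp
  have IH: "vv (num p ?s) \<noteq> 0" using less.hyps[of ?s] n p_pos dl(1) by simp
  have "eop p \<rho> i (vv (num p s)) = fscale (of_nat ((M - num p ?s) div p ^ i)) (vv (num p ?s))"
   using eop_vv[OF le_digits(4)[OF less.prems], of i] n by simp
  moreover have "(of_nat ((M - num p ?s) div p ^ i) :: 'k) \<noteq> 0"
   using le_digits(5)[OF dl(1), of i] of_digit_0[of i ?s] dl(2) by simp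
  ultimately have "eop p \<rho> i (vv (num p s)) \<noteq> 0" using IH by (auto simp: fun_eq_iff)
  then show ?thesis by auto
 qed
qed

sublocale dig: digit_setup p m "UNIV :: (unit => 'k) set" "\<lambda>\<nu>. if \<nu> = int (num p m) then UNIV else {0}"
proof
 show "CHAR('k) = p" "prime p" by (rule chark, rule primep)
 show "m i < p" for i by (rule m_facts)
qed auto

abbreviation "DS \<equiv> digit_space m (UNIV :: (unit => 'k) set)"
abbreviation "DW \<equiv> digit_Wt p m (UNIV :: (unit => 'k) set) (\<lambda>\<nu>. if \<nu> = int (num p m) then UNIV else {0})"

definition psi :: "((nat => nat) \<times> unit => 'k) => 'i => 'k" where
 "psi f = (\<Sum>N\<le>M. fscale (f (dg p N, ())) (vv N))"

lemma psi_add: "psi (f + g) = psi f + psi g"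
 by (simp add: psi_def fscale_add_left sum.distrib)

lemma psi_scale: "psi (fscale c f) = fscale c (psi f)"
 by (simp add: psi_def fscale_sum)

lemma psi_S: "psi f \<in> S"
 unfolding psi_def by (intro S_sum0 S_fscale vv_S)

lemma psi_wt:
 assumes f: "f \<in> DW \<mu>"
 shows "psi f \<in> wtsp S \<rho> \<mu>"
 unfolding psi_def
proof (rule Wt_sum)
 fix N
 show "fscale (f (dg p N, ())) (vv N) \<in> wtsp S \<rho> \<mu>"
 proof (cases "f (dg p N, ()) = 0")
  case True
  then show ?thesis using Wt_0 by simp
 next
  case False
  have "slice f (dg p N) \<in> (if \<mu> + 2 * int (num p (dg p N)) = int (num p m) then UNIV else {0})"
   using f by (simp add: digit_Wt_def)
  then have "\<mu> + 2 * int (num p (dg p N)) = int (num p m)"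
   using False by (auto simp: slice_def fun_eq_iff split: if_splits)
  then have "\<mu> = int M - 2 * int N" using dg_facts[OF p_ge2, of N] m_facts(2) by simp
  then show ?thesis using vv_wt by (simp add: Wt_scale)
 qed
qed

lemma psi_e:
 assumes f: "f \<in> DS"
 shows "psi (digit_e m i f) = eop p \<rho> i (psi f)"
proof -
 let ?c = "\<lambda>N. of_nat ((M - N) div p ^ i) :: 'k"
 let ?t = "\<lambda>N. fscale (f (dg p (N + p ^ i), ()) * ?c N) (vv N)"
 have f0: "f (s, ()) = 0" if "\<not> s \<le> m" for s
 proof -
  have "slice f s = 0" using dig.S_D(3)[OF f, of s] that by blast
  then show ?thesis using slice_eq_0D[of f s "()"] by simp
 qed
 have "eop p \<rho> i (psi f) = (\<Sum>N\<le>M. fscale (f (dg p N, ())) (eop p \<rho> i (vv N)))"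
  unfolding psi_def eop_def by (subst divpow_sum) (auto simp: S_fscale vv_S divpow_scale)
 also have "... = (\<Sum>N\<in>{p ^ i..M}. fscale (f (dg p N, ())) (eop p \<rho> i (vv N)))"
  by (rule sum.mono_neutral_right) (auto simp: eop_vv)
 also have "... = (\<Sum>N\<in>{N. N + p ^ i \<le> M}. ?t N)"
  by (rule sum.reindex_bij_witness[of _ "\<lambda>N. N + p ^ i" "\<lambda>N. N - p ^ i"]) (auto simp: eop_vv)
 also have "... = (\<Sum>N\<le>M. fscale (digit_e m i f (dg p N, ())) (vv N))"
 proof (rule sum.mono_neutral_cong_left)
  show "\<forall>N\<in>{..M} - {N. N + p ^ i \<le> M}. fscale (digit_e m i f (dg p N, ())) (vv N) = 0"
  proof
   fix N assume N: "N \<in> {..M} - {N. N + p ^ i \<le> M}"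
   show "fscale (digit_e m i f (dg p N, ())) (vv N) = 0"
   proof (cases "inc i (dg p N) \<le> m")
    case True
    have "num p (inc i (dg p N)) = N + p ^ i" using num_inc dg_facts[OF p_ge2, of N] by metis
    then show ?thesis using le_digits(4)[OF True] N by simp
   qed (simp add: digit_e_def f0)
  qed
  fix N assume "N \<in> {N. N + p ^ i \<le> M}"
  then have N: "N + p ^ i \<le> M" by simp
  show "?t N = fscale (digit_e m i f (dg p N, ())) (vv N)"
  proof (cases "vv N = 0")
   case False
   then have le: "dg p N \<le> m" by (rule vv_support)
   have n: "num p (dg p N) = N" using dg_facts[OF p_ge2] by blast
   have c: "?c N = of_nat (m i - dg p N i)" using le_digits(5)[OF le, of i] n by simp
   show ?thesis
   proof (cases "?c N = 0")
    case True
    then show ?thesis using c by (simp add: digit_e_def)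
   next
    case False
    then have "dg p (N + p ^ i) = inc i (dg p N)" using step_up(1)[of "N + p ^ i" i] N le by simp
    then show ?thesis using c by (simp add: digit_e_def mult.commute)
   qed
  qed simp
 qed auto
 finally show ?thesis by (simp add: psi_def)
qed

lemma psi_indep:
 assumes f: "psi f \<in> wtsp S \<rho> \<mu>" and s: "s \<le> m" "\<mu> \<noteq> int M - 2 * int (num p s)"
 shows "f (s, ()) = 0"
proof -
 have "fscale (f (dg p (num p s), ())) (vv (num p s)) = 0"
 proof (rule wt_indep[where X = "{..M}" and f = "\<lambda>n. int M - 2 * int n" and c = "\<lambda>N. fscale (f (dg p N, ())) (vv N)" and \<mu> = \<mu>])
  show "(\<Sum>N\<le>M. fscale (f (dg p N, ())) (vv N)) \<in> wtsp S \<rho> \<mu>" using f by (simp add: psi_def)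
  show "fscale (f (dg p N, ())) (vv N) \<in> wtsp S \<rho> (int M - 2 * int N)" for N by (intro Wt_scale vv_wt)
 qed (use s le_digits(4)[OF s(1)] in \<open>auto simp: inj_on_def\<close>)
 then show ?thesis using vv_nz[OF s(1)] le_digits(3)[OF s(1)] by (auto simp: fun_eq_iff)
qed

lemma psi_inj:
 assumes f: "f \<in> DS" and 0: "psi f = 0"
 shows "f = 0"
proof (rule ext, clarify)
 fix s :: "nat => nat"
 show "f (s, ()) = 0 (s, ())"
 proof (cases "s \<le> m")
  case True
  \<comment> \<open>This weight has the wrong parity and so differs from every weight that occurs,
    while 0 belongs to all weight spaces.\<close>
  have "psi f \<in> wtsp S \<rho> (int M - 2 * int (num p s) + 1)" using 0 Wt_0 by simp
  from psi_indep[OF this True] show ?thesis by simp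
 next
  case False
  then have "slice f s = 0" using dig.S_D(3)[OF f, of s] by blast
  then show ?thesis using slice_eq_0D[of f s "()"] by simp
 qed
qed

lemma psi_surj:
 assumes w: "w \<in> wtsp S \<rho> \<mu>"
 shows "\<exists>f\<in>DW \<mu>. psi f = w"
proof -
 obtain c where c: "w = (\<Sum>N\<le>M. fscale (c N) (vv N))" using spanned w by (auto simp: wtsp_def)
 \<comment> \<open>The coefficients \<open>c\<close> are not unique. Only those at digits below
   \<open>m\<close> and of weight \<open>\<mu>\<close> are kept; the terms of all others are
   0.\<close>
 define f where "f = (\<lambda>(s :: nat => nat, j :: unit). if s \<le> m \<and> \<mu> = int M - 2 * int (num p s) then c (num p s) else 0)"
 have nz: "s \<le> m \<and> \<mu> = int M - 2 * int (num p s)" if "slice f s \<noteq> 0" for s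
  using that by (auto simp: slice_def f_def fun_eq_iff split: if_splits)
 have "f \<in> DS"
 proof (rule dig.S_I[of "dg p ` {..M}"])
  fix s assume "slice f s \<noteq> 0"
  then have "s \<le> m" using nz by blast
  then show "s \<in> dg p ` {..M} \<and> fin_supp s \<and> s \<le> m"
   using le_digits(1,3,4)[of s] by (auto intro!: image_eqI[of _ _ "num p s"])
 qed auto
 then have "f \<in> DW \<mu>"
  using nz m_facts(2) by (force simp: digit_Wt_def)
 moreover have "psi f = w"
  unfolding psi_def c
 proof (rule sum.cong[OF refl])
  fix N assume N: "N \<in> {..M}"
  show "fscale (f (dg p N, ())) (vv N) = fscale (c N) (vv N)"
  proof (cases "vv N = 0")
   case False
   have n: "num p (dg p N) = N" using dg_facts[OF p_ge2] by blast
   show ?thesis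
   proof (cases "\<mu> = int M - 2 * int N")
    case True
    then show ?thesis using vv_support[OF False] n by (simp add: f_def)
   next
    case ne: False
    have "fscale (c N) (vv N) = 0"
    proof (rule wt_indep[where X = "{..M}" and f = "\<lambda>n. int M - 2 * int n" and c = "\<lambda>N. fscale (c N) (vv N)" and \<mu> = \<mu>])
     show "(\<Sum>N\<le>M. fscale (c N) (vv N)) \<in> wtsp S \<rho> \<mu>" using w c by simp
     show "fscale (c N) (vv N) \<in> wtsp S \<rho> (int M - 2 * int N)" for N by (intro Wt_scale vv_wt)
    qed (use N ne in \<open>auto simp: inj_on_def\<close>)
    then show ?thesis using ne n by (simp add: f_def)
   qed
  qed simp
 qed
 ultimately show ?thesis by blast
qed

sublocale psi: graded_map p DS "digit_e m" DW S "eop p \<rho>" "wtsp S \<rho>" psi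
proof unfold_locales
 show "psi v \<in> S" for v by (rule psi_S)
 show "psi (v + w) = psi v + psi w" for v w by (rule psi_add)
qed (fact psi_e psi_wt)+

theorem quot_dim_simple:
 assumes "finite (solutions p m q)"
 shows "quot_dim cscale (cocyc p (eop p \<rho>) (wtsp S \<rho>) (int q)) (cobd p (eop p \<rho>) (wtsp S \<rho>) (int q)) (card (solutions p m q))"
proof -
 have "quot_dim (\<lambda>c z r. fscale c (z r)) (cocyc p (eop p \<rho>) (wtsp S \<rho>) (int q)) (cobd p (eop p \<rho>) (wtsp S \<rho>) (int q)) (card (solutions p m q))"
 proof (rule psi.quot_dim_iso[where s = fscale])
  show "v = 0" if "v \<in> DS" "psi v = 0" for v using that by (rule psi_inj)
  show "\<exists>v\<in>DW \<mu>. psi v = w" if "w \<in> wtsp S \<rho> \<mu>" for w \<mu> using that by (rule psi_surj)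
  show "psi (fscale c v) = fscale c (psi v)" for c v by (rule psi_scale)
  show "(\<lambda>r. fscale c (z r)) \<in> cocyc p (digit_e m) DW (int q)" if "z \<in> cocyc p (digit_e m) DW (int q)" for c z
   using dig.cocyc_scale[OF that, of c] by (simp only: cscale_def)
  show "quot_dim (\<lambda>c z r. fscale c (z r)) (cocyc p (digit_e m) DW (int q)) (cobd p (digit_e m) DW (int q)) (card (solutions p m q))"
  proof -
   have "simple_digit_setup TYPE('k) p m"
    unfolding simple_digit_setup_def simple_digit_setup_axioms_def using dig.digit_setup_axioms m_facts(1) by blast
   from simple_digit_setup.quot_dim_digit[OF this assms] show ?thesis by (simp only: cscale_def[abs_def])
  qed
 qed
 then show ?thesis by (simp only: cscale_def[abs_def])
qed

end

subsection \<open>Vector spaces as spaces of functions\<close>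

lemma vector_space_fscale: "vector_space (fscale :: 'k::field => ('x => 'k) => 'x => 'k)"
 by unfold_locales (auto simp: fscale_add fscale_add_left)

text \<open>The choice of a complement of \<open>K\<close>; below it serves in place of quotient
  spaces and of extensions of linear maps.\<close>

lemma subspace_projection:
 fixes K :: "('x => 'k::field) set"
 assumes "0 \<in> K" "\<And>v w. v \<in> K ==> w \<in> K ==> v + w \<in> K" "\<And>c v. v \<in> K ==> fscale c v \<in> K"
 shows "\<exists>g. (\<forall>f. g f \<in> K) \<and> (\<forall>f\<in>K. g f = f) \<and> (\<forall>f h. g (f + h) = g f + g h) \<and> (\<forall>c f. g (fscale c f) = fscale c (g f))"
proof -
 interpret vector_space "fscale :: 'k => ('x => 'k) => 'x => 'k" by (rule vector_space_fscale)
 interpret pr: vector_space_pair "fscale :: 'k => ('x => 'k) => 'x => 'k" "fscale :: 'k => ('x => 'k) => 'x => 'k" ..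
 have "subspace K" using assms by (simp add: subspace_def)
 then obtain g where g: "g ` UNIV \<subseteq> K" "Vector_Spaces.linear fscale fscale g" "\<forall>v\<in>K. g (id v) = v"
  using pr.linear_exists_left_inverse_on[OF linear_id _ inj_on_id] by blast
 interpret g: Vector_Spaces.linear fscale fscale g by (rule g(2))
 show ?thesis using g(1,3) g.add g.scale by (intro exI[of _ g]) auto
qed

text \<open>A linear isomorphism \<open>\<beta>\<close> from a space given by a record onto a
  subspace of a function type, whose operations are those of the type classes.\<close>

definition fn_model :: "('k::field, 'v, 'm) module_scheme => ('v => 'x => 'k) => ('x => 'k) set => bool" where
 "fn_model V \<beta> S \<longleftrightarrow> \<beta> ` carrier V = S \<and> inj_on \<beta> (carrier V) \<and> \<zero>\<^bsub>V\<^esub> \<in> carrier V \<and> \<beta> \<zero>\<^bsub>V\<^esub> = 0 \<and>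
  (\<forall>x\<in>carrier V. \<forall>y\<in>carrier V. x \<oplus>\<^bsub>V\<^esub> y \<in> carrier V \<and> \<beta> (x \<oplus>\<^bsub>V\<^esub> y) = \<beta> x + \<beta> y) \<and>
  (\<forall>c. \<forall>x\<in>carrier V. c \<odot>\<^bsub>V\<^esub> x \<in> carrier V \<and> \<beta> (c \<odot>\<^bsub>V\<^esub> x) = fscale c (\<beta> x))"

lemma fn_modelD:
 assumes "fn_model V \<beta> S"
 shows "\<beta> ` carrier V = S" "inj_on \<beta> (carrier V)" "\<zero>\<^bsub>V\<^esub> \<in> carrier V" "\<beta> \<zero>\<^bsub>V\<^esub> = 0"
  "x \<in> carrier V ==> y \<in> carrier V ==> x \<oplus>\<^bsub>V\<^esub> y \<in> carrier V" "x \<in> carrier V ==> y \<in> carrier V ==> \<beta> (x \<oplus>\<^bsub>V\<^esub> y) = \<beta> x + \<beta> y"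
  "x \<in> carrier V ==> c \<odot>\<^bsub>V\<^esub> x \<in> carrier V" "x \<in> carrier V ==> \<beta> (c \<odot>\<^bsub>V\<^esub> x) = fscale c (\<beta> x)"
  "x \<in> carrier V ==> y \<in> carrier V ==> \<beta> x = \<beta> y ==> x = y"
  "x \<in> carrier V ==> \<beta> x = 0 \<longleftrightarrow> x = \<zero>\<^bsub>V\<^esub>" "x \<in> carrier V ==> \<beta> x \<in> S"
proof -
 note d = assms[unfolded fn_model_def]
 show 1: "\<beta> ` carrier V = S" "inj_on \<beta> (carrier V)" "\<zero>\<^bsub>V\<^esub> \<in> carrier V" "\<beta> \<zero>\<^bsub>V\<^esub> = 0"
  using d by blast+
 assume x: "x \<in> carrier V"
 show "c \<odot>\<^bsub>V\<^esub> x \<in> carrier V" "\<beta> (c \<odot>\<^bsub>V\<^esub> x) = fscale c (\<beta> x)" "\<beta> x \<in> S" using d x by blast+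
 show "\<beta> x = 0 \<longleftrightarrow> x = \<zero>\<^bsub>V\<^esub>" using inj_onD[OF 1(2) _ x 1(3)] 1(4) by auto
 assume y: "y \<in> carrier V"
 show "x \<oplus>\<^bsub>V\<^esub> y \<in> carrier V" "\<beta> (x \<oplus>\<^bsub>V\<^esub> y) = \<beta> x + \<beta> y" using d x y by blast+
 assume "\<beta> x = \<beta> y"
 then show "x = y" using inj_onD[OF 1(2) _ x y] by blast
qed

lemma fn_model_space:
 assumes m: "fn_model V \<beta> S"
 shows "0 \<in> S" "v \<in> S ==> w \<in> S ==> v + w \<in> S" "v \<in> S ==> fscale c v \<in> S"
proof -
 note f = fn_modelD[OF m]
 show "0 \<in> S" using f(11)[OF f(3)] f(4) by simp
 assume "v \<in> S"
 then obtain x where x: "x \<in> carrier V" "v = \<beta> x" using f(1) by blast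
 show "fscale c v \<in> S" using f(11)[OF f(7)[OF x(1)], of c] f(8)[OF x(1), of c] x(2) by simp
 assume "w \<in> S"
 then obtain y where y: "y \<in> carrier V" "w = \<beta> y" using f(1) by blast
 show "v + w \<in> S" using f(11)[OF f(5)[OF x(1) y(1)]] f(6)[OF x(1) y(1)] x(2) y(2) by simp
qed

lemma fn_model_vectorspace:
 assumes m: "fn_model V \<beta> S"
 shows "vectorspace class_ring V"
proof -
 note f = fn_modelD[OF m]
 have eq: "x = y" if "\<beta> x = \<beta> y" "x \<in> carrier V" "y \<in> carrier V" for x y using f(9)[OF that(2,3,1)] .
 have neg: "\<exists>w\<in>carrier V. v \<oplus>\<^bsub>V\<^esub> w = \<zero>\<^bsub>V\<^esub>" if v: "v \<in> carrier V" for v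
 proof (rule bexI)
  show c: "(- 1) \<odot>\<^bsub>V\<^esub> v \<in> carrier V" by (rule f(7)[OF v])
  show "v \<oplus>\<^bsub>V\<^esub> ((- 1) \<odot>\<^bsub>V\<^esub> v) = \<zero>\<^bsub>V\<^esub>"
   using f(6)[OF v c] f(8)[OF v, of "- 1"] by (intro eq f(3) f(5) v c) (simp add: f(4) fun_eq_iff)
 qed
 have comm: "v \<oplus>\<^bsub>V\<^esub> w = w \<oplus>\<^bsub>V\<^esub> v" if "v \<in> carrier V" "w \<in> carrier V" for v w
  using f(5,6)[OF that] f(5,6)[OF that(2,1)] by (intro eq) (simp_all only: add.commute)
 have assoc: "(v \<oplus>\<^bsub>V\<^esub> w) \<oplus>\<^bsub>V\<^esub> x = v \<oplus>\<^bsub>V\<^esub> (w \<oplus>\<^bsub>V\<^esub> x)" if v: "v \<in> carrier V" and w: "w \<in> carrier V" and x: "x \<in> carrier V" for v w x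
  by (rule eq) (simp_all only: f(5,6) v w x add.assoc)
 have r0: "v \<oplus>\<^bsub>V\<^esub> \<zero>\<^bsub>V\<^esub> = v" if v: "v \<in> carrier V" for v
  by (rule eq) (simp_all only: f(3-6) v add_0_right)
 have sm: "(a * b) \<odot>\<^bsub>V\<^esub> v = a \<odot>\<^bsub>V\<^esub> (b \<odot>\<^bsub>V\<^esub> v)" "1 \<odot>\<^bsub>V\<^esub> v = v" "(a + b) \<odot>\<^bsub>V\<^esub> v = a \<odot>\<^bsub>V\<^esub> v \<oplus>\<^bsub>V\<^esub> b \<odot>\<^bsub>V\<^esub> v"
  if v: "v \<in> carrier V" for v a b
  by (rule eq; simp only: f(5-8) v fscale_simps fscale_add_left)+
 have sa: "a \<odot>\<^bsub>V\<^esub> (v \<oplus>\<^bsub>V\<^esub> w) = a \<odot>\<^bsub>V\<^esub> v \<oplus>\<^bsub>V\<^esub> a \<odot>\<^bsub>V\<^esub> w" if v: "v \<in> carrier V" and w: "w \<in> carrier V" for v w a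
  by (rule eq) (simp_all only: f(5-8) v w fscale_add)
 show ?thesis
 proof (rule vs_criteria)
  show "\<forall>v w x. v \<in> carrier V \<and> w \<in> carrier V \<and> x \<in> carrier V \<longrightarrow> (v \<oplus>\<^bsub>V\<^esub> w) \<oplus>\<^bsub>V\<^esub> x = v \<oplus>\<^bsub>V\<^esub> (w \<oplus>\<^bsub>V\<^esub> x)"
   using assoc by blast
  show "\<forall>v w. v \<in> carrier V \<and> w \<in> carrier V \<longrightarrow> v \<oplus>\<^bsub>V\<^esub> w = w \<oplus>\<^bsub>V\<^esub> v" using comm by blast
 qed (simp_all add: class_field f(3,5,7) neg r0 sm sa)
qed

locale vs_functions = vectorspace class_ring V for V :: "('k::field, 'v, 'm) module_scheme" (structure)
begin

definition FS :: "('v => 'k) set" where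
 "FS = {f. finite {x. f x \<noteq> 0} \<and> {x. f x \<noteq> 0} \<subseteq> carrier V}"

definition ev :: "('v => 'k) => 'v" where
 "ev f = lincomb f {x. f x \<noteq> 0}"

lemma ev_eq:
 assumes "finite A" "A \<subseteq> carrier V" "{x. f x \<noteq> 0} \<subseteq> A"
 shows "ev f = lincomb f A"
 unfolding ev_def lincomb_def
proof (rule add.finprod_mono_neutral_cong_left)
 show "f x \<odot>\<^bsub>V\<^esub> x = \<zero>\<^bsub>V\<^esub>" if "x \<in> A - {x. f x \<noteq> 0}" for x
 proof -
  have "x \<in> carrier V" "f x = 0" using that assms(2) by auto
  then show ?thesis using lmult_0[of x] by simp
 qed
qed (use assms in auto)

lemma ev_closed: "f \<in> FS ==> ev f \<in> carrier V"
 unfolding ev_def by (rule lincomb_closed) (auto simp: FS_def)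

lemma FS_add: "f \<in> FS ==> h \<in> FS ==> f + h \<in> FS"
proof -
 assume "f \<in> FS" "h \<in> FS"
 moreover have "{x. (f + h) x \<noteq> 0} \<subseteq> {x. f x \<noteq> 0} \<union> {x. h x \<noteq> 0}" by auto
 ultimately show ?thesis unfolding FS_def using finite_subset[OF _ finite_UnI] by blast
qed

lemma FS_scale: "f \<in> FS ==> fscale c f \<in> FS"
 unfolding FS_def by (auto elim: rev_finite_subset)

lemma ev_add:
 assumes f: "f \<in> FS" "h \<in> FS"
 shows "ev (f + h) = ev f \<oplus> ev h"
proof -
 let ?A = "{x. f x \<noteq> 0} \<union> {x. h x \<noteq> 0}"
 have A: "finite ?A" "?A \<subseteq> carrier V" using f by (auto simp: FS_def)
 have "ev (f + h) = lincomb (f + h) ?A" by (rule ev_eq[OF A]) auto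
 also have "... = lincomb f ?A \<oplus> lincomb h ?A"
  using lincomb_sum[OF A, of f h] by (simp add: class_ring_simps plus_fun_def)
 also have "lincomb f ?A = ev f" by (rule ev_eq[OF A, symmetric]) auto
 also have "lincomb h ?A = ev h" by (rule ev_eq[OF A, symmetric]) auto
 finally show ?thesis .
qed

lemma ev_scale:
 assumes f: "f \<in> FS"
 shows "ev (fscale c f) = c \<odot>\<^bsub>V\<^esub> ev f"
proof -
 let ?A = "{x. f x \<noteq> 0}"
 have A: "finite ?A" "?A \<subseteq> carrier V" using f by (auto simp: FS_def)
 have "ev (fscale c f) = lincomb (fscale c f) ?A" by (rule ev_eq[OF A]) auto
 also have "... = c \<odot>\<^bsub>V\<^esub> lincomb f ?A"
  using lincomb_smult[OF A(2), of f c] by (simp add: fscale_def)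
 finally show ?thesis by (simp add: ev_def)
qed

definition delta :: "'v => 'v => 'k" where "delta v = (\<lambda>x. if x = v then 1 else 0)"

lemma delta_FS: "v \<in> carrier V ==> delta v \<in> FS"
 by (simp add: FS_def delta_def)

lemma ev_delta: "v \<in> carrier V ==> ev (delta v) = v"
proof -
 assume v: "v \<in> carrier V"
 have "ev (delta v) = lincomb (delta v) {v}" by (rule ev_eq) (auto simp: v delta_def)
 also have "... = (\<Oplus>x\<in>{v}. x)" unfolding lincomb_def using v smult_one[OF v]
  by (intro finsum_cong') (auto simp: delta_def)
 finally show ?thesis using v by simp
qed

text \<open>\<open>V\<close> is the quotient of the free space on its elements by the kernel
  \<open>?K\<close> of evaluation, and a complement of \<open>?K\<close> realizes this quotient
  inside the free space. The functions are indexed by \<open>'v\<close> itself.\<close>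

lemma model_exists: "\<exists>\<beta> :: 'v => 'v => 'k. \<exists>S. fn_model V \<beta> S"
proof -
 let ?K = "{f \<in> FS. ev f = \<zero>}"
 have z: "(0 :: 'v => 'k) \<in> FS" by (simp add: FS_def)
 have ez: "ev 0 = \<zero>" by (simp add: ev_def lincomb_def)
 have s0: "c \<odot>\<^bsub>V\<^esub> \<zero> = \<zero>" for c using smult_r_null[of c] by simp
 have "\<exists>g. (\<forall>f. g f \<in> ?K) \<and> (\<forall>f\<in>?K. g f = f) \<and> (\<forall>f h. g (f + h) = g f + g h) \<and> (\<forall>c f. g (fscale c f) = fscale c (g f))"
  by (rule subspace_projection) (auto simp: z ez FS_add FS_scale ev_add ev_scale s0)
 then obtain g where g: "\<And>f. g f \<in> ?K" "\<And>f. f \<in> ?K ==> g f = f" "\<And>f h. g (f + h) = g f + g h" "\<And>c f. g (fscale c f) = fscale c (g f)"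
  by blast
 define T where "T f = f - g f" for f
 have T: "T (a + b) = T a + T b" "T (fscale c a) = fscale c (T a)" for a b c
  using g by (auto simp: T_def fun_eq_iff algebra_simps)
 have T0: "T f = 0 \<longleftrightarrow> ev f = \<zero>" if "f \<in> FS" for f
  using g(1)[of f] g(2)[of f] that by (auto simp: T_def)
 have neg: "(- 1) \<odot>\<^bsub>V\<^esub> v = \<ominus> v" if "v \<in> carrier V" for v
  using smult_l_minus[of 1 v] smult_one[OF that] that by (simp add: class_ring_simps)
 have eq: "T a = T b \<longleftrightarrow> ev a = ev b" if ab: "a \<in> FS" "b \<in> FS" for a b
 proof -
  have "T a = T b \<longleftrightarrow> T (a + fscale (- 1) b) = 0"
   unfolding T by (auto simp: fun_eq_iff)
  also have "... \<longleftrightarrow> ev (a + fscale (- 1) b) = \<zero>" by (intro T0 FS_add FS_scale ab)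
  also have "ev (a + fscale (- 1) b) = ev a \<ominus> ev b"
   using ab neg[OF ev_closed[OF ab(2)]] by (simp add: ev_add ev_scale FS_scale a_minus_def)
  also have "ev a \<ominus> ev b = \<zero> \<longleftrightarrow> ev a = ev b"
  proof
   assume "ev a \<ominus> ev b = \<zero>"
   then have "ev a \<oplus> (\<ominus> ev b) = \<zero>" by (simp only: a_minus_def)
   from M.minus_equality[OF this _ ev_closed[OF ab(1)]] show "ev a = ev b" using ev_closed[OF ab(2)] by simp
  next
   assume "ev a = ev b"
   then show "ev a \<ominus> ev b = \<zero>" using M.r_neg[OF ev_closed[OF ab(2)]] by (simp only: a_minus_def)
  qed
  finally show ?thesis .
 qed
 define \<beta> where "\<beta> v = T (delta v)" for v
 have "\<beta> \<zero> = T 0" unfolding \<beta>_def using eq[of "delta \<zero>" 0] by (simp add: z ez delta_FS ev_delta)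
 also have "T 0 = 0" using T0[OF z] ez by simp
 finally have "\<beta> \<zero> = 0" .
 moreover have "\<beta> (x \<oplus> y) = \<beta> x + \<beta> y" if "x \<in> carrier V" "y \<in> carrier V" for x y
  unfolding \<beta>_def T(1)[symmetric] using that eq[of "delta (x \<oplus> y)" "delta x + delta y"]
  by (simp add: delta_FS FS_add ev_add ev_delta)
 moreover have "\<beta> (c \<odot>\<^bsub>V\<^esub> x) = fscale c (\<beta> x)" if "x \<in> carrier V" for c x
 proof -
  have cx: "c \<odot>\<^bsub>V\<^esub> x \<in> carrier V" using that by simp
  show ?thesis unfolding \<beta>_def T(2)[symmetric] using that cx eq[of "delta (c \<odot>\<^bsub>V\<^esub> x)" "fscale c (delta x)"]
   by (simp add: delta_FS FS_scale ev_scale ev_delta)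
 qed
 moreover have "inj_on \<beta> (carrier V)"
  by (rule inj_onI) (use eq delta_FS ev_delta in \<open>force simp: \<beta>_def\<close>)
 ultimately have "fn_model V \<beta> (\<beta> ` carrier V)" unfolding fn_model_def by auto
 then show ?thesis by blast
qed

end

lemma fn_model_finsum:
 assumes m: "fn_model V \<beta> S" and A: "finite A" "f \<in> A \<rightarrow> carrier V"
 shows "finsum V f A \<in> carrier V" "\<beta> (finsum V f A) = (\<Sum>a\<in>A. \<beta> (f a))"
proof -
 interpret vectorspace class_ring V by (rule fn_model_vectorspace[OF m])
 show "finsum V f A \<in> carrier V" using A(2) by (rule finsum_closed)
 show "\<beta> (finsum V f A) = (\<Sum>a\<in>A. \<beta> (f a))"
  using A
 proof (induction A)
  case (insert x F)
  have c: "f x \<in> carrier V" "f \<in> F \<rightarrow> carrier V" using insert.prems by auto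
  have "finsum V f (insert x F) = f x \<oplus>\<^bsub>V\<^esub> finsum V f F" by (rule finsum_insert[OF insert.hyps c(2,1)])
  then show ?case
   using fn_modelD(6)[OF m c(1) finsum_closed[OF c(2)]] insert.IH[OF c(2)] insert.hyps by simp
 qed (simp add: fn_modelD(4)[OF m])
qed

lemma fn_model_inv:
 assumes m: "fn_model V \<beta> S" and v: "v \<in> S"
 shows "inv_into (carrier V) \<beta> v \<in> carrier V" "\<beta> (inv_into (carrier V) \<beta> v) = v"
proof -
 have "v \<in> \<beta> ` carrier V" using v fn_modelD(1)[OF m] by simp
 then show "inv_into (carrier V) \<beta> v \<in> carrier V" "\<beta> (inv_into (carrier V) \<beta> v) = v"
  by (rule inv_into_into, rule f_inv_into_f)
qed

lemma fn_model_inv_left: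
 assumes m: "fn_model V \<beta> S" and x: "x \<in> carrier V"
 shows "inv_into (carrier V) \<beta> (\<beta> x) = x"
 by (rule inv_into_f_f[OF fn_modelD(2)[OF m] x])

definition gmodel :: "('k::field, 'v) gmodule => ('v => 'x => 'k) => ('x => 'k) set => ('k mat => ('x => 'k) => 'x => 'k) => bool" where
 "gmodel V \<beta> S \<rho> \<longleftrightarrow> fn_model V \<beta> S \<and> (\<forall>g\<in>SL2. \<forall>v\<in>carrier V. act V g v \<in> carrier V \<and> \<beta> (act V g v) = \<rho> g (\<beta> v))"

lemma gmodelD:
 assumes "gmodel V \<beta> S \<rho>"
 shows "fn_model V \<beta> S" "g \<in> SL2 ==> v \<in> carrier V ==> act V g v \<in> carrier V"
  "g \<in> SL2 ==> v \<in> carrier V ==> \<beta> (act V g v) = \<rho> g (\<beta> v)"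
 using assms by (auto simp: gmodel_def)

lemma gmodel_rational:
 fixes V :: "('k::alg_closed_field, 'v) gmodule"
 assumes g: "gmodel V \<beta> S \<rho>" and m: "gmod S \<rho>"
 shows "rational_module V"
proof -
 interpret gmod S \<rho> by (rule m)
 note f = gmodelD(1)[OF g]
 note F = fn_modelD[OF f] and G = gmodelD(2,3)[OF g]
 interpret V: vectorspace class_ring V by (rule fn_model_vectorspace[OF f])
 show ?thesis
 proof
  show "act V g \<in> LinearCombinations.module_hom class_ring V V" if "g \<in> SL2" for g
   using that unfolding LinearCombinations.module_hom_def
   by (auto simp: G(1) F(5,7) intro!: F(9)) (simp_all add: G F(5-8,11) \<rho>_add \<rho>_scale)
  show "act V (1\<^sub>m 2) v = v" if "v \<in> carrier V" for v
  proof -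
   have "1\<^sub>m 2 \<in> SL2" by (simp add: one_mat2)
   then show ?thesis using F(9)[OF G(1)[OF _ that] that] G(2)[OF _ that] \<rho>_one[OF F(11)[OF that]] by simp
  qed
  show "act V (g * h) v = act V g (act V h v)" if "g \<in> SL2" "h \<in> SL2" "v \<in> carrier V" for g h v
   using that by (intro F(9)) (simp_all add: G F(11) \<rho>_mult SL2_mult)
  show "\<exists>A f. finite A \<and> A \<subseteq> carrier V \<and> (\<forall>a\<in>A. f a \<in> regular_functions) \<and>
    (\<forall>g\<in>SL2. act V g v = (\<Oplus>\<^bsub>V\<^esub>a\<in>A. f a g \<odot>\<^bsub>V\<^esub> a))" if v: "v \<in> carrier V" for v
  proof -
   obtain N :: nat and r a where ra: "\<forall>l<N. r l \<in> regular_functions \<and> a l \<in> S"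
    "\<forall>g\<in>SL2. \<rho> g (\<beta> v) = (\<Sum>l<N. fscale (r l g) (a l))" using \<rho>_rational[OF F(11)[OF v]] by blast
   define b where "b l = inv_into (carrier V) \<beta> (a l)" for l
   have b: "b l \<in> carrier V" "\<beta> (b l) = a l" if "l < N" for l
    using fn_model_inv[OF f, of "a l"] ra(1) that by (auto simp: b_def)
   define A where "A = b ` {..<N}"
   \<comment> \<open>Several indices may give the same vector, so the coefficient functions are
     added over each fibre of \<open>b\<close>.\<close>
   define h where "h x g = (\<Sum>l\<in>{l\<in>{..<N}. b l = x}. r l g)" for x g
   have A: "finite A" "A \<subseteq> carrier V" using b by (auto simp: A_def)
   have "h x \<in> regular_functions" for x
    unfolding h_def[abs_def] using ra(1) by (intro reg_sum) auto
   moreover have "act V g v = (\<Oplus>\<^bsub>V\<^esub>x\<in>A. h x g \<odot>\<^bsub>V\<^esub> x)" if gS: "g \<in> SL2" for g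
   proof (rule F(9))
    have hA: "(\<lambda>x. h x g \<odot>\<^bsub>V\<^esub> x) \<in> A \<rightarrow> carrier V" using A(2) F(7) by auto
    show "(\<Oplus>\<^bsub>V\<^esub>x\<in>A. h x g \<odot>\<^bsub>V\<^esub> x) \<in> carrier V" by (rule fn_model_finsum[OF f A(1) hA])
    have "\<beta> (\<Oplus>\<^bsub>V\<^esub>x\<in>A. h x g \<odot>\<^bsub>V\<^esub> x) = (\<Sum>x\<in>A. \<beta> (h x g \<odot>\<^bsub>V\<^esub> x))" by (rule fn_model_finsum[OF f A(1) hA])
    also have "... = (\<Sum>x\<in>A. \<Sum>l\<in>{l\<in>{..<N}. b l = x}. fscale (r l g) (a l))"
    proof (rule sum.cong[OF refl])
     fix x assume x: "x \<in> A"
     then have "\<beta> (h x g \<odot>\<^bsub>V\<^esub> x) = fscale (h x g) (\<beta> x)" using A(2) F(8) by blast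
     also have "... = (\<Sum>l\<in>{l\<in>{..<N}. b l = x}. fscale (r l g) (\<beta> x))"
      by (auto simp: h_def fun_eq_iff sum_fun_apply sum_distrib_right)
     also have "... = (\<Sum>l\<in>{l\<in>{..<N}. b l = x}. fscale (r l g) (a l))"
      using b(2) by (intro sum.cong) auto
     finally show "\<beta> (h x g \<odot>\<^bsub>V\<^esub> x) = (\<Sum>l\<in>{l\<in>{..<N}. b l = x}. fscale (r l g) (a l))" .
    qed
    also have "... = (\<Sum>l<N. fscale (r l g) (a l))"
     by (rule sum.group) (auto simp: A_def)
    also have "... = \<beta> (act V g v)" using ra(2) gS G(2)[OF gS v] by simp
    finally show "\<beta> (act V g v) = \<beta> (\<Oplus>\<^bsub>V\<^esub>x\<in>A. h x g \<odot>\<^bsub>V\<^esub> x)" by (rule sym)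
   qed (use G(1)[OF gS v] in simp)
   ultimately show ?thesis using A by (intro exI[of _ A] exI[of _ h]) blast
  qed
 qed
qed

lemma rational_gmodel:
 fixes V :: "('k::alg_closed_field, 'v) gmodule"
 assumes "rational_module V"
 shows "\<exists>\<beta> :: 'v => 'v => 'k. \<exists>S \<rho>. gmodel V \<beta> S \<rho> \<and> gmod S \<rho>"
proof -
 interpret rational_module V by (rule assms)
 interpret vs_functions V by unfold_locales
 obtain \<beta> :: "'v => 'v => 'k" and S where f: "fn_model V \<beta> S" using model_exists by blast
 note F = fn_modelD[OF f] and I = fn_model_inv[OF f]
 define \<rho> where "\<rho> g w = \<beta> (act V g (inv_into (carrier V) \<beta> w))" for g w
 have ac: "act V g v \<in> carrier V" "act V g (v \<oplus>\<^bsub>V\<^esub> w) = act V g v \<oplus>\<^bsub>V\<^esub> act V g w" "act V g (c \<odot>\<^bsub>V\<^esub> v) = c \<odot>\<^bsub>V\<^esub> act V g v"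
  if "g \<in> SL2" "v \<in> carrier V" "w \<in> carrier V" for g :: "'k mat" and v w c
  using act_hom[OF that(1)] that(2,3) by (auto simp: LinearCombinations.module_hom_def)
 have r: "\<rho> g (\<beta> v) = \<beta> (act V g v)" if "v \<in> carrier V" for g v
  using fn_model_inv_left[OF f that] by (simp add: \<rho>_def)
 have "gmodel V \<beta> S \<rho>" using f ac r by (simp add: gmodel_def)
 moreover have "gmod S \<rho>"
 proof
  show "v + w \<in> S" if "v \<in> S" "w \<in> S" for v w
   using fn_model_space(2)[OF f] that by blast
  show "0 \<in> S" by (rule fn_model_space[OF f])
  show "fscale c v \<in> S" if "v \<in> S" for v c using fn_model_space(3)[OF f that] .
  show "\<rho> g v \<in> S" if "g \<in> SL2" "v \<in> S" for g :: "'k mat" and v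
   using that I[of v] ac F(11) by (simp add: \<rho>_def)
  fix g :: "'k mat" and v w c assume g: "g \<in> SL2" and v: "v \<in> S"
  obtain x where x: "x \<in> carrier V" "v = \<beta> x" using I[OF v] by metis
  show "\<rho> g (fscale c v) = fscale c (\<rho> g v)"
  proof -
   have "\<rho> g (fscale c v) = \<rho> g (\<beta> (c \<odot>\<^bsub>V\<^esub> x))" by (simp only: F(8)[OF x(1)] x(2))
   also have "... = \<beta> (c \<odot>\<^bsub>V\<^esub> act V g x)" by (simp only: r[OF F(7)[OF x(1)]] ac(3)[OF g x(1) x(1)])
   finally show ?thesis by (simp only: F(8)[OF ac(1)[OF g x(1) x(1)]] x(2) r[OF x(1)])
  qed
  show "\<rho> g (v + w) = \<rho> g v + \<rho> g w" if w: "w \<in> S"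
  proof -
   obtain y where y: "y \<in> carrier V" "w = \<beta> y" using I[OF w] by metis
   have "\<rho> g (v + w) = \<rho> g (\<beta> (x \<oplus>\<^bsub>V\<^esub> y))" by (simp only: F(6)[OF x(1) y(1)] x(2) y(2))
   also have "... = \<beta> (act V g x \<oplus>\<^bsub>V\<^esub> act V g y)" by (simp only: r[OF F(5)[OF x(1) y(1)]] ac(2)[OF g x(1) y(1)])
   finally show ?thesis
    by (simp only: F(6)[OF ac(1)[OF g x(1) x(1)] ac(1)[OF g y(1) y(1)]] x(2) y(2) r[OF x(1)] r[OF y(1)])
  qed
  show "\<rho> (g * h) v = \<rho> g (\<rho> h v)" if "h \<in> SL2" for h
   unfolding x(2) using r[OF x(1)] r[OF ac(1)[OF that x(1) x(1)]] act_mult[OF g that x(1)] by simp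
 next
  fix v assume v: "v \<in> S"
  obtain x where x: "x \<in> carrier V" "v = \<beta> x" using I[OF v] by metis
  show "\<rho> (1\<^sub>m 2) v = v" unfolding x(2) using r[OF x(1)] act_one[OF x(1)] by simp
  obtain A f where A: "finite A" "A \<subseteq> carrier V" "\<forall>a\<in>A. f a \<in> regular_functions"
   "\<forall>g\<in>SL2. act V g x = (\<Oplus>\<^bsub>V\<^esub>a\<in>A. f a g \<odot>\<^bsub>V\<^esub> a)" using rational[OF x(1)] by blast
  obtain e where e: "bij_betw e {..<card A} A" using ex_bij_betw_nat_finite[OF A(1)] by (metis atLeast0LessThan)
  have eA: "e l \<in> A" if "l < card A" for l using e that by (auto simp: bij_betw_def)
  have "\<rho> g v = (\<Sum>l<card A. fscale (f (e l) g) (\<beta> (e l)))" if g: "g \<in> SL2" for g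
  proof -
   have hA: "(\<lambda>a. f a g \<odot>\<^bsub>V\<^esub> a) \<in> A \<rightarrow> carrier V" using A(2) F(7) by auto
   have "\<rho> g v = (\<Sum>a\<in>A. \<beta> (f a g \<odot>\<^bsub>V\<^esub> a))"
    unfolding x(2) using r[OF x(1)] A(4) g fn_model_finsum(2)[OF f A(1) hA] by simp
   also have "... = (\<Sum>a\<in>A. fscale (f a g) (\<beta> a))" using A(2) F(8) by (intro sum.cong) auto
   also have "... = (\<Sum>l<card A. fscale (f (e l) g) (\<beta> (e l)))" by (rule sum.reindex_bij_betw[OF e, symmetric])
   finally show ?thesis .
  qed
  then show "\<exists>(N::nat) r a. (\<forall>l<N. r l \<in> regular_functions \<and> a l \<in> S) \<and> (\<forall>g\<in>SL2. \<rho> g v = (\<Sum>l<N. fscale (r l g) (a l)))"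
  proof (intro exI[of _ "card A"] exI[of _ "\<lambda>l. f (e l)"] exI[of _ "\<lambda>l. \<beta> (e l)"] conjI allI impI ballI)
   fix l assume "l < card A"
   then have "e l \<in> A" by (rule eA)
   then show "f (e l) \<in> regular_functions" "\<beta> (e l) \<in> S" using A(2,3) F(11) by blast+
  qed
 qed
 ultimately show ?thesis by blast
qed

text \<open>A function module transported along an injection into the type of the given module, since injectivity only
 refers to modules with carrier in that type.\<close>

definition copy :: "(('x => 'k) => 'v) => ('x => 'k::field) set => ('k mat => ('x => 'k) => 'x => 'k) => ('k, 'v) gmodule" where
 "copy \<iota> S \<rho> = \<lparr>carrier = \<iota> ` S, monoid.mult = undefined, one = undefined, zero = \<iota> 0,
   add = (\<lambda>x y. \<iota> (inv_into S \<iota> x + inv_into S \<iota> y)),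
   module.smult = (\<lambda>c x. \<iota> (fscale c (inv_into S \<iota> x))), act = (\<lambda>g x. \<iota> (\<rho> g (inv_into S \<iota> x)))\<rparr>"

lemma gmodel_copy:
 assumes "gmod S \<rho>" "inj_on \<iota> S"
 shows "gmodel (copy \<iota> S \<rho>) (inv_into S \<iota>) S \<rho>"
proof -
 interpret gmod S \<rho> by (rule assms)
 have k: "inv_into S \<iota> (\<iota> v) = v" if "v \<in> S" for v using that assms(2) by simp
 show ?thesis
  unfolding gmodel_def fn_model_def
  by (auto simp: copy_def k S_zero S_plus S_fscale \<rho>_S inj_on_inv_into image_image)
qed

subsection \<open>Injective modules\<close>

lemma subspace_projectionE:
 fixes K :: "('x => 'k::field) set"
 assumes "0 \<in> K" "\<And>v w. v \<in> K ==> w \<in> K ==> v + w \<in> K" "\<And>c v. v \<in> K ==> fscale c v \<in> K"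
 obtains g where "\<And>f. g f \<in> K" "\<And>f. f \<in> K ==> g f = f" "\<And>f h. g (f + h) = g f + g h" "\<And>c f. g (fscale c f) = fscale c (g f)"
 using subspace_projection[of K, OF assms] by blast

text \<open>Expressions for regular functions, which can be coded injectively by recursion.\<close>

datatype 'k rx = Cst 'k | Ent nat nat | Pls "'k rx" "'k rx" | Tms "'k rx" "'k rx"

primrec rx_eval :: "'k::comm_ring_1 rx => 'k mat => 'k" where
 "rx_eval (Cst c) = (\<lambda>g. c)"
| "rx_eval (Ent i j) = (\<lambda>g. g $$ (i, j))"
| "rx_eval (Pls s t) = (\<lambda>g. rx_eval s g + rx_eval t g)"
| "rx_eval (Tms s t) = (\<lambda>g. rx_eval s g * rx_eval t g)"

lemma regular_rx: "r \<in> regular_functions ==> \<exists>t. rx_eval t = r"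
proof (induction rule: regular_functions.induct)
 case (const c) show ?case by (rule exI[of _ "Cst c"]) simp
next
 case (entry i j) show ?case by (rule exI[of _ "Ent i j"]) simp
next
 case (add f h)
 then obtain s t where "rx_eval s = f" "rx_eval t = h" by blast
 then show ?case by (intro exI[of _ "Pls s t"]) simp
next
 case (mult f h)
 then obtain s t where "rx_eval s = f" "rx_eval t = h" by blast
 then show ?case by (intro exI[of _ "Tms s t"]) simp
qed

primrec rx_code :: "('v \<times> 'v => 'v) => (nat => 'v) => ('k => 'v) => 'k rx => 'v" where
 "rx_code pr nn kv (Cst c) = pr (nn 0, kv c)"
| "rx_code pr nn kv (Ent i j) = pr (nn 1, pr (nn i, nn j))"
| "rx_code pr nn kv (Pls s t) = pr (nn 2, pr (rx_code pr nn kv s, rx_code pr nn kv t))"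
| "rx_code pr nn kv (Tms s t) = pr (nn 3, pr (rx_code pr nn kv s, rx_code pr nn kv t))"

lemma rx_code_inj:
 assumes "inj pr" "inj nn" "inj kv"
 shows "rx_code pr nn kv s = rx_code pr nn kv t ==> s = t"
proof (induction s arbitrary: t)
 case (Cst c) then show ?case using assms by (cases t) (auto simp: inj_eq)
next
 case (Ent i j) then show ?case using assms by (cases t) (auto simp: inj_eq)
next
 case (Pls s1 s2) then show ?case using assms by (cases t) (auto simp: inj_eq)
next
 case (Tms s1 s2) then show ?case using assms by (cases t) (auto simp: inj_eq)
qed

primrec list_code :: "('v \<times> 'v => 'v) => (nat => 'v) => ('a => 'v) => 'a list => 'v" where
 "list_code pr nn f [] = pr (nn 0, nn 0)"
| "list_code pr nn f (x # xs) = pr (nn 1, pr (f x, list_code pr nn f xs))"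

lemma list_code_inj:
 assumes "inj pr" "inj nn" "inj_on f X"
 shows "set xs \<subseteq> X ==> set ys \<subseteq> X ==> list_code pr nn f xs = list_code pr nn f ys ==> xs = ys"
proof (induction xs arbitrary: ys)
 case Nil then show ?case using assms by (cases ys) (auto simp: inj_eq)
next
 case (Cons x xs) then show ?case using assms by (cases ys) (auto simp: inj_eq dest: inj_onD)
qed

text \<open>An element is described by a finite list of pairs of an expression and a vector of
  \<open>W\<close>. Such lists are coded in \<open>'v\<close> by a pairing and by copies of the
  natural numbers and of \<open>k\<close>; the pairing and the natural numbers come from infinity of
  the type.\<close>

lemma reg_maps_embed:
 fixes kv :: "'k::field => 'v" and W :: "('x => 'k) set"
 assumes inf: "infinite (UNIV :: 'v set)" and kv: "inj kv" and j: "inj_on (j :: ('x => 'k) => 'v) W"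
 shows "\<exists>\<iota> :: ('k mat \<times> 'x => 'k) => 'v. inj_on \<iota> (reg_maps W)"
proof -
 obtain nn :: "nat => 'v" where nn: "inj nn" using infinite_countable_subset[OF inf] by blast
 obtain pr :: "'v \<times> 'v => 'v" where "bij_betw pr (UNIV \<times> UNIV) UNIV"
  using card_of_Times_same_infinite[OF inf] card_of_ordIso by blast
 then have pr: "inj pr" by (auto simp: bij_betw_def)
 define ev where "ev l = sum_list (map (\<lambda>(t, w). pure_fn (rx_eval t) w) l)" for l :: "('k rx \<times> ('x => 'k)) list"
 define X where "X = (UNIV :: 'k rx set) \<times> W"
 have ex: "\<exists>l. set l \<subseteq> X \<and> f = ev l" if "f \<in> reg_maps W" for f
  using that
 proof (induction f rule: reg_maps_induct)
  case zero
  show ?case by (intro exI[of _ "[]"]) (simp add: ev_def)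
 next
  case (step f r w)
  obtain l where l: "set l \<subseteq> X" "f = ev l" using step.IH by blast
  obtain t where "rx_eval t = r" using regular_rx[OF step.hyps(2)] by blast
  then have "f + pure_fn r w = ev ((t, w) # l)" unfolding l(2) by (simp only: ev_def list.map sum_list.Cons split add.commute)
  moreover have "set ((t, w) # l) \<subseteq> X" using l(1) step.hyps(3) by (simp add: X_def)
  ultimately show ?case by blast
 qed
 define c where "c = (\<lambda>(t, w). pr (rx_code pr nn kv t, j w))"
 have c: "inj_on c X"
  using rx_code_inj[OF pr nn kv] inj_onD[OF j] by (auto simp: inj_on_def c_def X_def inj_eq[OF pr])
 define L where "L f = (SOME l. set l \<subseteq> X \<and> f = ev l)" for f
 have L: "set (L f) \<subseteq> X" "f = ev (L f)" if "f \<in> reg_maps W" for f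
  using someI_ex[OF ex[OF that]] by (auto simp: L_def)
 have "inj_on (\<lambda>f. list_code pr nn c (L f)) (reg_maps W)"
 proof (rule inj_onI)
  fix f h assume f: "f \<in> reg_maps W" and h: "h \<in> reg_maps W" and "list_code pr nn c (L f) = list_code pr nn c (L h)"
  then have "L f = L h" using list_code_inj[OF pr nn c] L(1) by blast
  then show "f = h" using L(2)[OF f] L(2)[OF h] by simp
 qed
 then show ?thesis by blast
qed

lemma G_homD:
 assumes "f \<in> G_hom V W"
 shows "v \<in> carrier V ==> f v \<in> carrier W" "v \<in> carrier V ==> w \<in> carrier V ==> f (v \<oplus>\<^bsub>V\<^esub> w) = f v \<oplus>\<^bsub>W\<^esub> f w"
  "v \<in> carrier V ==> f (c \<odot>\<^bsub>V\<^esub> v) = c \<odot>\<^bsub>W\<^esub> f v" "g \<in> SL2 ==> v \<in> carrier V ==> f (act V g v) = act W g (f v)"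
 using assms by (auto simp: G_hom_def LinearCombinations.module_hom_def)

lemma G_homI:
 assumes V: "gmodel V \<beta> S \<rho>" and W: "gmodel W \<beta>' S' \<rho>'"
  and T: "\<And>v. v \<in> S ==> T v \<in> S'" "\<And>v w. v \<in> S ==> w \<in> S ==> T (v + w) = T v + T w"
   "\<And>c v. v \<in> S ==> T (fscale c v) = fscale c (T v)" "\<And>g v. g \<in> SL2 ==> v \<in> S ==> T (\<rho> g v) = \<rho>' g (T v)"
 shows "\<exists>f\<in>G_hom V W. \<forall>v\<in>carrier V. \<beta>' (f v) = T (\<beta> v)"
proof -
 note fV = gmodelD(1)[OF V] and fW = gmodelD(1)[OF W]
 note FV = fn_modelD[OF fV] and FW = fn_modelD[OF fW] and I = fn_model_inv[OF fW]
 define f where "f = (\<lambda>v\<in>carrier V. inv_into (carrier W) \<beta>' (T (\<beta> v)))"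
 have f: "f v \<in> carrier W" "\<beta>' (f v) = T (\<beta> v)" if "v \<in> carrier V" for v
  using that I[OF T(1)[OF FV(11)[OF that]]] by (auto simp: f_def)
 have "f (v \<oplus>\<^bsub>V\<^esub> w) = f v \<oplus>\<^bsub>W\<^esub> f w" if v: "v \<in> carrier V" and w: "w \<in> carrier V" for v w
  by (rule FW(9)) (simp_all only: f FV(5,6,11) FW(5,6) v w T)
 moreover have "f (c \<odot>\<^bsub>V\<^esub> v) = c \<odot>\<^bsub>W\<^esub> f v" if v: "v \<in> carrier V" for v c
  by (rule FW(9)) (simp_all only: f FV(7,8,11) FW(7,8) v T)
 moreover have "f (act V g v) = act W g (f v)" if g: "g \<in> SL2" and v: "v \<in> carrier V" for g v
  by (rule FW(9)) (simp_all only: f gmodelD(2,3)[OF V] gmodelD(2,3)[OF W] FV(11) v g T)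
 ultimately have "f \<in> G_hom V W"
  using f(1) by (auto simp: G_hom_def LinearCombinations.module_hom_def f_def)
 then show ?thesis using f(2) by blast
qed

text \<open>Frobenius reciprocity: the map \<open>V \<rightarrow> W \<otimes> k[G]\<close> attached to a linear map \<open>e\<close> from \<open>V\<close> to \<open>W\<close>.\<close>

definition frob :: "('k::field mat => 'a => 'a) => ('a => 'x => 'k) => 'a => 'k mat \<times> 'x => 'k" where
 "frob \<rho> e v = (\<lambda>(g, x). if g \<in> SL2 then e (\<rho> g v) x else 0)"

context gmod
begin

context
 fixes e :: "('i => 'k) => 'x => 'k" and W :: "('x => 'k) set"
 assumes e: "\<And>v. v \<in> S ==> e v \<in> W" "\<And>v w. v \<in> S ==> w \<in> S ==> e (v + w) = e v + e w" "\<And>c v. v \<in> S ==> e (fscale c v) = fscale c (e v)"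
begin

lemma e_sum: "(\<And>a. a \<in> A ==> f a \<in> S) ==> e (sum f A) = (\<Sum>a\<in>A. e (f a))"
proof (induction A rule: infinite_finite_induct)
 case (insert x F)
 then have 1: "e (f x + sum f F) = e (f x) + e (sum f F)" by (intro e(2) S_sum0) auto
 have 2: "e (sum f F) = (\<Sum>a\<in>F. e (f a))" using insert by simp
 show ?case by (simp only: sum.insert[OF insert(1,2)] 1 2)
next
 case (infinite A)
 have "e 0 = 0" using e(3)[OF S_zero, of 0] by simp
 then show ?case by (simp only: sum.infinite[OF infinite(1)])
next
 case empty
 have "e 0 = 0" using e(3)[OF S_zero, of 0] by simp
 then show ?case by (simp only: sum.empty)
qed

lemma frob_mem:
 assumes v: "v \<in> S"
 shows "frob \<rho> e v \<in> reg_maps W"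
proof -
 obtain N :: nat and r a where ra: "\<forall>l<N. r l \<in> regular_functions \<and> a l \<in> S"
  "\<forall>g\<in>SL2. \<rho> g v = (\<Sum>l<N. fscale (r l g) (a l))" using \<rho>_rational[OF v] by blast
 have "frob \<rho> e v = (\<Sum>l<N. pure_fn (r l) (e (a l)))"
 proof (rule ext, clarify)
  fix g x
  have "e (\<Sum>l<N. fscale (r l g) (a l)) = (\<Sum>l<N. fscale (r l g) (e (a l)))"
   using ra(1) by (subst e_sum) (auto simp: e(3) intro!: S_fscale sum.cong)
  then show "frob \<rho> e v (g, x) = (\<Sum>l<N. pure_fn (r l) (e (a l))) (g, x)"
   using ra(2) by (simp add: frob_def sum_fun_apply pure_fn_def)
 qed
 then show ?thesis using ra(1) e(1) unfolding reg_maps_def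
  by (intro CollectI exI[of _ N] exI[of _ r] exI[of _ "\<lambda>l. e (a l)"]) simp
qed

lemma frob_add: "v \<in> S ==> w \<in> S ==> frob \<rho> e (v + w) = frob \<rho> e v + frob \<rho> e w"
 by (auto simp: frob_def fun_eq_iff \<rho>_add e(2) \<rho>_S)

lemma frob_scale: "v \<in> S ==> frob \<rho> e (fscale c v) = fscale c (frob \<rho> e v)"
 by (auto simp: frob_def fun_eq_iff \<rho>_scale e(3) \<rho>_S)

lemma frob_act: "g \<in> SL2 ==> v \<in> S ==> frob \<rho> e (\<rho> g v) = rtrans g (frob \<rho> e v)"
 by (auto simp: frob_def rtrans_def fun_eq_iff \<rho>_mult SL2_mult)

end

end

lemma reg_maps_eval:
 assumes W: "0 \<in> W" "\<And>v w. v \<in> W ==> w \<in> W ==> v + w \<in> W" "\<And>c v. v \<in> W ==> fscale c v \<in> W"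
  and f: "f \<in> reg_maps W"
 shows "(\<lambda>x. f (1\<^sub>m 2, x)) \<in> W"
 using f
proof (induction f rule: reg_maps_induct)
 case zero
 then show ?case using W(1) by (simp add: zero_fun_def)
next
 case (step f r w)
 have "1\<^sub>m 2 \<in> SL2" by (simp add: one_mat2)
 then have "(\<lambda>x. (f + pure_fn r w) (1\<^sub>m 2, x)) = (\<lambda>x. f (1\<^sub>m 2, x)) + fscale (r (1\<^sub>m 2)) w"
  by (auto simp: pure_fn_def fun_eq_iff)
 then show ?case using W(2)[OF step.IH W(3)[OF step.hyps(3)]] by (simp only:)
qed

text \<open>Over a field the linear map \<open>f\<close> followed by evaluation at 1 extends along
  \<open>i\<close>, and Frobenius reciprocity turns the extension into a homomorphism that still
  extends \<open>f\<close>.\<close>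

theorem reg_maps_injective:
 fixes W :: "('x => 'k::alg_closed_field) set" and \<iota> :: "('k mat \<times> 'x => 'k) => 'v"
 assumes W: "0 \<in> W" "\<And>v w. v \<in> W ==> w \<in> W ==> v + w \<in> W" "\<And>c v. v \<in> W ==> fscale c v \<in> W"
  and \<iota>: "inj_on \<iota> (reg_maps W)"
 shows "injective_module (copy \<iota> (reg_maps W) rtrans)"
proof -
 let ?J = "copy \<iota> (reg_maps W) rtrans" and ?\<kappa> = "inv_into (reg_maps W) \<iota>"
 have J: "gmodel ?J ?\<kappa> (reg_maps W) rtrans" by (rule gmodel_copy[OF gmod_reg_maps \<iota>])
 note fJ = gmodelD(1)[OF J]
 note FJ = fn_modelD[OF fJ]
 have rat: "rational_module ?J" by (rule gmodel_rational[OF J gmod_reg_maps])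
 have "\<exists>h\<in>G_hom B ?J. \<forall>a\<in>carrier A. h (i a) = f a"
  if A: "rational_module A" and B: "rational_module B" and i: "i \<in> G_hom A B" "inj_on i (carrier A)" and f: "f \<in> G_hom A ?J"
  for A B :: "('k, 'v) gmodule" and i f
 proof -
  note iD = G_homD[OF i(1)] and fD = G_homD[OF f]
  obtain \<alpha> :: "'v => 'v => 'k" and SA \<rho>A where gA: "gmodel A \<alpha> SA \<rho>A" "gmod SA \<rho>A" using rational_gmodel[OF A] by blast
  obtain \<beta> :: "'v => 'v => 'k" and SB \<rho>B where gB: "gmodel B \<beta> SB \<rho>B" "gmod SB \<rho>B" using rational_gmodel[OF B] by blast
  interpret B: gmod SB \<rho>B by (rule gB(2))
  note FA = fn_modelD[OF gmodelD(1)[OF gA(1)]] and FB = fn_modelD[OF gmodelD(1)[OF gB(1)]]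
  define \<theta> where "\<theta> a = \<beta> (i a)" for a
  have inj: "a = b" if "\<theta> a = \<theta> b" "a \<in> carrier A" "b \<in> carrier A" for a b
   using that FB(9)[OF iD(1) iD(1)] inj_onD[OF i(2)] by (auto simp: \<theta>_def)
  have \<theta>: "\<theta> (a \<oplus>\<^bsub>A\<^esub> b) = \<theta> a + \<theta> b" "\<theta> (c \<odot>\<^bsub>A\<^esub> a) = fscale c (\<theta> a)" if "a \<in> carrier A" "b \<in> carrier A" for a b c
   using that by (simp_all add: \<theta>_def iD FB(6,8))
  let ?K = "\<theta> ` carrier A"
  obtain q where q: "\<And>f. q f \<in> ?K" "\<And>f. f \<in> ?K ==> q f = f" "\<And>f h. q (f + h) = q f + q h" "\<And>c f. q (fscale c f) = fscale c (q f)"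
  proof (rule subspace_projectionE[of ?K])
   have "\<theta> \<zero>\<^bsub>A\<^esub> = fscale 0 (\<theta> \<zero>\<^bsub>A\<^esub>)"
    using \<theta>(2)[OF FA(3) FA(3), of 0] FA(7)[OF FA(3), of 0] FA(8)[OF FA(3), of 0] FA(10)[of "0 \<odot>\<^bsub>A\<^esub> \<zero>\<^bsub>A\<^esub>"] by simp
   then show "0 \<in> ?K" using FA(3) by (intro image_eqI[of _ _ "\<zero>\<^bsub>A\<^esub>"]) auto
   show "v + w \<in> ?K" if vw: "v \<in> ?K" "w \<in> ?K" for v w
   proof -
    obtain a b where "a \<in> carrier A" "b \<in> carrier A" "v = \<theta> a" "w = \<theta> b" using vw by blast
    then show ?thesis using \<theta>(1)[of a b] FA(5)[of a b] by (intro image_eqI[of _ _ "a \<oplus>\<^bsub>A\<^esub> b"]) simp_all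
   qed
   show "fscale c v \<in> ?K" if v: "v \<in> ?K" for c v
   proof -
    obtain a where "a \<in> carrier A" "v = \<theta> a" using v by blast
    then show ?thesis using \<theta>(2)[of a a c] FA(7)[of a c] by (intro image_eqI[of _ _ "c \<odot>\<^bsub>A\<^esub> a"]) simp_all
   qed
  qed (rule that)
  \<comment> \<open>A linear map defined on all functions that inverts \<open>\<theta>\<close> on
    its image.\<close>
  define s where "s v = inv_into (carrier A) \<theta> (q v)" for v
  have s: "s v \<in> carrier A" "\<theta> (s v) = q v" for v
   unfolding s_def by (rule inv_into_into[OF q(1)], rule f_inv_into_f[OF q(1)])
  have s_add: "s (v + w) = s v \<oplus>\<^bsub>A\<^esub> s w" for v w
   by (rule inj) (simp_all only: s \<theta> q FA(5))
  have s_scale: "s (fscale c v) = c \<odot>\<^bsub>A\<^esub> s v" for c v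
   by (rule inj) (simp_all only: s \<theta>(2)[OF s(1) s(1)] q FA(7))
  have s_\<theta>: "s (\<theta> a) = a" if "a \<in> carrier A" for a
   using that by (intro inj s) (simp_all add: s q)
  define e where "e v = (\<lambda>x. ?\<kappa> (f (s v)) (1\<^sub>m 2, x))" for v
  have e: "e v \<in> W" "e (v + w) = e v + e w" "e (fscale c v) = fscale c (e v)" for v w c
  proof -
   show "e v \<in> W" unfolding e_def by (rule reg_maps_eval[OF W FJ(11)[OF fD(1)[OF s(1)]]])
   show "e (v + w) = e v + e w"
    unfolding e_def s_add fD(2)[OF s(1) s(1)] FJ(6)[OF fD(1)[OF s(1)] fD(1)[OF s(1)]] by (simp add: fun_eq_iff)
   show "e (fscale c v) = fscale c (e v)"
    unfolding e_def s_scale fD(3)[OF s(1)] FJ(8)[OF fD(1)[OF s(1)]] by (simp add: fun_eq_iff)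
  qed
  have "\<exists>h\<in>G_hom B ?J. \<forall>v\<in>carrier B. ?\<kappa> (h v) = frob \<rho>B e (\<beta> v)"
  proof (rule G_homI[OF gB(1) J])
   show "frob \<rho>B e v \<in> reg_maps W" if "v \<in> SB" for v by (rule B.frob_mem[of e W, OF e that])
   show "frob \<rho>B e (v + w) = frob \<rho>B e v + frob \<rho>B e w" if "v \<in> SB" "w \<in> SB" for v w
    by (rule B.frob_add[of e W, OF e that])
   show "frob \<rho>B e (fscale c v) = fscale c (frob \<rho>B e v)" if "v \<in> SB" for v c
    by (rule B.frob_scale[of e W, OF e that])
   show "frob \<rho>B e (\<rho>B g v) = rtrans g (frob \<rho>B e v)" if "g \<in> SL2" "v \<in> SB" for v g
    by (rule B.frob_act[of e W, OF e that])
  qed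
  then obtain h where h: "h \<in> G_hom B ?J" "\<And>v. v \<in> carrier B ==> ?\<kappa> (h v) = frob \<rho>B e (\<beta> v)" by blast
  have "h (i a) = f a" if a: "a \<in> carrier A" for a
  proof (rule FJ(9))
   show "h (i a) \<in> carrier ?J" "f a \<in> carrier ?J" using G_homD(1)[OF h(1)] iD(1) fD(1) a by auto
   \<comment> \<open>The value at \<open>g\<close> is the value at 1 of the translate by
     \<open>g\<close>, so agreement at 1 spreads by equivariance.\<close>
   have "frob \<rho>B e (\<beta> (i a)) (g, x) = ?\<kappa> (f a) (g, x)" for g x
   proof (cases "g \<in> SL2")
    case True
    have "\<rho>B g (\<beta> (i a)) = \<theta> (act A g a)"
     using gmodelD(3)[OF gB(1) True iD(1)[OF a]] iD(4)[OF True a] by (simp add: \<theta>_def)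
    then have "e (\<rho>B g (\<beta> (i a))) x = ?\<kappa> (f (act A g a)) (1\<^sub>m 2, x)"
     using s_\<theta>[OF gmodelD(2)[OF gA(1) True a]] by (simp add: e_def)
    also have "... = rtrans g (?\<kappa> (f a)) (1\<^sub>m 2, x)"
     using fD(4)[OF True a] gmodelD(3)[OF J True fD(1)[OF a]] by simp
    also have "... = ?\<kappa> (f a) (g, x)"
    proof -
     have "1\<^sub>m 2 \<in> (SL2 :: 'k mat set)" "1\<^sub>m 2 * g = g" using True by (auto simp: one_mat2 SL2_def simp flip: one_mat2)
     then show ?thesis by (simp add: rtrans_def)
    qed
    finally show ?thesis using True by (simp add: frob_def)
   next
    case False
    then show ?thesis using reg_maps_off[OF FJ(11)[OF fD(1)[OF a]]] by (simp add: frob_def)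
   qed
   then show "?\<kappa> (h (i a)) = ?\<kappa> (f a)" using h(2)[OF iD(1)[OF a]] by (auto simp: fun_eq_iff)
  qed
  then show ?thesis using h(1) by blast
 qed
 then show ?thesis using rat unfolding injective_module_def by blast
qed

definition stable :: "('k::field, 'v) gmodule => 'v set => bool" where
 "stable M E \<longleftrightarrow> E \<subseteq> carrier M \<and> \<zero>\<^bsub>M\<^esub> \<in> E \<and> (\<forall>v\<in>E. \<forall>w\<in>E. v \<oplus>\<^bsub>M\<^esub> w \<in> E) \<and>
  (\<forall>c. \<forall>v\<in>E. c \<odot>\<^bsub>M\<^esub> v \<in> E) \<and> (\<forall>g\<in>SL2. \<forall>v\<in>E. act M g v \<in> E)"

definition transport :: "('k::field, 'v, 'm) module_scheme => ('v => 'x => 'k) => ('w => 'y => 'k) => ('v => 'w) => ('x => 'k) => 'y => 'k" where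
 "transport V \<beta> \<beta>' f v = \<beta>' (f (inv_into (carrier V) \<beta> v))"

lemma transport:
 fixes V :: "('k::field, 'v) gmodule" and W :: "('k, 'w) gmodule" and f \<beta> \<beta>'
 defines "T \<equiv> transport V \<beta> \<beta>' f"
 assumes V: "gmodel V \<beta> S \<rho>" and W: "gmodel W \<beta>' S' \<rho>'" and f: "f \<in> G_hom V W"
 shows "x \<in> carrier V ==> T (\<beta> x) = \<beta>' (f x)" "v \<in> S ==> T v \<in> S'" "v \<in> S ==> w \<in> S ==> T (v + w) = T v + T w"
  "v \<in> S ==> T (fscale c v) = fscale c (T v)" "g \<in> SL2 ==> v \<in> S ==> T (\<rho> g v) = \<rho>' g (T v)"
proof -
 note F = fn_modelD[OF gmodelD(1)[OF V]] and G = gmodelD(2,3)[OF V] and F' = fn_modelD[OF gmodelD(1)[OF W]]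
 have T: "T (\<beta> x) = \<beta>' (f x)" if "x \<in> carrier V" for x
  unfolding T_def transport_def fn_model_inv_left[OF gmodelD(1)[OF V] that] ..
 then show "x \<in> carrier V ==> T (\<beta> x) = \<beta>' (f x)" .
 assume "v \<in> S"
 then obtain x where x: "x \<in> carrier V" "v = \<beta> x" using F(1) by blast
 note fx = G_homD(1)[OF f x(1)]
 show "T v \<in> S'" unfolding x(2) T[OF x(1)] by (rule F'(11)[OF fx])
 show "T (fscale c v) = fscale c (T v)"
  unfolding x(2) F(8)[OF x(1), symmetric] T[OF x(1)] T[OF F(7)[OF x(1)]] G_homD(3)[OF f x(1)] by (rule F'(8)[OF fx])
 show "T (\<rho> g v) = \<rho>' g (T v)" if g: "g \<in> SL2"
  unfolding x(2) G(2)[OF g x(1), symmetric] T[OF x(1)] T[OF G(1)[OF g x(1)]] G_homD(4)[OF f g x(1)] by (rule gmodelD(3)[OF W g fx])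
 assume "w \<in> S"
 then obtain y where y: "y \<in> carrier V" "w = \<beta> y" using F(1) by blast
 show "T (v + w) = T v + T w"
  unfolding x(2) y(2) F(6)[OF x(1) y(1), symmetric] T[OF x(1)] T[OF y(1)] T[OF F(5)[OF x(1) y(1)]] G_homD(2)[OF f x(1) y(1)]
  by (rule F'(6)[OF fx G_homD(1)[OF f y(1)]])
qed

lemma G_hom_0:
 assumes V: "gmodel V \<beta> S \<rho>" and W: "gmodel W \<beta>' S' \<rho>'" and f: "f \<in> G_hom V W"
 shows "f \<zero>\<^bsub>V\<^esub> = \<zero>\<^bsub>W\<^esub>"
proof -
 note FV = fn_modelD[OF gmodelD(1)[OF V]] and FW = fn_modelD[OF gmodelD(1)[OF W]]
 have "0 \<odot>\<^bsub>V\<^esub> \<zero>\<^bsub>V\<^esub> = \<zero>\<^bsub>V\<^esub>" using FV(10)[OF FV(7)[OF FV(3), of 0]] FV(8)[OF FV(3), of 0] by simp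
 then have "f \<zero>\<^bsub>V\<^esub> = 0 \<odot>\<^bsub>W\<^esub> f \<zero>\<^bsub>V\<^esub>" using G_homD(3)[OF f FV(3), of 0] by simp
 then have "\<beta>' (f \<zero>\<^bsub>V\<^esub>) = 0" using FW(8)[OF G_homD(1)[OF f FV(3)], of 0] by simp
 then show ?thesis using FW(10)[OF G_homD(1)[OF f FV(3)]] by simp
qed

lemma stable_image:
 fixes V :: "('k::alg_closed_field, 'v) gmodule" and W :: "('k, 'w) gmodule"
 assumes "rational_module V" "rational_module W" and f: "f \<in> G_hom V W"
 shows "stable W (f ` carrier V)"
proof -
 obtain \<beta> :: "'v => 'v => 'k" and S \<rho> where V: "gmodel V \<beta> S \<rho>" using rational_gmodel[OF assms(1)] by blast
 obtain \<beta>' :: "'w => 'w => 'k" and S' \<rho>' where W: "gmodel W \<beta>' S' \<rho>'" using rational_gmodel[OF assms(2)] by blast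
 note FV = fn_modelD[OF gmodelD(1)[OF V]]
 show ?thesis unfolding stable_def
 proof (intro conjI ballI allI)
  show "f ` carrier V \<subseteq> carrier W" using G_homD(1)[OF f] by blast
  show "\<zero>\<^bsub>W\<^esub> \<in> f ` carrier V" using G_hom_0[OF V W f] FV(3) by (intro image_eqI[of _ _ "\<zero>\<^bsub>V\<^esub>"]) auto
  show "v \<oplus>\<^bsub>W\<^esub> w \<in> f ` carrier V" if vw: "v \<in> f ` carrier V" "w \<in> f ` carrier V" for v w
  proof -
   obtain x y where "x \<in> carrier V" "y \<in> carrier V" "v = f x" "w = f y" using vw by blast
   then show ?thesis using G_homD(2)[OF f] FV(5) by (intro image_eqI[of _ _ "x \<oplus>\<^bsub>V\<^esub> y"]) auto
  qed
  show "c \<odot>\<^bsub>W\<^esub> v \<in> f ` carrier V" if v: "v \<in> f ` carrier V" for c v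
  proof -
   obtain x where "x \<in> carrier V" "v = f x" using v by blast
   then show ?thesis using G_homD(3)[OF f] FV(7) by (intro image_eqI[of _ _ "c \<odot>\<^bsub>V\<^esub> x"]) auto
  qed
  show "act W g v \<in> f ` carrier V" if g: "g \<in> SL2" and v: "v \<in> f ` carrier V" for g v
  proof -
   obtain x where "x \<in> carrier V" "v = f x" using v by blast
   then show ?thesis using G_homD(4)[OF f g] gmodelD(2)[OF V g] by (intro image_eqI[of _ _ "act V g x"]) auto
  qed
 qed
qed

lemma embed_exists:
 fixes V :: "('k::alg_closed_field, 'v) gmodule"
 assumes kv: "inj (kv :: 'k => 'v)" and V: "gmodel V \<beta> S \<rho>"
 shows "\<exists>\<iota> :: ('k mat \<times> 'x => 'k) => 'v. inj_on \<iota> (reg_maps S)"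
proof (rule reg_maps_embed[OF _ kv])
 show "infinite (UNIV :: 'v set)"
  using infinite_alg_closed[where 'k = 'k] finite_subset[OF subset_UNIV, of "range kv"] finite_imageD[OF _ kv] by blast
 have "\<beta> ` carrier V = S" using fn_modelD(1)[OF gmodelD(1)[OF V]] .
 then show "inj_on (inv_into (carrier V) \<beta>) S" using inj_on_inv_into by blast
qed

text \<open>With a prescribed kernel a resolution can be continued without quotient modules. A
  linear map with kernel \<open>E\<close> yields by Frobenius reciprocity a homomorphism that kills
  the vectors all of whose translates lie in \<open>E\<close>; as \<open>E\<close> is stable, these
  are the vectors of \<open>E\<close>.\<close>

lemma enough_injectives:
 fixes M :: "('k::alg_closed_field, 'v) gmodule"
 assumes kv: "inj (kv :: 'k => 'v)" and M: "rational_module M" and E: "stable M E"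
 shows "\<exists>(J :: ('k, 'v) gmodule) d. injective_module J \<and> d \<in> G_hom M J \<and> {v \<in> carrier M. d v = \<zero>\<^bsub>J\<^esub>} = E"
proof -
 obtain \<beta> :: "'v => 'v => 'k" and S \<rho> where g: "gmodel M \<beta> S \<rho>" "gmod S \<rho>" using rational_gmodel[OF M] by blast
 interpret gmod S \<rho> by (rule g(2))
 note F = fn_modelD[OF gmodelD(1)[OF g(1)]]
 note Ed = E[unfolded stable_def]
 have EM: "E \<subseteq> carrier M" using Ed by blast
 obtain \<iota> :: "('k mat \<times> 'v => 'k) => 'v" where \<iota>: "inj_on \<iota> (reg_maps S)" using embed_exists[OF kv g(1)] by blast
 let ?J = "copy \<iota> (reg_maps S) rtrans"
 have J: "gmodel ?J (inv_into (reg_maps S) \<iota>) (reg_maps S) rtrans" by (rule gmodel_copy[OF gmod_reg_maps \<iota>])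
 have inj: "injective_module ?J" by (rule reg_maps_injective[OF S_zero S_plus S_fscale \<iota>])
 let ?K = "\<beta> ` E"
 obtain q where q: "\<And>f. q f \<in> ?K" "\<And>f. f \<in> ?K ==> q f = f" "\<And>f h. q (f + h) = q f + q h" "\<And>c f. q (fscale c f) = fscale c (q f)"
 proof (rule subspace_projectionE[of ?K])
  show "0 \<in> ?K" using Ed F(4) by (intro image_eqI[of _ _ "\<zero>\<^bsub>M\<^esub>"]) auto
  show "v + w \<in> ?K" if vw: "v \<in> ?K" "w \<in> ?K" for v w
  proof -
   obtain a b where ab: "a \<in> E" "b \<in> E" "v = \<beta> a" "w = \<beta> b" using vw by blast
   then have "\<beta> (a \<oplus>\<^bsub>M\<^esub> b) = v + w" using F(6) EM by auto
   moreover have "a \<oplus>\<^bsub>M\<^esub> b \<in> E" using Ed ab by blast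
   ultimately show ?thesis by (intro image_eqI[of _ _ "a \<oplus>\<^bsub>M\<^esub> b"]) auto
  qed
  show "fscale c v \<in> ?K" if v: "v \<in> ?K" for c v
  proof -
   obtain a where a: "a \<in> E" "v = \<beta> a" using v by blast
   then have "\<beta> (c \<odot>\<^bsub>M\<^esub> a) = fscale c v" using F(8) EM by auto
   moreover have "c \<odot>\<^bsub>M\<^esub> a \<in> E" using Ed a by blast
   ultimately show ?thesis by (intro image_eqI[of _ _ "c \<odot>\<^bsub>M\<^esub> a"]) auto
  qed
 qed (rule that)
 have KS: "?K \<subseteq> S" using EM F(11) by blast
 define e where "e v = v - q v" for v
 have e: "e v \<in> S" if "v \<in> S" for v unfolding e_def using that q(1)[of v] KS by (intro diff_S) auto
 have e_add: "e (v + w) = e v + e w" and e_scale: "e (fscale c v) = fscale c (e v)" for v w c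
  by (simp_all add: e_def q fscale_diff)
 have e0: "e v = 0 \<longleftrightarrow> v \<in> ?K" for v
 proof
  assume "e v = 0"
  then have "v = q v" by (simp add: e_def)
  then show "v \<in> ?K" using q(1)[of v] by (simp only:)
 qed (simp add: e_def q(2))
 have "\<exists>d\<in>G_hom M ?J. \<forall>v\<in>carrier M. inv_into (reg_maps S) \<iota> (d v) = frob \<rho> e (\<beta> v)"
 proof (rule G_homI[OF g(1) J])
  show "frob \<rho> e v \<in> reg_maps S" if "v \<in> S" for v by (rule frob_mem[of e S, OF e e_add e_scale that])
  show "frob \<rho> e (v + w) = frob \<rho> e v + frob \<rho> e w" if "v \<in> S" "w \<in> S" for v w
   by (rule frob_add[of e S, OF e e_add e_scale that])
  show "frob \<rho> e (fscale c v) = fscale c (frob \<rho> e v)" if "v \<in> S" for v c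
   by (rule frob_scale[of e S, OF e e_add e_scale that])
  show "frob \<rho> e (\<rho> g v) = rtrans g (frob \<rho> e v)" if "g \<in> SL2" "v \<in> S" for v g
   by (rule frob_act[of e S, OF e e_add e_scale that])
 qed
 then obtain d where d: "d \<in> G_hom M ?J" "\<And>v. v \<in> carrier M ==> inv_into (reg_maps S) \<iota> (d v) = frob \<rho> e (\<beta> v)" by blast
 have "d v = \<zero>\<^bsub>?J\<^esub> \<longleftrightarrow> v \<in> E" if v: "v \<in> carrier M" for v
 proof -
  have "d v = \<zero>\<^bsub>?J\<^esub> \<longleftrightarrow> frob \<rho> e (\<beta> v) = 0"
   using fn_modelD(10)[OF gmodelD(1)[OF J] G_homD(1)[OF d(1) v]] d(2)[OF v] by simp
  also have "... \<longleftrightarrow> (\<forall>g\<in>SL2. e (\<rho> g (\<beta> v)) = 0)"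
   by (auto simp: frob_def fun_eq_iff split: if_splits)
  also have "... \<longleftrightarrow> (\<forall>g\<in>SL2. act M g v \<in> E)"
  proof (intro ball_cong refl)
   fix g :: "'k mat" assume gS: "g \<in> SL2"
   have "\<beta> (act M g v) \<in> ?K \<longleftrightarrow> act M g v \<in> E"
    using F(9)[OF gmodelD(2)[OF g(1) gS v]] EM by auto
   then show "e (\<rho> g (\<beta> v)) = 0 \<longleftrightarrow> act M g v \<in> E" using e0 gmodelD(3)[OF g(1) gS v] by simp
  qed
  also have "... \<longleftrightarrow> v \<in> E"
  proof
   assume "\<forall>g\<in>SL2. act M g v \<in> E"
   moreover have "1\<^sub>m 2 \<in> (SL2 :: 'k mat set)" by (simp add: one_mat2)
   ultimately show "v \<in> E" using rational_module.act_one[OF M v] by auto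
  qed (use Ed in blast)
  finally show ?thesis .
 qed
 then show ?thesis using inj d(1) EM by (intro exI[of _ ?J] exI[of _ d]) auto
qed

text \<open>Dependent choice on pairs of an injective module and the image of the preceding map,
  which is prescribed as kernel of the next one.\<close>

theorem injective_resolution_exists:
 fixes M :: "('k::alg_closed_field, 'v) gmodule"
 assumes kv: "inj (kv :: 'k => 'v)" and M: "rational_module M"
 shows "\<exists>(I :: nat => ('k, 'v) gmodule) d. injective_resolution M I d"
proof -
 obtain \<beta> :: "'v => 'v => 'k" and S \<rho> where g: "gmodel M \<beta> S \<rho>" "gmod S \<rho>" using rational_gmodel[OF M] by blast
 note F = fn_modelD[OF gmodelD(1)[OF g(1)]]
 have ratJ: "rational_module J" if "injective_module J" for J :: "('k, 'v) gmodule"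
  using that by (simp add: injective_module_def)
 have "stable M {\<zero>\<^bsub>M\<^esub>}"
 proof -
  have "\<zero>\<^bsub>M\<^esub> \<oplus>\<^bsub>M\<^esub> \<zero>\<^bsub>M\<^esub> = \<zero>\<^bsub>M\<^esub>" using F(10)[OF F(5)[OF F(3) F(3)]] F(6)[OF F(3) F(3)] F(4) by simp
  moreover have "c \<odot>\<^bsub>M\<^esub> \<zero>\<^bsub>M\<^esub> = \<zero>\<^bsub>M\<^esub>" for c using F(10)[OF F(7)[OF F(3)]] F(8)[OF F(3)] F(4) by simp
  moreover have "act M x \<zero>\<^bsub>M\<^esub> = \<zero>\<^bsub>M\<^esub>" if "x \<in> SL2" for x
   using F(10)[OF gmodelD(2)[OF g(1) that F(3)]] gmodelD(3)[OF g(1) that F(3)] F(4) gmod.\<rho>_0[OF g(2) that] by simp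
  ultimately show ?thesis using F(3) by (simp add: stable_def)
 qed
 from enough_injectives[OF kv M this] obtain I0 :: "('k, 'v) gmodule" and e where I0: "injective_module I0" "e \<in> G_hom M I0" "{v \<in> carrier M. e v = \<zero>\<^bsub>I0\<^esub>} = {\<zero>\<^bsub>M\<^esub>}" by blast
 define P where "P n x \<longleftrightarrow> injective_module (fst x) \<and> stable (fst x) (snd x) \<and> (n = (0::nat) \<longrightarrow> x = (I0, e ` carrier M))"
  for n and x :: "('k, 'v) gmodule \<times> 'v set"
 define Q where "Q n x y \<longleftrightarrow> (\<exists>d\<in>G_hom (fst x) (fst y). {v \<in> carrier (fst x). d v = \<zero>\<^bsub>fst y\<^esub>} = snd x \<and> snd y = d ` carrier (fst x))"
  for n :: nat and x y :: "('k, 'v) gmodule \<times> 'v set"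
 have "\<exists>f. \<forall>n. P n (f n) \<and> Q n (f n) (f (Suc n))"
 proof (rule dependent_nat_choice)
  show "\<exists>x. P 0 x" using I0 stable_image[OF M ratJ[OF I0(1)] I0(2)]
   by (intro exI[of _ "(I0, e ` carrier M)"]) (simp add: P_def)
  show "\<exists>y. P (Suc n) y \<and> Q n x y" if x: "P n x" for x n
  proof -
   have inj: "injective_module (fst x)" "stable (fst x) (snd x)" using x by (auto simp: P_def)
   from enough_injectives[OF kv ratJ[OF inj(1)] inj(2)]
   obtain J :: "('k, 'v) gmodule" and d where J: "injective_module J" "d \<in> G_hom (fst x) J" "{v \<in> carrier (fst x). d v = \<zero>\<^bsub>J\<^esub>} = snd x" by blast
   then show ?thesis using stable_image[OF ratJ[OF inj(1)] ratJ[OF J(1)] J(2)]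
    by (intro exI[of _ "(J, d ` carrier (fst x))"]) (auto simp: P_def Q_def)
  qed
 qed
 then obtain f where f: "\<And>n. P n (f n)" "\<And>n. Q n (f n) (f (Suc n))" by blast
 define I where "I n = fst (f n)" for n
 have "\<forall>n. \<exists>d. d \<in> G_hom (I n) (I (Suc n)) \<and> {v \<in> carrier (I n). d v = \<zero>\<^bsub>I (Suc n)\<^esub>} = snd (f n) \<and> snd (f (Suc n)) = d ` carrier (I n)"
  using f(2) unfolding Q_def I_def Bex_def by blast
 from choice[OF this] obtain d where d: "\<And>n. d n \<in> G_hom (I n) (I (Suc n))" "\<And>n. {v \<in> carrier (I n). d n v = \<zero>\<^bsub>I (Suc n)\<^esub>} = snd (f n)"
  "\<And>n. snd (f (Suc n)) = d n ` carrier (I n)" by blast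
 have f0: "f 0 = (I0, e ` carrier M)" using f(1)[of 0] by (simp add: P_def)
 have "inj_on e (carrier M)"
 proof (rule inj_onI)
  obtain r :: "'v => 'v => 'k" and S' \<rho>' where g': "gmodel I0 r S' \<rho>'" using rational_gmodel[OF ratJ[OF I0(1)]] by blast
  note F' = fn_modelD[OF gmodelD(1)[OF g']]
  fix x y assume x: "x \<in> carrier M" and y: "y \<in> carrier M" and eq: "e x = e y"
  let ?z = "x \<oplus>\<^bsub>M\<^esub> ((- 1) \<odot>\<^bsub>M\<^esub> y)"
  have y': "(- 1) \<odot>\<^bsub>M\<^esub> y \<in> carrier M" using F(7)[OF y] .
  have z: "?z \<in> carrier M" using F(5)[OF x y'] .
  have "r (e ?z) = r (e x) + fscale (- 1) (r (e y))"
   unfolding G_homD(2)[OF I0(2) x y'] G_homD(3)[OF I0(2) y]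
   using F'(6)[OF G_homD(1)[OF I0(2) x] F'(7)[OF G_homD(1)[OF I0(2) y]]] F'(8)[OF G_homD(1)[OF I0(2) y]] by simp
  also have "... = 0" unfolding eq by (simp add: fun_eq_iff)
  finally have "e ?z = \<zero>\<^bsub>I0\<^esub>" using F'(10)[OF G_homD(1)[OF I0(2) z]] by simp
  then have "?z = \<zero>\<^bsub>M\<^esub>" using I0(3) z by blast
  then have "\<beta> x + fscale (- 1) (\<beta> y) = 0" using F(6)[OF x y'] F(8)[OF y, of "- 1"] F(4) by simp
  then have "\<beta> x = \<beta> y" by (auto simp: fun_eq_iff)
  then show "x = y" using F(9)[OF x y] by simp
 qed
 moreover have "I 0 = I0" "e ` carrier M = {v \<in> carrier (I 0). d 0 v = \<zero>\<^bsub>I 1\<^esub>}" using f0 d(2)[of 0] by (simp_all add: I_def)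
 moreover have "injective_module (I n)" for n using f(1)[of n] by (simp add: P_def I_def)
 moreover have "d n ` carrier (I n) = {v \<in> carrier (I (Suc n)). d (Suc n) v = \<zero>\<^bsub>I (Suc (Suc n))\<^esub>}" for n
  using d(2)[of "Suc n"] d(3)[of n] by simp
 ultimately have "injective_resolution M I d" unfolding injective_resolution_def using d(1) I0(2) by blast
 then show ?thesis by blast
qed

lemma ghom_bmod_hom:
 fixes S :: "('i => 'k::alg_closed_field) set" and S' :: "('j => 'k) set"
 assumes "gmod S \<rho>" "gmod S' \<rho>'" "CHAR('k) = p" "prime p"
  and T: "\<And>v. v \<in> S ==> T v \<in> S'" "\<And>v w. v \<in> S ==> w \<in> S ==> T (v + w) = T v + T w"
   "\<And>c v. v \<in> S ==> T (fscale c v) = fscale c (T v)" "\<And>g v. g \<in> SL2 ==> v \<in> S ==> T (\<rho> g v) = \<rho>' g (T v)"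
 shows "bmod_hom S \<rho> S' \<rho>' p T"
proof -
 interpret A: gmod S \<rho> by (rule assms(1))
 interpret B: gmod S' \<rho>' by (rule assms(2))
 show ?thesis
  by unfold_locales (auto simp: assms(3,4) T)
qed

text \<open>Frobenius reciprocity for the identity embeds \<open>I\<close> in a coinduced module,
  injectivity of \<open>I\<close> splits the embedding, and acyclicity passes to the
  summand.\<close>

theorem injective_acyclic:
 fixes I :: "('k::alg_closed_field, 'v) gmodule" and \<beta> :: "'v => 'x => 'k"
 assumes kv: "inj (kv :: 'k => 'v)" and p: "CHAR('k) = p" "prime p" "p \<ge> 3"
  and I: "injective_module I" and g: "gmodel I \<beta> S \<rho>" "gmod S \<rho>" and n: "n > 0"
 shows "cocyc p (eop p \<rho>) (wtsp S \<rho>) n \<subseteq> cobd p (eop p \<rho>) (wtsp S \<rho>) n"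
proof -
 interpret gmod S \<rho> by (rule g(2))
 note F = fn_modelD[OF gmodelD(1)[OF g(1)]]
 have rI: "rational_module I" using I by (simp add: injective_module_def)
 obtain \<iota> :: "('k mat \<times> 'x => 'k) => 'v" where \<iota>: "inj_on \<iota> (reg_maps S)" using embed_exists[OF kv g(1)] by blast
 let ?J = "copy \<iota> (reg_maps S) rtrans" and ?\<kappa> = "inv_into (reg_maps S) \<iota>"
 have J: "gmodel ?J ?\<kappa> (reg_maps S) rtrans" by (rule gmodel_copy[OF gmod_reg_maps \<iota>])
 have rJ: "rational_module ?J" by (rule gmodel_rational[OF J gmod_reg_maps])
 let ?T = "frob \<rho> (\<lambda>v. v)"
 note fr = frob_mem[of "\<lambda>v. v" S, simplified] frob_add[of "\<lambda>v. v" S, simplified] frob_scale[of "\<lambda>v. v" S, simplified] frob_act[of "\<lambda>v. v" S, simplified]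
 have ev: "(\<lambda>x. ?T v (1\<^sub>m 2, x)) = v" if "v \<in> S" for v
  using \<rho>_one[OF that] by (auto simp: frob_def one_mat2)
 have "\<exists>f\<in>G_hom I ?J. \<forall>v\<in>carrier I. ?\<kappa> (f v) = ?T (\<beta> v)"
  by (rule G_homI[where T = ?T, OF g(1) J fr])
 then obtain i where i: "i \<in> G_hom I ?J" "\<And>v. v \<in> carrier I ==> ?\<kappa> (i v) = ?T (\<beta> v)" by blast
 have "inj_on i (carrier I)"
 proof (rule inj_onI)
  fix x y assume x: "x \<in> carrier I" and y: "y \<in> carrier I" and eq: "i x = i y"
  have "?T (\<beta> x) = ?T (\<beta> y)" by (simp only: i(2)[OF x, symmetric] i(2)[OF y, symmetric] eq)
  then have "\<beta> x = (\<lambda>t. ?T (\<beta> y) (1\<^sub>m 2, t))" using ev[OF F(11)[OF x]] by (simp only:)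
  then have "\<beta> x = \<beta> y" by (simp only: ev[OF F(11)[OF y]])
  then show "x = y" by (rule F(9)[OF x y])
 qed
 moreover have "(\<lambda>v\<in>carrier I. v) \<in> G_hom I I"
  using F(5,7) gmodelD(2)[OF g(1)] by (auto simp: G_hom_def LinearCombinations.module_hom_def)
 ultimately obtain h where h: "h \<in> G_hom ?J I" "\<And>v. v \<in> carrier I ==> h (i v) = v"
 proof -
  assume "inj_on i (carrier I)" and id: "(\<lambda>v\<in>carrier I. v) \<in> G_hom I I"
  then have "\<exists>h\<in>G_hom ?J I. \<forall>a\<in>carrier I. h (i a) = (\<lambda>v\<in>carrier I. v) a"
   using I rI rJ i(1) unfolding injective_module_def by blast
  then show ?thesis using that by (simp add: Bex_def) blast
 qed
 let ?T' = "transport ?J ?\<kappa> \<beta> h"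
 note T' = transport[OF J g(1) h(1)]
 interpret T: bmod_hom S \<rho> "reg_maps S" rtrans p ?T
  by (rule ghom_bmod_hom[where T = ?T, OF g(2) gmod_reg_maps p(1,2) fr])
 interpret T': bmod_hom "reg_maps S" rtrans S \<rho> p ?T'
  by (rule ghom_bmod_hom[where T = ?T', OF gmod_reg_maps g(2) p(1,2) T'(2-5)])
 have T'T: "?T' (?T v) = v" if v: "v \<in> S" for v
 proof -
  obtain x where x: "x \<in> carrier I" "v = \<beta> x" using fn_model_inv[OF gmodelD(1)[OF g(1)] v] by metis
  have "?T' (?T v) = ?T' (?\<kappa> (i x))" by (simp only: i(2)[OF x(1)] x(2))
  also have "... = \<beta> (h (i x))" by (rule T'(1)[OF G_homD(1)[OF i(1) x(1)]])
  finally show ?thesis by (simp only: h(2)[OF x(1)] x(2))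
 qed
 interpret cech p S by unfold_locales (rule p)+
 show ?thesis
 proof
  fix z assume z: "z \<in> cocyc p (eop p \<rho>) (wtsp S \<rho>) n"
  then have zS: "z r \<in> S" for r using T.A.chainsD(1) by (auto simp: cocyc_def)
  have "(\<lambda>r. ?T (z r)) \<in> cobd p (eop p rtrans) (wtsp (reg_maps S) rtrans) n"
   using T.f_cocyc[OF z] reg_maps_acyclic[OF n] by blast
  then have "(\<lambda>r. ?T' (?T (z r))) \<in> cobd p (eop p \<rho>) (wtsp S \<rho>) n" by (rule T'.f_cobd)
  then show "z \<in> cobd p (eop p \<rho>) (wtsp S \<rho>) n" by (simp add: T'T zS)
 qed
qed

subsection \<open>Cohomology from a resolution\<close>

text \<open>A linear projection onto \<open>Z\<close>, applied to the coefficient vectors, shows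
  that a submodule is again rational.\<close>

lemma sub_gmod:
 assumes m: "gmod S \<rho>" and Z: "Z \<subseteq> S" "0 \<in> Z" "\<And>v w. v \<in> Z ==> w \<in> Z ==> v + w \<in> Z" "\<And>c v. v \<in> Z ==> fscale c v \<in> Z"
  and act: "\<And>g v. g \<in> SL2 ==> v \<in> Z ==> \<rho> g v \<in> Z"
 shows "gmod Z \<rho>"
proof -
 interpret gmod S \<rho> by (rule m)
 have S: "v \<in> S" if "v \<in> Z" for v using that Z(1) by blast
 obtain q where q: "\<And>f. q f \<in> Z" "\<And>f. f \<in> Z ==> q f = f" "\<And>f h. q (f + h) = q f + q h" "\<And>c f. q (fscale c f) = fscale c (q f)"
 proof (rule subspace_projectionE[of Z])
  show "v + w \<in> Z" if "v \<in> Z" "w \<in> Z" for v w using that by (rule Z)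
  show "fscale c v \<in> Z" if "v \<in> Z" for c v using that by (rule Z)
 qed (rule Z, rule that)
 have q0: "q 0 = 0" by (rule q(2)[OF Z(2)])
 have qs: "q (sum f A) = (\<Sum>a\<in>A. q (f a))" for f and A :: "nat set"
  by (induction A rule: infinite_finite_induct) (simp_all only: sum.infinite sum.empty sum.insert q0 q(3) not_False_eq_True)
 show ?thesis
 proof
  show "\<exists>(N::nat) r a. (\<forall>l<N. r l \<in> regular_functions \<and> a l \<in> Z) \<and> (\<forall>g\<in>SL2. \<rho> g v = (\<Sum>l<N. fscale (r l g) (a l)))" if v: "v \<in> Z" for v
  proof -
   obtain N :: nat and r a where ra: "\<forall>l<N. r l \<in> regular_functions \<and> a l \<in> S"
    "\<forall>g\<in>SL2. \<rho> g v = (\<Sum>l<N. fscale (r l g) (a l))" using \<rho>_rational[OF S[OF v]] by blast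
   have "\<rho> g v = (\<Sum>l<N. fscale (r l g) (q (a l)))" if g: "g \<in> SL2" for g
   proof -
    have "\<rho> g v = (\<Sum>l<N. fscale (r l g) (a l))" using ra(2) g by blast
    then have "q (\<rho> g v) = (\<Sum>l<N. fscale (r l g) (q (a l)))" by (simp only: qs q(4))
    then show ?thesis using q(2)[OF act[OF g v]] by (simp only:)
   qed
   then show ?thesis using ra(1) q(1)
    by (intro exI[of _ N] exI[of _ r] exI[of _ "\<lambda>l. q (a l)"]) simp
  qed
 qed (simp_all add: S Z act \<rho>_add \<rho>_scale \<rho>_one \<rho>_mult)
qed

locale gres =
 fixes p :: nat and S :: "nat => ('x => 'k::alg_closed_field) set" and \<rho> :: "nat => 'k mat => ('x => 'k) => 'x => 'k"
  and D :: "nat => ('x => 'k) => 'x => 'k"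
 assumes chark: "CHAR('k) = p" and primep: "prime p"
  and gm: "gmod (S n) (\<rho> n)"
  and D_S: "v \<in> S n ==> D n v \<in> S (Suc n)" and D_plus: "v \<in> S n ==> w \<in> S n ==> D n (v + w) = D n v + D n w"
  and D_fscale: "v \<in> S n ==> D n (fscale c v) = fscale c (D n v)"
  and D_act: "g \<in> SL2 ==> v \<in> S n ==> D n (\<rho> n g v) = \<rho> (Suc n) g (D n v)"
  and D_exact: "D n ` S n = {v \<in> S (Suc n). D (Suc n) v = 0}"
  and acyc: "q > 0 ==> cocyc p (eop p (\<rho> n)) (wtsp (S n) (\<rho> n)) q \<subseteq> cobd p (eop p (\<rho> n)) (wtsp (S n) (\<rho> n)) q"
begin

text \<open>By exactness \<open>Z (Suc n)\<close> is also the image of \<open>D n\<close>, so these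
  kernels are the successive terms of the dimension shifting.\<close>

definition Z :: "nat => ('x => 'k) set" where
 "Z n = {v \<in> S n. D n v = 0}"

lemma gmZ: "gmod (Z n) (\<rho> n)"
proof -
 interpret gmod "S n" "\<rho> n" by (rule gm)
 interpret G': gmod "S (Suc n)" "\<rho> (Suc n)" by (rule gm)
 have D0: "D n 0 = 0" using D_fscale[OF S_zero, of 0] by simp
 show ?thesis
 proof (rule sub_gmod[OF gm])
  show "Z n \<subseteq> S n" "0 \<in> Z n" using D0 S_zero by (auto simp: Z_def)
  show "v + w \<in> Z n" if "v \<in> Z n" "w \<in> Z n" for v w using that D_plus[of v n w] S_plus by (simp add: Z_def)
  show "fscale c v \<in> Z n" if "v \<in> Z n" for c v using that D_fscale[of v n c] S_fscale by (simp add: Z_def)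
  show "\<rho> n g v \<in> Z n" if "g \<in> SL2" "v \<in> Z n" for g v
   using that D_act[of g v n] \<rho>_S[of g v] G'.\<rho>_0[of g] by (simp add: Z_def)
 qed
qed

abbreviation "eo n \<equiv> eop p (\<rho> n)"
abbreviation "WS n \<equiv> wtsp (S n) (\<rho> n)"
abbreviation "WZ n \<equiv> wtsp (Z n) (\<rho> n)"

lemma WZ_iff: "v \<in> WZ n \<mu> \<longleftrightarrow> v \<in> WS n \<mu> \<and> v \<in> Z n"
 by (auto simp: wtsp_def Z_def)

lemma D_Z: "v \<in> S n ==> D n v \<in> Z (Suc n)"
 using D_exact[of n] by (auto simp: Z_def)

text \<open>The point to check is lifting of weight vectors: an arbitrary lift is decomposed into
  weight vectors, and its component of weight \<open>\<mu>\<close> is still a lift.\<close>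

lemma ses: "short_exact p (Z n) (eo n) (WZ n) (S n) (eo n) (WS n) (Z (Suc n)) (eo (Suc n)) (WZ (Suc n)) (\<lambda>v. v) (D n)"
proof -
 interpret i: bmod_hom "Z n" "\<rho> n" "S n" "\<rho> n" p "\<lambda>v. v"
  by (rule ghom_bmod_hom[OF gmZ gm chark primep]) (simp_all add: Z_def)
 interpret d: bmod_hom "S n" "\<rho> n" "Z (Suc n)" "\<rho> (Suc n)" p "D n"
  by (rule ghom_bmod_hom[OF gm gmZ chark primep]) (simp_all add: D_Z D_plus D_fscale D_act)
 interpret G: gmod "S n" "\<rho> n" by (rule gm)
 show ?thesis
 proof unfold_locales
  show "v \<in> WZ n \<mu>" if "v \<in> Z n" "v \<in> WS n \<mu>" for v \<mu> using that by (simp add: WZ_iff)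
  show "\<exists>x\<in>WS n \<mu>. D n x = u" if u: "u \<in> WZ (Suc n) \<mu>" for u \<mu>
  proof -
   have "u \<in> Z (Suc n)" using u by (simp add: WZ_iff)
   then have "u \<in> D n ` S n" using D_exact[of n] by (simp add: Z_def)
   then obtain x where x: "x \<in> S n" "D n x = u" by blast
   obtain N K :: nat and c where c: "\<And>l. c l \<in> WS n (int l - int N)" "x = (\<Sum>l\<le>K. c l)"
    using G.weight_decomposition[OF x(1)] by blast
   have cS: "c l \<in> S n" for l using c(1) by (simp add: wtsp_def)
   have Du: "u = (\<Sum>l\<le>K. D n (c l))" unfolding x(2)[symmetric] c(2) by (rule d.f_sum) (rule cS)
   have 0: "D n (c l) = 0" if "l \<le> K" "int l - int N \<noteq> \<mu>" for l
   proof (rule d.B.wt_indep[where X = "{..K}" and f = "\<lambda>l. int l - int N" and c = "\<lambda>l. D n (c l)" and \<mu> = \<mu>])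
    show "(\<Sum>l\<le>K. D n (c l)) \<in> WZ (Suc n) \<mu>" using u Du by simp
    show "D n (c l) \<in> WZ (Suc n) (int l - int N)" for l by (rule d.f_wtsp[OF c(1)])
   qed (use that in \<open>auto simp: inj_on_def\<close>)
   let ?L = "{l \<in> {..K}. int l - int N = \<mu>}"
   have "(\<Sum>l\<in>?L. c l) \<in> WS n \<mu>" by (rule i.B.Wt_sum) (use c(1) in force)
   moreover have "D n (\<Sum>l\<in>?L. c l) = u"
   proof -
    have "D n (\<Sum>l\<in>?L. c l) = (\<Sum>l\<in>?L. D n (c l))" by (rule d.f_sum) (rule cS)
    also have "... = (\<Sum>l\<le>K. D n (c l))" by (rule sum.mono_neutral_left) (use 0 in auto)
    finally show ?thesis by (simp only: Du)
   qed
   ultimately show ?thesis by blast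
  qed
  show "D n x = 0 \<longleftrightarrow> x \<in> (\<lambda>v. v) ` Z n" if "x \<in> S n" for x using that by (simp add: Z_def)
 qed (simp_all add: D_fscale)
qed

abbreviation "HZ q n N \<equiv> quot_dim cscale (cocyc p (eo n) (WZ n) q) (cobd p (eo n) (WZ n) q) N"

text \<open>For \<open>q \<ge> 1\<close> the cocycles of the middle term are coboundaries, so their
  images add nothing to the denominator.\<close>

lemma shift:
 assumes q: "q \<ge> 1" and H: "HZ (q + 1) n N"
 shows "HZ q (Suc n) N"
proof -
 interpret short_exact p "Z n" "eo n" "WZ n" "S n" "eo n" "WS n" "Z (Suc n)" "eo (Suc n)" "WZ (Suc n)" "\<lambda>v. v" "D n"
  by (rule ses)
 have "quot_dim cscale (cocyc p (eo (Suc n)) (WZ (Suc n)) q)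
  {(\<lambda>r. D n (y r)) + D_op p (eo (Suc n)) w | y w. y \<in> cocyc p (eo n) (WS n) q \<and> w \<in> chains p (WZ (Suc n)) (q - 1)} N"
  by (rule dimension_shift[OF acyc H]) (use q in simp)
 moreover have "{(\<lambda>r. D n (y r)) + D_op p (eo (Suc n)) w | y w. y \<in> cocyc p (eo n) (WS n) q \<and> w \<in> chains p (WZ (Suc n)) (q - 1)}
   = cobd p (eo (Suc n)) (WZ (Suc n)) q" (is "?L = ?R")
 proof
  show "?L \<subseteq> ?R"
  proof
   fix b assume "b \<in> ?L"
   then obtain y w where yw: "y \<in> cocyc p (eo n) (WS n) q" "w \<in> chains p (WZ (Suc n)) (q - 1)"
    "b = (\<lambda>r. D n (y r)) + D_op p (eo (Suc n)) w" by blast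
   have "y \<in> cobd p (eo n) (WS n) q" using acyc[of q n] yw(1) q by auto
   then have "(\<lambda>r. D n (y r)) \<in> ?R" by (rule d.f_cobd)
   then obtain x where x: "x \<in> chains p (WZ (Suc n)) (q - 1)" "(\<lambda>r. D n (y r)) = D_op p (eo (Suc n)) x"
    by (auto simp: cobd_def)
   have "b = D_op p (eo (Suc n)) (x + w)" unfolding yw(3) x(2) by (rule C.D_add[OF x(1) yw(2), symmetric])
   then show "b \<in> ?R" using C.chains_add[OF x(1) yw(2)] unfolding cobd_def by blast
  qed
  show "?R \<subseteq> ?L"
  proof
   fix b assume "b \<in> ?R"
   then obtain w where w: "w \<in> chains p (WZ (Suc n)) (q - 1)" "b = D_op p (eo (Suc n)) w" by (auto simp: cobd_def)
   have "b = (\<lambda>r. D n ((0 :: (nat => nat) => 'x => 'k) r)) + D_op p (eo (Suc n)) w"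
    unfolding w(2) using d.f_0 by (simp add: fun_eq_iff)
   then show "b \<in> ?L" using B.cocyc_0 w(1) by blast
  qed
 qed
 ultimately show ?thesis by (simp only:)
qed

lemma shifts: "HZ (int (n + j)) 0 N ==> n \<ge> 1 ==> HZ (int n) j N"
proof (induction j arbitrary: n)
 case (Suc j)
 have "HZ (int n + 1) j N" using Suc.IH[of "Suc n"] Suc.prems by (simp add: add.commute)
 then show ?case using Suc.prems by (intro shift) auto
qed simp

definition Inv :: "nat => ('x => 'k) set" where
 "Inv n = {v \<in> S n. \<forall>g\<in>SL2. \<rho> n g v = v}"

lemma inv_cocycle:
 assumes m: "gmod T (\<rho> n)"
 shows "z \<in> cocyc p (eo n) (wtsp T (\<rho> n)) 0 \<longleftrightarrow> (\<exists>v\<in>T. (\<forall>g\<in>SL2. \<rho> n g v = v) \<and> z = (\<lambda>r. if r = (\<lambda>_. 0) then v else 0))"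
proof -
 interpret gmod T "\<rho> n" by (rule m)
 interpret bmod_char T "\<rho> n" p by unfold_locales (rule chark, rule primep)
 have "v \<in> wtsp T (\<rho> n) 0 \<and> (\<forall>i. eo n i v = 0) \<longleftrightarrow> v \<in> T \<and> (\<forall>g\<in>SL2. \<rho> n g v = v)" for v
 proof
  assume v: "v \<in> wtsp T (\<rho> n) 0 \<and> (\<forall>i. eo n i v = 0)"
  then have vT: "v \<in> T" by (simp add: wtsp_def)
  have "\<rho> n g v = v" if "g \<in> SL2" for g
   by (rule invariant[OF vT eop_all_0[OF vT] _ that]) (use v in \<open>auto simp: wtsp_def\<close>)
  then show "v \<in> T \<and> (\<forall>g\<in>SL2. \<rho> n g v = v)" using vT by blast
 next
  assume v: "v \<in> T \<and> (\<forall>g\<in>SL2. \<rho> n g v = v)"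
  then have "v \<in> wtsp T (\<rho> n) 0" by (simp add: wtsp_def)
  moreover have "eo n i v = 0" for i by (rule inv_eop) (use v in auto)
  ultimately show "v \<in> wtsp T (\<rho> n) 0 \<and> (\<forall>i. eo n i v = 0)" by blast
 qed
 then show ?thesis unfolding cocyc_0_iff by blast
qed

text \<open>\<open>j\<close> shifts lead from degree \<open>Suc j\<close> to degree 1. One more ends
  in degree 0, where the cocycles are invariants and the denominator is the image of the invariants
  of \<open>S j\<close>.\<close>

theorem quot_dim_invariants:
 assumes H: "HZ (int (Suc j)) 0 N"
 shows "quot_dim fscale {v \<in> Inv (Suc j). D (Suc j) v = 0} (D j ` Inv j) N"
proof -
 interpret short_exact p "Z j" "eo j" "WZ j" "S j" "eo j" "WS j" "Z (Suc j)" "eo (Suc j)" "WZ (Suc j)" "\<lambda>v. v" "D j"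
  by (rule ses)
 have "HZ 1 j N" using shifts[of 1 j N] H by simp
 then have H1: "HZ (0 + 1) j N" by simp
 let ?B = "{(\<lambda>r. D j (y r)) + D_op p (eo (Suc j)) w | y w. y \<in> cocyc p (eo j) (WS j) 0 \<and> w \<in> chains p (WZ (Suc j)) (0 - 1)}"
 have qd: "quot_dim cscale (cocyc p (eo (Suc j)) (WZ (Suc j)) 0) ?B N"
  by (rule dimension_shift[OF acyc H1]) simp
 define c where "c v = (\<lambda>r::nat => nat. if r = (\<lambda>_. 0) then v else 0)" for v :: "'x => 'k"
 let ?A' = "{v \<in> Inv (Suc j). D (Suc j) v = 0}"
 have A': "v \<in> ?A' \<longleftrightarrow> v \<in> Z (Suc j) \<and> (\<forall>g\<in>SL2. \<rho> (Suc j) g v = v)" for v by (auto simp: Inv_def Z_def)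
 have cA: "z \<in> cocyc p (eo (Suc j)) (WZ (Suc j)) 0 \<longleftrightarrow> (\<exists>v\<in>?A'. z = c v)" for z
  unfolding inv_cocycle[OF gmZ] c_def using A' by blast
 have cS: "z \<in> cocyc p (eo j) (WS j) 0 \<longleftrightarrow> (\<exists>v\<in>Inv j. z = c v)" for z
  unfolding inv_cocycle[OF gm] c_def Inv_def by blast
 \<comment> \<open>Chains of degree \<open>-1\<close> vanish, so no coboundaries remain in the
   denominator.\<close>
 have w0: "w = 0" if "w \<in> chains p (WZ (Suc j)) (0 - 1)" for w
 proof
  fix r show "w r = 0 r" using C.chainsD(4)[OF that, of r] by (cases "w r = 0") auto
 qed
 have Dc: "(\<lambda>r. D j (c v r)) = c (D j v)" for v using d.f_0 by (auto simp: c_def)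
 have B: "?B = c ` D j ` Inv j"
 proof (rule equalityI; rule subsetI)
  fix b assume "b \<in> ?B"
  then obtain y w where yw: "y \<in> cocyc p (eo j) (WS j) 0" "w \<in> chains p (WZ (Suc j)) (0 - 1)"
    "b = (\<lambda>r. D j (y r)) + D_op p (eo (Suc j)) w" by blast
  obtain v where v: "v \<in> Inv j" "y = c v" using yw(1) cS by blast
  have "b = c (D j v)" unfolding yw(3) w0[OF yw(2)] C.D_0 v(2) Dc by simp
  then show "b \<in> c ` D j ` Inv j" using v(1) by blast
 next
  fix b assume "b \<in> c ` D j ` Inv j"
  then obtain v where v: "v \<in> Inv j" "b = c (D j v)" by blast
  have "b = (\<lambda>r. D j (c v r)) + D_op p (eo (Suc j)) 0" unfolding v(2) C.D_0 Dc by simp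
  moreover have "c v \<in> cocyc p (eo j) (WS j) 0" using cS v(1) by blast
  ultimately show "b \<in> ?B" using C.chains_0 by blast
 qed
 have inj: "c v = c w \<longleftrightarrow> v = w" for v w
 proof
  assume "c v = c w"
  from fun_cong[OF this, of "\<lambda>_. 0"] show "v = w" by (simp add: c_def)
 qed simp
 interpret Z1: gmod "Z (Suc j)" "\<rho> (Suc j)" by (rule gmZ)
 show ?thesis
 proof (rule quot_dim_transfer[OF qd, of "\<lambda>a b. b \<in> ?A' \<and> a = c b"])
  show "0 \<in> ?A' \<and> 0 = c 0" unfolding A' using Z1.S_zero Z1.\<rho>_0 by (auto simp: c_def fun_eq_iff)
  show "b - b' \<in> ?A' \<and> a - a' = c (b - b')" if "b \<in> ?A' \<and> a = c b" "b' \<in> ?A' \<and> a' = c b'" for a b a' b'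
  proof -
   have b: "b \<in> Z (Suc j)" "b' \<in> Z (Suc j)" using that A' by blast+
   have e: "b - b' = b + fscale (- 1) b'" by (simp add: fun_eq_iff)
   have "b - b' \<in> ?A'"
    unfolding A' e using b that[unfolded A'] Z1.S_plus Z1.S_fscale Z1.\<rho>_add Z1.\<rho>_scale by simp
   moreover have "c b - c b' = c (b - b')" by (auto simp: c_def fun_eq_iff)
   ultimately show ?thesis using that by blast
  qed
  show "fscale l b \<in> ?A' \<and> cscale l a = c (fscale l b)" if "b \<in> ?A' \<and> a = c b" for l a b
  proof -
   have "fscale l b \<in> ?A'" unfolding A' using that[unfolded A'] Z1.S_fscale Z1.\<rho>_scale by simp
   moreover have "cscale l (c b) = c (fscale l b)" by (auto simp: c_def cscale_def fun_eq_iff)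
   ultimately show ?thesis using that by blast
  qed
  show "\<exists>b. b \<in> ?A' \<and> a = c b" if "a \<in> cocyc p (eo (Suc j)) (WZ (Suc j)) 0" for a using that cA by blast
  show "\<exists>a\<in>cocyc p (eo (Suc j)) (WZ (Suc j)) 0. b \<in> ?A' \<and> a = c b" if "b \<in> ?A'" for b using that cA by blast
  show "a \<in> ?B \<longleftrightarrow> b \<in> D j ` Inv j" if "b \<in> ?A' \<and> a = c b" for a b
   unfolding B using that inj by (auto simp: image_iff)
 qed blast
qed

end

subsection \<open>Dimensions of the Ext groups\<close>

text \<open>The model space is a copy of \<open>k ^ N\<close>, and the preimages of the unit vectors
  form a basis.\<close>

lemma fn_model_dim:
 fixes V :: "('k::field, 'v, 'm) module_scheme"
 assumes m: "fn_model V r {c. \<forall>l\<ge>N. c l = 0}"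
 shows "vectorspace.fin_dim class_ring V \<and> vectorspace.dim class_ring V = (N::nat)"
proof -
 interpret vectorspace class_ring V by (rule fn_model_vectorspace[OF m])
 note F = fn_modelD[OF m] and I = fn_model_inv[OF m]
 define u where "u l = (\<lambda>i::nat. if i = l then 1 else (0::'k))" for l
 define b where "b l = inv_into (carrier V) r (u l)" for l
 have b: "b l \<in> carrier V" "r (b l) = u l" if "l < N" for l
 proof -
  have "u l \<in> {c. \<forall>l\<ge>N. c l = 0}" using that by (auto simp: u_def)
  then show "b l \<in> carrier V" "r (b l) = u l" unfolding b_def by (rule I)+
 qed
 define A where "A = b ` {..<N}"
 have inj: "inj_on b {..<N}"
 proof (rule inj_onI)
  fix l k assume lk: "l \<in> {..<N}" "k \<in> {..<N}" "b l = b k"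
  then have "u l = u k" using b(2)[of l] b(2)[of k] by simp
  from fun_cong[OF this, of l] show "l = k" by (simp add: u_def split: if_splits)
 qed
 have A: "finite A" "A \<subseteq> carrier V" "card A = N" using b(1) card_image[OF inj] by (auto simp: A_def)
 have lc: "r (lincomb a A) l = (if l < N then a (b l) else 0)" for a l
 proof -
  have "(\<lambda>v. a v \<odot>\<^bsub>V\<^esub> v) \<in> A \<rightarrow> carrier V" using A(2) F(7) by auto
  then have "r (lincomb a A) = (\<Sum>v\<in>A. r (a v \<odot>\<^bsub>V\<^esub> v))" unfolding lincomb_def by (rule fn_model_finsum(2)[OF m A(1)])
  also have "... = (\<Sum>k<N. r (a (b k) \<odot>\<^bsub>V\<^esub> b k))" unfolding A_def by (rule sum.reindex_cong[OF inj refl refl])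
  also have "... = (\<Sum>k<N. fscale (a (b k)) (u k))" using b F(8) by (intro sum.cong) auto
  finally have "r (lincomb a A) l = (\<Sum>k<N. a (b k) * u k l)" by (simp add: sum_fun_apply)
  also have "... = (\<Sum>k<N. if k = l then a (b k) else 0)" by (intro sum.cong) (auto simp: u_def)
  finally show ?thesis by (simp add: sum.delta')
 qed
 have "span A = carrier V"
 proof
  show "span A \<subseteq> carrier V" using span_is_subset2[OF A(2)] .
  show "carrier V \<subseteq> span A"
  proof
   fix v assume v: "v \<in> carrier V"
   define a where "a w = r v (the_inv_into {..<N} b w)" for w
   have ab: "a (b l) = r v l" if "l < N" for l using the_inv_into_f_f[OF inj, of l] that by (simp add: a_def)
   have c: "lincomb a A \<in> carrier V" by (rule lincomb_closed[OF A(2)]) simp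
   have "r (lincomb a A) = r v"
   proof
    fix l show "r (lincomb a A) l = r v l" using lc[of a l] ab F(11)[OF v] by simp
   qed
   then have "v = lincomb a A" using F(9)[OF c v] by simp
   then show "v \<in> span A" using finite_span[OF A(1,2)] by auto
  qed
 qed
 moreover have "lin_indpt A"
 proof (rule finite_lin_indpt2[OF A(1,2)])
  fix a assume "lincomb a A = \<zero>\<^bsub>V\<^esub>"
  then have "r (lincomb a A) l = 0" for l using F(4) by simp
  then have "a (b l) = 0" if "l < N" for l using lc[of a l] that by simp
  then show "\<forall>v\<in>A. a v = \<zero>\<^bsub>class_ring\<^esub>" by (auto simp: A_def)
 qed
 ultimately have "basis A" using A(2) by (simp add: basis_def)
 moreover have "fin_dim" unfolding fin_dim_def using A(1,2) \<open>span A = carrier V\<close> by blast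
 ultimately show ?thesis using dim_basis[OF A(1)] A(3) by simp
qed

text \<open>Taking coordinates with respect to the representatives turns \<open>quot_dim\<close>
  into a linear map that can serve as a model of the quotient space.\<close>

lemma quot_dim_coordinates:
 fixes A :: "('x => 'k::field) set"
 assumes A: "0 \<in> A" "\<And>v w. v \<in> A ==> w \<in> A ==> v + w \<in> A" "\<And>c v. v \<in> A ==> fscale c v \<in> A"
  and B: "0 \<in> B" "\<And>v w. v \<in> B ==> w \<in> B ==> v + w \<in> B" "\<And>c v. v \<in> B ==> fscale c v \<in> B"
  and qd: "quot_dim fscale A B N"
 obtains \<pi> where "\<And>v w. v \<in> A ==> w \<in> A ==> \<pi> (v + w) = \<pi> v + \<pi> w" "\<And>c v. v \<in> A ==> \<pi> (fscale c v) = fscale c (\<pi> v)"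
  "\<pi> ` A = {c. \<forall>l\<ge>N. c l = 0}" "\<And>v. v \<in> A ==> \<pi> v = 0 \<longleftrightarrow> v \<in> B"
proof -
 obtain \<xi> where \<xi>: "\<And>l. l < N ==> \<xi> l \<in> A" "\<And>a. a \<in> A ==> \<exists>c. a - (\<Sum>l<N. fscale (c l) (\<xi> l)) \<in> B"
  "\<And>c. (\<Sum>l<N. fscale (c l) (\<xi> l)) \<in> B ==> \<forall>l<N. c l = 0"
  using qd unfolding quot_dim_def by blast
 have Bm: "v - w \<in> B" if "v \<in> B" "w \<in> B" for v w
 proof -
  have "v - w = v + fscale (- 1) w" by (simp add: fun_eq_iff)
  then show ?thesis using B(2)[OF that(1) B(3)[OF that(2), of "- 1"]] by (simp only:)
 qed
 define K where "K = {c :: nat => 'k. \<forall>l\<ge>N. c l = 0}"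
 define L where "L c = (\<Sum>l<N. fscale (c l) (\<xi> l))" for c
 have L: "L (c + c') = L c + L c'" "L (fscale a c) = fscale a (L c)" for c c' a
  by (simp_all add: L_def fscale_add_left sum.distrib fscale_sum)
 have LA: "L c \<in> A" for c
 proof -
  have "(\<Sum>l<n. fscale (c l) (\<xi> l)) \<in> A" if "n \<le> N" for n
   using that
  proof (induction n)
   case (Suc n)
   have a: "(\<Sum>l<n. fscale (c l) (\<xi> l)) \<in> A" by (rule Suc.IH) (use Suc.prems in simp)
   have "\<xi> n \<in> A" using \<xi>(1)[of n] Suc.prems by simp
   from A(2)[OF a A(3)[OF this, of "c n"]] show ?case by (simp only: sum.lessThan_Suc)
  qed (simp add: A(1))
  then show ?thesis unfolding L_def by blast
 qed
 have Lu: "c = c'" if c: "c \<in> K" "c' \<in> K" "v - L c \<in> B" "v - L c' \<in> B" for c c' v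
 proof
  have "L (c + fscale (- 1) c') = (v - L c') - (v - L c)" unfolding L by (simp add: fun_eq_iff)
  then have "L (c + fscale (- 1) c') \<in> B" using Bm[OF c(4,3)] by (simp only:)
  from \<xi>(3)[OF this[unfolded L_def]] show "c l = c' l" for l
   using c(1,2) by (cases "l < N") (auto simp: K_def)
 qed
 have Le: "\<exists>c. c \<in> K \<and> v - L c \<in> B" if v: "v \<in> A" for v
 proof -
  obtain c where c: "v - (\<Sum>l<N. fscale (c l) (\<xi> l)) \<in> B" using \<xi>(2)[OF v] by blast
  have "L (\<lambda>l. if l < N then c l else 0) = (\<Sum>l<N. fscale (c l) (\<xi> l))" unfolding L_def by (intro sum.cong) auto
  then show ?thesis using c by (intro exI[of _ "\<lambda>l. if l < N then c l else 0"]) (simp add: K_def)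
 qed
 define \<pi> where "\<pi> v = (SOME c. c \<in> K \<and> v - L c \<in> B)" for v
 have \<pi>: "\<pi> v \<in> K" "v - L (\<pi> v) \<in> B" if "v \<in> A" for v
  using someI_ex[OF Le[OF that]] by (auto simp: \<pi>_def)
 have eq: "\<pi> v = c" if "v \<in> A" "c \<in> K" "v - L c \<in> B" for v c
  using Lu[OF \<pi>(1) that(2) \<pi>(2) that(3)] that(1) by blast
 show thesis
 proof (rule that[of \<pi>])
  fix v assume v: "v \<in> A"
  show "\<pi> v = 0 \<longleftrightarrow> v \<in> B"
  proof
   assume "\<pi> v = 0"
   then show "v \<in> B" using \<pi>(2)[OF v] by (simp add: L_def)
  qed (intro eq[OF v], simp_all add: K_def L_def)
  show "\<pi> (fscale a v) = fscale a (\<pi> v)" for a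
  proof (rule eq[OF A(3)[OF v]])
   have "fscale a v - L (fscale a (\<pi> v)) = fscale a (v - L (\<pi> v))" unfolding L by (simp add: fscale_diff)
   then show "fscale a v - L (fscale a (\<pi> v)) \<in> B" using B(3)[OF \<pi>(2)[OF v]] by (simp only:)
  qed (use \<pi>(1)[OF v] in \<open>simp add: K_def\<close>)
  fix w assume w: "w \<in> A"
  show "\<pi> (v + w) = \<pi> v + \<pi> w"
  proof (rule eq[OF A(2)[OF v w]])
   have "v + w - L (\<pi> v + \<pi> w) = (v - L (\<pi> v)) + (w - L (\<pi> w))" unfolding L by simp
   then show "v + w - L (\<pi> v + \<pi> w) \<in> B" using B(2)[OF \<pi>(2)[OF v] \<pi>(2)[OF w]] by (simp only:)
  qed (use \<pi>(1)[OF v] \<pi>(1)[OF w] in \<open>simp add: K_def\<close>)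
 next
  have "c = \<pi> (L c)" if "c \<in> K" for c using eq[OF LA that] B(1) by simp
  then show "\<pi> ` A = {c. \<forall>l\<ge>N. c l = 0}" using \<pi>(1) LA unfolding K_def[symmetric] by blast
 qed
qed

text \<open>The cosets of \<open>W\<close> are the fibres of \<open>\<pi>\<close>, so the quotient
  operations correspond to those on the values.\<close>

lemma quotient_space_model:
 fixes V :: "('k::field, 'v) module" (structure) and \<pi> :: "'v => nat => 'k"
 assumes m: "fn_model V \<beta> A" and add: "\<And>x y. x \<in> carrier V ==> y \<in> carrier V ==> \<pi> (x \<oplus> y) = \<pi> x + \<pi> y"
  and scale: "\<And>c x. x \<in> carrier V ==> \<pi> (c \<odot> x) = fscale c (\<pi> x)" and W: "W = {x \<in> carrier V. \<pi> x = 0}"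
 shows "\<exists>r. fn_model (quotient_space V W) r (\<pi> ` carrier V)"
proof -
 note F = fn_modelD[OF m]
 define C where "C k = {x \<in> carrier V. \<pi> x = k}" for k
 have sub: "y \<oplus> ((- 1) \<odot> x) \<in> carrier V" "\<pi> (y \<oplus> ((- 1) \<odot> x)) = \<pi> y - \<pi> x" "(y \<oplus> ((- 1) \<odot> x)) \<oplus> x = y"
  if x: "x \<in> carrier V" and y: "y \<in> carrier V" for x y
 proof -
  show 1: "y \<oplus> ((- 1) \<odot> x) \<in> carrier V" by (rule F(5)[OF y F(7)[OF x]])
  show "\<pi> (y \<oplus> ((- 1) \<odot> x)) = \<pi> y - \<pi> x" using add[OF y F(7)[OF x]] scale[OF x] by (simp add: fun_eq_iff)
  show "(y \<oplus> ((- 1) \<odot> x)) \<oplus> x = y"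
   by (rule F(9)[OF F(5)[OF 1 x] y]) (use F(6)[OF 1 x] F(6)[OF y F(7)[OF x]] F(8)[OF x] in \<open>simp add: fun_eq_iff\<close>)
 qed
 have coset: "W +> x = C (\<pi> x)" if x: "x \<in> carrier V" for x
 proof -
  have "y \<in> C (\<pi> x) \<longleftrightarrow> (\<exists>w\<in>W. y = w \<oplus> x)" for y
  proof
   assume "y \<in> C (\<pi> x)"
   then have y: "y \<in> carrier V" "\<pi> y = \<pi> x" by (auto simp: C_def)
   show "\<exists>w\<in>W. y = w \<oplus> x"
    by (rule bexI[of _ "y \<oplus> ((- 1) \<odot> x)"]) (use sub[OF x y(1)] y(2) in \<open>simp_all add: W\<close>)
  qed (use F(5) add x in \<open>auto simp: C_def W\<close>)
  then show ?thesis by (auto simp: a_r_coset_def r_coset_def)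
 qed
 let ?Q = "quotient_space V W"
 have car: "carrier ?Q = C ` \<pi> ` carrier V"
  using coset by (auto simp: quotient_space_def A_RCOSETS_def RCOSETS_def a_r_coset_def image_def)
 have plus: "C (\<pi> x) \<oplus>\<^bsub>?Q\<^esub> C (\<pi> y) = C (\<pi> (x \<oplus> y))" if x: "x \<in> carrier V" and y: "y \<in> carrier V" for x y
 proof -
  have "(\<exists>h\<in>C (\<pi> x). \<exists>k\<in>C (\<pi> y). z = h \<oplus> k) \<longleftrightarrow> z \<in> C (\<pi> (x \<oplus> y))" for z
  proof
   assume "z \<in> C (\<pi> (x \<oplus> y))"
   then have z: "z \<in> carrier V" "\<pi> z = \<pi> x + \<pi> y" using add[OF x y] by (auto simp: C_def)
   show "\<exists>h\<in>C (\<pi> x). \<exists>k\<in>C (\<pi> y). z = h \<oplus> k"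
    by (rule bexI[of _ "z \<oplus> ((- 1) \<odot> y)"], rule bexI[of _ y]) (use sub[OF y z(1)] z(2) y in \<open>simp_all add: C_def\<close>)
  qed (use F(5) add x y in \<open>auto simp: C_def\<close>)
  then show ?thesis by (auto simp: quotient_space_def set_add_def set_mult_def)
 qed
 have smult: "c \<odot>\<^bsub>?Q\<^esub> C (\<pi> x) = C (\<pi> (c \<odot> x))" if x: "x \<in> carrier V" for c x
 proof -
  have "W +> (c \<odot> y) = C (\<pi> (c \<odot> x))" if "y \<in> C (\<pi> x)" for y
   using that coset[OF F(7)] scale[OF x] scale[of y] by (simp add: C_def)
  moreover have "x \<in> C (\<pi> x)" using x by (simp add: C_def)
  ultimately show ?thesis by (auto simp: quotient_space_def)
 qed
 define r where "r X = \<pi> (SOME x. x \<in> X)" for X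
 have r: "r (C (\<pi> x)) = \<pi> x" if "x \<in> carrier V" for x
  using someI[of "\<lambda>y. y \<in> C (\<pi> x)" x] that by (auto simp: r_def C_def)
 have \<pi>0: "\<pi> \<zero> = 0" using scale[OF F(3), of 0] F(9)[OF F(7)[OF F(3), of 0] F(3)] F(4) F(8)[OF F(3), of 0] by simp
 have zero: "\<zero>\<^bsub>?Q\<^esub> = C (\<pi> \<zero>)" by (simp add: quotient_space_def W C_def \<pi>0)
 have "fn_model ?Q r (\<pi> ` carrier V)"
  unfolding fn_model_def car zero ball_simps
 proof (intro conjI ballI allI)
  show "r ` C ` \<pi> ` carrier V = \<pi> ` carrier V" unfolding image_image by (rule image_cong[OF refl r])
  show "inj_on r (C ` \<pi> ` carrier V)" by (rule inj_onI) (use r in auto)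
  show "r (C (\<pi> \<zero>)) = 0" by (rule trans[OF r[OF F(3)] \<pi>0])
  fix x assume x: "x \<in> carrier V"
  show "c \<odot>\<^bsub>?Q\<^esub> C (\<pi> x) \<in> C ` \<pi> ` carrier V" for c unfolding smult[OF x] using F(7)[OF x] by blast
  show "r (c \<odot>\<^bsub>?Q\<^esub> C (\<pi> x)) = fscale c (r (C (\<pi> x)))" for c
   unfolding smult[OF x] r[OF x] r[OF F(7)[OF x]] by (rule scale[OF x])
  fix y assume y: "y \<in> carrier V"
  show "C (\<pi> x) \<oplus>\<^bsub>?Q\<^esub> C (\<pi> y) \<in> C ` \<pi> ` carrier V" unfolding plus[OF x y] using F(5)[OF x y] by blast
  show "r (C (\<pi> x) \<oplus>\<^bsub>?Q\<^esub> C (\<pi> y)) = r (C (\<pi> x)) + r (C (\<pi> y))"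
   unfolding plus[OF x y] r[OF x] r[OF y] r[OF F(5)[OF x y]] by (rule add[OF x y])
 qed (use F(3) in blast)
 then show ?thesis by blast
qed

lemma trivial_sel: "carrier trivial_module = UNIV" "act trivial_module g v = v" "v \<oplus>\<^bsub>trivial_module\<^esub> w = v + w"
 "c \<odot>\<^bsub>trivial_module\<^esub> v = c * v"
 by (simp_all add: trivial_module_def)

text \<open>A homomorphism from the trivial module is determined by its value at 1, which must be
  invariant.\<close>

lemma G_hom_trivial:
 fixes J :: "('k::alg_closed_field, 'v) gmodule" (structure)
 assumes J: "gmodel J \<beta> S \<rho>" and m: "gmod S \<rho>"
 shows "G_hom trivial_module J = (\<lambda>y c. c \<odot> y) ` {y \<in> carrier J. \<beta> y \<in> {v \<in> S. \<forall>g\<in>SL2. \<rho> g v = v}}"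
proof (rule equalityI; rule subsetI)
 note F = fn_modelD[OF gmodelD(1)[OF J]] and G = gmodelD(2,3)[OF J]
 fix f assume f: "f \<in> G_hom trivial_module J"
 have y: "f 1 \<in> carrier J" using G_homD(1)[OF f, of 1] by (simp add: trivial_sel)
 have "f c = c \<odot> f 1" for c using G_homD(3)[OF f, of 1 c] by (simp add: trivial_sel)
 then have "f = (\<lambda>c. c \<odot> f 1)" by (rule ext)
 moreover have "\<rho> g (\<beta> (f 1)) = \<beta> (f 1)" if g: "g \<in> SL2" for g
  using G_homD(4)[OF f g, of 1] G(2)[OF g y] by (simp add: trivial_sel)
 ultimately show "f \<in> (\<lambda>y c. c \<odot> y) ` {y \<in> carrier J. \<beta> y \<in> {v \<in> S. \<forall>g\<in>SL2. \<rho> g v = v}}"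
  using y F(11)[OF y] by (intro image_eqI[of f _ "f 1"]) blast+
next
 interpret gmod S \<rho> by (rule m)
 note F = fn_modelD[OF gmodelD(1)[OF J]] and G = gmodelD(2,3)[OF J]
 fix f assume "f \<in> (\<lambda>y c. c \<odot> y) ` {y \<in> carrier J. \<beta> y \<in> {v \<in> S. \<forall>g\<in>SL2. \<rho> g v = v}}"
 then obtain y where y: "y \<in> carrier J" "\<And>g. g \<in> SL2 ==> \<rho> g (\<beta> y) = \<beta> y" and f: "f = (\<lambda>c. c \<odot> y)" by blast
 have "(c + c') \<odot> y = c \<odot> y \<oplus> c' \<odot> y" for c c'
  by (rule F(9)) (simp_all only: F(5,6,7,8) y(1) fscale_add_left)
 moreover have "(c * c') \<odot> y = c \<odot> (c' \<odot> y)" for c c'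
  by (rule F(9)) (simp_all only: F(7,8) y(1) fscale_simps)
 moreover have "act J g (c \<odot> y) = c \<odot> y" if g: "g \<in> SL2" for g c
  by (rule F(9)) (simp_all only: F(7,8,11) G y g \<rho>_scale)
 ultimately show "f \<in> G_hom trivial_module J"
  using y(1) F(7) by (auto simp: G_hom_def LinearCombinations.module_hom_def trivial_sel f extensional_def)
qed

lemma Hom_trivial_model:
 fixes J :: "('k::field, 'v) gmodule" (structure)
 assumes J: "fn_model J \<beta> S" and T: "T \<subseteq> S" "0 \<in> T" "\<And>v w. v \<in> T ==> w \<in> T ==> v + w \<in> T" "\<And>c v. v \<in> T ==> fscale c v \<in> T"
 shows "fn_model (Hom_space trivial_module J\<lparr>carrier := (\<lambda>y c. c \<odot> y) ` {y \<in> carrier J. \<beta> y \<in> T}\<rparr>) (\<lambda>f. \<beta> (f 1)) T"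
  (is "fn_model ?H ?\<beta> T")
proof -
 note F = fn_modelD[OF J] and I = fn_model_inv[OF J]
 have one: "1 \<odot> y = y" if "y \<in> carrier J" for y
  by (rule F(9)) (simp_all only: F(7,8) that fscale_simps)
 let ?Y = "{y \<in> carrier J. \<beta> y \<in> T}"
 have sel: "\<zero>\<^bsub>?H\<^esub> = (\<lambda>c. \<zero>)" "f \<oplus>\<^bsub>?H\<^esub> h = (\<lambda>c. f c \<oplus> h c)" "a \<odot>\<^bsub>?H\<^esub> f = (\<lambda>c. a \<odot> f c)"
  "carrier ?H = (\<lambda>y c. c \<odot> y) ` ?Y" for f h a
  by (simp_all add: Hom_space_def trivial_sel restrict_def)
 have zero: "(\<lambda>c. \<zero>) = (\<lambda>c. c \<odot> \<zero>)"
  by (rule ext, rule F(9)) (simp_all only: F(3,4,7,8) fscale_simps)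
 have Y: "\<zero> \<in> ?Y" "\<And>y z. y \<in> ?Y ==> z \<in> ?Y ==> y \<oplus> z \<in> ?Y" "\<And>a y. y \<in> ?Y ==> a \<odot> y \<in> ?Y"
  using F(3,4,5,6,7,8) T by auto
 show ?thesis unfolding fn_model_def sel ball_simps(9)
 proof (intro conjI ballI allI)
  show "(\<lambda>f. \<beta> (f 1)) ` (\<lambda>y c. c \<odot> y) ` ?Y = T" unfolding image_image
  proof (rule equalityI; rule subsetI)
   fix v assume v: "v \<in> T"
   from I(1,2) T(1) v obtain y where "y \<in> carrier J" "\<beta> y = v" by blast
   then show "v \<in> (\<lambda>y. \<beta> (1 \<odot> y)) ` ?Y" using v one by (intro image_eqI[of _ _ y]) auto
  qed (use one in auto)
  show "inj_on (\<lambda>f. \<beta> (f 1)) ((\<lambda>y c. c \<odot> y) ` ?Y)"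
   using one F(9) by (intro inj_onI) (elim imageE, clarsimp, metis)
  show "(\<lambda>c. \<zero>) \<in> (\<lambda>y c. c \<odot> y) ` ?Y" unfolding zero using Y(1) by blast
  show "\<beta> \<zero> = 0" by (rule F(4))
  fix y assume y: "y \<in> ?Y"
  then have y': "y \<in> carrier J" by blast
  have e: "(\<lambda>c. a \<odot> (c \<odot> y)) = (\<lambda>c. c \<odot> (a \<odot> y))" for a
   by (rule ext, rule F(9)) (simp_all only: F(7,8) y' fscale_simps mult.commute)
  show "(\<lambda>c. a \<odot> (c \<odot> y)) \<in> (\<lambda>y c. c \<odot> y) ` ?Y" for a unfolding e using Y(3)[OF y] by blast
  show "\<beta> (a \<odot> (1 \<odot> y)) = fscale a (\<beta> (1 \<odot> y))" for a by (rule F(8)[OF F(7)[OF y']])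
  fix z assume z: "z \<in> ?Y"
  then have z': "z \<in> carrier J" by blast
  have e: "(\<lambda>c. c \<odot> y \<oplus> c \<odot> z) = (\<lambda>c. c \<odot> (y \<oplus> z))"
   by (rule ext, rule F(9)) (simp_all only: F(5,6,7,8) y' z' fscale_add)
  show "(\<lambda>c. c \<odot> y \<oplus> c \<odot> z) \<in> (\<lambda>y c. c \<odot> y) ` ?Y" unfolding e using Y(2)[OF y z] by blast
  show "\<beta> (1 \<odot> y \<oplus> 1 \<odot> z) = \<beta> (1 \<odot> y) + \<beta> (1 \<odot> z)" by (rule F(6)[OF F(7)[OF y'] F(7)[OF z']])
 qed
qed

context gres
begin

text \<open>Evaluation at 1 identifies the cochains in the definition of \<open>Ext\<close> with
  invariants and the coboundaries with the image of \<open>Inv j\<close>, so the quotient is the one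
  of \<open>quot_dim_invariants\<close>.\<close>

lemma ext_dim:
 fixes I :: "nat => ('k, 'v) gmodule" and d j
 defines "H \<equiv> Hom_space trivial_module (I (Suc j))\<lparr>carrier := cocycles trivial_module I d (Suc j)\<rparr>"
 assumes gI: "\<And>n. gmodel (I n) (\<beta> n) (S n) (\<rho> n)" and d: "\<And>n. d n \<in> G_hom (I n) (I (Suc n))"
  and dD: "\<And>n v. v \<in> carrier (I n) ==> \<beta> (Suc n) (d n v) = D n (\<beta> n v)"
  and qd: "quot_dim fscale {v \<in> Inv (Suc j). D (Suc j) v = 0} (D j ` Inv j) N"
 shows "vectorspace.fin_dim class_ring (quotient_space H (coboundaries trivial_module I d (Suc j)))
  \<and> vectorspace.dim class_ring (quotient_space H (coboundaries trivial_module I d (Suc j))) = N"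
proof -
 let ?J = "I (Suc j)" and ?\<beta> = "\<beta> (Suc j)" and ?A = "{v \<in> Inv (Suc j). D (Suc j) v = 0}"
 note F = fn_modelD[OF gmodelD(1)[OF gI]] and V = fn_model_inv[OF gmodelD(1)[OF gI]]
 note T = G_hom_trivial[OF gI gm, folded Inv_def]
 have Inv: "v \<in> Inv n ==> v \<in> S n" for v n by (simp add: Inv_def)
 have D0: "D n 0 = 0" for n using D_fscale[OF gmod.S_zero[OF gm], of n 0] by simp
 have Ip: "v + w \<in> Inv n" and Is: "fscale c v \<in> Inv n" if "v \<in> Inv n" "w \<in> Inv n" for v w c n
 proof -
  interpret N: gmod "S n" "\<rho> n" by (rule gm)
  show "v + w \<in> Inv n" "fscale c v \<in> Inv n"
   using that N.S_plus N.S_fscale N.\<rho>_add N.\<rho>_scale by (simp_all add: Inv_def)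
 qed
 have I0: "0 \<in> Inv n" for n using gmod.S_zero[OF gm] gmod.\<rho>_0[OF gm] by (simp add: Inv_def)
 have A: "0 \<in> ?A" "\<And>v w. v \<in> ?A ==> w \<in> ?A ==> v + w \<in> ?A" "\<And>c v. v \<in> ?A ==> fscale c v \<in> ?A"
  using I0 D0 Ip Is Inv D_plus D_fscale by auto
 have B: "0 \<in> D j ` Inv j" "v \<in> D j ` Inv j ==> w \<in> D j ` Inv j ==> v + w \<in> D j ` Inv j"
  "v \<in> D j ` Inv j ==> fscale c v \<in> D j ` Inv j" for v w c
 proof -
  show "0 \<in> D j ` Inv j" using imageI[OF I0, of "D j"] D0 by simp
  assume "v \<in> D j ` Inv j"
  then obtain a where a: "a \<in> Inv j" "v = D j a" by blast
  show "fscale c v \<in> D j ` Inv j"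
   unfolding a(2) D_fscale[OF Inv[OF a(1)], symmetric] by (rule imageI[OF Is[OF a(1) a(1)]])
  assume "w \<in> D j ` Inv j"
  then obtain b where b: "b \<in> Inv j" "w = D j b" by blast
  show "v + w \<in> D j ` Inv j"
   unfolding a(2) b(2) D_plus[OF Inv[OF a(1)] Inv[OF b(1)], symmetric] by (rule imageI[OF Ip[OF a(1) b(1)]])
 qed
 obtain \<pi> where \<pi>: "\<And>v w. v \<in> ?A ==> w \<in> ?A ==> \<pi> (v + w) = \<pi> v + \<pi> w" "\<And>c v. v \<in> ?A ==> \<pi> (fscale c v) = fscale c (\<pi> v)"
  "\<pi> ` ?A = {c. \<forall>l\<ge>N. c l = 0}" "\<And>v. v \<in> ?A ==> \<pi> v = 0 \<longleftrightarrow> v \<in> D j ` Inv j"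
  using quot_dim_coordinates[OF A B qd] by blast
 have d0: "d n x = \<zero>\<^bsub>I (Suc n)\<^esub> \<longleftrightarrow> D n (\<beta> n x) = 0" if "x \<in> carrier (I n)" for n x
  using F(10)[OF G_homD(1)[OF d that]] dD[OF that] by simp
 have one: "1 \<odot>\<^bsub>?J\<^esub> y = y" if "y \<in> carrier ?J" for y
  using F(9)[OF F(7)[OF that] that] F(8)[OF that] by simp
 have Z: "cocycles trivial_module I d (Suc j) = (\<lambda>y c. c \<odot>\<^bsub>?J\<^esub> y) ` {y \<in> carrier ?J. ?\<beta> y \<in> ?A}"
 proof -
  have "(\<forall>c. d (Suc j) (c \<odot>\<^bsub>?J\<^esub> y) = \<zero>\<^bsub>I (Suc (Suc j))\<^esub>) \<longleftrightarrow> D (Suc j) (?\<beta> y) = 0" if y: "y \<in> carrier ?J" for y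
   unfolding d0[OF F(7)[OF y]] F(8)[OF y] D_fscale[OF F(11)[OF y]] by (metis fscale_simps(1,3))
  then show ?thesis unfolding cocycles_def T by (auto simp: trivial_sel)
 qed
 have B': "(\<lambda>c. d j (c \<odot>\<^bsub>I j\<^esub> y)) = (\<lambda>c. c \<odot>\<^bsub>?J\<^esub> d j y)" if "y \<in> carrier (I j)" for y
  using G_homD(3)[OF d that] by simp
 have m: "fn_model H (\<lambda>f. ?\<beta> (f 1)) ?A"
  unfolding H_def Z by (rule Hom_trivial_model[OF gmodelD(1)[OF gI] _ A]) (use Inv in blast)
 note FH = fn_modelD[OF m]
 have W: "coboundaries trivial_module I d (Suc j) = {f \<in> carrier H. \<pi> (?\<beta> (f 1)) = 0}"
 proof -
  have "coboundaries trivial_module I d (Suc j) = (\<lambda>y c. d j (c \<odot>\<^bsub>I j\<^esub> y)) ` {y \<in> carrier (I j). \<beta> j y \<in> Inv j}"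
   by (simp add: T compose_def trivial_sel restrict_def image_image)
  also have "... = (\<lambda>y c. c \<odot>\<^bsub>?J\<^esub> y) ` d j ` {y \<in> carrier (I j). \<beta> j y \<in> Inv j}"
   unfolding image_image by (rule image_cong[OF refl B']) blast
  also have "d j ` {y \<in> carrier (I j). \<beta> j y \<in> Inv j} = {y \<in> carrier ?J. ?\<beta> y \<in> D j ` Inv j}"
  proof (rule equalityI; rule subsetI)
   fix y assume "y \<in> {y \<in> carrier ?J. ?\<beta> y \<in> D j ` Inv j}"
   then obtain v where y: "y \<in> carrier ?J" "v \<in> Inv j" "?\<beta> y = D j v" by blast
   from V(1,2)[OF Inv[OF y(2)]] obtain x where x: "x \<in> carrier (I j)" "\<beta> j x = v" by blast
   have "y = d j x" using F(9)[OF y(1) G_homD(1)[OF d x(1)]] dD[OF x(1)] x(2) y(3) by simp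
   then show "y \<in> d j ` {y \<in> carrier (I j). \<beta> j y \<in> Inv j}" using x y(2) by blast
  qed (use G_homD(1)[OF d] dD in auto)
  finally have e: "coboundaries trivial_module I d (Suc j) = (\<lambda>y c. c \<odot>\<^bsub>?J\<^esub> y) ` {y \<in> carrier ?J. ?\<beta> y \<in> D j ` Inv j}" .
  have "?\<beta> y \<in> ?A \<and> \<pi> (?\<beta> (1 \<odot>\<^bsub>?J\<^esub> y)) = 0 \<longleftrightarrow> ?\<beta> y \<in> D j ` Inv j" if y: "y \<in> carrier ?J" for y
  proof -
   have "D j v \<in> ?A" if v: "v \<in> Inv j" for v
   proof -
    have "\<rho> (Suc j) g (D j v) = D j v" if "g \<in> SL2" for g
     using D_act[OF that Inv[OF v]] v that by (simp add: Inv_def)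
    moreover have "D j v \<in> {v \<in> S (Suc j). D (Suc j) v = 0}" unfolding D_exact[symmetric] by (rule imageI[OF Inv[OF v]])
    ultimately show ?thesis by (simp add: Inv_def)
   qed
   then have "D j ` Inv j \<subseteq> ?A" by blast
   then show ?thesis unfolding one[OF y] using \<pi>(4) by blast
  qed
  then have "{y \<in> carrier ?J. ?\<beta> y \<in> D j ` Inv j} = {y \<in> {y \<in> carrier ?J. ?\<beta> y \<in> ?A}. \<pi> (?\<beta> (1 \<odot>\<^bsub>?J\<^esub> y)) = 0}" by blast
  moreover have "carrier H = (\<lambda>y c. c \<odot>\<^bsub>?J\<^esub> y) ` {y \<in> carrier ?J. ?\<beta> y \<in> ?A}" by (simp add: H_def Z)
  ultimately show ?thesis unfolding e by (simp only: Compr_image_eq)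
 qed
 have ex: "\<exists>r. fn_model (quotient_space H (coboundaries trivial_module I d (Suc j))) r ((\<lambda>f. \<pi> (?\<beta> (f 1))) ` carrier H)"
 proof (rule quotient_space_model[OF m _ _ W])
  fix f assume f: "f \<in> carrier H"
  show "\<pi> (?\<beta> ((c \<odot>\<^bsub>H\<^esub> f) 1)) = fscale c (\<pi> (?\<beta> (f 1)))" for c unfolding FH(8)[OF f] by (rule \<pi>(2)[OF FH(11)[OF f]])
  fix h assume h: "h \<in> carrier H"
  show "\<pi> (?\<beta> ((f \<oplus>\<^bsub>H\<^esub> h) 1)) = \<pi> (?\<beta> (f 1)) + \<pi> (?\<beta> (h 1))" unfolding FH(6)[OF f h] by (rule \<pi>(1)[OF FH(11)[OF f] FH(11)[OF h]])
 qed
 have "(\<lambda>f. \<pi> (?\<beta> (f 1))) ` carrier H = {c. \<forall>l\<ge>N. c l = 0}"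
  unfolding \<pi>(3)[symmetric] FH(1)[symmetric] image_image ..
 from ex[unfolded this] show ?thesis by (elim exE) (rule fn_model_dim)
qed

end

lemma simple_gmod_highest_weight:
 fixes V :: "('k::alg_closed_field, 'v) gmodule"
 assumes V: "is_simple_of_highest_weight m V" and p: "CHAR('k) = p" "prime p" and g: "gmodel V \<beta> S \<rho>" "gmod S \<rho>"
 shows "\<exists>v0. simple_gmod S \<rho> p m v0"
proof -
 interpret gmod S \<rho> by (rule g(2))
 note F = fn_modelD[OF gmodelD(1)[OF g(1)]] and I = fn_model_inv[OF gmodelD(1)[OF g(1)]] and G = gmodelD(2,3)[OF g(1)]
 have tau: "tau t \<in> SL2" if "t \<noteq> 0" for t :: 'k using that by simp
 have wt: "v \<in> weight_space V \<mu> \<longleftrightarrow> \<beta> v \<in> wtsp S \<rho> \<mu>" if v: "v \<in> carrier V" for v \<mu>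
 proof -
  have "act V (tau t) v = (t powi \<mu>) \<odot>\<^bsub>V\<^esub> v \<longleftrightarrow> \<rho> (tau t) (\<beta> v) = fscale (t powi \<mu>) (\<beta> v)" if t: "t \<noteq> 0" for t
   using F(9)[OF G(1)[OF tau[OF t] v] F(7)[OF v, of "t powi \<mu>"]] G(2)[OF tau[OF t] v] F(8)[OF v, of "t powi \<mu>"] by metis
  then show ?thesis using v F(11)[OF v] by (auto simp: weight_space_def wtsp_def tau_eq)
 qed
 have isw: "is_weight V \<mu> \<longleftrightarrow> (\<exists>v\<in>wtsp S \<rho> \<mu>. v \<noteq> 0)" for \<mu>
 proof
  have "\<zero>\<^bsub>V\<^esub> \<in> weight_space V \<mu>" unfolding wt[OF F(3)] F(4) using \<rho>_0 tau by (simp add: wtsp_def S_zero)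
  moreover assume "is_weight V \<mu>"
  ultimately obtain v where v: "v \<in> weight_space V \<mu>" "v \<noteq> \<zero>\<^bsub>V\<^esub>" unfolding is_weight_def by blast
  then have "v \<in> carrier V" by (simp add: weight_space_def)
  then show "\<exists>v\<in>wtsp S \<rho> \<mu>. v \<noteq> 0" using v wt[of v] F(10)[of v] by blast
 next
  assume "\<exists>v\<in>wtsp S \<rho> \<mu>. v \<noteq> 0"
  then obtain w where w: "w \<in> wtsp S \<rho> \<mu>" "w \<noteq> 0" by blast
  then have "w \<in> S" by (simp add: wtsp_def)
  from I(1,2)[OF this] obtain v where v: "v \<in> carrier V" "\<beta> v = w" by blast
  have "v \<in> weight_space V \<mu>" using wt[OF v(1)] v(2) w(1) by simp
  moreover have "v \<noteq> \<zero>\<^bsub>V\<^esub>" using F(4) v(2) w(2) by auto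
  ultimately show "is_weight V \<mu>" unfolding is_weight_def by blast
 qed
 have hw: "highest_weight V (int m)" and si: "simple_module V" using V by (auto simp: is_simple_of_highest_weight_def)
 obtain v0 where v0: "v0 \<in> wtsp S \<rho> (int m)" "v0 \<noteq> 0" using hw isw unfolding highest_weight_def by blast
 have "simple_gmod S \<rho> p m v0"
 proof (unfold_locales, rule p(1), rule p(2))
  fix T
  assume T: "T \<subseteq> S" "0 \<in> T" "\<And>v w. v \<in> T ==> w \<in> T ==> v + w \<in> T" "\<And>c v. v \<in> T ==> fscale c v \<in> T"
   "\<And>g v. g \<in> SL2 ==> v \<in> T ==> \<rho> g v \<in> T"
  define W where "W = {v \<in> carrier V. \<beta> v \<in> T}"
  have bW: "\<beta> ` W = T"
  proof (rule equalityI; rule subsetI)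
   fix w assume w: "w \<in> T"
   then have "w \<in> S" using T(1) by blast
   from I(1,2)[OF this] obtain v where "v \<in> carrier V" "\<beta> v = w" by blast
   then show "w \<in> \<beta> ` W" using w by (auto simp: W_def)
  qed (auto simp: W_def)
  have "VectorSpace.subspace class_ring W V"
  proof -
   interpret vectorspace class_ring V by (rule fn_model_vectorspace[OF gmodelD(1)[OF g(1)]])
   show ?thesis
   proof (rule subspace.intro[OF vectorspace_axioms], unfold_locales)
    show "W \<subseteq> carrier V" by (auto simp: W_def)
    show "\<zero>\<^bsub>V\<^esub> \<in> W" using F(3,4) T(2) by (simp add: W_def)
    show "v \<oplus>\<^bsub>V\<^esub> w \<in> W" if "v \<in> W" "w \<in> W" for v w using that F(5,6) T(3) by (simp add: W_def)
    show "c \<odot>\<^bsub>V\<^esub> w \<in> W" if "c \<in> carrier class_ring" "w \<in> W" for c w using that F(7,8) T(4) by (simp add: W_def)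
   qed
  qed
  moreover have "\<forall>g\<in>SL2. \<forall>w\<in>W. act V g w \<in> W" using G T(5) by (simp add: W_def)
  ultimately have "W = {\<zero>\<^bsub>V\<^esub>} \<or> W = carrier V" using si unfolding simple_module_def by blast
  then show "T = {0} \<or> T = S" unfolding bW[symmetric] using F(1,4) by auto
 next
  show "v0 \<in> wtsp S \<rho> (int m)" "v0 \<noteq> 0" by (rule v0)+
  show "\<exists>j::nat. \<mu> = int m - 2 * int j" if "v \<in> wtsp S \<rho> \<mu>" "v \<noteq> 0" for v \<mu>
   using hw that isw unfolding highest_weight_def by blast
 qed
 then show ?thesis by blast
qed

text \<open>The kernel \<open>Z 0\<close> in the resolution is a copy of \<open>V\<close>; the count
  for \<open>V\<close> is transported to \<open>Z 0\<close> and then shifted along the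
  resolution.\<close>

theorem cohomology_dim:
 fixes V :: "('k::alg_closed_field, 'v) gmodule"
 assumes V: "is_simple_of_highest_weight m V" and p: "CHAR('k) = p" "prime p" "p \<ge> 3" and kv: "inj (kv :: 'k => 'v)"
  and fin: "finite (solutions p (dg p m) (Suc j))"
 shows "vectorspace.fin_dim class_ring (rational_cohomology (Suc j) V) \<and>
  vectorspace.dim class_ring (rational_cohomology (Suc j) V) = card (solutions p (dg p m) (Suc j))"
proof -
 have rV: "rational_module V" using V by (simp add: is_simple_of_highest_weight_def simple_module_def)
 \<comment> \<open>The resolution selected in the definition of \<open>Ext\<close>. Once one is
   known to exist, it has the defining properties, and nothing else about it is used.\<close>
 define Id where "Id = (SOME (I :: nat => ('k, 'v) gmodule, d). injective_resolution V I d)"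
 define I where "I = fst Id"
 define d where "d = snd Id"
 have Id: "Id = (I, d)" by (simp add: I_def d_def)
 have "\<exists>x. (\<lambda>(I :: nat => ('k, 'v) gmodule, d). injective_resolution V I d) x" using injective_resolution_exists[OF kv rV] by auto
 from someI_ex[OF this] have res: "injective_resolution V I d" unfolding Id_def[symmetric] Id by simp
 have inj: "injective_module (I n)" and dn: "d n \<in> G_hom (I n) (I (Suc n))" for n
  using res by (auto simp: injective_resolution_def)
 obtain e where e: "e \<in> G_hom V (I 0)" "inj_on e (carrier V)" "e ` carrier V = {v \<in> carrier (I 0). d 0 v = \<zero>\<^bsub>I 1\<^esub>}"
  using res unfolding injective_resolution_def by blast
 have ex: "d n ` carrier (I n) = {v \<in> carrier (I (Suc n)). d (Suc n) v = \<zero>\<^bsub>I (Suc (Suc n))\<^esub>}" for n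
  using res unfolding injective_resolution_def by blast
 have "\<forall>n. \<exists>x :: ('v => 'v => 'k) \<times> ('v => 'k) set \<times> ('k mat => ('v => 'k) => 'v => 'k).
   gmodel (I n) (fst x) (fst (snd x)) (snd (snd x)) \<and> gmod (fst (snd x)) (snd (snd x))"
 proof
  fix n
  have "rational_module (I n)" using inj[of n] by (simp add: injective_module_def)
  from rational_gmodel[OF this] obtain \<beta> :: "'v => 'v => 'k" and S \<rho> where "gmodel (I n) \<beta> S \<rho> \<and> gmod S \<rho>" by blast
  then show "\<exists>x :: ('v => 'v => 'k) \<times> ('v => 'k) set \<times> ('k mat => ('v => 'k) => 'v => 'k).
   gmodel (I n) (fst x) (fst (snd x)) (snd (snd x)) \<and> gmod (fst (snd x)) (snd (snd x))" by (intro exI[of _ "(\<beta>, S, \<rho>)"]) simp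
 qed
 from choice[OF this] obtain x :: "nat => ('v => 'v => 'k) \<times> ('v => 'k) set \<times> ('k mat => ('v => 'k) => 'v => 'k)"
  where x: "\<And>n. gmodel (I n) (fst (x n)) (fst (snd (x n))) (snd (snd (x n)))" "\<And>n. gmod (fst (snd (x n))) (snd (snd (x n)))" by blast
 define \<beta> where "\<beta> n = fst (x n)" for n
 define S where "S n = fst (snd (x n))" for n
 define \<rho> where "\<rho> n = snd (snd (x n))" for n
 have gI: "gmodel (I n) (\<beta> n) (S n) (\<rho> n)" and gm: "gmod (S n) (\<rho> n)" for n unfolding \<beta>_def S_def \<rho>_def by (rule x)+
 note F = fn_modelD[OF gmodelD(1)[OF gI]]
 define D where "D n = transport (I n) (\<beta> n) (\<beta> (Suc n)) (d n)" for n
 note D = transport[OF gI gI dn, folded D_def]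
 have Sr: "\<exists>y\<in>carrier (I n). v = \<beta> n y" if "v \<in> S n" for v n using that F(1)[of n] by blast
 have d0: "d n y = \<zero>\<^bsub>I (Suc n)\<^esub> \<longleftrightarrow> D n (\<beta> n y) = 0" if "y \<in> carrier (I n)" for n y
  using F(10)[OF G_homD(1)[OF dn that]] D(1)[OF that] by simp
 interpret gres p S \<rho> D
 proof (rule gres.intro, rule p(1), rule p(2), rule gm, rule D(2), assumption, rule D(3), assumption+, rule D(4), assumption, rule D(5), assumption+)
  fix n
  show "D n ` S n = {v \<in> S (Suc n). D (Suc n) v = 0}"
  proof (rule equalityI; rule subsetI)
   fix v assume "v \<in> D n ` S n"
   then obtain y where y: "y \<in> carrier (I n)" "v = D n (\<beta> n y)" using Sr by blast
   have v: "v = \<beta> (Suc n) (d n y)" using y(2) D(1)[OF y(1)] by simp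
   have "d n y \<in> {v \<in> carrier (I (Suc n)). d (Suc n) v = \<zero>\<^bsub>I (Suc (Suc n))\<^esub>}" unfolding ex[symmetric] using y(1) by blast
   then show "v \<in> {v \<in> S (Suc n). D (Suc n) v = 0}" unfolding v using d0 F(11) by blast
  next
   fix v assume "v \<in> {v \<in> S (Suc n). D (Suc n) v = 0}"
   then have v: "v \<in> S (Suc n)" "D (Suc n) v = 0" by auto
   obtain y where y: "y \<in> carrier (I (Suc n))" "v = \<beta> (Suc n) y" using Sr[OF v(1)] by blast
   have "y \<in> d n ` carrier (I n)" unfolding ex using y(1) d0[OF y(1)] v(2) y(2) by simp
   then obtain z where z: "z \<in> carrier (I n)" "y = d n z" by blast
   show "v \<in> D n ` S n" by (rule image_eqI[OF _ F(11)[OF z(1)]]) (simp only: y(2) z(2) D(1)[OF z(1)])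
  qed
 next
  fix n and q :: int assume "q > 0"
  then show "cocyc p (eop p (\<rho> n)) (wtsp (S n) (\<rho> n)) q \<subseteq> cobd p (eop p (\<rho> n)) (wtsp (S n) (\<rho> n)) q"
   by (rule injective_acyclic[OF kv p inj gI gm])
 qed
 obtain \<beta>V :: "'v => 'v => 'k" and SV \<rho>V where gV: "gmodel V \<beta>V SV \<rho>V" "gmod SV \<rho>V" using rational_gmodel[OF rV] by blast
 obtain v0 where "simple_gmod SV \<rho>V p m v0" using simple_gmod_highest_weight[OF V p(1,2) gV] by blast
 then interpret V: simple_gmod SV \<rho>V p m v0 .
 note FV = fn_modelD[OF gmodelD(1)[OF gV(1)]]
 define \<epsilon> where "\<epsilon> = transport V \<beta>V (\<beta> 0) e"
 note \<epsilon> = transport[OF gV(1) gI e(1), folded \<epsilon>_def]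
 have SVr: "\<exists>y\<in>carrier V. v = \<beta>V y" if "v \<in> SV" for v using that FV(1) by blast
 have eZ: "\<epsilon> ` SV = Z 0"
 proof (rule equalityI; rule subsetI)
  fix v assume "v \<in> \<epsilon> ` SV"
  then obtain y where y: "y \<in> carrier V" "v = \<beta> 0 (e y)" using SVr \<epsilon>(1) by (metis imageE)
  have "e y \<in> e ` carrier V" using y(1) by blast
  then have "e y \<in> carrier (I 0)" "d 0 (e y) = \<zero>\<^bsub>I 1\<^esub>" unfolding e(3) by auto
  then show "v \<in> Z 0" using d0[of "e y" 0] F(11) y(2) by (simp add: Z_def)
 next
  fix v assume "v \<in> Z 0"
  then have v: "v \<in> S 0" "D 0 v = 0" by (auto simp: Z_def)
  obtain y where y: "y \<in> carrier (I 0)" "v = \<beta> 0 y" using Sr[OF v(1)] by blast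
  have "y \<in> e ` carrier V" unfolding e(3) using y(1) d0[OF y(1)] v(2) y(2) by simp
  then obtain z where z: "z \<in> carrier V" "y = e z" by blast
  show "v \<in> \<epsilon> ` SV" by (rule image_eqI[OF _ FV(11)[OF z(1)]]) (simp only: y(2) z(2) \<epsilon>(1)[OF z(1)])
 qed
 have e_inj: "v = 0" if v: "v \<in> SV" "\<epsilon> v = 0" for v
 proof -
  obtain y where y: "y \<in> carrier V" "v = \<beta>V y" using SVr[OF v(1)] by blast
  have "\<beta> 0 (e y) = 0" using v(2) \<epsilon>(1)[OF y(1)] y(2) by simp
  then have "e y = \<zero>\<^bsub>I 0\<^esub>" using F(10)[OF G_homD(1)[OF e(1) y(1)]] by simp
  then have "e y = e \<zero>\<^bsub>V\<^esub>" using G_hom_0[OF gV(1) gI e(1)] by simp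
  then have "y = \<zero>\<^bsub>V\<^esub>" using inj_onD[OF e(2) _ y(1) FV(3)] by blast
  then show ?thesis using y(2) FV(4) by simp
 qed
 interpret h: bmod_hom SV \<rho>V "Z 0" "\<rho> 0" p \<epsilon>
  by (rule ghom_bmod_hom[where T = \<epsilon>, OF gV(2) gmZ p(1,2) _ \<epsilon>(3-5)]) (use eZ in blast)
 have H: "HZ (int (Suc j)) 0 (card (solutions p (dg p m) (Suc j)))"
  unfolding cscale_def
 proof (rule h.quot_dim_iso[where s = fscale])
  show "v = 0" if "v \<in> SV" "\<epsilon> v = 0" for v using that by (rule e_inj)
  show "\<epsilon> (fscale c v) = fscale c (\<epsilon> v)" if "v \<in> SV" for c v using that by (rule h.f_scale)
  show "\<exists>v\<in>wtsp SV \<rho>V \<mu>. \<epsilon> v = w" if w: "w \<in> WZ 0 \<mu>" for w \<mu>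
  proof -
   have "w \<in> \<epsilon> ` SV" unfolding eZ using w by (simp add: WZ_iff)
   then obtain v where v: "v \<in> SV" "w = \<epsilon> v" by blast
   have "\<rho>V (tau t) v = fscale (t powi \<mu>) v" if t: "t \<noteq> 0" for t
   proof -
    have tS: "tau t \<in> SL2" using t by simp
    have "\<epsilon> (\<rho>V (tau t) v) = fscale (t powi \<mu>) (\<epsilon> v)" using w t h.f_t[OF v(1) t] v(2) by (simp add: wtsp_def)
    then have "\<epsilon> (\<rho>V (tau t) v + fscale (- 1) (fscale (t powi \<mu>) v)) = 0"
     using h.f_plus[OF V.\<rho>_S[OF tS v(1)] V.S_fscale[OF V.S_fscale[OF v(1)]], of "- 1" "t powi \<mu>"]
      h.f_scale[OF V.S_fscale[OF v(1)], of "- 1" "t powi \<mu>"] h.f_scale[OF v(1), of "t powi \<mu>"] by (simp add: fun_eq_iff)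
    then have "\<rho>V (tau t) v + fscale (- 1) (fscale (t powi \<mu>) v) = 0"
     by (rule e_inj[OF V.S_plus[OF V.\<rho>_S[OF tS v(1)] V.S_fscale[OF V.S_fscale[OF v(1)]]]])
    then show ?thesis by (simp add: fun_eq_iff)
   qed
   then have "v \<in> wtsp SV \<rho>V \<mu>" using v(1) by (simp add: wtsp_def)
   then show ?thesis using v(2) by blast
  qed
  show "quot_dim (\<lambda>c z r. fscale c (z r)) (cocyc p (eop p \<rho>V) (wtsp SV \<rho>V) (int (Suc j))) (cobd p (eop p \<rho>V) (wtsp SV \<rho>V) (int (Suc j))) (card (solutions p (dg p m) (Suc j)))"
   using V.quot_dim_simple[OF fin] unfolding cscale_def .
  show "(\<lambda>r. fscale c (z r)) \<in> cocyc p (eop p \<rho>V) (wtsp SV \<rho>V) (int (Suc j))" if "z \<in> cocyc p (eop p \<rho>V) (wtsp SV \<rho>V) (int (Suc j))" for c z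
   using V.cocyc_scale[OF that, of c] by (simp only: cscale_def)
 qed
 have "rational_cohomology (Suc j) V = quotient_space (Hom_space trivial_module (I (Suc j))\<lparr>carrier := cocycles trivial_module I d (Suc j)\<rparr>) (coboundaries trivial_module I d (Suc j))"
  unfolding rational_cohomology_def Ext_def Id_def[symmetric] Id by simp
 then show ?thesis using ext_dim[OF gI dn D(1)[symmetric] quot_dim_invariants[OF H]] by simp
qed

subsection \<open>Exponential growth\<close>

text \<open>\<open>20 = 4 * 5\<close> and \<open>5 \<le> exp 2 \<le> exp (2 * pi / sqrt 3)\<close>,
  the latter because \<open>sqrt 3 \<le> 2 \<le> pi\<close>.\<close>

lemma twenty_pow_le: "20 ^ n \<le> (2 * real n + 7) * C_const n" if "n \<ge> 1"
proof -
 have "sqrt 3 \<le> 2" by (rule real_le_lsqrt) simp_all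
 then have "2 * sqrt 3 \<le> 2 * pi" using pi_ge_two by linarith
 then have e: "2 \<le> 2 * pi / sqrt 3" by (simp add: field_simps)
 have "1 + 2 + 2\<^sup>2 / 2 \<le> exp (2::real)" by (rule exp_lower_Taylor_quadratic) simp
 then have "5 \<le> exp (2::real)" by (simp add: power2_eq_square)
 also have "... \<le> exp (2 * pi / sqrt 3)" using e by (rule iffD2[OF exp_le_cancel_iff])
 finally have "5 \<le> exp (2 * pi / sqrt 3)" .
 then have "5 ^ n \<le> exp (2 * pi / sqrt 3) ^ n" by (intro power_mono) simp_all
 also have "... = exp (2 * pi * real n / sqrt 3)" by (simp add: exp_of_nat_mult[symmetric] mult_ac)
 finally have "4 ^ n * (5::real) ^ n \<le> 4 ^ n * exp (2 * pi * real n / sqrt 3)" by simp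
 also have "... \<le> ((2 * real n + 7) * real n) * (4 ^ n * exp (2 * pi * real n / sqrt 3))"
 proof -
  have "1 * 1 \<le> (2 * real n + 7) * real n" by (rule mult_mono) (use that in auto)
  then show ?thesis using mult_right_mono[of 1 "(2 * real n + 7) * real n" "4 ^ n * exp (2 * pi * real n / sqrt 3)"] by simp
 qed
 finally show ?thesis by (simp add: C_const_def power_mult_distrib[symmetric] mult_ac)
qed

theorem theorem6p8:
  fixes p :: nat and L :: "nat \<Rightarrow> ('k::alg_closed_field, 'v) gmodule"
  assumes "prime p" and "p \<ge> 3" and "CHAR('k) = p"
    and "\<And>m. is_simple_of_highest_weight m (L m)"
  shows "(\<forall>n\<ge>1. \<forall>m. vectorspace.fin_dim class_ring (rational_cohomology n (L m)) \<and>
            real (vectorspace.dim class_ring (rational_cohomology n (L m)))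
              \<le> (2 * real n + 7) * C_const n) \<and>
         exponential_growth
           (\<lambda>n. real (MAX m. vectorspace.dim class_ring (rational_cohomology n (L m))))"
proof -
 define dim where "dim n m = vectorspace.dim class_ring (rational_cohomology n (L m))" for n m
 have p2: "p \<ge> 2" using assms(2) by simp
 have dg: "dg p m i < p" "fin_supp (dg p m)" for m i
  using dg_facts[OF p2, of m] p2 by (auto simp: dg_def)
 \<comment> \<open>Scalar multiples of a nonzero vector of \<open>L 0\<close> embed the field in the
   element type, which the construction of injective modules requires.\<close>
 obtain kv :: "'k => 'v" where kv: "inj kv"
 proof -
  have s: "simple_module (L 0)" using assms(4)[of 0] by (simp add: is_simple_of_highest_weight_def)
  then have rL: "rational_module (L 0)" and nz: "carrier (L 0) \<noteq> {\<zero>\<^bsub>L 0\<^esub>}" by (simp_all add: simple_module_def)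
  obtain \<beta> :: "'v => 'v => 'k" and S \<rho> where g: "gmodel (L 0) \<beta> S \<rho>" "gmod S \<rho>" using rational_gmodel[OF rL] by blast
  note F = fn_modelD[OF gmodelD(1)[OF g(1)]]
  obtain v where v: "v \<in> carrier (L 0)" "v \<noteq> \<zero>\<^bsub>L 0\<^esub>" using nz F(3) by blast
  then obtain i where i: "\<beta> v i \<noteq> 0" using F(10)[OF v(1)] by (auto simp: fun_eq_iff)
  have "inj (\<lambda>c. c \<odot>\<^bsub>L 0\<^esub> v)"
  proof (rule injI)
   fix a b assume "a \<odot>\<^bsub>L 0\<^esub> v = b \<odot>\<^bsub>L 0\<^esub> v"
   then have "fscale a (\<beta> v) = fscale b (\<beta> v)" using F(8)[OF v(1)] by metis
   from fun_cong[OF this, of i] show "a = b" using i by simp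
  qed
  then show thesis by (rule that)
 qed
 have d: "vectorspace.fin_dim class_ring (rational_cohomology n (L m))" "dim n m = card (solutions p (dg p m) n)" "dim n m \<le> 20 ^ n"
  if n: "n \<ge> 1" for n m
 proof -
  obtain j where j: "n = Suc j" using n by (cases n) auto
  note c = card_solutions_le[of p "dg p m" n, OF assms(2) dg]
  have "finite (solutions p (dg p m) (Suc j))" using c j by simp
  from cohomology_dim[OF assms(4,3,1,2) kv this]
  show "vectorspace.fin_dim class_ring (rational_cohomology n (L m))" "dim n m = card (solutions p (dg p m) n)"
   by (simp_all add: dim_def j)
  then show "dim n m \<le> 20 ^ n" using c by simp
 qed
 \<comment> \<open>\<open>MAX\<close> runs over infinitely many \<open>m\<close>; the uniform bound
   makes the set of values finite, so that the maximum is meaningful.\<close>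
 have range: "finite (range (dim n))" if "n \<ge> 1" for n
  by (rule finite_subset[of _ "{..20 ^ n}"]) (use d(3)[OF that] in auto)
 have up: "real (MAX m. dim n m) \<le> 20 ^ n" if "n \<ge> 1" for n
 proof -
  have "(MAX m. dim n m) \<le> 20 ^ n" using range[OF that] d(3)[OF that] by (subst Max_le_iff) auto
  then have "real (MAX m. dim n m) \<le> real (20 ^ n)" by (simp only: of_nat_le_iff)
  then show ?thesis by simp
 qed
 \<comment> \<open>The lower bound doubles every \<open>2 * (p + 1)\<close> degrees; the factor
   \<open>1/2\<close> below absorbs the rounding in the exponent.\<close>
 define \<alpha> where "\<alpha> = 2 powr (1 / real (2 * (p + 1)))"
 have lo: "1/2 * \<alpha> ^ n \<le> real (MAX m. dim n m)" if n: "n \<ge> 1" for n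
 proof -
  obtain m where m: "\<forall>i. m i < p" "fin_supp m" "2 ^ (n div (2 * (p + 1))) \<le> card (solutions p m n)"
   using solutions_exponential[OF assms(2), of n] by blast
  have "dg p (num p m) = m" using m dg_num[of m p] by auto
  then have "2 ^ (n div (2 * (p + 1))) \<le> dim n (num p m)" using m(3) d(2)[OF n] by simp
  also have "... \<le> (MAX m. dim n m)" by (rule Max_ge[OF range[OF n]]) simp
  finally have "real (2 ^ (n div (2 * (p + 1)))) \<le> real (MAX m. dim n m)" by (simp only: of_nat_le_iff)
  then have "2 ^ (n div (2 * (p + 1))) \<le> real (MAX m. dim n m)" by (simp only: of_nat_power of_nat_numeral)
  moreover have "\<alpha> ^ n \<le> 2 * 2 ^ (n div (2 * (p + 1)))"
  proof -
   let ?q = "2 * (p + 1)"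
   have "n = n div ?q * ?q + n mod ?q" by (rule div_mult_mod_eq[symmetric])
   moreover have "n mod ?q < ?q" by simp
   ultimately have "n \<le> (n div ?q + 1) * ?q" by (simp only: add_mult_distrib)
   then have "real n \<le> real (n div ?q + 1) * real ?q" unfolding of_nat_mult[symmetric] of_nat_le_iff .
   then have "real n / real ?q \<le> real (n div ?q + 1)" by (subst pos_divide_le_eq) simp_all
   then have "2 powr (real n / real ?q) \<le> 2 powr real (n div ?q + 1)" by simp
   also have "... = 2 * 2 ^ (n div ?q)" by (subst powr_realpow) simp_all
   also have "2 powr (real n / real ?q) = \<alpha> ^ n" unfolding \<alpha>_def by (subst powr_power) simp_all
   finally show ?thesis .
  qed
  ultimately show ?thesis by linarith
 qed
 have "\<alpha> > 1" unfolding \<alpha>_def by (rule gr_one_powr) simp_all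
 moreover have "\<forall>\<^sub>F n in sequentially. 1/2 * \<alpha> ^ n \<le> real (MAX m. dim n m) \<and> real (MAX m. dim n m) \<le> 1 * 20 ^ n"
  using eventually_ge_at_top[of 1] by eventually_elim (use up lo in simp)
 ultimately have "exponential_growth (\<lambda>n. real (MAX m. dim n m))"
  unfolding exponential_growth_def by (intro exI[of _ "1/2"] exI[of _ 1] exI[of _ \<alpha>] exI[of _ 20]) simp
 moreover have "real (dim n m) \<le> (2 * real n + 7) * C_const n" if "n \<ge> 1" for n m
 proof -
  have "real (dim n m) \<le> real (20 ^ n)" using d(3)[OF that] by (simp only: of_nat_le_iff)
  also have "... = 20 ^ n" by simp
  also have "... \<le> (2 * real n + 7) * C_const n" by (rule twenty_pow_le[OF that])
  finally show ?thesis .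
 qed
 ultimately show ?thesis using d(1) unfolding dim_def by blast
qed

end
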